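(* Let $d\ge2$. If $\alpha$ is a $(d+1)\times(d-1)$ matrix of linear forms on $\mathbf P^2$ whose minors of order $d-1$ generate an ideal of codimension 3 (the generic value), then $$\operatorname{coker}\bigl(\mathcal O_{\mathbf P^2}(d-2)^{d-1}\xrightarrow{\ \alpha\ }\mathcal O_{\mathbf P^2}(d-1)^{d+1}\bigr)$$ is an Ulrich sheaf on the $d$-uple embedding of $\mathbf P^2$.
   Context: $\mathbf P^2$ is over a field $K$, and the codimension is taken in the polynomial ring in three variables. A coherent sheaf $\mathcal G$ of dimension $k$ on a projective space is an Ulrich sheaf if $H^q(\mathcal G(j))=0$ for $1\le q\le k-1$ and all $j$, $H^0(\mathcal G(j))=0$ for $j<0$, and $H^k(\mathcal G(j))=0$ for $j\ge-k$. A sheaf on $\mathbf P^2$ is an Ulrich sheaf on the $d$-uple embedding if its pushforward under that embedding is an Ulrich sheaf. *)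

theory Defs
  imports
    "HOL-Library.Poly_Mapping"
    "HOL-Library.Extended_Nat"
    "HOL-Computational_Algebra.Fraction_Field"
    "HOL-Algebra.Ideal"
    "HOL-Algebra.Module"
    "HOL-Analysis.Abstract_Topology"
    "Jordan_Normal_Form.Determinant"
    "Jordan_Normal_Form.DL_Submatrix"
begin

hide_const (open) Multiset.mult Polynomial.smult

section \<open>Polynomial rings, height and codimension\<close>

text \<open>Polynomials with variables indexed by \<open>'i\<close>; a monomial is a finitely supported exponent
  function. The polynomial ring on a set \<open>I\<close> of variables is a subring of this type.\<close>

type_synonym ('i, 'k) mpoly = "('i \<Rightarrow>\<^sub>0 nat) \<Rightarrow>\<^sub>0 'k"

definition mdeg :: "('i \<Rightarrow>\<^sub>0 nat) \<Rightarrow> nat" where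
  "mdeg t = (\<Sum>i\<in>Poly_Mapping.keys t. Poly_Mapping.lookup t i)"

definition mvar :: "'i \<Rightarrow> ('i, 'k::field) mpoly" where
  "mvar i = Poly_Mapping.single (Poly_Mapping.single i 1) 1"

definition polys :: "'i set \<Rightarrow> ('i, 'k::field) mpoly set" where
  "polys I = {f. \<forall>t\<in>Poly_Mapping.keys f. Poly_Mapping.keys t \<subseteq> I}"

definition forms :: "'i set \<Rightarrow> nat \<Rightarrow> ('i, 'k::field) mpoly set" where
  "forms I n = {f \<in> polys I. \<forall>t\<in>Poly_Mapping.keys f. mdeg t = n}"

definition poly_ring :: "'i set \<Rightarrow> ('i, 'k::field) mpoly ring" where
  "poly_ring I = \<lparr>carrier = polys I, mult = (*), one = 1, zero = 0, add = (+)\<rparr>"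

definition hom_component :: "nat \<Rightarrow> ('i, 'k::field) mpoly \<Rightarrow> ('i, 'k) mpoly" where
  "hom_component n f = (\<Sum>t\<in>{t \<in> Poly_Mapping.keys f. mdeg t = n}.
      Poly_Mapping.single t (Poly_Mapping.lookup f t))"

definition subst_poly :: "('i \<Rightarrow> ('j, 'k::field) mpoly) \<Rightarrow> ('i, 'k) mpoly \<Rightarrow> ('j, 'k) mpoly" where
  "subst_poly \<sigma> f = (\<Sum>t\<in>Poly_Mapping.keys f.
      Poly_Mapping.single 0 (Poly_Mapping.lookup f t) *
      (\<Prod>i\<in>Poly_Mapping.keys t. \<sigma> i ^ Poly_Mapping.lookup t i))"

definition prime_height :: "('a, 'm) ring_scheme \<Rightarrow> 'a set \<Rightarrow> enat" where
  "prime_height R P = Sup {enat n | n. \<exists>C. C n = P \<and> (\<forall>i\<le>n. primeideal (C i) R) \<and>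
      (\<forall>i<n. C i \<subset> C (Suc i))}"

definition ideal_codim :: "('a, 'm) ring_scheme \<Rightarrow> 'a set \<Rightarrow> enat" where
  "ideal_codim R J = (INF P\<in>{P. primeideal P R \<and> J \<subseteq> P}. prime_height R P)"

definition maximal_minors :: "'a::comm_ring_1 mat \<Rightarrow> 'a set" where
  "maximal_minors A = {det (submatrix A R UNIV) | R. R \<subseteq> {..<dim_row A} \<and> card R = dim_col A}"


section \<open>Ringed spaces and sheaves of modules\<close>

record ('p, 'r) ringed_space =
  rs_top :: "'p topology"
  rs_ring :: "'p set \<Rightarrow> 'r ring"
  rs_res :: "'p set \<Rightarrow> 'p set \<Rightarrow> 'r \<Rightarrow> 'r"

text \<open>The restriction from \<open>U\<close> to \<open>V \<subseteq> U\<close> is \<open>res F U V\<close>.\<close>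

record ('p, 'r, 's) mod_presheaf =
  sec :: "'p set \<Rightarrow> ('r, 's) module"
  res :: "'p set \<Rightarrow> 'p set \<Rightarrow> 's \<Rightarrow> 's"

text \<open>The record type of modules extends that of rings; a module has no use for the
  multiplicative fields.\<close>

definition mk_module :: "'s set \<Rightarrow> ('s \<Rightarrow> 's \<Rightarrow> 's) \<Rightarrow> 's \<Rightarrow> ('r \<Rightarrow> 's \<Rightarrow> 's) \<Rightarrow> ('r, 's) module" where
  "mk_module A pl z sm = \<lparr>carrier = A, mult = (\<lambda>_ _. undefined), one = undefined,
     zero = z, add = pl, smult = sm\<rparr>"

definition sheaf_of_modules ::
    "('p, 'r) ringed_space \<Rightarrow> ('p, 'r, 's) mod_presheaf \<Rightarrow> bool" where
  "sheaf_of_modules X F \<longleftrightarrow>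
    (\<forall>U. openin (rs_top X) U \<longrightarrow> module (rs_ring X U) (sec F U)) \<and>
    (\<forall>U V. openin (rs_top X) U \<and> openin (rs_top X) V \<and> V \<subseteq> U \<longrightarrow>
      (\<forall>s\<in>carrier (sec F U). res F U V s \<in> carrier (sec F V)) \<and>
      (\<forall>s\<in>carrier (sec F U). \<forall>t\<in>carrier (sec F U).
        res F U V (s \<oplus>\<^bsub>sec F U\<^esub> t) = res F U V s \<oplus>\<^bsub>sec F V\<^esub> res F U V t) \<and>
      (\<forall>r\<in>carrier (rs_ring X U). \<forall>s\<in>carrier (sec F U).
        res F U V (r \<odot>\<^bsub>sec F U\<^esub> s) = rs_res X U V r \<odot>\<^bsub>sec F V\<^esub> res F U V s)) \<and>
    (\<forall>U. openin (rs_top X) U \<longrightarrow> (\<forall>s\<in>carrier (sec F U). res F U U s = s)) \<and>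
    (\<forall>U V W. openin (rs_top X) U \<and> openin (rs_top X) V \<and> openin (rs_top X) W \<and> W \<subseteq> V \<and> V \<subseteq> U \<longrightarrow>
      (\<forall>s\<in>carrier (sec F U). res F V W (res F U V s) = res F U W s)) \<and>
    (\<forall>\<C>. (\<forall>V\<in>\<C>. openin (rs_top X) V) \<longrightarrow>
      (\<forall>s\<in>carrier (sec F (\<Union>\<C>)). \<forall>t\<in>carrier (sec F (\<Union>\<C>)).
        (\<forall>V\<in>\<C>. res F (\<Union>\<C>) V s = res F (\<Union>\<C>) V t) \<longrightarrow> s = t) \<and>
      (\<forall>\<sigma>. (\<forall>V\<in>\<C>. \<sigma> V \<in> carrier (sec F V)) \<and>
           (\<forall>V\<in>\<C>. \<forall>W\<in>\<C>. res F V (V \<inter> W) (\<sigma> V) = res F W (V \<inter> W) (\<sigma> W)) \<longrightarrow>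
         (\<exists>s\<in>carrier (sec F (\<Union>\<C>)). \<forall>V\<in>\<C>. res F (\<Union>\<C>) V s = \<sigma> V)))"

definition struct_module :: "('p, 'r) ringed_space \<Rightarrow> ('p, 'r, 'r) mod_presheaf" where
  "struct_module X =
    \<lparr>sec = (\<lambda>U. mk_module (carrier (rs_ring X U)) (add (rs_ring X U)) (zero (rs_ring X U))
                (mult (rs_ring X U))),
     res = rs_res X\<rparr>"

text \<open>The direct sum of \<open>n\<close> copies of \<open>F\<close>; a section is a family indexed by \<open>{..<n}\<close>.\<close>

definition direct_power :: "nat \<Rightarrow> ('p, 'r, 's) mod_presheaf \<Rightarrow> ('p, 'r, nat \<Rightarrow> 's) mod_presheaf" where
  "direct_power n F =
    \<lparr>sec = (\<lambda>U. mk_module ({..<n} \<rightarrow>\<^sub>E carrier (sec F U))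
                (\<lambda>s t. \<lambda>i\<in>{..<n}. s i \<oplus>\<^bsub>sec F U\<^esub> t i)
                (\<lambda>i\<in>{..<n}. \<zero>\<^bsub>sec F U\<^esub>)
                (\<lambda>r s. \<lambda>i\<in>{..<n}. r \<odot>\<^bsub>sec F U\<^esub> s i)),
     res = (\<lambda>U V s. \<lambda>i\<in>{..<n}. res F U V (s i))\<rparr>"

text \<open>The germ at \<open>p\<close> of a section \<open>s\<close> over \<open>U\<close> is the class of all pairs \<open>(V, t)\<close> that agree
  with \<open>(U, s)\<close> near \<open>p\<close>. Sums and multiples of germs are computed from representatives; all the
  germs in the unions below coincide.\<close>

definition germ :: "('p, 'r) ringed_space \<Rightarrow> ('p, 'r, 's) mod_presheaf \<Rightarrow>
    'p \<Rightarrow> 'p set \<Rightarrow> 's \<Rightarrow> ('p set \<times> 's) set" where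
  "germ X F p U s = {(V, t). openin (rs_top X) V \<and> p \<in> V \<and> t \<in> carrier (sec F V) \<and>
     (\<exists>W. openin (rs_top X) W \<and> p \<in> W \<and> W \<subseteq> U \<inter> V \<and> res F U W s = res F V W t)}"

definition germ_add :: "('p, 'r) ringed_space \<Rightarrow> ('p, 'r, 's) mod_presheaf \<Rightarrow> 'p \<Rightarrow>
    ('p set \<times> 's) set \<Rightarrow> ('p set \<times> 's) set \<Rightarrow> ('p set \<times> 's) set" where
  "germ_add X F p A B = (\<Union>(U, s)\<in>A. \<Union>(V, t)\<in>B.
     germ X F p (U \<inter> V) (res F U (U \<inter> V) s \<oplus>\<^bsub>sec F (U \<inter> V)\<^esub> res F V (U \<inter> V) t))"

definition germ_smult :: "('p, 'r) ringed_space \<Rightarrow> ('p, 'r, 's) mod_presheaf \<Rightarrow> 'p \<Rightarrow>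
    'p set \<Rightarrow> 'r \<Rightarrow> ('p set \<times> 's) set \<Rightarrow> ('p set \<times> 's) set" where
  "germ_smult X F p U r A = (\<Union>(V, t)\<in>A.
     germ X F p (U \<inter> V) (rs_res X U (U \<inter> V) r \<odot>\<^bsub>sec F (U \<inter> V)\<^esub> res F V (U \<inter> V) t))"

definition sheafify :: "('p, 'r) ringed_space \<Rightarrow> ('p, 'r, 's) mod_presheaf \<Rightarrow>
    ('p, 'r, 'p \<Rightarrow> ('p set \<times> 's) set) mod_presheaf" where
  "sheafify X F =
    \<lparr>sec = (\<lambda>U. mk_module
       {\<sigma> \<in> extensional U. \<forall>p\<in>U. \<exists>V. openin (rs_top X) V \<and> p \<in> V \<and> V \<subseteq> U \<and>
          (\<exists>t\<in>carrier (sec F V). \<forall>q\<in>V. \<sigma> q = germ X F q V t)}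
       (\<lambda>\<sigma> \<tau>. \<lambda>p\<in>U. germ_add X F p (\<sigma> p) (\<tau> p))
       (\<lambda>p\<in>U. germ X F p U \<zero>\<^bsub>sec F U\<^esub>)
       (\<lambda>r \<sigma>. \<lambda>p\<in>U. germ_smult X F p U r (\<sigma> p))),
     res = (\<lambda>U V \<sigma>. restrict \<sigma> V)\<rparr>"

text \<open>The cokernel of \<open>\<phi> : E \<rightarrow> F\<close>: the sheaf associated with \<open>U \<mapsto> F(U) / \<phi>(E(U))\<close>.\<close>

definition coker_presheaf :: "('p, 'r, 't) mod_presheaf \<Rightarrow> ('p, 'r, 's) mod_presheaf \<Rightarrow>
    ('p set \<Rightarrow> 't \<Rightarrow> 's) \<Rightarrow> ('p, 'r, 's set) mod_presheaf" where
  "coker_presheaf E F \<phi> =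
    (let N = (\<lambda>U. \<phi> U ` carrier (sec E U)) in
    \<lparr>sec = (\<lambda>U. mk_module (a_rcosets\<^bsub>sec F U\<^esub> (N U)) (set_add (sec F U)) (N U)
                (\<lambda>r A. \<Union>a\<in>A. N U +>\<^bsub>sec F U\<^esub> (r \<odot>\<^bsub>sec F U\<^esub> a))),
     res = (\<lambda>U V A. \<Union>a\<in>A. N V +>\<^bsub>sec F V\<^esub> res F U V a)\<rparr>)"

definition coker_sheaf :: "('p, 'r) ringed_space \<Rightarrow> ('p, 'r, 't) mod_presheaf \<Rightarrow>
    ('p, 'r, 's) mod_presheaf \<Rightarrow> ('p set \<Rightarrow> 't \<Rightarrow> 's) \<Rightarrow>
    ('p, 'r, 'p \<Rightarrow> ('p set \<times> 's set) set) mod_presheaf" where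
  "coker_sheaf X E F \<phi> = sheafify X (coker_presheaf E F \<phi>)"

text \<open>The pushforward of \<open>F\<close> along a morphism of ringed spaces from \<open>X\<close> that consists of the map \<open>h\<close>
  on points and the ring homomorphisms \<open>hs V\<close> from the sections over \<open>V\<close> to those over
  \<open>h\<^sup>-\<^sup>1(V)\<close>.\<close>

definition preim :: "('p, 'r) ringed_space \<Rightarrow> ('p \<Rightarrow> 'q) \<Rightarrow> 'q set \<Rightarrow> 'p set" where
  "preim X h V = {p \<in> topspace (rs_top X). h p \<in> V}"

definition pushforward :: "('p, 'r) ringed_space \<Rightarrow> ('p \<Rightarrow> 'q) \<Rightarrow> ('q set \<Rightarrow> 'u \<Rightarrow> 'r) \<Rightarrow>
    ('p, 'r, 's) mod_presheaf \<Rightarrow> ('q, 'u, 's) mod_presheaf" where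
  "pushforward X h hs F =
    \<lparr>sec = (\<lambda>V. let M = sec F (preim X h V) in
                mk_module (carrier M) (add M) (zero M) (\<lambda>r s. hs V r \<odot>\<^bsub>M\<^esub> s)),
     res = (\<lambda>V W. res F (preim X h V) (preim X h W))\<rparr>"


section \<open>Coherence, support and dimension\<close>

text \<open>\<open>locally_fg X G R U\<close>: the family \<open>R\<close> of sections of \<open>G\<close> over the open subsets of \<open>U\<close> is a
  submodule sheaf of finite type.\<close>

definition locally_fg :: "('p, 'r) ringed_space \<Rightarrow> ('p, 'r, 's) mod_presheaf \<Rightarrow>
    ('p set \<Rightarrow> 's set) \<Rightarrow> 'p set \<Rightarrow> bool" where
  "locally_fg X G R U \<longleftrightarrow>
    (\<forall>p\<in>U. \<exists>V. openin (rs_top X) V \<and> p \<in> V \<and> V \<subseteq> U \<and>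
      (\<exists>m::nat. \<exists>g. (\<forall>i<m. g i \<in> R V) \<and>
        (\<forall>W. openin (rs_top X) W \<and> W \<subseteq> V \<longrightarrow> (\<forall>r\<in>R W. \<forall>q\<in>W.
          \<exists>W'. openin (rs_top X) W' \<and> q \<in> W' \<and> W' \<subseteq> W \<and>
            (\<exists>c. (\<forall>i<m. c i \<in> carrier (rs_ring X W')) \<and>
              res G W W' r =
                (\<Oplus>\<^bsub>sec G W'\<^esub>i\<in>{..<m}. c i \<odot>\<^bsub>sec G W'\<^esub> res G V W' (g i)))))))"

definition relations :: "('p, 'r) ringed_space \<Rightarrow> ('p, 'r, 's) mod_presheaf \<Rightarrow>
    nat \<Rightarrow> 'p set \<Rightarrow> (nat \<Rightarrow> 's) \<Rightarrow> 'p set \<Rightarrow> (nat \<Rightarrow> 'r) set" where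
  "relations X F n U s W = {c \<in> {..<n} \<rightarrow>\<^sub>E carrier (rs_ring X W).
     (\<Oplus>\<^bsub>sec F W\<^esub>i\<in>{..<n}. c i \<odot>\<^bsub>sec F W\<^esub> res F U W (s i)) = \<zero>\<^bsub>sec F W\<^esub>}"

text \<open>Coherent: of finite type, and the relations between any finitely many sections over any open
  set are of finite type (Serre, Faisceaux algebriques coherents, no. 12--13).\<close>

definition coherent :: "('p, 'r) ringed_space \<Rightarrow> ('p, 'r, 's) mod_presheaf \<Rightarrow> bool" where
  "coherent X F \<longleftrightarrow> sheaf_of_modules X F \<and>
    locally_fg X F (\<lambda>U. carrier (sec F U)) (topspace (rs_top X)) \<and>
    (\<forall>n U s. openin (rs_top X) U \<and> (\<forall>i<n. s i \<in> carrier (sec F U)) \<longrightarrow>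
      locally_fg X (direct_power n (struct_module X)) (relations X F n U s) U)"

definition support :: "('p, 'r) ringed_space \<Rightarrow> ('p, 'r, 's) mod_presheaf \<Rightarrow> 'p set" where
  "support X F = {p \<in> topspace (rs_top X). \<exists>U. openin (rs_top X) U \<and> p \<in> U \<and>
     (\<exists>s\<in>carrier (sec F U). germ X F p U s \<noteq> germ X F p U \<zero>\<^bsub>sec F U\<^esub>)}"

definition irreducible_closed :: "'p topology \<Rightarrow> 'p set \<Rightarrow> bool" where
  "irreducible_closed T C \<longleftrightarrow> closedin T C \<and> C \<noteq> {} \<and>
     (\<forall>A B. closedin T A \<and> closedin T B \<and> C = A \<union> B \<longrightarrow> C = A \<or> C = B)"

text \<open>Chains of irreducible closed sets have length at most \<open>k\<close>, and \<open>k\<close> is attained. The empty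
  space has no dimension in this sense.\<close>

definition has_krull_dim :: "'p topology \<Rightarrow> nat \<Rightarrow> bool" where
  "has_krull_dim T k \<longleftrightarrow>
    (let chain = (\<lambda>n::nat. \<exists>C. (\<forall>i\<le>n. irreducible_closed T (C i)) \<and> (\<forall>i<n. C i \<subset> C (Suc i)))
     in chain k \<and> (\<forall>n. chain n \<longrightarrow> n \<le> k))"

definition has_sheaf_dim :: "('p, 'r) ringed_space \<Rightarrow> ('p, 'r, 's) mod_presheaf \<Rightarrow> nat \<Rightarrow> bool" where
  "has_sheaf_dim X F k \<longleftrightarrow> has_krull_dim (subtopology (rs_top X) (support X F)) k"


section \<open>Cohomology\<close>

text \<open>Sheaf cohomology as defined by Serre (Faisceaux algebriques coherents, no. 20--21): the
  colimit of Cech cohomology over all open covers. As in Godement's book (II.5.8), the covers are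
  indexed by the points \<open>x\<close>, with \<open>x \<in> \<U> x\<close>. These are cofinal among all covers, and a refinement
  \<open>\<V> x \<subseteq> \<U> x\<close> needs no choice of a refinement map. A \<open>q\<close>-cochain assigns to a list
  \<open>x\<^sub>0, \<dots>, x\<^sub>q\<close> a section over \<open>\<U> x\<^sub>0 \<inter> \<dots> \<inter> \<U> x\<^sub>q\<close>; it need not be alternating.\<close>

definition pt_cover :: "'p topology \<Rightarrow> ('p \<Rightarrow> 'p set) \<Rightarrow> bool" where
  "pt_cover T \<U> \<longleftrightarrow> (\<forall>x\<in>topspace T. openin T (\<U> x) \<and> x \<in> \<U> x)"

definition simplices :: "'p topology \<Rightarrow> nat \<Rightarrow> 'p list set" where
  "simplices T q = {xs. set xs \<subseteq> topspace T \<and> length xs = Suc q}"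

definition cap :: "('p \<Rightarrow> 'p set) \<Rightarrow> 'p list \<Rightarrow> 'p set" where
  "cap \<U> xs = (\<Inter>x\<in>set xs. \<U> x)"

definition cochains :: "('p, 'r) ringed_space \<Rightarrow> ('p, 'r, 's) mod_presheaf \<Rightarrow>
    ('p \<Rightarrow> 'p set) \<Rightarrow> nat \<Rightarrow> ('p list \<Rightarrow> 's) set" where
  "cochains X F \<U> q = (\<Pi> xs\<in>simplices (rs_top X) q. carrier (sec F (cap \<U> xs)))"

definition omit :: "nat \<Rightarrow> 'a list \<Rightarrow> 'a list" where
  "omit k xs = take k xs @ drop (Suc k) xs"

definition cobdry :: "('p, 'r, 's) mod_presheaf \<Rightarrow> ('p \<Rightarrow> 'p set) \<Rightarrow>
    ('p list \<Rightarrow> 's) \<Rightarrow> 'p list \<Rightarrow> 's" where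
  "cobdry F \<U> f xs = (\<Oplus>\<^bsub>sec F (cap \<U> xs)\<^esub>k\<in>{..<length xs}.
     let t = res F (cap \<U> (omit k xs)) (cap \<U> xs) (f (omit k xs))
     in if even k then t else \<ominus>\<^bsub>sec F (cap \<U> xs)\<^esub> t)"

definition cocycles :: "('p, 'r) ringed_space \<Rightarrow> ('p, 'r, 's) mod_presheaf \<Rightarrow> nat \<Rightarrow>
    (('p \<Rightarrow> 'p set) \<times> ('p list \<Rightarrow> 's)) set" where
  "cocycles X F q = {(\<U>, f). pt_cover (rs_top X) \<U> \<and> f \<in> cochains X F \<U> q \<and>
     (\<forall>xs\<in>simplices (rs_top X) (Suc q). cobdry F \<U> f xs = \<zero>\<^bsub>sec F (cap \<U> xs)\<^esub>)}"

definition is_cobdry :: "('p, 'r) ringed_space \<Rightarrow> ('p, 'r, 's) mod_presheaf \<Rightarrow>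
    ('p \<Rightarrow> 'p set) \<Rightarrow> nat \<Rightarrow> ('p list \<Rightarrow> 's) \<Rightarrow> bool" where
  "is_cobdry X F \<U> q f \<longleftrightarrow>
    (case q of
       0 \<Rightarrow> \<forall>xs\<in>simplices (rs_top X) 0. f xs = \<zero>\<^bsub>sec F (cap \<U> xs)\<^esub>
     | Suc r \<Rightarrow> \<exists>g\<in>cochains X F \<U> r. \<forall>xs\<in>simplices (rs_top X) q. f xs = cobdry F \<U> g xs)"

definition cohomologous :: "('p, 'r) ringed_space \<Rightarrow> ('p, 'r, 's) mod_presheaf \<Rightarrow> nat \<Rightarrow>
    ((('p \<Rightarrow> 'p set) \<times> ('p list \<Rightarrow> 's)) \<times> (('p \<Rightarrow> 'p set) \<times> ('p list \<Rightarrow> 's))) set" where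
  "cohomologous X F q = {((\<U>, f), (\<V>, g)). (\<U>, f) \<in> cocycles X F q \<and> (\<V>, g) \<in> cocycles X F q \<and>
     (\<exists>\<W>. pt_cover (rs_top X) \<W> \<and> (\<forall>x\<in>topspace (rs_top X). \<W> x \<subseteq> \<U> x \<inter> \<V> x) \<and>
       is_cobdry X F \<W> q (\<lambda>xs. res F (cap \<U> xs) (cap \<W> xs) (f xs) \<ominus>\<^bsub>sec F (cap \<W> xs)\<^esub>
                                 res F (cap \<V> xs) (cap \<W> xs) (g xs)))}"

definition cohomology :: "('p, 'r) ringed_space \<Rightarrow> ('p, 'r, 's) mod_presheaf \<Rightarrow> nat \<Rightarrow>
    (('p \<Rightarrow> 'p set) \<times> ('p list \<Rightarrow> 's)) set set" where
  "cohomology X F q = cocycles X F q // cohomologous X F q"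

text \<open>The cohomology group is zero iff its only element is the class of \<open>0\<close>.\<close>

definition cohomology_zero :: "('p, 'r) ringed_space \<Rightarrow> ('p, 'r, 's) mod_presheaf \<Rightarrow> nat \<Rightarrow> bool" where
  "cohomology_zero X F q \<longleftrightarrow> is_singleton (cohomology X F q)"


section \<open>Projective space\<close>

text \<open>\<open>proj I\<close> is the scheme Proj of the polynomial ring on the variables \<open>I\<close>, over the field that is
  the coefficient type. Its points are the homogeneous primes that do not contain all variables.\<close>

definition proj_points :: "'i set \<Rightarrow> ('i, 'k::field) mpoly set set" where
  "proj_points I = {P. primeideal P (poly_ring I) \<and> (\<forall>f\<in>P. \<forall>n. hom_component n f \<in> P) \<and>
     \<not> mvar ` I \<subseteq> P}"

definition proj_top :: "'i set \<Rightarrow> ('i, 'k::field) mpoly set topology" where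
  "proj_top I = topology (\<lambda>U. \<exists>T. T \<subseteq> (\<Union>n. forms I n) \<and> U = {P \<in> proj_points I. \<not> T \<subseteq> P})"

lemma one_in_forms: "1 \<in> forms I 0"
  by (auto simp: forms_def polys_def mdeg_def)

lemma polys_mult:
  assumes "f \<in> polys I" "g \<in> polys I"
  shows "f * g \<in> polys I"
  unfolding polys_def
proof (intro CollectI ballI)
  fix t assume "t \<in> Poly_Mapping.keys (f * g)"
  then obtain u v where uv: "u \<in> Poly_Mapping.keys f" "v \<in> Poly_Mapping.keys g" "t = u + v"
    using keys_mult[of f g] by blast
  then show "Poly_Mapping.keys t \<subseteq> I"
    using assms keys_add[of u v] by (fastforce simp: polys_def)
qed

lemma mdeg_add: "mdeg (u + v) = mdeg u + mdeg v"
proof -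
  let ?K = "Poly_Mapping.keys u \<union> Poly_Mapping.keys v"
  have *: "mdeg w = (\<Sum>i\<in>?K. Poly_Mapping.lookup w i)" if "Poly_Mapping.keys w \<subseteq> ?K" for w
    unfolding mdeg_def using that
    by (intro sum.mono_neutral_left) (auto simp: in_keys_iff)
  show ?thesis
    by (simp add: *[of u] *[of v] *[of "u + v"] keys_add lookup_add sum.distrib)
qed

lemma forms_mult:
  assumes "f \<in> forms I m" "g \<in> forms I n"
  shows "f * g \<in> forms I (m + n)"
proof -
  have "mdeg t = m + n" if t: "t \<in> Poly_Mapping.keys (f * g)" for t
  proof -
    obtain u v where "u \<in> Poly_Mapping.keys f" "v \<in> Poly_Mapping.keys g" "t = u + v"
      using t keys_mult[of f g] by blast
    then show ?thesis using assms by (auto simp: forms_def mdeg_add)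
  qed
  then show ?thesis using assms polys_mult by (auto simp: forms_def)
qed

lemma forms_mult_in_prime_iff:
  assumes "P \<in> proj_points I" "f \<in> polys I" "g \<in> polys I"
  shows "f * g \<in> P \<longleftrightarrow> f \<in> P \<or> g \<in> P"
proof -
  have P: "primeideal P (poly_ring I)" using assms by (simp add: proj_points_def)
  then have J: "ideal P (poly_ring I)" by (rule primeideal.axioms)
  show ?thesis
    using primeideal.I_prime[OF P, of f g] ideal.I_l_closed[OF J, of g f]
      ideal.I_r_closed[OF J, of f g] assms
    by (auto simp: poly_ring_def)
qed

lemma one_notin_proj_point:
  assumes "P \<in> proj_points I"
  shows "1 \<notin> P"
proof
  assume "1 \<in> P"
  have P: "primeideal P (poly_ring I)" using assms by (simp add: proj_points_def)
  then have "ideal P (poly_ring I)" by (rule primeideal.axioms)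
  then have "P = carrier (poly_ring I)"
    using ideal.one_imp_carrier \<open>1 \<in> P\<close> by (fastforce simp: poly_ring_def)
  then show False using primeideal.I_notcarr[OF P] by simp
qed

lemma openin_proj_top:
  "openin (proj_top I) U \<longleftrightarrow>
    (\<exists>T. T \<subseteq> (\<Union>n. forms I n) \<and> U = {P \<in> proj_points I. \<not> T \<subseteq> P})" (is "_ \<longleftrightarrow> ?open U")
proof -
  have int: "?open (U \<inter> V)" if U: "?open U" and V: "?open V" for U V
  proof -
    obtain S where S: "S \<subseteq> (\<Union>n. forms I n)" "U = {P \<in> proj_points I. \<not> S \<subseteq> P}"
      using U by blast
    obtain T where T: "T \<subseteq> (\<Union>n. forms I n)" "V = {P \<in> proj_points I. \<not> T \<subseteq> P}"
      using V by blast
    let ?W = "{f * g | f g. f \<in> S \<and> g \<in> T}"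
    have poly: "f \<in> polys I" if "f \<in> S \<union> T" for f
      using that S(1) T(1) by (auto simp: forms_def)
    have "?W \<subseteq> (\<Union>n. forms I n)"
      using S(1) T(1) by (blast intro: forms_mult)
    moreover have "U \<inter> V = {P \<in> proj_points I. \<not> ?W \<subseteq> P}"
    proof (intro Set.set_eqI)
      fix P
      have "(\<not> S \<subseteq> P \<and> \<not> T \<subseteq> P) \<longleftrightarrow> \<not> ?W \<subseteq> P" if "P \<in> proj_points I"
      proof -
        have "f * g \<in> P \<longleftrightarrow> f \<in> P \<or> g \<in> P" if "f \<in> S" "g \<in> T" for f g
          using forms_mult_in_prime_iff \<open>P \<in> proj_points I\<close> poly that by blast
        then show ?thesis by blast
      qed
      then show "P \<in> U \<inter> V \<longleftrightarrow> P \<in> {P \<in> proj_points I. \<not> ?W \<subseteq> P}"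
        by (auto simp only: S(2) T(2) Int_iff mem_Collect_eq)
    qed
    ultimately show ?thesis by (intro exI[of _ ?W] conjI)
  qed
  have un: "?open (\<Union>\<K>)" if \<K>: "\<forall>U\<in>\<K>. ?open U" for \<K>
  proof -
    obtain T where T: "\<And>U. U \<in> \<K> \<Longrightarrow> T U \<subseteq> (\<Union>n. forms I n) \<and> U = {P \<in> proj_points I. \<not> T U \<subseteq> P}"
      using bchoice[OF \<K>] by blast
    have "(\<Union>U\<in>\<K>. T U) \<subseteq> (\<Union>n. forms I n)" using T by blast
    moreover have "\<Union>\<K> = {P \<in> proj_points I. \<not> (\<Union>U\<in>\<K>. T U) \<subseteq> P}"
    proof (intro Set.set_eqI)
      fix P
      have "P \<in> U \<longleftrightarrow> P \<in> proj_points I \<and> \<not> T U \<subseteq> P" if "U \<in> \<K>" for U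
        using T[OF that] by blast
      then show "P \<in> \<Union>\<K> \<longleftrightarrow> P \<in> {P \<in> proj_points I. \<not> (\<Union>U\<in>\<K>. T U) \<subseteq> P}" by blast
    qed
    ultimately show ?thesis by (intro exI[of _ "\<Union>U\<in>\<K>. T U"] conjI)
  qed
  have "istopology ?open" unfolding istopology_def by (intro conjI allI impI int un)
  then show ?thesis unfolding proj_top_def by (simp add: topology_inverse')
qed

lemma topspace_proj_top: "topspace (proj_top I) = proj_points I"
proof
  show "topspace (proj_top I) \<subseteq> proj_points I"
    using openin_topspace[of "proj_top I"] unfolding openin_proj_top by blast
  have "openin (proj_top I) (proj_points I)"
    unfolding openin_proj_top
    using one_in_forms one_notin_proj_point by (intro exI[of _ "{1}"]) blast
  then show "proj_points I \<subseteq> topspace (proj_top I)" by (rule openin_subset)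
qed

text \<open>Sections of \<open>\<O>(m)\<close>: functions that are locally a quotient of two forms whose degrees differ by
  \<open>m\<close>. As the polynomial ring is a domain, its homogeneous localisations are taken inside the
  fraction field.\<close>

definition O_sections :: "'i::linorder set \<Rightarrow> int \<Rightarrow> ('i, 'k::field) mpoly set set \<Rightarrow>
    (('i, 'k) mpoly set \<Rightarrow> ('i, 'k) mpoly fract) set" where
  "O_sections I m U = {s \<in> extensional U. \<forall>P\<in>U. \<exists>V. openin (proj_top I) V \<and> P \<in> V \<and> V \<subseteq> U \<and>
     (\<exists>k l. int k = int l + m \<and> (\<exists>a\<in>forms I k. \<exists>f\<in>forms I l.
        \<forall>Q\<in>V. f \<notin> Q \<and> s Q = Fract a f))}"

type_synonym ('i, 'k) proj_fun = "('i, 'k) mpoly set \<Rightarrow> ('i, 'k) mpoly fract"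

definition proj :: "'i::linorder set \<Rightarrow> (('i, 'k::field) mpoly set, ('i, 'k) proj_fun) ringed_space" where
  "proj I =
    \<lparr>rs_top = proj_top I,
     rs_ring = (\<lambda>U. \<lparr>carrier = O_sections I 0 U, mult = (\<lambda>s t. \<lambda>P\<in>U. s P * t P),
        one = (\<lambda>P\<in>U. 1), zero = (\<lambda>P\<in>U. 0), add = (\<lambda>s t. \<lambda>P\<in>U. s P + t P)\<rparr>),
     rs_res = (\<lambda>U V s. restrict s V)\<rparr>"

definition proj_O :: "'i::linorder set \<Rightarrow> int \<Rightarrow>
    (('i, 'k::field) mpoly set, ('i, 'k) proj_fun, ('i, 'k) proj_fun) mod_presheaf" where
  "proj_O I m =
    \<lparr>sec = (\<lambda>U. mk_module (O_sections I m U) (\<lambda>s t. \<lambda>P\<in>U. s P + t P) (\<lambda>P\<in>U. 0)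
                (\<lambda>r s. \<lambda>P\<in>U. r P * s P)),
     res = (\<lambda>U V s. restrict s V)\<rparr>"

text \<open>The map \<open>\<O>(m)\<^sup>b \<rightarrow> \<O>(m + e)\<^sup>a\<close> given by an \<open>a \<times> b\<close> matrix of forms of degree \<open>e\<close>, acting on
  column vectors.\<close>

definition matrix_map :: "('i::linorder, 'k::field) mpoly mat \<Rightarrow> ('i, 'k) mpoly set set \<Rightarrow>
    (nat \<Rightarrow> ('i, 'k) proj_fun) \<Rightarrow> (nat \<Rightarrow> ('i, 'k) proj_fun)" where
  "matrix_map A U s = (\<lambda>i\<in>{..<dim_row A}. \<lambda>P\<in>U. \<Sum>j<dim_col A. Fract (A $$ (i, j)) 1 * s j P)"

text \<open>The twist \<open>F(j)\<close> as defined by Serre (loc. cit., no. 54): the sheaves \<open>F\<close> restricted to the basic open sets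
  \<open>x\<^sub>i \<noteq> 0\<close> are glued by multiplication with \<open>(x\<^sub>k / x\<^sub>i)\<^sup>j\<close>, which are the transition functions
  of \<open>\<O>(j)\<close>.\<close>

definition basic_open :: "'i set \<Rightarrow> 'i \<Rightarrow> ('i, 'k::field) mpoly set set" where
  "basic_open I i = {P \<in> proj_points I. mvar i \<notin> P}"

definition transition :: "'i::linorder \<Rightarrow> 'i \<Rightarrow> int \<Rightarrow> ('i, 'k::field) mpoly set set \<Rightarrow>
    ('i, 'k) proj_fun" where
  "transition i k j W = (\<lambda>P\<in>W. Fract (mvar k) (mvar i) powi j)"

definition twist :: "'i::linorder set \<Rightarrow> int \<Rightarrow>
    (('i, 'k::field) mpoly set, ('i, 'k) proj_fun, 's) mod_presheaf \<Rightarrow>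
    (('i, 'k) mpoly set, ('i, 'k) proj_fun, 'i \<Rightarrow> 's) mod_presheaf" where
  "twist I j F =
    \<lparr>sec = (\<lambda>U. mk_module
       {s \<in> (\<Pi>\<^sub>E i\<in>I. carrier (sec F (U \<inter> basic_open I i))). \<forall>i\<in>I. \<forall>k\<in>I.
          (let W = U \<inter> basic_open I i \<inter> basic_open I k in
           res F (U \<inter> basic_open I i) W (s i) =
             transition i k j W \<odot>\<^bsub>sec F W\<^esub> res F (U \<inter> basic_open I k) W (s k))}
       (\<lambda>s t. \<lambda>i\<in>I. s i \<oplus>\<^bsub>sec F (U \<inter> basic_open I i)\<^esub> t i)
       (\<lambda>i\<in>I. \<zero>\<^bsub>sec F (U \<inter> basic_open I i)\<^esub>)
       (\<lambda>r s. \<lambda>i\<in>I. restrict r (U \<inter> basic_open I i) \<odot>\<^bsub>sec F (U \<inter> basic_open I i)\<^esub> s i)),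
     res = (\<lambda>U V s. \<lambda>i\<in>I. res F (U \<inter> basic_open I i) (V \<inter> basic_open I i) (s i))\<rparr>"


section \<open>The \<open>d\<close>-uple embedding\<close>

text \<open>The target has one homogeneous coordinate \<open>y\<^sub>m\<close> for every monomial \<open>m\<close> of degree \<open>d\<close>, and
  \<open>y\<^sub>m\<close> pulls back to \<open>m\<close>. A point, that is a homogeneous prime, is sent to its preimage under this
  ring homomorphism.\<close>

definition monomials :: "'i set \<Rightarrow> nat \<Rightarrow> ('i \<Rightarrow>\<^sub>0 nat) set" where
  "monomials I d = {m. Poly_Mapping.keys m \<subseteq> I \<and> mdeg m = d}"

definition uple_pull :: "('i \<Rightarrow>\<^sub>0 nat, 'k::field) mpoly \<Rightarrow> ('i, 'k) mpoly" where
  "uple_pull = subst_poly (\<lambda>m. Poly_Mapping.single m 1)"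

definition uple_point :: "'i set \<Rightarrow> nat \<Rightarrow> ('i, 'k::field) mpoly set \<Rightarrow> ('i \<Rightarrow>\<^sub>0 nat, 'k) mpoly set" where
  "uple_point I d P = {g \<in> polys (monomials I d). uple_pull g \<in> P}"

text \<open>The induced map on local rings, \<open>a / f \<mapsto> uple_pull a / uple_pull f\<close>, is only defined on
  fractions with \<open>uple_pull f \<notin> P\<close>; for these the value does not depend on the representation.\<close>

definition uple_local :: "'i::linorder set \<Rightarrow> nat \<Rightarrow> ('i, 'k::field) mpoly set \<Rightarrow>
    ('i \<Rightarrow>\<^sub>0 nat, 'k) mpoly fract \<Rightarrow> ('i, 'k) mpoly fract" where
  "uple_local I d P v = (THE w. \<exists>a\<in>polys (monomials I d). \<exists>f\<in>polys (monomials I d).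
     uple_pull f \<notin> P \<and> v = Fract a f \<and> w = Fract (uple_pull a) (uple_pull f))"

definition uple_sheaf_map :: "'i::linorder set \<Rightarrow> nat \<Rightarrow> ('i \<Rightarrow>\<^sub>0 nat, 'k::field) mpoly set set \<Rightarrow>
    ('i \<Rightarrow>\<^sub>0 nat, 'k) proj_fun \<Rightarrow> ('i, 'k) proj_fun" where
  "uple_sheaf_map I d V s =
    (\<lambda>P\<in>preim (proj I) (uple_point I d) V. uple_local I d P (s (uple_point I d P)))"

definition uple_pushforward :: "'i::linorder set \<Rightarrow> nat \<Rightarrow>
    (('i, 'k::field) mpoly set, ('i, 'k) proj_fun, 's) mod_presheaf \<Rightarrow>
    (('i \<Rightarrow>\<^sub>0 nat, 'k) mpoly set, ('i \<Rightarrow>\<^sub>0 nat, 'k) proj_fun, 's) mod_presheaf" where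
  "uple_pushforward I d = pushforward (proj I) (uple_point I d) (uple_sheaf_map I d)"


section \<open>Ulrich sheaves\<close>

definition ulrich_sheaf :: "'i::linorder set \<Rightarrow>
    (('i, 'k::field) mpoly set, ('i, 'k) proj_fun, 's) mod_presheaf \<Rightarrow> bool" where
  "ulrich_sheaf I G \<longleftrightarrow> coherent (proj I) G \<and>
    (\<exists>k. has_sheaf_dim (proj I) G k \<and>
      (\<forall>q j. 1 \<le> q \<and> int q \<le> int k - 1 \<longrightarrow> cohomology_zero (proj I) (twist I j G) q) \<and>
      (\<forall>j<0. cohomology_zero (proj I) (twist I j G) 0) \<and>
      (\<forall>j\<ge>- int k. cohomology_zero (proj I) (twist I j G) k))"

definition ulrich_on_uple :: "'i::linorder set \<Rightarrow> nat \<Rightarrow>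
    (('i, 'k::field) mpoly set, ('i, 'k) proj_fun, 's) mod_presheaf \<Rightarrow> bool" where
  "ulrich_on_uple I d F \<longleftrightarrow> ulrich_sheaf (monomials I d) (uple_pushforward I d F)"

text \<open>The homogeneous coordinates of the projective plane.\<close>

abbreviation plane_coords :: "nat set" where
  "plane_coords \<equiv> {..<3}"

end

(*
  {0} lies in every nonempty open set, so a section of O(n) over such a set is a constant of the
  function field lying in all its stalks.  Write e = d - 1 and Q(u,w) = det [u | w | alpha].
  Codimension 3 says that the maximal minors of alpha have no common zero, and Cramer's rule then
  makes the complex
    O(d-2)^e --alpha--> O(d-1)^(d+1) --B--> O(2d-2)^(d+1) --alpha^T--> O(2d-1)^e,
    (B w)_l = Q(e_l, w),
  exact at every point.  Hence the cokernel is the kernel G of alpha^T on O(2d-2)^(d+1), whose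
  sections are constant vectors, and its j-th twist on the d-uple embedding is G(2d-2+dj).
  Chasing through 0 -> G -> O(2d-2)^(d+1) -> O(2d-1)^e -> 0 reduces the vanishing statements to the
  cohomology of O(n) on the plane and to the bijectivity of alpha^T from forms of degree d-2 to
  forms of degree d-1, which follows from H^1(O(-2)) = 0 and a dimension count.  Coherence comes
  from Noetherianity of polynomial rings (Dickson's lemma on leading monomials), the dimension
  of the support from algebraic dependence of four polynomials in three variables.
*)
theory Submission
  imports Defs "HOL-Computational_Algebra.Polynomial_Factorial"
begin

text \<open>The j-th twist of the pushforward is \<open>G m\<close> with m = 2e + dj and d = e + 1.
  On global sections the transpose, from degree m to m + 1, is onto if m + 1 is negative or at least
  e, while for 0 \<le> m + 1 < e the target has the larger dimension. The values of m jump over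
  exactly this gap, and j < 0, j \<ge> -2 become m < e, m \<ge> -2: the ranges where
  \<open>G m\<close> has no sections and O(m) no second cohomology. The kernel is preferred to the
  cokernel because in a subsheaf of a constant sheaf restriction is the identity, gluing is equality
  of vectors, and a Cech cocycle is already a coboundary of constants, so that only regularity has
  to be repaired. The obstacle is that open sets and points of the target need not come from the
  plane: a nonempty open set may have empty preimage. So comparisons of sections ask for a point of
  the preimage, members of a cover that miss the plane are dropped, and the support is described as
  the zero locus of the kernel of the pullback, without lifting its points.\<close>

type_synonym 'k xpoly = "(nat, 'k) mpoly"
type_synonym 'k ypoly = "(nat \<Rightarrow>\<^sub>0 nat, 'k) mpoly"

abbreviation (input) "keys \<equiv> Poly_Mapping.keys"
abbreviation (input) "lookup \<equiv> Poly_Mapping.lookup"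
abbreviation (input) "single \<equiv> Poly_Mapping.single"
abbreviation (input) "xyz \<equiv> {..<3 :: nat}"

section \<open>Polynomials and forms\<close>

text \<open>Serves twice: for the homogeneous components and for sorting the monomials of Laurent
  numerators by the size of their exponents.\<close>

definition part :: "(('i \<Rightarrow>\<^sub>0 nat) => bool) => ('i, 'k::field) mpoly => ('i, 'k) mpoly" where
 "part A f = Abs_poly_mapping (%t. if A t then lookup f t else 0)"

lemma lookup_part: "lookup (part A f) t = (if A t then lookup f t else 0)"
proof -
 have "{t. (if A t then lookup f t else 0) ~= 0} \<subseteq> {t. lookup f t ~= 0}"
 proof
  fix t assume "t \<in> {t. (if A t then lookup f t else 0) ~= 0}"
  then show "t \<in> {t. lookup f t ~= 0}" by (cases "A t") simp_all
 qed
 then have "finite {t. (if A t then lookup f t else 0) ~= 0}"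
  using finite_lookup by (rule finite_subset)
 then show ?thesis by (simp add: part_def)
qed

lemma keys_part: "keys (part A f) = {t \<in> keys f. A t}"
 by (auto simp: in_keys_iff lookup_part split: if_splits)

lemma part_add: "part A (f + g) = part A f + part A g"
 by (rule poly_mapping_eqI) (simp add: lookup_part lookup_add)

lemma part_0 [simp]: "part A 0 = 0"
 by (rule poly_mapping_eqI) (simp add: lookup_part)

lemma part_sum: "part A (sum f F) = (\<Sum>x\<in>F. part A (f x))"
 by (induction F rule: infinite_finite_induct) (simp_all add: part_add)

lemma part_compl: "part A f + part (%t. \<not> A t) f = f"
 by (rule poly_mapping_eqI) (simp add: lookup_part lookup_add)

lemma part_id: "(!!t. t \<in> keys f ==> A t) ==> part A f = f"
 by (rule poly_mapping_eqI) (auto simp: lookup_part in_keys_iff)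

lemma part_eq_0: "(!!t. t \<in> keys f ==> \<not> A t) ==> part A f = 0"
 by (rule poly_mapping_eqI) (auto simp: lookup_part in_keys_iff)

lemma hom_component_eq_part: "hom_component n f = part (%t. mdeg t = n) f"
proof (rule poly_mapping_eqI)
 fix u
 have "lookup (hom_component n f) u =
   (\<Sum>t\<in>{t \<in> keys f. mdeg t = n}. if t = u then lookup f t else 0)"
  unfolding hom_component_def by (simp add: lookup_sum lookup_single when_def)
 also have "\<dots> = lookup (part (%t. mdeg t = n) f) u"
  by (simp add: sum.delta lookup_part in_keys_iff)
 finally show "lookup (hom_component n f) u = lookup (part (%t. mdeg t = n) f) u" .
qed

lemmas lookup_hom_component = lookup_part[of "%t. mdeg t = n" for n, folded hom_component_eq_part]
lemmas hom_component_add = part_add[of "%t. mdeg t = n" for n, folded hom_component_eq_part]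
lemmas hom_component_sum = part_sum[of "%t. mdeg t = n" for n, folded hom_component_eq_part]
lemmas hom_component_0 = part_0[of "%t. mdeg t = n" for n, folded hom_component_eq_part]

lemma polys_0 [simp]: "0 \<in> polys I" and polys_1 [simp]: "1 \<in> polys I"
 by (auto simp: polys_def)

lemma polys_add: "f \<in> polys I ==> g \<in> polys I ==> f + g \<in> polys I"
 using keys_add[of f g] by (auto simp: polys_def)

lemma polys_uminus: "f \<in> polys I ==> - f \<in> polys I"
 by (auto simp: polys_def)

lemma polys_diff: "f \<in> polys I ==> g \<in> polys I ==> f - g \<in> polys I"
 using polys_add[of f I "- g"] polys_uminus[of g I] by simp

lemma polys_sum: "(!!x. x \<in> F ==> f x \<in> polys I) ==> sum f F \<in> polys I"
 by (induction F rule: infinite_finite_induct) (auto simp: polys_add)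

lemma polys_power: "f \<in> polys I ==> f ^ n \<in> polys I"
 by (induction n) (auto simp: polys_mult)

lemma polys_part: "f \<in> polys I ==> part A f \<in> polys I"
 by (auto simp: polys_def keys_part)

lemma polys_single: "keys t \<subseteq> I ==> single t c \<in> polys I"
 by (auto simp: polys_def split: if_splits)

lemma forms_polys: "f \<in> forms I n ==> f \<in> polys I"
 by (simp add: forms_def)

lemma forms_0 [simp]: "0 \<in> forms I n"
 by (simp add: forms_def)

lemma forms_1 [simp]: "1 \<in> forms I 0"
 by (rule one_in_forms)

lemma forms_add: "f \<in> forms I n ==> g \<in> forms I n ==> f + g \<in> forms I n"
 using keys_add[of f g] by (auto simp: forms_def polys_add)

lemma forms_uminus: "f \<in> forms I n ==> - f \<in> forms I n"
 by (auto simp: forms_def polys_uminus)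

lemma forms_diff: "f \<in> forms I n ==> g \<in> forms I n ==> f - g \<in> forms I n"
 using forms_add[of f I n "- g"] forms_uminus[of g I] by simp

lemma forms_sum: "(!!x. x \<in> F ==> f x \<in> forms I n) ==> sum f F \<in> forms I n"
 by (induction F rule: infinite_finite_induct) (auto simp: forms_add)

lemma forms_power: "f \<in> forms I m ==> f ^ n \<in> forms I (n * m)"
 by (induction n) (auto simp: forms_mult)

lemma forms_prod: "(!!x. x \<in> F ==> f x \<in> forms I (\<delta> x)) ==> prod f F \<in> forms I (sum \<delta> F)"
 by (induction F rule: infinite_finite_induct) (auto simp: forms_mult)

lemma forms_part: "f \<in> forms I n ==> part A f \<in> forms I n"
 by (auto simp: forms_def polys_part keys_part)

lemma forms_single: "keys t \<subseteq> I ==> mdeg t = n ==> single t c \<in> forms I n"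
 by (auto simp: forms_def polys_single split: if_splits)

lemma mdeg_single [simp]: "mdeg (single i n) = n"
 by (simp add: mdeg_def)

lemma mdeg_0 [simp]: "mdeg 0 = 0"
 by (simp add: mdeg_def)

lemma forms_const: "single 0 c \<in> forms I 0"
 by (rule forms_single) auto

lemma forms_mvar: "i \<in> I ==> mvar i \<in> forms I 1"
 unfolding mvar_def by (rule forms_single) auto

lemma mvar_nonzero [simp]: "mvar i ~= 0"
 by (metis mvar_def lookup_single_eq lookup_zero one_neq_zero)

lemma hom_component_forms: "f \<in> polys I ==> hom_component n f \<in> forms I n"
 by (auto simp: forms_def hom_component_eq_part polys_part keys_part)

lemma hom_component_form: "f \<in> forms I m ==> hom_component n f = (if n = m then f else 0)"
 by (auto simp: forms_def hom_component_eq_part intro: part_id part_eq_0)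

lemma forms_disjoint: "f \<in> forms I m ==> f \<in> forms I n ==> f ~= 0 ==> m = n"
 using hom_component_form by metis

lemma forms_mult_const: "f \<in> forms I n ==> single 0 c * f \<in> forms I n"
 using forms_mult[OF forms_const] by fastforce

lemma sum_hom_components:
 assumes "!!t. t \<in> keys f ==> mdeg t < D"
 shows "(\<Sum>n<D. hom_component n f) = f"
proof (rule poly_mapping_eqI)
 fix u
 show "lookup (\<Sum>n<D. hom_component n f) u = lookup f u"
  using assms[of u] by (auto simp: lookup_sum lookup_hom_component in_keys_iff)
qed

lemma degree_bound: obtains D where "!!t. t \<in> keys f ==> mdeg t < D"
proof
 fix t assume "t \<in> keys f"
 then show "mdeg t < Suc (Max (mdeg ` keys f))"
  by (simp add: le_imp_less_Suc)
qed

lemma hom_component_mult: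
 "hom_component n (f * g) = (\<Sum>i\<le>n. hom_component i f * hom_component (n - i) g)"
proof -
 obtain D1 where D1: "!!t. t \<in> keys f ==> mdeg t < D1" using degree_bound[of f] by blast
 obtain D2 where D2: "!!t. t \<in> keys g ==> mdeg t < D2" using degree_bound[of g] by blast
 \<comment> \<open>The bound also exceeds \<open>n\<close>, so that every index \<open>n - i\<close>
   with \<open>i \<le> n\<close> lies in the range of the second sum.\<close>
 let ?D = "max (Suc n) (max D1 D2)"
 have f: "f = (\<Sum>i<?D. hom_component i f)" and g: "g = (\<Sum>i<?D. hom_component i g)"
  using D1 D2 by (auto intro!: sum_hom_components[symmetric] simp: less_max_iff_disj)
 have fm: "hom_component i f * hom_component j g \<in> forms UNIV (i + j)" for i j
  by (intro forms_mult hom_component_forms) (auto simp: polys_def)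
 have "hom_component n (f * g) =
   (\<Sum>i<?D. \<Sum>j<?D. hom_component n (hom_component i f * hom_component j g))"
  by (subst f, subst g) (simp only: sum_product hom_component_sum)
 also have "\<dots> = (\<Sum>i<?D. \<Sum>j<?D. if j = n - i & i \<le> n then hom_component i f * hom_component j g else 0)"
  by (intro sum.cong refl) (auto simp: hom_component_form[OF fm])
 also have "\<dots> = (\<Sum>i<?D. if i \<le> n then hom_component i f * hom_component (n - i) g else 0)"
  by (intro sum.cong refl) (auto simp: sum.delta)
 also have "\<dots> = (\<Sum>i\<le>n. hom_component i f * hom_component (n - i) g)"
  by (rule sum.mono_neutral_cong_right) auto
 finally show ?thesis .
qed

lemma hom_component_mult_form:
 assumes "f \<in> forms I m"
 shows "hom_component n (g * f) = (if m \<le> n then hom_component (n - m) g * f else 0)"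
proof -
 have "hom_component n (f * g) = (\<Sum>i\<le>n. if i = m then f * hom_component (n - m) g else 0)"
  unfolding hom_component_mult by (intro sum.cong refl) (simp add: hom_component_form[OF assms])
 then show ?thesis by (simp add: mult.commute)
qed

lemma polys_hom_component: "f \<in> polys I ==> hom_component n f \<in> polys I"
 using hom_component_forms forms_polys by blast

subsection \<open>Ideals of polynomials\<close>

text \<open>Ideals of the subring \<open>polys I\<close> in terms of the operations of the ambient
  type; \<open>pideal_ideal\<close> and \<open>pprime_primeideal\<close> identify them with the
  ideals and primes of \<open>poly_ring I\<close>.\<close>

definition pideal :: "'i set => ('i, 'k::field) mpoly set => bool" where
 "pideal I P \<longleftrightarrow> P \<subseteq> polys I & 0 \<in> P & (\<forall>f\<in>P. \<forall>g\<in>P. f + g \<in> P) &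
   (\<forall>f\<in>P. \<forall>g\<in>polys I. g * f \<in> P)"

definition pprime :: "'i set => ('i, 'k::field) mpoly set => bool" where
 "pprime I P \<longleftrightarrow> pideal I P & 1 \<notin> P &
   (\<forall>f\<in>polys I. \<forall>g\<in>polys I. f * g \<in> P --> f \<in> P \<or> g \<in> P)"

definition homog :: "('i, 'k::field) mpoly set => bool" where
 "homog P \<longleftrightarrow> (\<forall>f\<in>P. \<forall>n. hom_component n f \<in> P)"

lemma pidealD:
 assumes "pideal I P"
 shows "f \<in> P ==> f \<in> polys I" "0 \<in> P" "f \<in> P ==> g \<in> P ==> f + g \<in> P"
  "f \<in> P ==> h \<in> polys I ==> h * f \<in> P" "f \<in> P ==> h \<in> polys I ==> f * h \<in> P"
  "f \<in> P ==> - f \<in> P"  "f \<in> P ==> g \<in> P ==> f - g \<in> P"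
proof -
 note P = assms[unfolded pideal_def]
 show *: "f \<in> P ==> f \<in> polys I" "0 \<in> P" "f \<in> P ==> g \<in> P ==> f + g \<in> P"
  "f \<in> P ==> h \<in> polys I ==> h * f \<in> P" for f g h using P by auto
 then show "f \<in> P ==> h \<in> polys I ==> f * h \<in> P" by (simp add: mult.commute)
 show m: "f \<in> P ==> - f \<in> P" for f
  using *(4)[of f "- 1"] polys_uminus[OF polys_1, of I] by simp
 show "f \<in> P ==> g \<in> P ==> f - g \<in> P"
  using *(3)[of f "- g"] m[of g] by simp
qed

lemma pideal_sum:
 assumes "pideal I P" "!!x. x \<in> F ==> f x \<in> P"
 shows "sum f F \<in> P"
 using assms(2) by (induction F rule: infinite_finite_induct) (auto simp: pidealD[OF assms(1)])

lemma pprimeD: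
 assumes "pprime I P"
 shows "pideal I P" "1 \<notin> P" "f \<in> polys I ==> g \<in> polys I ==> f * g \<in> P ==> f \<in> P \<or> g \<in> P"
 using assms by (auto simp: pprime_def)

lemma pprime_power:
 assumes "pprime I P" "f \<in> polys I" "f ^ n \<in> P"
 shows "f \<in> P"
 using assms(3)
proof (induction n)
 case (Suc n)
 then show ?case using pprimeD(3)[OF assms(1,2) polys_power[OF assms(2)]] by auto
qed (use pprimeD(2)[OF assms(1)] in simp)

lemma cring_poly_ring: "cring (poly_ring I :: ('i, 'k::field) mpoly ring)"
proof (rule cringI)
 have "\<exists>y\<in>polys I. x + y = 0" if "x \<in> polys I" for x :: "('i, 'k) mpoly"
  using polys_uminus[OF that] by (intro bexI[of _ "- x"]) auto
 then show "abelian_group (poly_ring I :: ('i, 'k) mpoly ring)"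
  by (intro abelian_groupI) (auto simp: poly_ring_def polys_add ac_simps)
 show "comm_monoid (poly_ring I :: ('i, 'k) mpoly ring)"
  by (rule comm_monoidI) (auto simp: poly_ring_def polys_mult ac_simps)
qed (auto simp: poly_ring_def algebra_simps)

lemma pideal_ideal: "pideal I P \<longleftrightarrow> ideal P (poly_ring I)"
proof
 interpret R: cring "poly_ring I" by (rule cring_poly_ring)
 show "ideal P (poly_ring I)" if "pideal I P"
 proof (rule idealI)
  show "ring (poly_ring I)" ..
  have "subgroup P (add_monoid (poly_ring I))"
  proof (rule R.add.subgroupI)
   show "P \<subseteq> carrier (poly_ring I)" using pidealD[OF that] by (auto simp: poly_ring_def)
   show "P ~= {}" using pidealD(2)[OF that] by blast
   fix a assume a: "a \<in> P"
   have "\<ominus>\<^bsub>poly_ring I\<^esub> a = - a"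
    by (rule R.minus_equality)
     (use a that pidealD[OF that] polys_uminus in \<open>auto simp: poly_ring_def\<close>)
   then show "\<ominus>\<^bsub>poly_ring I\<^esub> a \<in> P" using a pidealD(6)[OF that] by simp
  qed (use pidealD[OF that] in \<open>auto simp: poly_ring_def\<close>)
  then show "subgroup P (add_monoid (poly_ring I))" .
 qed (use pidealD[OF that] in \<open>auto simp: poly_ring_def\<close>)
 show "pideal I P" if P: "ideal P (poly_ring I)"
 proof -
  interpret P: ideal P "poly_ring I" by (rule P)
  show ?thesis
   using P.a_subset P.zero_closed P.a_closed P.I_l_closed
   by (auto simp: pideal_def poly_ring_def)
 qed
qed

lemma pprime_primeideal: "pprime I P \<longleftrightarrow> primeideal P (poly_ring I)"
proof
 show "primeideal P (poly_ring I)" if "pprime I P"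
  by (rule primeidealI)
   (use that pideal_ideal cring_poly_ring pprimeD[OF that] in \<open>auto simp: poly_ring_def\<close>)
 show "pprime I P" if P: "primeideal P (poly_ring I)"
 proof -
  interpret P: primeideal P "poly_ring I" by (rule P)
  have "1 \<notin> P"
   using P.one_imp_carrier P.I_notcarr by (auto simp: poly_ring_def)
  moreover have "pideal I P" using pideal_ideal P.is_ideal by blast
  ultimately show ?thesis using P.I_prime by (auto simp: pprime_def poly_ring_def)
 qed
qed

lemma proj_points_iff:
 "P \<in> proj_points I \<longleftrightarrow> pprime I P & homog P & \<not> mvar ` I \<subseteq> P"
 by (simp add: proj_points_def pprime_primeideal homog_def)

lemma homog_memI:
 assumes "pideal I P" "!!n. hom_component n f \<in> P"
 shows "f \<in> P"
proof -
 obtain D where D: "!!t. t \<in> keys f ==> mdeg t < D" using degree_bound[of f] by blast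
 show ?thesis using pideal_sum[OF assms(1), of "{..<D}" "%n. hom_component n f"] assms(2)
  by (simp add: sum_hom_components[OF D])
qed

text \<open>A product outside a homogeneous ideal is detected on the lowest components outside it.\<close>

lemma homog_primeI:
 fixes P :: "('i, 'k::field) mpoly set"
 assumes P: "pideal I P" "homog P" "1 \<notin> P"
  and *: "!!f g m n. f \<in> forms I m ==> g \<in> forms I n ==> f * g \<in> P ==> f \<in> P \<or> g \<in> P"
 shows "pprime I P"
 unfolding pprime_def
proof (intro conjI P ballI impI, rule ccontr)
 fix f g assume fg: "f \<in> polys I" "g \<in> polys I" "f * g \<in> P" and "\<not> (f \<in> P \<or> g \<in> P)"
 then obtain m0 n0 where "hom_component m0 f \<notin> P" "hom_component n0 g \<notin> P"
  using homog_memI[OF P(1)] by metis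
 then obtain m n where m: "hom_component m f \<notin> P" "!!i. i < m ==> hom_component i f \<in> P"
  and n: "hom_component n g \<notin> P" "!!i. i < n ==> hom_component i g \<in> P"
  using exists_least_iff[of "%m. hom_component m f \<notin> P"]
   exists_least_iff[of "%m. hom_component m g \<notin> P"] by metis
 have "hom_component (m + n) (f * g) \<in> P" using fg(3) P(2) by (simp add: homog_def)
 moreover have "hom_component (m + n) (f * g) = hom_component m f * hom_component n g +
   (\<Sum>i\<in>{..m + n} - {m}. hom_component i f * hom_component (m + n - i) g)"
  unfolding hom_component_mult by (subst sum.remove[of _ m]) auto
 moreover have "(\<Sum>i\<in>{..m + n} - {m}. hom_component i f * hom_component (m + n - i) g) \<in> P"
 proof (rule pideal_sum[OF P(1)])
  fix i assume "i \<in> {..m + n} - {m}"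
  then consider "i < m" | "m + n - i < n" by fastforce
  then show "hom_component i f * hom_component (m + n - i) g \<in> P"
  proof cases
   case 1
   then show ?thesis using pidealD(5)[OF P(1) m(2) polys_hom_component[OF fg(2)]] by blast
  next
   case 2
   then show ?thesis using pidealD(4)[OF P(1) n(2) polys_hom_component[OF fg(1)]] by blast
  qed
 qed
 ultimately have "hom_component m f * hom_component n g \<in> P"
  using pidealD(7)[OF P(1)] by fastforce
 then show False using *[OF hom_component_forms hom_component_forms] m n fg by blast
qed

section \<open>Generated homogeneous ideals and the projective Nullstellensatz\<close>

definition pgen :: "'i set => ('i, 'k::field) mpoly set => ('i, 'k) mpoly set" where
 "pgen I T = {f. \<exists>F c. finite F & F \<subseteq> T & (\<forall>t\<in>F. c t \<in> polys I) & f = (\<Sum>t\<in>F. c t * t)}"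

lemma pgen_superset: "T \<subseteq> pgen I T"
proof
 fix t assume "t \<in> T"
 then show "t \<in> pgen I T" unfolding pgen_def
  by (intro CollectI exI[of _ "{t}"] exI[of _ "%_. 1"]) auto
qed

lemma pideal_pgen:
 fixes T :: "('i, 'k::field) mpoly set"
 assumes "T \<subseteq> polys I"
 shows "pideal I (pgen I T)"
 unfolding pideal_def
proof (intro conjI ballI subsetI)
 fix f assume "f \<in> pgen I T"
 then show "f \<in> polys I"
  using assms by (auto simp: pgen_def intro!: polys_sum polys_mult)
next
 show "0 \<in> pgen I T" unfolding pgen_def by (intro CollectI exI[of _ "{}"]) auto
next
 fix f g assume "f \<in> pgen I T" "g \<in> pgen I T"
 then obtain F c G e where F: "finite F" "F \<subseteq> T" "\<forall>t\<in>F. c t \<in> polys I" "f = (\<Sum>t\<in>F. c t * t)"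
  and G: "finite G" "G \<subseteq> T" "\<forall>t\<in>G. e t \<in> polys I" "g = (\<Sum>t\<in>G. e t * t)"
  unfolding pgen_def by blast
 let ?c = "%t. (if t \<in> F then c t else 0) + (if t \<in> G then e t else 0)"
 have "f = (\<Sum>t\<in>F \<union> G. (if t \<in> F then c t else 0) * t)"
  unfolding F(4) by (rule sum.mono_neutral_cong_left) (use F G in auto)
 moreover have "g = (\<Sum>t\<in>F \<union> G. (if t \<in> G then e t else 0) * t)"
  unfolding G(4) by (rule sum.mono_neutral_cong_left) (use F G in auto)
 ultimately have "f + g = (\<Sum>t\<in>F \<union> G. ?c t * t)"
  by (simp add: distrib_right sum.distrib)
 then show "f + g \<in> pgen I T" unfolding pgen_def
  by (intro CollectI exI[of _ "F \<union> G"] exI[of _ ?c]) (use F G in \<open>auto intro: polys_add\<close>)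
next
 fix f g :: "('i, 'k) mpoly" assume "f \<in> pgen I T" and g: "g \<in> polys I"
 then obtain F c where F: "finite F" "F \<subseteq> T" "\<forall>t\<in>F. c t \<in> polys I" "f = (\<Sum>t\<in>F. c t * t)"
  unfolding pgen_def by blast
 show "g * f \<in> pgen I T" unfolding pgen_def
  by (intro CollectI exI[of _ F] exI[of _ "%t. g * c t"])
   (use F g in \<open>auto intro: polys_mult simp: sum_distrib_left mult.assoc\<close>)
qed

text \<open>The component of degree \<open>n\<close> of a representation is again a representation,
  now with homogeneous coefficients; generators of degree above \<open>n\<close> drop out of
  it.\<close>

lemma pgen_form:
 assumes "f \<in> pgen I T" "f \<in> forms I n" "!!t. t \<in> T ==> t \<in> forms I (\<delta> t)"
 obtains F c where "finite F" "F \<subseteq> T" "!!t. t \<in> F ==> \<delta> t \<le> n & c t \<in> forms I (n - \<delta> t)"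
  "f = (\<Sum>t\<in>F. c t * t)"
proof -
 obtain F c where F: "finite F" "F \<subseteq> T" "\<forall>t\<in>F. c t \<in> polys I" "f = (\<Sum>t\<in>F. c t * t)"
  using assms(1) unfolding pgen_def by blast
 have "f = hom_component n f" by (simp add: hom_component_form[OF assms(2)])
 also have "\<dots> = (\<Sum>t\<in>F. hom_component n (c t * t))" unfolding F(4) hom_component_sum ..
 also have "\<dots> = (\<Sum>t\<in>F. if \<delta> t \<le> n then hom_component (n - \<delta> t) (c t) * t else 0)"
  by (intro sum.cong refl hom_component_mult_form) (use F assms in blast)
 also have "\<dots> = (\<Sum>t\<in>{t \<in> F. \<delta> t \<le> n}. hom_component (n - \<delta> t) (c t) * t)"
  using F(1) by (simp add: sum.inter_filter)
 finally have eq: "f = (\<Sum>t\<in>{t \<in> F. \<delta> t \<le> n}. hom_component (n - \<delta> t) (c t) * t)" .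
 show ?thesis
  by (rule that[OF _ _ _ eq]) (use F in \<open>auto intro!: hom_component_forms\<close>)
qed

lemma homog_pgen:
 assumes "T \<subseteq> (\<Union>n. forms I n)"
 shows "homog (pgen I T)"
 unfolding homog_def
proof (intro ballI allI)
 fix f n assume "f \<in> pgen I T"
 then obtain F c where F: "finite F" "F \<subseteq> T" "\<forall>t\<in>F. c t \<in> polys I" "f = (\<Sum>t\<in>F. c t * t)"
  unfolding pgen_def by blast
 have T: "T \<subseteq> polys I" using assms forms_polys by blast
 show "hom_component n f \<in> pgen I T"
  unfolding F(4) hom_component_sum
 proof (rule pideal_sum[OF pideal_pgen[OF T]])
  fix t assume t: "t \<in> F"
  then obtain m where m: "t \<in> forms I m" using F assms by blast
  have "t \<in> pgen I T" using t F pgen_superset by blast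
  then show "hom_component n (c t * t) \<in> pgen I T"
   using t F pidealD(4)[OF pideal_pgen[OF T]] pidealD(2)[OF pideal_pgen[OF T]]
   by (simp add: hom_component_mult_form[OF m] polys_hom_component)
 qed
qed

text \<open>Zorn's lemma on the homogeneous ideals above \<open>T\<close> that contain no power of \<open>h\<close>.\<close>

lemma exists_homog_prime:
 fixes h :: "('i, 'k::field) mpoly"
 assumes T: "T \<subseteq> (\<Union>n. forms I n)" and h: "h \<in> forms I m" and nin: "!!N. h ^ N \<notin> pgen I T"
 obtains P where "pprime I P" "homog P" "T \<subseteq> P" "h \<notin> P"
proof -
 let ?\<A> = "{P. pideal I P & homog P & T \<subseteq> P & (\<forall>N. h ^ N \<notin> P)}"
 have T': "T \<subseteq> polys I" using T forms_polys by blast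
 have ne: "pgen I T \<in> ?\<A>"
  using pideal_pgen[OF T'] homog_pgen[OF T] pgen_superset nin by blast
 have "\<Union>C \<in> ?\<A>" if C: "C ~= {}" "subset.chain ?\<A> C" for C
 proof -
  have sub: "P \<in> ?\<A>" if "P \<in> C" for P using that C by (auto simp: subset.chain_def)
  have "pideal I (\<Union>C)" unfolding pideal_def
  proof (intro conjI ballI)
   show "\<Union>C \<subseteq> polys I" using sub unfolding pideal_def by blast
   show "0 \<in> \<Union>C" using C(1) sub by (auto simp: pideal_def)
  next
   fix f g assume "f \<in> \<Union>C" "g \<in> \<Union>C"
   then obtain A B where AB: "A \<in> C" "B \<in> C" "f \<in> A" "g \<in> B" by blast
   then have "A \<subseteq> B \<or> B \<subseteq> A" using C(2) by (auto simp: subset.chain_def)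
   moreover have "pideal I A" "pideal I B" using sub AB by auto
   ultimately have "f + g \<in> A \<or> f + g \<in> B" using AB pidealD(3) by blast
   then show "f + g \<in> \<Union>C" using AB by blast
  next
   fix f g :: "('i, 'k) mpoly" assume "f \<in> \<Union>C" "g \<in> polys I"
   then obtain A where "A \<in> C" "f \<in> A" by blast
   then show "g * f \<in> \<Union>C" using sub[of A] pidealD(4)[of I A f g] \<open>g \<in> polys I\<close> by auto
  qed
  moreover have "homog (\<Union>C)" using sub unfolding homog_def by blast
  moreover have "T \<subseteq> \<Union>C" "\<forall>N. h ^ N \<notin> \<Union>C" using sub C(1) by auto
  ultimately show ?thesis by simp
 qed
 then have "\<exists>M\<in>?\<A>. \<forall>X\<in>?\<A>. M \<subseteq> X --> X = M"
  by (intro subset_Zorn_nonempty) (use ne in auto)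
 then obtain P where P: "P \<in> ?\<A>" and max: "!!Q. Q \<in> ?\<A> ==> P \<subseteq> Q ==> Q = P"
  by auto
 have idP: "pideal I P" and hP: "homog P" and TP: "T \<subseteq> P" and nP: "!!N. h ^ N \<notin> P" using P by auto
 \<comment> \<open>By maximality the homogeneous ideal P + (f) contains a power of \<open>h\<close>.
   Multiplying two such powers, for \<open>f\<close> and for \<open>g\<close> with
   \<open>f * g \<in> P\<close>, will put a power of \<open>h\<close> into \<open>P\<close>.\<close>
 have ext: "\<exists>N. \<exists>p\<in>P. \<exists>a\<in>polys I. h ^ N = p + a * f" if f: "f \<in> forms I k" "f \<notin> P" for f k
 proof (rule ccontr)
  assume neg: "\<not> ?thesis"
  let ?Q = "{p + a * f | p a. p \<in> P & a \<in> polys I}"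
  have fp: "f \<in> polys I" using f forms_polys by blast
  have PQ: "P \<subseteq> ?Q"
  proof
   fix p assume "p \<in> P"
   then show "p \<in> ?Q" by (intro CollectI exI[of _ p] exI[of _ 0]) auto
  qed
  have fQ: "f \<in> ?Q" using pidealD(2)[OF idP] by (intro CollectI exI[of _ 0] exI[of _ 1]) auto
  have "pideal I ?Q" unfolding pideal_def
  proof (intro conjI ballI)
   show "?Q \<subseteq> polys I" using pidealD(1)[OF idP] fp by (auto intro!: polys_add polys_mult)
   show "0 \<in> ?Q" using PQ pidealD(2)[OF idP] by blast
  next
   fix u v assume "u \<in> ?Q" "v \<in> ?Q"
   then obtain p a q b where "u = p + a * f" "v = q + b * f" "p \<in> P" "q \<in> P" "a \<in> polys I" "b \<in> polys I"
    by blast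
   then show "u + v \<in> ?Q"
    by (intro CollectI exI[of _ "p + q"] exI[of _ "a + b"])
     (auto simp: algebra_simps pidealD[OF idP] polys_add)
  next
   fix u v :: "('i, 'k) mpoly" assume "u \<in> ?Q" "v \<in> polys I"
   then obtain p a where "u = p + a * f" "p \<in> P" "a \<in> polys I" by blast
   then show "v * u \<in> ?Q" using \<open>v \<in> polys I\<close>
    by (intro CollectI exI[of _ "v * p"] exI[of _ "v * a"])
     (auto simp: algebra_simps pidealD[OF idP] polys_mult)
  qed
  moreover have "homog ?Q" unfolding homog_def
  proof (intro ballI allI)
   fix u n assume "u \<in> ?Q"
   then obtain p a where u: "u = p + a * f" "p \<in> P" "a \<in> polys I" by blast
   show "hom_component n u \<in> ?Q"
    by (intro CollectI exI[of _ "hom_component n p"]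
      exI[of _ "if k \<le> n then hom_component (n - k) a else 0"])
     (use u hP in \<open>auto simp: hom_component_add hom_component_mult_form[OF f(1)] homog_def
      polys_hom_component\<close>)
  qed
  moreover have "h ^ N \<notin> ?Q" for N using neg by auto
  moreover have "T \<subseteq> ?Q" using PQ TP by (rule order_trans[rotated])
  ultimately have "?Q = P" using max[of ?Q] PQ by simp
  then show False using fQ f(2) by blast
 qed
 have "pprime I P"
 proof (rule homog_primeI[OF idP hP])
  show "1 \<notin> P" using nP[of 0] by simp
 next
  fix f g k l assume fg: "f \<in> forms I k" "g \<in> forms I l" "f * g \<in> P"
  show "f \<in> P \<or> g \<in> P"
  proof (rule ccontr)
   assume "\<not> (f \<in> P \<or> g \<in> P)"
   then obtain N p a M q b where "h ^ N = p + a * f" "h ^ M = q + b * g"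
    and pq: "p \<in> P" "q \<in> P" "a \<in> polys I" "b \<in> polys I"
    using ext[OF fg(1)] ext[OF fg(2)] by auto
   then have "h ^ (N + M) = p * (q + b * g) + a * f * q + a * b * (f * g)"
    by (simp add: power_add algebra_simps)
   moreover have "p * (q + b * g) + a * f * q + a * b * (f * g) \<in> P"
    using pq fg(3) forms_polys[OF fg(1)] forms_polys[OF fg(2)] pidealD(1)[OF idP pq(2)]
    by (intro pidealD(3)[OF idP] pidealD(4)[OF idP fg(3)] pidealD(5)[OF idP pq(1)]
      pidealD(4)[OF idP pq(2)] polys_add polys_mult)
   ultimately have "h ^ (N + M) \<in> P" by simp
   then show False using nP by blast
  qed
 qed
 then show ?thesis using that hP TP nP[of 1] by simp
qed

text \<open>A monomial of positive degree is divisible by a variable.\<close>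

lemma form_in_irrelevant:
 fixes h :: "('i, 'k::field) mpoly"
 assumes "pideal I P" "mvar ` I \<subseteq> P" "h \<in> forms I m" "0 < m"
 shows "h \<in> P"
proof -
 have s: "single t c \<in> P" if t: "t \<in> keys h" for t and c :: 'k
 proof -
  have "mdeg t = m" "keys t \<subseteq> I" using t assms(3) by (auto simp: forms_def polys_def)
  then have "keys t ~= {}" using assms(4) by (auto simp: mdeg_def)
  then obtain i where i: "i \<in> keys t" "i \<in> I"
   using \<open>keys t \<subseteq> I\<close> by blast
  define u where "u = t - single i 1"
  have tu: "t = u + single i 1"
   by (rule poly_mapping_eqI) (use i in \<open>auto simp: u_def lookup_add lookup_minus lookup_single when_def in_keys_iff\<close>)
  have "keys u \<subseteq> keys t"
   unfolding u_def by (auto simp: in_keys_iff lookup_minus)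
  then have "single u c * mvar i \<in> P"
   using assms(1,2) i \<open>keys t \<subseteq> I\<close> by (intro pidealD(4)[OF assms(1)] polys_single) auto
  then show ?thesis by (simp add: mvar_def mult_single tu)
 qed
 have "h = (\<Sum>t\<in>keys h. single t (lookup h t))"
  by (rule poly_mapping_eqI) (auto simp: lookup_sum lookup_single when_def in_keys_iff)
 then show ?thesis using pideal_sum[OF assms(1), of "keys h"] s by metis
qed

text \<open>A homogeneous prime that omits a form of positive degree cannot contain all variables,
  so it is a point of Proj. If no power of \<open>h\<close> lay in the ideal of \<open>T\<close>,
  the prime supplied by \<open>exists_homog_prime\<close> would therefore be a point that contains
  \<open>T\<close> but not \<open>h\<close>.\<close>

lemma projective_nullstellensatz:
 assumes T: "T \<subseteq> (\<Union>n. forms I n)" and h: "h \<in> forms I m" "0 < m"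
  and *: "!!P. P \<in> proj_points I ==> T \<subseteq> P ==> h \<in> P"
 obtains N where "h ^ N \<in> pgen I T"
proof (rule ccontr)
 assume "\<not> thesis"
 then have "!!N. h ^ N \<notin> pgen I T" using that by blast
 then obtain P where P: "pprime I P" "homog P" "T \<subseteq> P" "h \<notin> P"
  using exists_homog_prime[OF T h(1)] by blast
 then have "P \<in> proj_points I"
  unfolding proj_points_iff using form_in_irrelevant[OF pprimeD(1) _ h] by blast
 then show False using * P by blast
qed

section \<open>Points, principal open sets and local fractions\<close>

lemma proj_pointD:
 assumes "P \<in> proj_points I"
 shows "pprime I P" "pideal I P" "homog P" "1 \<notin> P" "0 \<in> P" "\<exists>i\<in>I. mvar i \<notin> P"
  "f \<in> polys I ==> g \<in> polys I ==> f * g \<in> P \<longleftrightarrow> f \<in> P \<or> g \<in> P"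
proof -
 note P = assms[unfolded proj_points_iff]
 show "pprime I P" "pideal I P" "homog P" "1 \<notin> P" "0 \<in> P" "\<exists>i\<in>I. mvar i \<notin> P"
  using P pidealD(2) by (auto simp: pprime_def)
 show "f \<in> polys I ==> g \<in> polys I ==> f * g \<in> P \<longleftrightarrow> f \<in> P \<or> g \<in> P"
  using assms by (rule forms_mult_in_prime_iff)
qed

lemma nonzero_if_notin: "P \<in> proj_points I ==> f \<notin> P ==> f ~= 0"
 using proj_pointD(5) by blast

lemma forms_mult_notin:
 assumes "P \<in> proj_points I" "f \<in> forms I m" "g \<in> forms I n" "f \<notin> P" "g \<notin> P"
 shows "f * g \<notin> P"
 using proj_pointD(7)[OF assms(1) forms_polys forms_polys] assms by blast

lemma forms_power_notin:
 assumes "P \<in> proj_points I" "f \<in> forms I m" "f \<notin> P"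
 shows "f ^ n \<notin> P"
 using pprime_power[OF proj_pointD(1)[OF assms(1)] forms_polys[OF assms(2)]] assms(3) by blast

lemma generic_point:
 assumes "I ~= {}"
 shows "{0 :: ('i::linorder, 'k::field) mpoly} \<in> proj_points I"
proof -
 have "pprime I {0 :: ('i, 'k) mpoly}" by (auto simp: pprime_def pideal_def)
 then show ?thesis using assms by (auto simp: proj_points_iff homog_def hom_component_0)
qed

definition pbasic :: "'i set => ('i, 'k::field) mpoly => ('i, 'k) mpoly set set" where
 "pbasic I f = {P \<in> proj_points I. f \<notin> P}"

lemma openin_pbasic: "f \<in> forms I n ==> openin (proj_top I) (pbasic I f)"
 unfolding openin_proj_top pbasic_def by (intro exI[of _ "{f}"]) auto

lemma pbasic_mult: "f \<in> forms I m ==> g \<in> forms I n ==> pbasic I (f * g) = pbasic I f \<inter> pbasic I g"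
 by (auto simp: pbasic_def proj_pointD(7)[OF _ forms_polys forms_polys])

lemma open_subset_points: "openin (proj_top I) U ==> U \<subseteq> proj_points I"
 using openin_subset topspace_proj_top by metis

lemma open_pbasic:
 assumes "openin (proj_top I) U" "P \<in> U"
 obtains f n where "f \<in> forms I n" "P \<in> pbasic I f" "pbasic I f \<subseteq> U"
proof -
 obtain T where T: "T \<subseteq> (\<Union>n. forms I n)" "U = {P \<in> proj_points I. \<not> T \<subseteq> P}"
  using assms(1) unfolding openin_proj_top by blast
 then obtain f where f: "f \<in> T" "f \<notin> P" using assms(2) by blast
 then obtain n where "f \<in> forms I n" using T by blast
 moreover have "P \<in> pbasic I f" "pbasic I f \<subseteq> U" using f T assms(2) by (auto simp: pbasic_def)
 ultimately show ?thesis using that by blast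
qed

lemma open_generization:
 assumes "openin (proj_top I) U" "P \<in> U" "Q \<in> proj_points I" "Q \<subseteq> P"
 shows "Q \<in> U"
proof -
 obtain f n where f: "f \<in> forms I n" "P \<in> pbasic I f" "pbasic I f \<subseteq> U"
  by (rule open_pbasic[OF assms(1,2)])
 then have "Q \<in> pbasic I f" using assms by (auto simp: pbasic_def)
 then show ?thesis using f by blast
qed

lemma generic_in_open:
 assumes "openin (proj_top I) U" "P \<in> U"
 shows "{0 :: ('i::linorder, 'k::field) mpoly} \<in> U"
proof -
 have P: "P \<in> proj_points I" using assms open_subset_points by blast
 then have "I ~= {}" using proj_pointD(6) by blast
 then show ?thesis
  by (rule open_generization[OF assms generic_point]) (use proj_pointD(5)[OF P] in auto)
qed

text \<open>The stalk of O(n) at \<open>P\<close>, as a subset of the function field.\<close>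

definition loc :: "'i::linorder set => int => ('i, 'k::field) mpoly set => ('i, 'k) mpoly fract set" where
 "loc I n P = {Fract a f | a f k l. a \<in> forms I k & f \<in> forms I l & f \<notin> P & int k = int l + n}"

lemma locI:
 "a \<in> forms I k ==> f \<in> forms I l ==> f \<notin> P ==> int k = int l + n ==> Fract a f \<in> loc I n P"
 unfolding loc_def by blast

lemma locE:
 assumes "v \<in> loc I n P"
 obtains a f k l where "a \<in> forms I k" "f \<in> forms I l" "f \<notin> P" "int k = int l + n" "v = Fract a f"
 using assms unfolding loc_def by blast

lemma loc_form: "P \<in> proj_points I ==> a \<in> forms I n ==> to_fract a \<in> loc I (int n) P"
 unfolding to_fract_def by (rule locI[of _ _ n _ 0]) (auto simp: proj_pointD)

lemma loc_inverse: "P \<in> proj_points I ==> f \<in> forms I l ==> f \<notin> P ==> 1 / to_fract f \<in> loc I (- int l) P"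
proof -
 assume *: "f \<in> forms I l" "f \<notin> P"
 have "1 / to_fract f = Fract 1 f" by (simp add: Fract_conv_to_fract)
 then show ?thesis using locI[OF forms_1 *, of "- int l"] by simp
qed

lemma loc_mult:
 assumes P: "P \<in> proj_points I" and v: "v \<in> loc I m P" and w: "w \<in> loc I n P"
 shows "v * w \<in> loc I (m + n) P"
proof -
 from v obtain a f k l where v: "a \<in> forms I k" "f \<in> forms I l" "f \<notin> P" "int k = int l + m" "v = Fract a f"
  by (rule locE)
 from w obtain b g k' l' where w: "b \<in> forms I k'" "g \<in> forms I l'" "g \<notin> P" "int k' = int l' + n" "w = Fract b g"
  by (rule locE)
 show ?thesis unfolding v(5) w(5) mult_fract
  by (rule locI[OF forms_mult forms_mult forms_mult_notin]) (use v w P in auto)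
qed

lemma loc_mult': "P \<in> proj_points I ==> v \<in> loc I m P ==> w \<in> loc I n P ==> k = m + n ==> v * w \<in> loc I k P"
 using loc_mult by blast

lemma loc_add:
 assumes P: "P \<in> proj_points I" and v: "v \<in> loc I n P" and w: "w \<in> loc I n P"
 shows "v + w \<in> loc I n P"
proof -
 from v obtain a f k l where v: "a \<in> forms I k" "f \<in> forms I l" "f \<notin> P" "int k = int l + n" "v = Fract a f"
  by (rule locE)
 from w obtain b g k' l' where w: "b \<in> forms I k'" "g \<in> forms I l'" "g \<notin> P" "int k' = int l' + n" "w = Fract b g"
  by (rule locE)
 have "f ~= 0" "g ~= 0" using v w P nonzero_if_notin by blast+
 then have "v + w = Fract (a * g + b * f) (f * g)" using v w by simp
 moreover have "a * g \<in> forms I (k + l')" "b * f \<in> forms I (k' + l)" using v w forms_mult by blast+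
 moreover have "k' + l = k + l'" using v w by linarith
 ultimately show ?thesis
  using locI[OF forms_add[of "a * g" I "k + l'" "b * f"] forms_mult forms_mult_notin] v w P by auto
qed

lemma loc_uminus:
 assumes "v \<in> loc I n P" shows "- v \<in> loc I n P"
proof -
 from assms obtain a f k l where v: "a \<in> forms I k" "f \<in> forms I l" "f \<notin> P" "int k = int l + n" "v = Fract a f"
  by (rule locE)
 show ?thesis unfolding v(5) minus_fract by (rule locI[OF forms_uminus]) (use v in auto)
qed

lemma loc_diff: "P \<in> proj_points I ==> v \<in> loc I n P ==> w \<in> loc I n P ==> v - w \<in> loc I n P"
 using loc_add[of P I v n "- w"] loc_uminus by fastforce

lemma loc_0: 
 assumes P: "P \<in> proj_points I" shows "0 \<in> loc I n P"
proof -
 obtain i where i: "i \<in> I" "mvar i \<notin> P" using proj_pointD(6)[OF P] by blast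
 \<comment> \<open>The numerator 0 counts as a form of degree \<open>nat n\<close> and the
   denominator has degree \<open>nat (- n)\<close>, so the degrees differ by \<open>n\<close> for
   either sign of \<open>n\<close>.\<close>
 have "Fract 0 (mvar i ^ nat (- n)) \<in> loc I n P"
  by (rule locI[of _ _ "nat n" _ "nat (- n)"])
   (use forms_power[OF forms_mvar[OF i(1)], of "nat (- n)"]
    forms_power_notin[OF P forms_mvar[OF i(1)] i(2)] in auto)
 then show ?thesis by (simp add: fract_collapse)
qed

lemma loc_sum: "P \<in> proj_points I ==> (!!x. x \<in> F ==> f x \<in> loc I n P) ==> sum f F \<in> loc I n P"
 by (induction F rule: infinite_finite_induct) (auto simp: loc_add loc_0)

lemma loc_1: "P \<in> proj_points I ==> 1 \<in> loc I 0 P"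
 using loc_form[OF _ forms_1] by fastforce

lemma loc_form_mult:
 "P \<in> proj_points I ==> a \<in> forms I m ==> v \<in> loc I n P ==> k = int m + n ==> to_fract a * v \<in> loc I k P"
 using loc_mult loc_form by blast

lemma loc_form_divide:
 assumes "P \<in> proj_points I" "f \<in> forms I m" "f \<notin> P" "v \<in> loc I n P" "k = n - int m"
 shows "v / to_fract f \<in> loc I k P"
 using loc_mult[OF assms(1,4) loc_inverse[OF assms(1-3)]] assms(5) by simp

text \<open>The denominators of \<open>v\<close> generate an ideal without zeros on the principal open set of \<open>f\<close>, so it
  contains a power of \<open>f\<close>.\<close>

lemma loc_pbasic:
 fixes f :: "('i::linorder, 'k::field) mpoly"
 assumes f: "f \<in> forms I l" "0 < l" "f ~= 0" and v: "!!P. P \<in> pbasic I f ==> v \<in> loc I n P"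
 obtains a N k where "a \<in> forms I k" "int k = int (N * l) + n" "v = to_fract a / to_fract f ^ N"
proof -
 define T where "T = {g. g ~= 0 & (\<exists>b k m. g \<in> forms I m & b \<in> forms I k & int k = int m + n & v = Fract b g)}"
 have T: "T \<subseteq> (\<Union>n. forms I n)" by (auto simp: T_def)
 have "f \<in> P" if P: "P \<in> proj_points I" "T \<subseteq> P" for P
 proof (rule ccontr)
  assume "f \<notin> P"
  then have "v \<in> loc I n P" using v P by (simp add: pbasic_def)
  then obtain b g k m where "b \<in> forms I k" "g \<in> forms I m" "g \<notin> P" "int k = int m + n" "v = Fract b g"
   by (rule locE)
  then show False using P nonzero_if_notin[of P I g] by (auto simp: T_def)
 qed
 then obtain N where N: "f ^ N \<in> pgen I T"
  using projective_nullstellensatz[OF T f(1,2)] by auto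
 define \<delta> where "\<delta> g = (SOME m. g \<in> forms I m)" for g :: "('i, 'k) mpoly"
 have \<delta>: "t \<in> forms I (\<delta> t)" if "t \<in> T" for t
 proof -
  have "\<exists>m. t \<in> forms I m" using that T by auto
  then show ?thesis unfolding \<delta>_def by (rule someI_ex)
 qed
 have fN: "f ^ N \<in> forms I (N * l)" using f forms_power by blast
 obtain F c where F: "finite F" "F \<subseteq> T" "!!t. t \<in> F ==> \<delta> t \<le> N * l & c t \<in> forms I (N * l - \<delta> t)"
  "f ^ N = (\<Sum>t\<in>F. c t * t)"
  using pgen_form[OF N fN \<delta>] by blast
 have "\<exists>b k. b \<in> forms I k & int k = int (\<delta> t) + n & v * to_fract t = to_fract b" if "t \<in> F" for t
 proof -
  have t: "t \<in> T" using that F by blast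
  then obtain b k m where b: "t ~= 0" "t \<in> forms I m" "b \<in> forms I k" "int k = int m + n" "v = Fract b t"
   unfolding T_def by blast
  have "m = \<delta> t" using forms_disjoint[OF b(2) \<delta>[OF t] b(1)] .
  then show ?thesis using b by (auto simp: Fract_conv_to_fract)
 qed
 then obtain b k where b: "!!t. t \<in> F ==> b t \<in> forms I (k t)" "!!t. t \<in> F ==> int (k t) = int (\<delta> t) + n"
  "!!t. t \<in> F ==> v * to_fract t = to_fract (b t)" by metis
 define a where "a = (\<Sum>t\<in>F. c t * b t)"
 have fN0: "f ^ N ~= 0" using f by simp
 have "v * to_fract (f ^ N) = to_fract a"
 proof -
  have "to_fract (\<Sum>t\<in>F. c t * b t) = (\<Sum>t\<in>F. to_fract (c t) * to_fract (b t))"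
   by (induction F rule: infinite_finite_induct) auto
  moreover have "to_fract (\<Sum>t\<in>F. c t * t) = (\<Sum>t\<in>F. to_fract (c t) * to_fract t)"
   by (induction F rule: infinite_finite_induct) auto
  ultimately show ?thesis
   unfolding F(4) a_def by (simp add: sum_distrib_left b(3)[symmetric] mult.left_commute cong: sum.cong)
 qed
 moreover have "to_fract (f ^ N) = to_fract f ^ N" by (induction N) auto
 ultimately have "v = to_fract a / to_fract f ^ N" using fN0 by (simp add: field_simps)
 \<comment> \<open>One member of \<open>F\<close> shows that \<open>N * l + n\<close> is not
   negative, hence equals the natural number \<open>K\<close>, which is the common degree of the
   products \<open>c t * b t\<close>.\<close>
 moreover have "F ~= {}" using F(4) fN0 by auto
 then obtain t0 where t0: "t0 \<in> F" by blast
 define K where "K = nat (int (N * l) + n)"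
 have K: "N * l - \<delta> t + k t = K" if "t \<in> F" for t
  using F(3)[OF that] b(2)[OF that] unfolding K_def by linarith
 have "a \<in> forms I K" unfolding a_def
 proof (rule forms_sum)
  fix t assume t: "t \<in> F"
  show "c t * b t \<in> forms I K" using forms_mult[OF conjunct2[OF F(3)[OF t]] b(1)[OF t]] K[OF t] by simp
 qed
 moreover have "int K = int (N * l) + n"
  using F(3)[OF t0] b(2)[OF t0] unfolding K_def by linarith
 ultimately show ?thesis using that by blast
qed

lemma to_fract_sum: "to_fract (sum f F) = (\<Sum>x\<in>F. to_fract (f x))"
 by (induction F rule: infinite_finite_induct) auto

lemma to_fract_power: "to_fract (f ^ n) = to_fract f ^ n"
 by (induction n) auto

section \<open>Sections are constant\<close>

text \<open>Over the empty set all constants give the same function; this is why comparisons of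
  constants ask for a point of \<open>U\<close>.\<close>

definition cst :: "'p set => 'v => 'p => 'v" where
 "cst U v = (\<lambda>P\<in>U. v)"

lemma cst_apply [simp]: "P \<in> U ==> cst U v P = v"
 by (simp add: cst_def)

lemma cst_eq: "P \<in> U ==> cst U v = cst U w \<longleftrightarrow> v = w"
 by (auto simp: cst_def fun_eq_iff)

lemma restrict_cst: "V \<subseteq> U ==> restrict (cst U v) V = cst V v"
 by (auto simp: cst_def fun_eq_iff)

lemma cst_lift2: "(\<lambda>P\<in>U. h (cst U v P) (cst U w P)) = cst U (h v w)"
 by (auto simp: cst_def fun_eq_iff)

lemma O_sections_eq:
 assumes U: "openin (proj_top I) U"
 shows "O_sections I m U = {cst U v | v. \<forall>P\<in>U. v \<in> loc I m P}"
proof (intro equalityI subsetI)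
 fix s assume s: "s \<in> O_sections I m U"
 have *: "s P = s {0} & s P \<in> loc I m P" if "P \<in> U" for P
 proof -
  have "\<exists>V. openin (proj_top I) V & P \<in> V & V \<subseteq> U &
   (\<exists>k l. int k = int l + m & (\<exists>a\<in>forms I k. \<exists>f\<in>forms I l. \<forall>Q\<in>V. f \<notin> Q & s Q = Fract a f))"
   using s that by (simp add: O_sections_def)
  then show ?thesis
  proof (elim exE conjE bexE)
   fix V k l a f
   assume V: "openin (proj_top I) V" "P \<in> V" "int k = int l + m"
    "a \<in> forms I k" "f \<in> forms I l" "\<forall>Q\<in>V. f \<notin> Q & s Q = Fract a f"
   have "{0} \<in> V" by (rule generic_in_open[OF V(1,2)])
   then have "s {0} = Fract a f" "s P = Fract a f" "f \<notin> P" using V(2,6) by auto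
   then show ?thesis using locI[OF V(4,5) _ V(3), of P] by simp
  qed
 qed
 have "s = cst U (s {0})"
  using s * by (auto simp: O_sections_def cst_def extensional_def fun_eq_iff)
 moreover have "\<forall>P\<in>U. s {0} \<in> loc I m P" using * by metis
 ultimately show "s \<in> {cst U v | v. \<forall>P\<in>U. v \<in> loc I m P}" by blast
next
 fix s assume "s \<in> {cst U v | v. \<forall>P\<in>U. v \<in> loc I m P}"
 then obtain v where v: "s = cst U v" "!!P. P \<in> U ==> v \<in> loc I m P" by blast
 show "s \<in> O_sections I m U" unfolding O_sections_def
 proof (intro CollectI conjI ballI)
  show "s \<in> extensional U" by (simp add: v(1) cst_def)
 next
  fix P assume P: "P \<in> U"
  then obtain a f k l where a: "a \<in> forms I k" "f \<in> forms I l" "f \<notin> P" "int k = int l + m" "v = Fract a f"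
   using v locE by metis
  have "P \<in> proj_points I" using P U open_subset_points by blast
  then have "P \<in> U \<inter> pbasic I f" using a P by (auto simp: pbasic_def)
  moreover have "openin (proj_top I) (U \<inter> pbasic I f)" using U openin_pbasic[OF a(2)] by blast
  ultimately show "\<exists>V. openin (proj_top I) V & P \<in> V & V \<subseteq> U &
   (\<exists>k l. int k = int l + m & (\<exists>a\<in>forms I k. \<exists>f\<in>forms I l. \<forall>Q\<in>V. f \<notin> Q & s Q = Fract a f))"
   using a v(1) by (intro exI[of _ "U \<inter> pbasic I f"]) (auto simp: pbasic_def)
 qed
qed

lemma cst_O_sections:
 "openin (proj_top I) U ==> (!!P. P \<in> U ==> v \<in> loc I m P) ==> cst U v \<in> O_sections I m U"
 by (auto simp: O_sections_eq)

lemma O_sectionsE: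
 assumes "s \<in> O_sections I m U" "openin (proj_top I) U"
 obtains v where "s = cst U v" "\<forall>P\<in>U. v \<in> loc I m P"
 using assms by (auto simp: O_sections_eq)

lemma rs_proj [simp]: "rs_top (proj I) = proj_top I"
 "carrier (rs_ring (proj I) U) = O_sections I 0 U"
 "mult (rs_ring (proj I) U) = (%s t. \<lambda>P\<in>U. s P * t P)"
 "add (rs_ring (proj I) U) = (%s t. \<lambda>P\<in>U. s P + t P)"
 "one (rs_ring (proj I) U) = cst U 1"
 "zero (rs_ring (proj I) U) = cst U 0"
 "rs_res (proj I) U V s = restrict s V"
 by (simp_all add: proj_def cst_def)

lemma cring_proj:
 assumes U: "openin (proj_top I) U"
 shows "cring (rs_ring (proj I :: (('i::linorder, 'k::field) mpoly set, ('i, 'k) proj_fun) ringed_space) U)"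
proof -
 let ?R = "rs_ring (proj I :: (('i, 'k) mpoly set, ('i, 'k) proj_fun) ringed_space) U"
 have pp: "P \<in> U ==> P \<in> proj_points I" for P using U open_subset_points by blast
 note cl = cst_O_sections[OF U] loc_add[OF pp] loc_0[OF pp] loc_1[OF pp] loc_uminus loc_mult'[OF pp]
 have add: "(\<lambda>P\<in>U. s P + t P) \<in> O_sections I 0 U" and mult: "(\<lambda>P\<in>U. s P * t P) \<in> O_sections I 0 U"
  if st: "s \<in> O_sections I 0 U" "t \<in> O_sections I 0 U" for s t :: "('i, 'k) proj_fun"
 proof -
  obtain v where v: "s = cst U v" "\<forall>P\<in>U. v \<in> loc I 0 P" by (rule O_sectionsE[OF st(1) U])
  obtain w where w: "t = cst U w" "\<forall>P\<in>U. w \<in> loc I 0 P" by (rule O_sectionsE[OF st(2) U])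
  show "(\<lambda>P\<in>U. s P + t P) \<in> O_sections I 0 U"
   unfolding v(1) w(1) cst_lift2 by (rule cl(1)) (use v w cl(2) in blast)
  show "(\<lambda>P\<in>U. s P * t P) \<in> O_sections I 0 U"
   unfolding v(1) w(1) cst_lift2 by (rule cl(1)) (use v w cl(6)[of _ v 0 w 0 0] in auto)
 qed
 have zero: "cst U 0 \<in> O_sections I 0 U" and one: "cst U 1 \<in> O_sections I 0 U" by (rule cl; use cl in simp)+
 show ?thesis
 proof (rule cringI)
  show "abelian_group ?R"
  proof (rule abelian_groupI)
   fix s assume "s \<in> carrier ?R"
   then obtain v where v: "s = cst U v" "\<forall>P\<in>U. v \<in> loc I 0 P"
    using O_sectionsE[OF _ U, of s 0] by auto
   show "\<exists>t\<in>carrier ?R. t \<oplus>\<^bsub>?R\<^esub> s = \<zero>\<^bsub>?R\<^esub>"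
    by (rule bexI[of _ "cst U (- v)"]) (use v in \<open>auto simp: cst_lift2 intro!: cst_O_sections[OF U] loc_uminus\<close>)
  qed (simp_all add: add zero, auto simp: O_sections_eq[OF U] cst_lift2 add_ac)
  show "comm_monoid ?R"
   by (rule comm_monoidI) (simp_all add: mult one, auto simp: O_sections_eq[OF U] cst_lift2 mult_ac)
 qed (auto simp: O_sections_eq[OF U] cst_lift2 algebra_simps)
qed

section \<open>Dimension\<close>

text \<open>Linear algebra over the ground field, for the two dimension counts: algebraic
  dependence, and the transpose on forms.\<close>

interpretation mpoly: vector_space "%(c::'k::field) (f :: ('i, 'k) mpoly). single 0 c * f"
 by standard (auto simp: algebra_simps single_add mult_single mult.assoc[symmetric])

lemma finite_bounded_exponents:
 assumes "finite I"
 shows "finite {t :: 'i \<Rightarrow>\<^sub>0 nat. keys t \<subseteq> I & (\<forall>i\<in>I. lookup t i \<le> M)}" (is "finite ?B")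
  "card {t :: 'i \<Rightarrow>\<^sub>0 nat. keys t \<subseteq> I & (\<forall>i\<in>I. lookup t i \<le> M)} \<le> (M + 1) ^ card I"
proof -
 let ?h = "%t :: 'i \<Rightarrow>\<^sub>0 nat. restrict (lookup t) I"
 have inj: "inj_on ?h ?B"
 proof (rule inj_onI)
  fix s t assume *: "s \<in> ?B" "t \<in> ?B" "?h s = ?h t"
  show "s = t"
  proof (rule poly_mapping_eqI)
   fix i show "lookup s i = lookup t i"
   proof (cases "i \<in> I")
    case True then show ?thesis using *(3) by (metis restrict_apply')
   next
    case False then have "i \<notin> keys s" "i \<notin> keys t" using * by auto
    then show ?thesis by (simp add: in_keys_iff)
   qed
  qed
 qed
 have sub: "?h ` ?B \<subseteq> (\<Pi>\<^sub>E i\<in>I. {..M})" by (auto simp: PiE_def Pi_def)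
 have fin: "finite (\<Pi>\<^sub>E i\<in>I. {..M})" using assms by (auto intro: finite_PiE)
 show "finite ?B" using inj_on_finite[OF inj sub fin] .
 have "card ?B \<le> card (\<Pi>\<^sub>E i\<in>I. {..M})" using card_inj_on_le[OF inj sub fin] .
 also have "\<dots> = (M + 1) ^ card I" using assms by (simp add: card_PiE)
 finally show "card ?B \<le> (M + 1) ^ card I" .
qed

lemma keys_power_mdeg:
 assumes "!!t. t \<in> keys f ==> mdeg t \<le> D"
 shows "t \<in> keys (f ^ n) ==> mdeg t \<le> n * D"
proof (induction n arbitrary: t)
 case (Suc n)
 then obtain u v where "u \<in> keys f" "v \<in> keys (f ^ n)" "t = u + v"
  using keys_mult[of f "f ^ n"] by auto
 then show ?case using Suc.IH assms by (fastforce simp: mdeg_add)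
qed auto

lemma keys_prod_mdeg:
 assumes "!!x t. x \<in> F ==> t \<in> keys (f x) ==> mdeg t \<le> D x" "finite F"
 shows "t \<in> keys (prod f F) ==> mdeg t \<le> sum D F"
 using assms(2,1)
proof (induction F arbitrary: t rule: finite_induct)
 case (insert x F)
 then obtain u v where "u \<in> keys (f x)" "v \<in> keys (prod f F)" "t = u + v"
  using keys_mult[of "f x" "prod f F"] by auto
 then have "mdeg u \<le> D x" "mdeg v \<le> sum D F" using insert.IH[of v] insert.prems by auto
 then show ?case using insert.hyps \<open>t = u + v\<close> by (simp add: mdeg_add)
qed auto

lemma lookup_le_mdeg: "lookup t i \<le> mdeg t"
 unfolding mdeg_def
 by (cases "i \<in> keys t") (auto simp: in_keys_iff intro: member_le_sum)

lemma poly_in_span: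
 assumes "f \<in> polys I" "!!t. t \<in> keys f ==> mdeg t \<le> M"
 shows "f \<in> mpoly.span ((%t. single t 1) `
  {t. keys t \<subseteq> I & (\<forall>i\<in>I. lookup t i \<le> M)})" (is "f \<in> mpoly.span ?S")
proof -
 have eq: "f = (\<Sum>t\<in>keys f. single 0 (lookup f t) * single t 1)"
  by (rule poly_mapping_eqI) (auto simp: mult_single lookup_sum lookup_single when_def in_keys_iff)
 have mem: "single t 1 \<in> ?S" if "t \<in> keys f" for t
 proof (rule imageI, intro CollectI conjI ballI)
  show "keys t \<subseteq> I" using assms(1) that by (auto simp: polys_def)
  show "lookup t i \<le> M" for i using le_trans[OF lookup_le_mdeg assms(2)[OF that]] .
 qed
 have "(\<Sum>t\<in>keys f. single 0 (lookup f t) * single t 1) \<in> mpoly.span ?S"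
  by (intro mpoly.span_sum mpoly.span_scale mpoly.span_base mem)
 then show ?thesis by (simp only: eq[symmetric])
qed

lemma polys_prod: "(!!x. x \<in> F ==> f x \<in> polys I) ==> prod f F \<in> polys I"
 by (induction F rule: infinite_finite_induct) (auto simp: polys_mult)

text \<open>Let n be the number of variables. The n + 1 polynomials have N^(n+1) products of powers
  with all exponents below N. These lie in the span of the monomials with exponents at most M, of
  which there are at most (M + 1)^n; as M grows only linearly in N, the products are dependent for
  large N.\<close>

lemma algebraic_dependence:
 fixes f :: "nat => ('i, 'k::field) mpoly"
 assumes "finite I" "!!i. i \<le> card I ==> f i \<in> polys I"
 obtains c where "finite {u. c u ~= 0}" "{u. c u ~= 0} ~= {}"
  "!!u. c u ~= 0 ==> u \<in> extensional {..card I}"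
  "(\<Sum>u | c u ~= 0. single 0 (c u) * (\<Prod>i\<le>card I. f i ^ u i)) = 0"
proof -
 define n where "n = card I"
 have "\<exists>D. \<forall>t\<in>keys (f i). mdeg t \<le> D" for i
  using degree_bound[of "f i"] less_imp_le by metis
 then obtain D' where D': "!!i t. t \<in> keys (f i) ==> mdeg t \<le> D' i" by metis
 define D where "D = Max (D' ` {..n})"
 have D: "mdeg t \<le> D" if "i \<le> n" "t \<in> keys (f i)" for i t
  using D'[OF that(2)] that(1) unfolding D_def by (meson Max_ge atMost_iff finite_atMost finite_imageI image_eqI order_trans)
 \<comment> \<open>Chosen so that M + 1 \<le> C N; then N > C^n gives (M + 1)^n \<le> C^n N^n <
   N^(n+1).\<close>
 define C where "C = (n + 1) * D + 1"
 define N where "N = C ^ n + 1"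
 define M where "M = (n + 1) * (N * D)"
 define E where "E = (\<Pi>\<^sub>E i\<in>{..n}. {..<N})"
 define F where "F u = (\<Prod>i\<le>n. f i ^ u i)" for u
 have E: "finite E" "card E = N ^ (n + 1)" unfolding E_def by (auto intro: finite_PiE simp: card_PiE)
 have "M + 1 \<le> C * N" unfolding M_def C_def N_def by (simp add: algebra_simps)
 then have "(M + 1) ^ n \<le> C ^ n * N ^ n" by (metis power_mono power_mult_distrib zero_le)
 also have "\<dots> < N * N ^ n" by (simp add: N_def)
 finally have lt: "(M + 1) ^ n < card E" by (simp add: E)
 let ?S = "(%t. single t (1::'k)) `
  {t :: 'i \<Rightarrow>\<^sub>0 nat. keys t \<subseteq> I & (\<forall>i\<in>I. lookup t i \<le> M)}"
 have span: "F u \<in> mpoly.span ?S" if u: "u \<in> E" for u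
 proof (rule poly_in_span)
  show "F u \<in> polys I" unfolding F_def using assms(2) by (auto intro!: polys_prod polys_power simp: n_def)
  fix t assume t: "t \<in> keys (F u)"
  have "mdeg t \<le> (\<Sum>i\<le>n. u i * D)"
   using t unfolding F_def by (rule keys_prod_mdeg[rotated 2]) (auto intro!: keys_power_mdeg[OF D])
  also have "\<dots> \<le> (\<Sum>i\<le>n. N * D)"
   using u by (intro sum_mono mult_right_mono) (auto simp: E_def PiE_def Pi_def less_imp_le)
  finally show "mdeg t \<le> M" by (simp add: M_def)
 qed
 have finS: "finite ?S" and cardS: "card ?S \<le> (M + 1) ^ n"
  using finite_bounded_exponents[OF assms(1), of M] card_image_le le_trans unfolding n_def by blast+
 show ?thesis
 proof (cases "inj_on F E")
  \<comment> \<open>Two exponent vectors with the same product give the relation with coefficients 1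
    and -1.\<close>
  case False
  then obtain u v where uv: "u \<in> E" "v \<in> E" "F u = F v" "u ~= v" by (auto simp: inj_on_def)
  define c where "c w = (if w = u then 1 else if w = v then - 1 else (0::'k))" for w
  have supp: "{w. c w ~= 0} = {u, v}" by (auto simp: c_def)
  have "single 0 (- 1 :: 'k) = (- 1 :: ('i, 'k) mpoly)"
   using single_uminus[of 0 "1::'k"] by simp
  moreover have "w \<in> extensional {..n}" if "c w ~= 0" for w
   using that uv by (auto simp: c_def E_def PiE_def split: if_splits)
  ultimately show ?thesis using that[of c] uv unfolding supp by (simp add: c_def F_def n_def)
 next
  case True
  have "\<not> mpoly.independent (F ` E)"
  proof
   assume "mpoly.independent (F ` E)"
   then have "card (F ` E) \<le> card ?S" using mpoly.independent_span_bound[OF finS] span by blast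
   then show False using card_image[OF True] cardS lt by simp
  qed
  then obtain r where r: "\<exists>v\<in>F ` E. r v ~= 0" "(\<Sum>v\<in>F ` E. single 0 (r v) * v) = 0"
   using mpoly.dependent_finite[of "F ` E"] E(1) by blast
  define c where "c u = (if u \<in> E then r (F u) else 0)" for u
  have fin: "finite {u. c u ~= 0}" by (rule finite_subset[OF _ E(1)]) (auto simp: c_def split: if_splits)
  have "(\<Sum>u | c u ~= 0. single 0 (c u) * F u) = (\<Sum>u\<in>E. single 0 (r (F u)) * F u)"
   by (rule sum.mono_neutral_cong_left) (use E in \<open>auto simp: c_def split: if_splits\<close>)
  also have "\<dots> = 0" using r(2) by (simp add: sum.reindex[OF True])
  finally have "(\<Sum>u | c u ~= 0. single 0 (c u) * F u) = 0" .
  moreover have "{u. c u ~= 0} ~= {}" using r(1) by (auto simp: c_def)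
  moreover have "u \<in> extensional {..n}" if "c u ~= 0" for u
   using that by (auto simp: c_def E_def PiE_def split: if_splits)
  ultimately show ?thesis using that[of c] fin unfolding F_def n_def by blast
 qed
qed

text \<open>If a nonzero polynomial \<open>Q\<close> in \<open>x\<^sub>k, \<dots>, x\<^sub>n\<close> lies in \<open>P\<^sub>k\<close>, then cancelling the lowest power of
  \<open>x\<^sub>k\<close> and reducing modulo \<open>x\<^sub>k \<in> P\<^sub>k\<^sub>+\<^sub>1\<close> gives one in \<open>x\<^sub>k\<^sub>+\<^sub>1, \<dots>, x\<^sub>n\<close> in \<open>P\<^sub>k\<^sub>+\<^sub>1\<close>. In the end a nonzero
  constant lies in a prime ideal.\<close>

lemma prime_chain_no_relation:
 fixes x :: "nat => ('i, 'k::field) mpoly"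
 assumes P: "!!i. i \<le> Suc n ==> pprime J (P i)" "!!i. i \<le> n ==> P i \<subseteq> P (Suc i)"
  and x: "!!i. i \<le> n ==> x i \<in> P (Suc i)" "!!i. i \<le> n ==> x i \<notin> P i"
  and c: "finite {u. c u ~= 0}" "{u. c u ~= 0} ~= {}" "!!u. c u ~= 0 ==> u \<in> extensional {..n}"
  and rel: "(\<Sum>u | c u ~= 0. single 0 (c u) * (\<Prod>i\<le>n. x i ^ u i)) \<in> P 0"
 shows False
proof -
 have xp: "x i \<in> polys J" if "i \<le> n" for i
  using x(1)[OF that] pidealD(1)[OF pprimeD(1)[OF P(1)]] that by force
 have "\<exists>c :: (nat => nat) => 'k. finite {u. c u ~= 0} & {u. c u ~= 0} ~= {} & (\<forall>u. c u ~= 0 --> (\<forall>i<k. u i = 0) & u \<in> extensional {..n}) &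
   (\<Sum>u | c u ~= 0. single 0 (c u) * (\<Prod>i\<in>{k..n}. x i ^ u i)) \<in> P k" if "k \<le> Suc n" for k
  using that
 proof (induction k)
  case 0
  then show ?case using c rel by (intro exI[of _ c]) (auto simp: atMost_atLeast0)
 next
  case (Suc k)
  then obtain c :: "(nat => nat) => 'k" where c: "finite {u. c u ~= 0}" "{u. c u ~= 0} ~= {}"
   "!!u i. c u ~= 0 ==> i < k ==> u i = 0" "!!u. c u ~= 0 ==> u \<in> extensional {..n}"
   "(\<Sum>u | c u ~= 0. single 0 (c u) * (\<Prod>i\<in>{k..n}. x i ^ u i)) \<in> P k" by auto
  have kn: "k \<le> n" using Suc by simp
  note Pk = pprimeD(1)[OF P(1), of k] and PSk = pprimeD(1)[OF P(1), of "Suc k"]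
  define S where "S = {u. c u ~= 0}"
  define m where "m = Min ((%u. u k) ` S)"
  have m_le: "m \<le> u k" if "u \<in> S" for u using that c(1) by (auto simp: m_def S_def)
  have "m \<in> (%u. u k) ` S" unfolding m_def by (rule Min_in) (use c in \<open>auto simp: S_def\<close>)
  then obtain u0 where u0: "u0 \<in> S" "u0 k = m" by auto
  define T where "T u = single 0 (c u) * (\<Prod>i\<in>{Suc k..n}. x i ^ u i)" for u
  have Tp: "T u \<in> polys J" for u
   unfolding T_def by (intro polys_mult polys_prod polys_power polys_single xp) auto
  have trm: "single 0 (c u) * (\<Prod>i\<in>{k..n}. x i ^ u i) = x k ^ m * (x k ^ (u k - m) * T u)"
   if "u \<in> S" for u
  proof -
   have "{k..n} = insert k {Suc k..n}" using kn by auto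
   then have "(\<Prod>i\<in>{k..n}. x i ^ u i) = x k ^ (m + (u k - m)) * (\<Prod>i\<in>{Suc k..n}. x i ^ u i)"
    using m_le[OF that] by simp
   then show ?thesis by (simp add: T_def power_add mult_ac)
  qed
  have "x k ^ m * (\<Sum>u\<in>S. x k ^ (u k - m) * T u) \<in> P k"
   using c(5) trm by (simp add: S_def[symmetric] sum_distrib_left cong: sum.cong)
  moreover have "x k ^ m \<notin> P k" using pprime_power[OF P(1) xp[OF kn]] x(2)[OF kn] kn by auto
  moreover have "x k ^ m \<in> polys J" "(\<Sum>u\<in>S. x k ^ (u k - m) * T u) \<in> polys J"
   using kn by (auto intro!: polys_sum polys_mult polys_power xp Tp)
  ultimately have "(\<Sum>u\<in>S. x k ^ (u k - m) * T u) \<in> P k"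
   using pprimeD(3)[OF P(1)[of k], of "x k ^ m" "\<Sum>u\<in>S. x k ^ (u k - m) * T u"] kn by simp
  then have "(\<Sum>u\<in>S. x k ^ (u k - m) * T u) \<in> P (Suc k)" using P(2)[OF kn] by auto
  moreover have "(\<Sum>u\<in>S. x k ^ (u k - m) * T u) =
    (\<Sum>u\<in>{u \<in> S. u k = m}. T u) + (\<Sum>u\<in>{u \<in> S. u k ~= m}. x k ^ (u k - m) * T u)"
  proof -
   have "(\<Sum>u\<in>S. x k ^ (u k - m) * T u) = (\<Sum>u\<in>{u \<in> S. u k = m} \<union> {u \<in> S. u k ~= m}. x k ^ (u k - m) * T u)"
    by (rule sum.cong) auto
   also have "\<dots> = (\<Sum>u\<in>{u \<in> S. u k = m}. x k ^ (u k - m) * T u) + (\<Sum>u\<in>{u \<in> S. u k ~= m}. x k ^ (u k - m) * T u)"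
    by (rule sum.union_disjoint) (use c(1) in \<open>auto simp: S_def\<close>)
   finally show ?thesis by simp
  qed
  moreover have "(\<Sum>u\<in>{u \<in> S. u k ~= m}. x k ^ (u k - m) * T u) \<in> P (Suc k)"
  proof (rule pideal_sum)
   show "pideal J (P (Suc k))" using PSk kn by simp
   fix u assume "u \<in> {u \<in> S. u k ~= m}"
   then have "u k - m = Suc (u k - m - 1)" using m_le by fastforce
   then obtain r where r: "u k - m = Suc r" by blast
   then have "x k ^ (u k - m) * T u = (x k ^ r * T u) * x k"
    by (simp only: r power_Suc mult_ac)
   also have "\<dots> \<in> P (Suc k)"
    by (rule pidealD(4)) (use PSk kn x(1) xp Tp in \<open>auto intro!: polys_mult polys_power\<close>)
   finally show "x k ^ (u k - m) * T u \<in> P (Suc k)" .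
  qed
  ultimately have res: "(\<Sum>u\<in>{u \<in> S. u k = m}. T u) \<in> P (Suc k)"
   using pidealD(7)[OF PSk] kn by fastforce
  \<comment> \<open>The surviving terms no longer contain \<open>x k\<close>. They are indexed anew
    by exponents whose entry at \<open>k\<close> is 0; putting \<open>m\<close> back there is the
    bijection with the old indices.\<close>
  define c' where "c' u = (if u k = 0 then c (u(k := m)) else 0)" for u
  have bij: "bij_betw (%u. u(k := m)) {u. c' u ~= 0} {u \<in> S. u k = m}"
   by (rule bij_betwI[where g = "%u. u(k := 0)"]) (auto simp: c'_def S_def fun_eq_iff split: if_splits)
  have "(\<Sum>u | c' u ~= 0. single 0 (c' u) * (\<Prod>i\<in>{Suc k..n}. x i ^ u i)) =
    (\<Sum>u | c' u ~= 0. T (u(k := m)))"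
   by (intro sum.cong refl) (auto simp: T_def c'_def split: if_splits intro!: prod.cong)
  also have "\<dots> = (\<Sum>u\<in>{u \<in> S. u k = m}. T u)" by (rule sum.reindex_bij_betw[OF bij])
  finally have "(\<Sum>u | c' u ~= 0. single 0 (c' u) * (\<Prod>i\<in>{Suc k..n}. x i ^ u i)) \<in> P (Suc k)"
   using res by simp
  moreover have "finite {u. c' u ~= 0}" using bij_betw_finite[OF bij] c(1) by (auto simp: S_def)
  moreover have "{u. c' u ~= 0} ~= {}" using bij u0 by (auto simp: bij_betw_def)
  moreover have "u i = 0" if "c' u ~= 0" "i < Suc k" for u i
   using c(3)[of "u(k := m)" i] that by (cases "i = k") (auto simp: c'_def split: if_splits)
  moreover have "u \<in> extensional {..n}" if "c' u ~= 0" for u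
   using c(4)[of "u(k := m)"] that kn by (auto simp: c'_def extensional_def split: if_splits)
  ultimately show ?case by blast
 qed
 from this[of "Suc n"] obtain c :: "(nat => nat) => 'k" where c: "finite {u. c u ~= 0}" "{u. c u ~= 0} ~= {}"
  "!!u i. c u ~= 0 ==> i < Suc n ==> u i = 0" "!!u. c u ~= 0 ==> u \<in> extensional {..n}"
  "(\<Sum>u | c u ~= 0. single 0 (c u) * (\<Prod>i\<in>{Suc n..n}. x i ^ u i)) \<in> P (Suc n)" by auto
 obtain z where z: "c z ~= 0" using c(2) by auto
 \<comment> \<open>All exponents up to \<open>n\<close> vanish and the indices are extensional
   functions, so a single index remains.\<close>
 have "u = z" if "c u ~= 0" for u
  using c(3)[OF that] c(3)[OF z] c(4)[OF that] c(4)[OF z]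
  by (intro extensionalityI[of u "{..n}" z]) auto
 then have "{u. c u ~= 0} = {z}" using z by blast
 then have "single 0 (c z) \<in> P (Suc n)" using c(5) by simp
 then have "single 0 (1 / c z) * single 0 (c z) \<in> P (Suc n)"
  by (rule pidealD(4)[OF pprimeD(1)[OF P(1)[OF order_refl]]]) (auto intro: polys_single)
 then show False using z pprimeD(2)[OF P(1)[of "Suc n"]] by (simp add: mult_single)
qed

text \<open>Pick \<open>x i\<close> in \<open>P (Suc i)\<close> outside \<open>P i\<close> for
  \<open>i \<le> card I\<close>. The images under \<theta> of these \<open>card I + 1\<close>
  elements are algebraically dependent, and the corresponding polynomial in the \<open>x i\<close>,
  being killed by \<theta>, lies in \<open>P 0\<close>. Applied to the identity and to the pullback
  of the embedding.\<close>

lemma prime_chain_length: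
 fixes \<theta> :: "('j, 'k::field) mpoly => ('i, 'k) mpoly"
 assumes I: "finite I"
  and hom: "!!f g. \<theta> (f + g) = \<theta> f + \<theta> g" "!!f g. \<theta> (f * g) = \<theta> f * \<theta> g"
   "!!c. \<theta> (single 0 c) = single 0 c"
   "!!f. f \<in> polys J ==> \<theta> f \<in> polys I"
  and P: "!!i. i \<le> m ==> pprime J (P i)" "!!i. i < m ==> P i \<subset> P (Suc i)"
  and ker: "!!f. f \<in> polys J ==> \<theta> f = 0 ==> f \<in> P 0"
 shows "m \<le> card I"
proof (rule ccontr)
 assume "\<not> m \<le> card I"
 then have m: "Suc (card I) \<le> m" by simp
 define n where "n = card I"
 have "\<exists>x. x \<in> P (Suc i) & x \<notin> P i" if "i \<le> n" for i using P(2)[of i] m that by (auto simp: n_def)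
 then obtain x where x: "!!i. i \<le> n ==> x i \<in> P (Suc i)" "!!i. i \<le> n ==> x i \<notin> P i" by metis
 have xp: "x i \<in> polys J" if "i \<le> n" for i
  using x(1)[OF that] pidealD(1)[OF pprimeD(1)[OF P(1)[of "Suc i"]]] that m by (simp add: n_def)
 have one: "\<theta> 1 = 1" using hom(3)[of 1] by simp
 have zero: "\<theta> 0 = 0" using hom(3)[of 0] by simp
 have pow: "\<theta> (f ^ n) = \<theta> f ^ n" for f n by (induction n) (auto simp: one hom)
 have prod: "\<theta> (prod f F) = (\<Prod>x\<in>F. \<theta> (f x))" for f and F :: "nat set"
  by (induction F rule: infinite_finite_induct) (auto simp: one hom)
 have sum: "\<theta> (sum f F) = (\<Sum>x\<in>F. \<theta> (f x))" for f and F :: "(nat => nat) set"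
  by (induction F rule: infinite_finite_induct) (auto simp: zero hom)
 obtain c where c: "finite {u. c u ~= 0}" "{u. c u ~= 0} ~= {}"
  "!!u. c u ~= 0 ==> u \<in> extensional {..card I}"
  "(\<Sum>u | c u ~= 0. single 0 (c u) * (\<Prod>i\<le>card I. \<theta> (x i) ^ u i)) = 0"
  by (rule algebraic_dependence[OF I, of "%i. \<theta> (x i)"]) (use xp hom(4) in \<open>auto simp: n_def\<close>)
 let ?Q = "\<Sum>u | c u ~= 0. single 0 (c u) * (\<Prod>i\<le>n. x i ^ u i)"
 have "\<theta> ?Q = 0" using c(4) by (simp add: sum hom prod pow n_def)
 moreover have "?Q \<in> polys J"
  by (intro polys_sum polys_mult polys_prod polys_power polys_single xp) auto
 ultimately have "?Q \<in> P 0" using ker by blast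
 then show False
  using prime_chain_no_relation[of n J P x c] P m x c by (auto simp: n_def less_imp_le)
qed

text \<open>The homogeneous maximal ideal. It lies strictly above every point of Proj, so it
  lengthens each chain of primes that ends in a point by one.\<close>

definition irrelevant :: "'i set => ('i, 'k::field) mpoly set" where
 "irrelevant I = {f \<in> polys I. hom_component 0 f = 0}"

lemma pprime_irrelevant: "pprime I (irrelevant I :: ('i::linorder, 'k::field) mpoly set)"
 unfolding pprime_def pideal_def irrelevant_def
 by (auto simp: hom_component_0 hom_component_add hom_component_mult polys_add polys_mult
   hom_component_form[OF forms_1])

lemma proj_point_irrelevant:
 assumes "P \<in> proj_points I"
 shows "P \<subset> irrelevant I"
proof -
 note P = proj_pointD[OF assms]
 have "P \<subseteq> irrelevant I"
 proof
  fix f assume f: "f \<in> P"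
  have fp: "f \<in> polys I" using f pidealD(1)[OF P(2)] by blast
  have "hom_component 0 f \<in> P" using f P(3) by (simp add: homog_def)
  moreover have "hom_component 0 f = single 0 (lookup f 0)"
  proof (rule poly_mapping_eqI)
   fix t :: "'a \<Rightarrow>\<^sub>0 nat"
   have "mdeg t = 0 \<longleftrightarrow> t = 0"
    by (auto simp: mdeg_def in_keys_iff intro!: poly_mapping_eqI)
   then show "lookup (hom_component 0 f) t = lookup (single 0 (lookup f 0)) t"
    by (simp add: lookup_hom_component lookup_single when_def)
  qed
  ultimately have "single 0 (lookup f 0) \<in> P" by simp
  then have "single 0 (1 / lookup f 0) * single 0 (lookup f 0) \<in> P"
   by (rule pidealD(4)[OF P(2)]) (auto intro: polys_single)
  then have "lookup f 0 = 0" using P(4) by (auto simp: mult_single split: if_splits)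
  then show "f \<in> irrelevant I"
   using fp \<open>hom_component 0 f = _\<close> by (simp add: irrelevant_def)
 qed
 moreover obtain i where "i \<in> I" "mvar i \<notin> P" using P(6) by blast
 moreover from this have "mvar i \<in> irrelevant I"
  using forms_polys[OF forms_mvar] hom_component_form[OF forms_mvar, of i I 0] by (auto simp: irrelevant_def)
 ultimately show ?thesis by blast
qed

text \<open>A chain of primes ending in a point extends by the irrelevant ideal, and the longer
  chain has length at most \<open>card I\<close>; so a point has height below \<open>card I\<close>.
  A point containing \<open>T\<close> would have height at least the codimension.\<close>

lemma full_codim_no_point:
 fixes T :: "('i::linorder, 'k::field) mpoly set"
 assumes I: "finite I" and T: "T \<subseteq> polys I"
  and codim: "ideal_codim (poly_ring I) (genideal (poly_ring I) T) = enat (card I)"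
  and P: "P \<in> proj_points I"
 shows "\<not> T \<subseteq> P"
proof
 assume TP: "T \<subseteq> P"
 interpret R: cring "poly_ring I :: ('i, 'k) mpoly ring" by (rule cring_poly_ring)
 have prime: "primeideal P (poly_ring I)" using proj_pointD(1)[OF P] pprime_primeideal by blast
 then have "genideal (poly_ring I) T \<subseteq> P"
  using R.genideal_minimal TP primeideal.axioms(1) by blast
 then have "enat (card I) \<le> prime_height (poly_ring I) P"
  using prime codim unfolding ideal_codim_def by (metis (mono_tags, lifting) INF_lower mem_Collect_eq)
 moreover have "prime_height (poly_ring I) P < enat (card I)" if "card I ~= 0"
 proof -
  have "n < card I" if C: "C n = P" "\<forall>i\<le>n. primeideal (C i) (poly_ring I)" "\<forall>i<n. C i \<subset> C (Suc i)" for C n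
  proof -
   let ?C = "%i. if i \<le> n then C i else irrelevant I"
   have "Suc n \<le> card I"
   proof (rule prime_chain_length[where \<theta> = id and P = ?C and J = I, OF I])
    fix i assume "i \<le> Suc n"
    then show "pprime I (?C i)" using C(2) pprime_irrelevant by (auto simp: pprime_primeideal)
   next
    fix i assume "i < Suc n"
    then show "?C i \<subset> ?C (Suc i)"
     using C proj_point_irrelevant[OF P] by (cases "i = n") auto
   next
    fix f :: "('i, 'k) mpoly" assume "id f = 0"
    then show "f \<in> ?C 0" using C(2) pidealD(2) primeideal.axioms(1) pideal_ideal by fastforce
   qed auto
   then show ?thesis by simp
  qed
  then have len: "\<exists>C. C n = P & (\<forall>i\<le>n. primeideal (C i) (poly_ring I)) & (\<forall>i<n. C i \<subset> C (Suc i)) ==> n < card I" for n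
   by (elim exE conjE) 
  have "prime_height (poly_ring I) P \<le> enat (card I - 1)"
   unfolding prime_height_def
  proof (rule Sup_least, elim CollectE exE conjE)
   fix x n C assume "x = enat n" "C n = P" "\<forall>i\<le>n. primeideal (C i) (poly_ring I)" "\<forall>i<n. C i \<subset> C (Suc i)"
   then have "n < card I" using len by (intro len exI[of _ C] conjI)
   then show "x \<le> enat (card I - 1)" using \<open>x = enat n\<close> by simp
  qed
  also have "\<dots> < enat (card I)" using that by simp
  finally show ?thesis .
 qed
 moreover have "card I ~= 0" using I proj_pointD(6)[OF P] by auto
 ultimately show False by simp
qed

section \<open>Cohomology of the twisting sheaves\<close>

text \<open>Quasi-compactness of a principal open set: some power of \<open>h\<close> is a
  combination of the \<open>\<phi> x\<close>, and one combination involves only finitely many of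
  them.\<close>

lemma finite_subcover:
 fixes \<phi> :: "'x => ('i, 'k::field) mpoly"
 assumes \<phi>: "!!x. x \<in> X ==> \<phi> x \<in> forms I (\<delta> x)" and h: "h \<in> forms I m" "0 < m"
  and cov: "!!P. P \<in> pbasic I h ==> \<exists>x\<in>X. \<phi> x \<notin> P"
 shows "\<exists>T. finite T & T \<subseteq> X & (\<forall>P\<in>pbasic I h. \<exists>x\<in>T. \<phi> x \<notin> P)"
proof -
 have "h \<in> P" if "P \<in> proj_points I" "\<phi> ` X \<subseteq> P" for P
  using cov[of P] that by (auto simp: pbasic_def)
 moreover have "\<phi> ` X \<subseteq> (\<Union>n. forms I n)" using \<phi> by auto
 ultimately obtain N where "h ^ N \<in> pgen I (\<phi> ` X)" using projective_nullstellensatz h by metis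
 then obtain F c where F: "finite F" "F \<subseteq> \<phi> ` X" "\<forall>t\<in>F. c t \<in> polys I" "h ^ N = (\<Sum>t\<in>F. c t * t)"
  unfolding pgen_def by blast
 obtain T where T: "T \<subseteq> X" "finite T" "F = \<phi> ` T"
  using finite_subset_image[OF F(1,2)] by blast
 have "\<exists>x\<in>T. \<phi> x \<notin> P" if P: "P \<in> pbasic I h" for P
 proof (rule ccontr)
  assume "\<not> ?thesis"
  then have FP: "F \<subseteq> P" using T by auto
  have pp: "P \<in> proj_points I" "h \<notin> P" using P by (auto simp: pbasic_def)
  have "c t * t \<in> P" if "t \<in> F" for t
   using pidealD(4)[OF proj_pointD(2)[OF pp(1)], of t "c t"] F(3) FP that by auto
  then have "h ^ N \<in> P" unfolding F(4) by (rule pideal_sum[OF proj_pointD(2)[OF pp(1)]])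
  then show False using forms_power_notin[OF pp(1) h(1) pp(2)] by blast
 qed
 then show ?thesis using T by blast
qed

text \<open>The powers \<open>\<phi> x ^ K\<close> have the same zeros as the
  \<open>\<phi> x\<close>. After division by \<open>h ^ M\<close> the terms sum to 1 on D(h); the
  exponent \<open>K\<close> is left free so that it can clear denominators.\<close>

lemma partition_of_unity:
 fixes \<phi> :: "'x => ('i, 'k::field) mpoly"
 assumes \<phi>: "!!x. x \<in> T ==> \<phi> x \<in> forms I (\<delta> x)" and h: "h \<in> forms I m" "0 < m" and T: "finite T"
  and cov: "!!P. P \<in> pbasic I h ==> \<exists>x\<in>T. \<phi> x \<notin> P"
 shows "\<exists>M c. h ^ M = (\<Sum>x\<in>T. c x * \<phi> x ^ K) &
  (\<forall>x\<in>T. c x = 0 \<or> (K * \<delta> x \<le> M * m & c x \<in> forms I (M * m - K * \<delta> x)))"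
proof -
 let ?\<psi> = "%x. \<phi> x ^ K"
 have \<psi>: "?\<psi> x \<in> forms I (K * \<delta> x)" if "x \<in> T" for x using \<phi>[OF that] by (rule forms_power)
 have "h \<in> P" if "P \<in> proj_points I" "?\<psi> ` T \<subseteq> P" for P
 proof (rule ccontr)
  assume "h \<notin> P"
  then have "P \<in> pbasic I h" using that(1) by (simp add: pbasic_def)
  then obtain x where x: "x \<in> T" "\<phi> x \<notin> P" using cov by blast
  show False using forms_power_notin[OF that(1) \<phi>[OF x(1)] x(2)] that(2) x(1) by auto
 qed
 moreover have "?\<psi> ` T \<subseteq> (\<Union>n. forms I n)" using \<psi> by auto
 ultimately obtain M where M: "h ^ M \<in> pgen I (?\<psi> ` T)" using projective_nullstellensatz h by metis
 \<comment> \<open>Several \<open>x\<close> may share the same power \<open>\<phi> x ^ K\<close>;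
   one of them is selected and the others get coefficient 0.\<close>
 define \<iota> where "\<iota> = inv_into T ?\<psi>"
 have \<iota>: "\<iota> t \<in> T" "?\<psi> (\<iota> t) = t" if "t \<in> ?\<psi> ` T" for t
  using inv_into_into[OF that] f_inv_into_f[OF that] by (simp_all add: \<iota>_def)
 obtain F c where F: "finite F" "F \<subseteq> ?\<psi> ` T"
  "!!t. t \<in> F ==> K * \<delta> (\<iota> t) \<le> M * m & c t \<in> forms I (M * m - K * \<delta> (\<iota> t))"
  "h ^ M = (\<Sum>t\<in>F. c t * t)"
 proof (rule pgen_form[OF M, of "M * m" "%t. K * \<delta> (\<iota> t)"])
  show "h ^ M \<in> forms I (M * m)" using h(1) by (rule forms_power)
  show "t \<in> forms I (K * \<delta> (\<iota> t))" if "t \<in> ?\<psi> ` T" for t using \<psi>[OF \<iota>(1)[OF that]] \<iota>(2)[OF that] by simp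
 qed blast
 define c' where "c' x = (if x \<in> \<iota> ` F then c (?\<psi> x) else 0)" for x
 have inj: "inj_on \<iota> F" using \<iota>(2) F(2) by (metis inj_on_def subsetD)
 have "(\<Sum>x\<in>T. c' x * ?\<psi> x) = (\<Sum>x\<in>\<iota> ` F. c (?\<psi> x) * ?\<psi> x)"
  by (rule sum.mono_neutral_cong_right) (use T F(2) \<iota> in \<open>auto simp: c'_def\<close>)
 also have "\<dots> = (\<Sum>t\<in>F. c (?\<psi> (\<iota> t)) * ?\<psi> (\<iota> t))" using inj by (simp add: sum.reindex)
 also have "\<dots> = h ^ M" unfolding F(4) using \<iota>(2) F(2) by (intro sum.cong refl) (auto simp: subset_iff)
 finally have "h ^ M = (\<Sum>x\<in>T. c' x * \<phi> x ^ K)" ..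
 moreover have "c' x = 0 \<or> (K * \<delta> x \<le> M * m & c' x \<in> forms I (M * m - K * \<delta> x))" if "x \<in> T" for x
 proof (cases "x \<in> \<iota> ` F")
  case True
  then obtain t where t: "t \<in> F" "x = \<iota> t" by blast
  then have "?\<psi> x = t" using \<iota>(2) F(2) by auto
  then show ?thesis using F(3)[OF t(1)] t by (auto simp: c'_def)
 qed (simp add: c'_def)
 ultimately show ?thesis by blast
qed

text \<open>Over D(hf) the function \<open>v\<close> has a denominator \<open>(h * f) ^ N\<close>.
  Every power of \<open>f\<close> with exponent at least \<open>N\<close> removes the poles along f
  = 0, uniformly in \<open>P\<close>.\<close>

lemma clear_denominator:
 assumes h: "h \<in> forms I m" "0 < m" "h ~= 0" and f: "f \<in> forms I l" "f ~= 0"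
  and v: "!!P. P \<in> pbasic I h ==> f \<notin> P ==> v \<in> loc I n P"
 shows "\<exists>k. \<forall>K P. k \<le> K --> P \<in> pbasic I h --> to_fract f ^ K * v \<in> loc I (n + int (K * l)) P"
proof -
 have hf: "h * f \<in> forms I (m + l)" "h * f ~= 0" using h f forms_mult by auto
 have "v \<in> loc I n P" if "P \<in> pbasic I (h * f)" for P
  using v that pbasic_mult[OF h(1) f(1)] by (auto simp: pbasic_def)
 then obtain a N k where a: "a \<in> forms I k" "int k = int (N * (m + l)) + n" "v = to_fract a / to_fract (h * f) ^ N"
  using loc_pbasic[OF hf(1) _ hf(2)] h(2) by (metis add_gr_0)
 have "to_fract f ^ K * v \<in> loc I (n + int (K * l)) P" if K: "N \<le> K" and P: "P \<in> pbasic I h" for K P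
 proof -
  have pp: "P \<in> proj_points I" "h \<notin> P" using P by (auto simp: pbasic_def)
  have "to_fract f ^ K = to_fract f ^ N * to_fract f ^ (K - N)" using K by (simp flip: power_add)
  then have eq: "to_fract f ^ K * v = to_fract (f ^ (K - N) * a) / to_fract (h ^ N)"
   using f(2) h(3) unfolding a(3) by (simp add: to_fract_power power_mult_distrib)
  obtain r where r: "K = N + r" using K le_Suc_ex by blast
  have "int ((K - N) * l + k) = n + int (K * l) + int (N * m)"
   using a(2) unfolding r by (simp add: algebra_simps)
  then have "to_fract (f ^ (K - N) * a) \<in> loc I (n + int (K * l) + int (N * m)) P"
   using loc_form[OF pp(1) forms_mult[OF forms_power[OF f(1), of "K - N"] a(1)]] by simp
  then have "to_fract (f ^ (K - N) * a) / to_fract (h ^ N) \<in> loc I (n + int (K * l)) P"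
   by (rule loc_form_divide[OF pp(1) forms_power[OF h(1)] forms_power_notin[OF pp(1) h(1) pp(2)]]) simp
  then show ?thesis unfolding eq .
 qed
 then show ?thesis by blast
qed

text \<open>Degree count for averages formed with the weights of
  \<open>partition_of_unity\<close>.\<close>

lemma weighted_sum_loc:
 fixes c :: "'x => ('i::linorder, 'k::field) mpoly"
 assumes P: "P \<in> pbasic I h" and h: "h \<in> forms I m"
  and c: "!!x. x \<in> T ==> c x = 0 \<or> (K * \<delta> x \<le> M * m & c x \<in> forms I (M * m - K * \<delta> x))"
  and w: "!!x. x \<in> T ==> w x \<in> loc I (n + int (K * \<delta> x)) P"
 shows "(\<Sum>x\<in>T. to_fract (c x) * w x) / to_fract (h ^ M) \<in> loc I n P"
proof -
 have pp: "P \<in> proj_points I" "h \<notin> P" using P by (auto simp: pbasic_def)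
 have "to_fract (c x) * w x \<in> loc I (n + int (M * m)) P" if x: "x \<in> T" for x
 proof (cases "c x = 0")
  case True then show ?thesis using loc_0[OF pp(1)] by simp
 next
  case False
  then have "K * \<delta> x \<le> M * m" "c x \<in> forms I (M * m - K * \<delta> x)" using c[OF x] by auto
  then show ?thesis by (intro loc_form_mult[OF pp(1) _ w[OF x]]) (auto simp: of_nat_diff)
 qed
 then have "(\<Sum>x\<in>T. to_fract (c x) * w x) \<in> loc I (n + int (M * m)) P" by (rule loc_sum[OF pp(1)])
 then show ?thesis
  by (rule loc_form_divide[OF pp(1) forms_power[OF h] forms_power_notin[OF pp(1) h pp(2)]]) simp
qed

text \<open>A family \<open>a\<close> that is locally constant modulo \<open>\<O>(n)\<close> is a section of the quotient of the constant
  sheaf by \<open>\<O>(n)\<close>. On an affine open set it lifts to a constant, by a partition of unity.\<close>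

lemma affine_cousin:
 fixes a :: "('i::linorder, 'k::field) mpoly set => ('i, 'k) mpoly fract"
 assumes h: "h \<in> forms I m" "0 < m" "h ~= 0"
  and a: "!!P. P \<in> pbasic I h ==>
   \<exists>U. openin (proj_top I) U & P \<in> U & (\<forall>Q\<in>U \<inter> pbasic I h. a P - a Q \<in> loc I n Q)"
 shows "\<exists>e. \<forall>P\<in>pbasic I h. e - a P \<in> loc I n P"
proof -
 have "\<exists>f l. f \<in> forms I l & f \<notin> P & (\<forall>Q\<in>pbasic I h. f \<notin> Q --> a P - a Q \<in> loc I n Q)"
  if P: "P \<in> pbasic I h" for P
 proof -
  obtain U where U: "openin (proj_top I) U" "P \<in> U" "\<forall>Q\<in>U \<inter> pbasic I h. a P - a Q \<in> loc I n Q"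
   using a[OF P] by blast
  obtain f l where "f \<in> forms I l" "P \<in> pbasic I f" "pbasic I f \<subseteq> U" using open_pbasic[OF U(1,2)] by blast
  then show ?thesis using U(3) by (intro exI[of _ f] exI[of _ l]) (auto simp: pbasic_def)
 qed
 then obtain \<phi> \<delta> where \<phi>: "!!P. P \<in> pbasic I h ==> \<phi> P \<in> forms I (\<delta> P)" "!!P. P \<in> pbasic I h ==> \<phi> P \<notin> P"
  "!!P Q. P \<in> pbasic I h ==> Q \<in> pbasic I h ==> \<phi> P \<notin> Q ==> a P - a Q \<in> loc I n Q" by metis
 have "\<exists>x\<in>pbasic I h. \<phi> x \<notin> P" if "P \<in> pbasic I h" for P using \<phi>(2)[OF that] that by blast
 from finite_subcover[OF \<phi>(1) h(1,2) this]
 obtain T where T: "finite T" "T \<subseteq> pbasic I h" "!!P. P \<in> pbasic I h ==> \<exists>x\<in>T. \<phi> x \<notin> P"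
  by auto
 have \<phi>0: "\<phi> x ~= 0" if "x \<in> T" for x
  using nonzero_if_notin \<phi>(2) T(2) that by (fastforce simp: pbasic_def)
 have "\<exists>k. \<forall>K P. k \<le> K --> P \<in> pbasic I (h * \<phi> y) --> to_fract (\<phi> x) ^ K * (a x - a y) \<in> loc I (n + int (K * \<delta> x)) P"
  if xy: "x \<in> T" "y \<in> T" for x y
 proof -
  have xy': "x \<in> pbasic I h" "y \<in> pbasic I h" using xy T by auto
  have hy: "h * \<phi> y \<in> forms I (m + \<delta> y)" "0 < m + \<delta> y" "h * \<phi> y ~= 0"
   using h \<phi>(1)[OF xy'(2)] \<phi>0[OF xy(2)] forms_mult by auto
  have "a x - a y \<in> loc I n P" if "P \<in> pbasic I (h * \<phi> y)" "\<phi> x \<notin> P" for P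
  proof -
   have P: "P \<in> pbasic I h" "\<phi> y \<notin> P" "P \<in> proj_points I"
    using that pbasic_mult[OF h(1) \<phi>(1)[OF xy'(2)]] by (auto simp: pbasic_def)
   have "(a x - a P) - (a y - a P) \<in> loc I n P"
    using \<phi>(3)[OF xy'(1) P(1) that(2)] \<phi>(3)[OF xy'(2) P(1,2)] loc_diff[OF P(3)] by blast
   then show ?thesis by simp
  qed
  then show ?thesis by (rule clear_denominator[OF hy \<phi>(1)[OF xy'(1)] \<phi>0[OF xy(1)]])
 qed
 then obtain k where k: "!!x y K P. x \<in> T ==> y \<in> T ==> k x y \<le> K ==> P \<in> pbasic I (h * \<phi> y) ==>
   to_fract (\<phi> x) ^ K * (a x - a y) \<in> loc I (n + int (K * \<delta> x)) P" by metis
 define K where "K = (\<Sum>(x, y)\<in>T \<times> T. k x y)"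
 have K: "k x y \<le> K" if "x \<in> T" "y \<in> T" for x y
  using member_le_sum[of "(x, y)" "T \<times> T" "%(x, y). k x y"] that T(1) by (auto simp: K_def)
 obtain M c where c: "h ^ M = (\<Sum>x\<in>T. c x * \<phi> x ^ K)"
  "!!x. x \<in> T ==> c x = 0 \<or> (K * \<delta> x \<le> M * m & c x \<in> forms I (M * m - K * \<delta> x))"
  using partition_of_unity[OF \<phi>(1)[OF subsetD[OF T(2)]] h(1,2) T(1,3), of K] by auto
 define e where "e = (\<Sum>x\<in>T. to_fract (c x) * (to_fract (\<phi> x) ^ K * a x)) / to_fract (h ^ M)"
 have "e - a P \<in> loc I n P" if P: "P \<in> pbasic I h" for P
 proof -
  have pp: "P \<in> proj_points I" using P by (auto simp: pbasic_def)
  obtain y where y: "y \<in> T" "\<phi> y \<notin> P" using T(3)[OF P] by blast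
  have y': "y \<in> pbasic I h" using y T by auto
  have Pyh: "P \<in> pbasic I (h * \<phi> y)" using P y pbasic_mult[OF h(1) \<phi>(1)[OF y']] by (auto simp: pbasic_def)
  have "to_fract (h ^ M) ~= 0" using h(3) by simp
  moreover have "to_fract (h ^ M) = (\<Sum>x\<in>T. to_fract (c x) * to_fract (\<phi> x) ^ K)"
   unfolding c(1) by (simp add: to_fract_sum to_fract_power)
  ultimately have aP: "a P = (\<Sum>x\<in>T. to_fract (c x) * to_fract (\<phi> x) ^ K * a P) / to_fract (h ^ M)"
   by (simp add: sum_distrib_right[symmetric])
  \<comment> \<open>Writing \<open>a P\<close> with the same weights turns \<open>e - a P\<close>
    into a weighted sum of the \<open>a x - a P\<close>. Each of these is
    \<open>(a x - a y) + (a y - a P)\<close>, where \<open>P\<close> lies in the piece of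
    \<open>y\<close>: the pole of the first part is cleared by \<open>\<phi> x ^ K\<close>, the
    second part is regular at \<open>P\<close>.\<close>
  have "e - a P = e - (\<Sum>x\<in>T. to_fract (c x) * to_fract (\<phi> x) ^ K * a P) / to_fract (h ^ M)"
   by (rule arg_cong2[of _ _ _ _ "(-)", OF refl aP])
  also have "\<dots> = (\<Sum>x\<in>T. to_fract (c x) * (to_fract (\<phi> x) ^ K * (a x - a P))) / to_fract (h ^ M)"
   unfolding e_def by (simp add: diff_divide_distrib[symmetric] sum_subtractf[symmetric] algebra_simps)
  also have "\<dots> \<in> loc I n P"
  proof (rule weighted_sum_loc[OF P h(1) c(2)])
   fix x assume x: "x \<in> T"
   then have x': "x \<in> pbasic I h" using T by auto
   have "to_fract (\<phi> x) ^ K * (a x - a y) \<in> loc I (n + int (K * \<delta> x)) P"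
    using k[OF x y(1) K[OF x y(1)] Pyh] .
   moreover have "to_fract (\<phi> x ^ K) * (a y - a P) \<in> loc I (n + int (K * \<delta> x)) P"
    by (rule loc_form_mult[OF pp forms_power[OF \<phi>(1)[OF x']] \<phi>(3)[OF y' P y(2)]]) simp
   ultimately have "to_fract (\<phi> x) ^ K * (a x - a y) + to_fract (\<phi> x ^ K) * (a y - a P) \<in> loc I (n + int (K * \<delta> x)) P"
    by (rule loc_add[OF pp])
   then show "to_fract (\<phi> x) ^ K * (a x - a P) \<in> loc I (n + int (K * \<delta> x)) P"
    by (simp add: to_fract_power algebra_simps)
  qed
  finally show ?thesis .
 qed
 then show ?thesis by blast
qed

subsection \<open>Laurent polynomials in three variables\<close>

lemma lookup_times_monomial:
 fixes f :: "('i, 'k::field) mpoly"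
 shows "lookup (single s 1 * f) (s + u) = lookup f u"
proof -
 have "f = (\<Sum>t\<in>keys f. single t (lookup f t))"
  by (rule poly_mapping_eqI) (auto simp: lookup_sum lookup_single when_def in_keys_iff)
 then have "single s 1 * f = (\<Sum>t\<in>keys f. single (s + t) (lookup f t))"
  by (metis (no_types, lifting) mult_1 mult_single sum.cong sum_distrib_left)
 then show ?thesis by (auto simp: lookup_sum lookup_single when_def in_keys_iff)
qed

lemma keys_times_monomial:
 fixes f :: "('i, 'k::field) mpoly"
 shows "keys (single s 1 * f) = (+) s ` keys f"
proof
 show "keys (single s 1 * f) \<subseteq> (+) s ` keys f"
  using keys_mult[of "single s 1" f] by auto
 show "(+) s ` keys f \<subseteq> keys (single s 1 * f)"
  by (auto simp: in_keys_iff lookup_times_monomial)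
qed

lemma divide_by_monomial:
 fixes f :: "('i, 'k::field) mpoly"
 assumes f: "f \<in> forms I n" and s: "!!t i. t \<in> keys f ==> lookup s i \<le> lookup t i"
 shows "\<exists>g. f = single s 1 * g & g \<in> forms I (n - mdeg s) & (f ~= 0 --> mdeg s \<le> n)"
proof -
 define g where "g = (\<Sum>t\<in>keys f. single (t - s) (lookup f t))"
 have t: "s + (t - s) = t" if "t \<in> keys f" for t
  by (rule poly_mapping_eqI) (use s[OF that] in \<open>simp add: lookup_add lookup_minus\<close>)
 have md: "mdeg s + mdeg (t - s) = n" if "t \<in> keys f" for t
  using t[OF that] mdeg_add[of s "t - s"] that f by (auto simp: forms_def)
 have "f = (\<Sum>t\<in>keys f. single t (lookup f t))"
  by (rule poly_mapping_eqI) (auto simp: lookup_sum lookup_single when_def in_keys_iff)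
 also have "\<dots> = single s 1 * g"
  unfolding g_def sum_distrib_left by (intro sum.cong refl) (simp add: mult_single t)
 finally have "f = single s 1 * g" .
 moreover have "g \<in> forms I (n - mdeg s)" unfolding g_def
 proof (intro forms_sum forms_single)
  fix t assume "t \<in> keys f"
  then show "mdeg (t - s) = n - mdeg s" using md by fastforce
  have "keys (t - s) \<subseteq> keys t" by (auto simp: in_keys_iff lookup_minus)
  then show "keys (t - s) \<subseteq> I" using f \<open>t \<in> _\<close> by (auto simp: forms_def polys_def)
 qed
 moreover have "mdeg s \<le> n" if f0: "f ~= 0"
 proof -
  obtain t where "t \<in> keys f" using f0 by (metis all_not_in_conv keys_eq_empty)
  then show ?thesis using md[of t] by simp
 qed
 ultimately show ?thesis by blast
qed

lemma mvar_power: "mvar i ^ n = single (single i n) 1"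
 by (induction n) (auto simp: mvar_def mult_single single_add[symmetric])

definition xm :: "'i set => ('i, 'k::field) mpoly" where
 "xm B = (\<Prod>i\<in>B. mvar i)"

lemma xm_form: "B \<subseteq> I ==> xm B \<in> forms I (card B)"
 using forms_prod[of B mvar I "%_. 1"] forms_mvar[of _ I] by (auto simp: xm_def)

lemma xm_notin:
 fixes P :: "('i, 'k::field) mpoly set"
 assumes P: "P \<in> proj_points I" and B: "finite B" "B \<subseteq> I"
 shows "xm B \<notin> P \<longleftrightarrow> (\<forall>i\<in>B. mvar i \<notin> P)"
 using B
proof (induction B rule: finite_induct)
 case empty
 then show ?case using proj_pointD(4)[OF P] by (simp add: xm_def)
next
 case (insert i B)
 have "xm (insert i B) = mvar i * (xm B :: ('i, 'k) mpoly)" using insert.hyps by (simp add: xm_def)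
 moreover have "mvar i \<in> polys I" "(xm B :: ('i, 'k) mpoly) \<in> polys I"
  using insert.prems forms_polys[OF forms_mvar] forms_polys[OF xm_form] by auto
 ultimately show ?case using proj_pointD(7)[OF P, of "mvar i" "xm B"] insert by auto
qed

lemma pbasic_xm: "finite B ==> B \<subseteq> I ==> pbasic I (xm B) = {P \<in> proj_points I. \<forall>i\<in>B. mvar i \<notin> P}"
 using xm_notin by (auto simp: pbasic_def)

lemma xm_nonzero [simp]: "finite B ==> xm B ~= (0 :: ('i::linorder, 'k::field) mpoly)"
 by (simp add: xm_def)

definition expo :: "'i set => nat => ('i \<Rightarrow>\<^sub>0 nat)" where
 "expo B N = (\<Sum>i\<in>B. single i N)"

lemma lookup_expo: "finite B ==> lookup (expo B N) i = (if i \<in> B then N else 0)"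
 by (auto simp: expo_def lookup_sum lookup_single when_def)

lemma mdeg_expo: "finite B ==> mdeg (expo B N) = card B * N"
proof (induction B rule: finite_induct)
 case (insert i B)
 then have "expo (insert i B) N = single i N + expo B N" by (simp add: expo_def)
 then show ?case using insert by (simp add: mdeg_add)
qed (simp add: expo_def)

lemma xm_power: "finite B ==> xm B ^ N = (single (expo B N) 1 :: ('i, 'k::field) mpoly)"
proof (induction B rule: finite_induct)
 case (insert i B)
 then have "xm (insert i B) ^ N = mvar i ^ N * (xm B ^ N :: ('i, 'k) mpoly)" by (simp add: xm_def power_mult_distrib)
 then show ?case using insert by (simp add: expo_def mvar_power mult_single)
qed (simp add: expo_def xm_def)

text \<open>Sections of O(n) over the intersection of the charts x_i \<noteq> 0 with i in
  \<open>B\<close>.\<close>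

definition On :: "'i::linorder set => int => 'i set => ('i, 'k::field) mpoly fract set" where
 "On I n B = {v. \<forall>P\<in>proj_points I. (\<forall>i\<in>B. mvar i \<notin> P) --> v \<in> loc I n P}"

lemma On_add: "v \<in> On I n B ==> w \<in> On I n B ==> v + w \<in> On I n B"
 and On_diff: "v \<in> On I n B ==> w \<in> On I n B ==> v - w \<in> On I n B"
 and On_uminus: "v \<in> On I n B ==> - v \<in> On I n B"
 by (simp_all add: On_def loc_add loc_diff loc_uminus)

text \<open>Over the N-th power of the product of all variables as denominator, absence of a pole
  along x_i = 0 becomes divisibility of the numerator by x_i^N. Every large \<open>N\<close> is
  allowed, so that finitely many sections can share one denominator; \<open>On_fraction\<close> is
  the converse.\<close>

lemma On_numerator:
 fixes v :: "('i::linorder, 'k::field) mpoly fract"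
 assumes I: "finite I" and B: "B \<subseteq> I" "B ~= {}" and v: "v \<in> On I n B"
 shows "\<exists>N0. \<forall>N\<ge>N0. \<exists>p k. p \<in> forms I k & int k = n + int (card I * N) &
  v = to_fract p / to_fract (xm I) ^ N & (\<forall>t\<in>keys p. \<forall>i\<in>I - B. N \<le> lookup t i)"
proof -
 have fB: "finite B" using I B finite_subset by blast
 have cB: "0 < card B" using fB B by (simp add: card_gt_0_iff)
 have "v \<in> loc I n P" if "P \<in> pbasic I (xm B)" for P
  using that v by (simp add: On_def pbasic_xm[OF fB B(1)])
 then obtain a N0 k where a: "a \<in> forms I k" "int k = int (N0 * card B) + n" "v = to_fract a / to_fract (xm B) ^ N0"
  by (rule loc_pbasic[OF xm_form[OF B(1)] cB xm_nonzero[OF fB]])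
 show ?thesis
 proof (intro exI[of _ N0] allI impI)
  fix N assume "N0 \<le> N"
  then obtain r where r: "N = N0 + r" using le_Suc_ex by blast
  let ?C = "I - B"
  let ?p = "a * xm B ^ r * xm ?C ^ N :: ('i, 'k) mpoly"
  have fC: "finite ?C" using I by simp
  have XI: "xm I = (xm B * xm ?C :: ('i, 'k) mpoly)"
   unfolding xm_def using prod.union_disjoint[OF fB fC, of mvar] B(1) by (simp add: Un_absorb1)
  have cI: "card I = card B + card ?C" using B(1) I fB by (simp add: card_Diff_subset card_mono)
  have "?p \<in> forms I (k + r * card B + N * card ?C)"
   by (intro forms_mult forms_power xm_form a(1) B) auto
  moreover have "int (k + r * card B + N * card ?C) = n + int (card I * N)"
   unfolding cI using a(2) by (simp add: r algebra_simps)
  moreover have "v = to_fract ?p / to_fract (xm I) ^ N"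
   unfolding XI a(3) r by (simp add: to_fract_power power_add power_mult_distrib fB fC)
  moreover have "N \<le> lookup t i" if t: "t \<in> keys ?p" and i: "i \<in> ?C" for t i
  proof -
   have "?p = single (expo ?C N) 1 * (a * xm B ^ r)" by (simp add: xm_power[OF fC] mult.commute)
   then have "t \<in> (+) (expo ?C N) ` keys (a * xm B ^ r)" using t by (simp only: keys_times_monomial)
   then obtain u where "t = expo ?C N + u" by blast
   then show ?thesis using i by (simp add: lookup_add lookup_expo[OF fC])
  qed
  ultimately show "\<exists>p k. p \<in> forms I k & int k = n + int (card I * N) &
   v = to_fract p / to_fract (xm I) ^ N & (\<forall>t\<in>keys p. \<forall>i\<in>?C. N \<le> lookup t i)"
   by blast
 qed
qed

lemma On_fraction:
 fixes p :: "('i::linorder, 'k::field) mpoly"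
 assumes I: "finite I" and B: "B \<subseteq> I" and p: "p \<in> forms I k" "int k = n + int (card I * N)"
  and t: "!!t i. t \<in> keys p ==> i \<in> I - B ==> N \<le> lookup t i"
 shows "to_fract p / to_fract (xm I) ^ N \<in> On I n B"
proof (cases "p = 0")
 case True
 then show ?thesis by (simp add: On_def loc_0)
next
 case False
 let ?C = "I - B"
 have fB: "finite B" and fC: "finite ?C" using I B finite_subset by auto
 have XI: "xm I = (xm B * xm ?C :: ('i, 'k) mpoly)"
  unfolding xm_def using prod.union_disjoint[OF fB fC, of mvar] B by (simp add: Un_absorb1)
 have cI: "card I = card B + card ?C" using B I fB by (simp add: card_Diff_subset card_mono)
 have "lookup (expo ?C N) i \<le> lookup u i" if "u \<in> keys p" for u i
  using t[OF that, of i] by (auto simp: lookup_expo[OF fC])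
 from divide_by_monomial[OF p(1) this]
 obtain g where g: "p = single (expo ?C N) 1 * g" "g \<in> forms I (k - mdeg (expo ?C N))"
  "mdeg (expo ?C N) \<le> k" using False by auto
 have pg: "p = xm ?C ^ N * g" using g(1) by (simp add: xm_power[OF fC])
 have eq: "to_fract p / to_fract (xm I) ^ N = to_fract g / to_fract (xm B ^ N)"
  unfolding XI pg by (simp add: to_fract_power power_mult_distrib fC)
 show ?thesis unfolding eq On_def
 proof (intro CollectI ballI impI)
  fix P :: "('i, 'k) mpoly set" assume P: "P \<in> proj_points I" and "\<forall>i\<in>B. mvar i \<notin> P"
  then have nB: "xm B \<notin> P" using xm_notin[OF P fB B] by blast
  have "to_fract g \<in> loc I (int (k - mdeg (expo ?C N))) P" by (rule loc_form[OF P g(2)])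
  then show "to_fract g / to_fract (xm B ^ N) \<in> loc I n P"
   by (rule loc_form_divide[OF P forms_power[OF xm_form[OF B]] forms_power_notin[OF P xm_form[OF B] nB]])
    (use g(3) p(2) in \<open>simp add: mdeg_expo[OF fC] of_nat_diff cI algebra_simps\<close>)
 qed
qed

lemma xyz_eq: "xyz = {0, 1, 2}"
 by auto

lemma On_plane_numerator:
 fixes v :: "(nat, 'k::field) mpoly fract"
 assumes "B \<subseteq> {0, 1, 2}" "B ~= {}" "v \<in> On xyz n B"
 shows "\<exists>N0. \<forall>N\<ge>N0. \<exists>p k. p \<in> forms xyz k & int k = n + int (3 * N) &
  v = to_fract p / to_fract (xm xyz) ^ N &
  (\<forall>t\<in>keys p. \<forall>i\<in>{0, 1, 2} - B. N \<le> lookup t i)"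
 using On_numerator[of xyz B v n] assms by (simp add: xyz_eq)

lemma On_plane_fraction:
 fixes p :: "(nat, 'k::field) mpoly"
 assumes "B \<subseteq> {0, 1, 2}" "p \<in> forms xyz k" "int k = n + int (3 * N)"
  "!!t i. t \<in> keys p ==> i \<in> {0, 1, 2} - B ==> N \<le> lookup t i"
 shows "to_fract p / to_fract (xm xyz) ^ N \<in> On xyz n B"
 using On_fraction[of xyz B p k n N] assms by (simp add: xyz_eq)

lemma fraction_numerator_eq:
 assumes "to_fract p / to_fract (xm xyz :: (nat, 'k::field) mpoly) ^ N = to_fract q / to_fract (xm xyz) ^ N"
 shows "p = q"
 using assms by simp

text \<open>The three weak inequalities below say that \<open>e\<^sub>0, e\<^sub>1, e\<^sub>2\<close> is a 1-cocycle on the standard cover. Over a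
  common denominator it is split by sorting the monomials of the numerators.\<close>

lemma laurent_H1:
 fixes e :: "nat => (nat, 'k::field) mpoly fract"
 assumes e: "e 0 - e 1 \<in> On xyz n {0, 1}" "e 0 - e 2 \<in> On xyz n {0, 2}"
  "e 1 - e 2 \<in> On xyz n {1, 2}"
 shows "\<exists>e'. e' - e 0 \<in> On xyz n {0} & e' - e 1 \<in> On xyz n {1} & e' - e 2 \<in> On xyz n {2}"
proof -
 let ?X = "xm xyz :: 'k xpoly"
 obtain N01 where N01: "\<forall>N\<ge>N01. \<exists>p k. p \<in> forms xyz k & int k = n + int (3 * N) &
  e 0 - e 1 = to_fract p / to_fract ?X ^ N & (\<forall>t\<in>keys p. \<forall>i\<in>{0, 1, 2} - {0, 1}. N \<le> lookup t i)"
  using On_plane_numerator[OF _ _ e(1)] by auto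
 obtain N02 where N02: "\<forall>N\<ge>N02. \<exists>p k. p \<in> forms xyz k & int k = n + int (3 * N) &
  e 0 - e 2 = to_fract p / to_fract ?X ^ N & (\<forall>t\<in>keys p. \<forall>i\<in>{0, 1, 2} - {0, 2}. N \<le> lookup t i)"
  using On_plane_numerator[OF _ _ e(2)] by auto
 obtain N12 where N12: "\<forall>N\<ge>N12. \<exists>p k. p \<in> forms xyz k & int k = n + int (3 * N) &
  e 1 - e 2 = to_fract p / to_fract ?X ^ N & (\<forall>t\<in>keys p. \<forall>i\<in>{0, 1, 2} - {1, 2}. N \<le> lookup t i)"
  using On_plane_numerator[OF _ _ e(3)] by auto
 define N where "N = N01 + N02 + N12"
 obtain p01 k where p01: "p01 \<in> forms xyz k" "int k = n + int (3 * N)"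
  "e 0 - e 1 = to_fract p01 / to_fract ?X ^ N" "!!t. t \<in> keys p01 ==> N \<le> lookup t 2"
  using N01[rule_format, of N] by (auto simp: N_def)
 obtain p02 k2 where p02: "p02 \<in> forms xyz k2" "int k2 = n + int (3 * N)"
  "e 0 - e 2 = to_fract p02 / to_fract ?X ^ N" "!!t. t \<in> keys p02 ==> N \<le> lookup t 1"
  using N02[rule_format, of N] by (auto simp: N_def)
 obtain p12 k12 where p12: "p12 \<in> forms xyz k12"
  "e 1 - e 2 = to_fract p12 / to_fract ?X ^ N" "!!t. t \<in> keys p12 ==> N \<le> lookup t 0"
  using N12[rule_format, of N] by (auto simp: N_def)
 have k2: "k2 = k" using p01(2) p02(2) by simp
 have "e 0 - e 2 = (e 0 - e 1) + (e 1 - e 2)" by simp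
 then have "to_fract p02 / to_fract ?X ^ N = to_fract (p01 + p12) / to_fract ?X ^ N"
  unfolding p01(3) p02(3) p12(2) by (simp add: add_divide_distrib)
 then have sum: "p02 = p01 + p12" by (rule fraction_numerator_eq)
 \<comment> \<open>Call an exponent large if it is at least \<open>N\<close>. Monomials of
   \<open>p01\<close> have a large exponent of x_2. Those with a large exponent of x_1 as well are
   regular on chart 0 and form \<open>p0\<close>; the others cannot occur in \<open>p02\<close>, so
   they cancel against \<open>p12\<close>, have a large exponent of x_0 and are regular on chart
   1.\<close>
 define p0 where "p0 = part (%t. N \<le> lookup t 1) p01"
 define e' where "e' = e 0 - to_fract p0 / to_fract ?X ^ N"
 have p0: "p0 \<in> forms xyz k" unfolding p0_def by (rule forms_part[OF p01(1)])
 have "e' - e 0 = to_fract (- p0) / to_fract ?X ^ N" by (simp add: e'_def)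
 moreover have "to_fract (- p0) / to_fract ?X ^ N \<in> On xyz n {0}"
  by (rule On_plane_fraction[OF _ forms_uminus[OF p0] p01(2)]) (use p01(4) in \<open>auto simp: p0_def keys_part\<close>)
 moreover have "e' - e 1 = (e 0 - e 1) - to_fract p0 / to_fract ?X ^ N" by (simp add: e'_def)
 then have "e' - e 1 = to_fract (p01 - p0) / to_fract ?X ^ N" unfolding p01(3) by (simp add: diff_divide_distrib)
 moreover have "to_fract (p01 - p0) / to_fract ?X ^ N \<in> On xyz n {1}"
 proof (rule On_plane_fraction[OF _ forms_diff[OF p01(1) p0] p01(2)])
  fix t i assume t: "t \<in> keys (p01 - p0)" and i: "i \<in> {0, 1, 2} - {1::nat}"
  then have t1: "t \<in> keys p01" "\<not> N \<le> lookup t 1"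
   by (auto simp: in_keys_iff lookup_minus p0_def lookup_part split: if_splits)
  then have "t \<notin> keys p02" using p02(4) by blast
  then have "t \<in> keys p12" using t1(1) by (auto simp: in_keys_iff sum lookup_add)
  then show "N \<le> lookup t i" using i p01(4)[OF t1(1)] p12(3) by auto
 qed auto
 moreover have "e' - e 2 = (e 0 - e 2) - to_fract p0 / to_fract ?X ^ N" by (simp add: e'_def)
 then have "e' - e 2 = to_fract (p02 - p0) / to_fract ?X ^ N" unfolding p02(3) by (simp add: diff_divide_distrib)
 moreover have "to_fract (p02 - p0) / to_fract ?X ^ N \<in> On xyz n {2}"
 proof (rule On_plane_fraction[OF _ forms_diff[OF p02(1)[unfolded k2] p0] p01(2)])
  fix t i assume t: "t \<in> keys (p02 - p0)" and i: "i \<in> {0, 1, 2} - {2::nat}"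
  have t1: "N \<le> lookup t 1"
  proof (rule ccontr)
   assume n1: "\<not> N \<le> lookup t 1"
   then have "lookup p02 t = 0" using p02(4)[of t] by (auto simp: in_keys_iff)
   then show False using t n1 by (simp add: in_keys_iff lookup_minus p0_def lookup_part)
  qed
  then have "t \<in> keys p12"
   using t by (auto simp: in_keys_iff lookup_minus p0_def lookup_part sum lookup_add)
  then show "N \<le> lookup t i" using i t1 p12(3) by auto
 qed auto
 ultimately show ?thesis by (intro exI[of _ e']) simp
qed

text \<open>A monomial of degree at least \<open>3N - 2\<close> has an exponent that is at least \<open>N\<close>.\<close>

lemma laurent_H2:
 fixes v :: "(nat, 'k::field) mpoly fract"
 assumes n: "- 2 \<le> n" and v: "v \<in> On xyz n {0, 1, 2}"
 shows "\<exists>a b c. v = a + b + c & a \<in> On xyz n {0, 1} & b \<in> On xyz n {0, 2} & c \<in> On xyz n {1, 2}"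
proof -
 let ?X = "xm xyz :: 'k xpoly"
 obtain N p k where p: "p \<in> forms xyz k" "int k = n + int (3 * N)" "v = to_fract p / to_fract ?X ^ N"
  using On_plane_numerator[OF _ _ v] by auto
 define q where "q = part (%t. \<not> N \<le> lookup t 2) p"
 define a where "a = part (%t. N \<le> lookup t 2) p"
 define b where "b = part (%t. N \<le> lookup t 1) q"
 define c where "c = part (%t. \<not> N \<le> lookup t 1) q"
 have "p = a + b + c" using part_compl[of "%t. N \<le> lookup t 2" p]
   part_compl[of "%t. N \<le> lookup t 1" q] by (simp add: a_def b_def c_def q_def add.assoc)
 then have "v = to_fract a / to_fract ?X ^ N + to_fract b / to_fract ?X ^ N + to_fract c / to_fract ?X ^ N"
  using p(3) by (simp add: add_divide_distrib)
 moreover have "to_fract a / to_fract ?X ^ N \<in> On xyz n {0, 1}"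
  by (rule On_plane_fraction[OF _ _ p(2)]) (auto simp: a_def keys_part intro: forms_part[OF p(1)])
 moreover have "to_fract b / to_fract ?X ^ N \<in> On xyz n {0, 2}"
  by (rule On_plane_fraction[OF _ _ p(2)]) (auto simp: b_def q_def keys_part intro!: forms_part p(1))
 moreover have "to_fract c / to_fract ?X ^ N \<in> On xyz n {1, 2}"
 proof (rule On_plane_fraction[OF _ _ p(2)])
  show "c \<in> forms xyz k" unfolding c_def q_def by (intro forms_part p(1))
  fix t i assume t: "t \<in> keys c" and i: "i \<in> {0, 1, 2} - {1, 2::nat}"
  have lt: "\<not> N \<le> lookup t 1" "\<not> N \<le> lookup t 2" and tp: "t \<in> keys p"
   using t by (auto simp: c_def q_def keys_part)
  have "keys t \<subseteq> {0, 1, 2}" "mdeg t = k"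
   using p(1) tp by (auto simp: forms_def polys_def xyz_eq)
  moreover have "mdeg t = (\<Sum>i\<in>{0, 1, 2}. lookup t i)"
   unfolding mdeg_def by (rule sum.mono_neutral_left) (use calculation in \<open>auto simp: in_keys_iff\<close>)
  ultimately have "k = (\<Sum>i\<in>{0, 1, 2}. lookup t i)" by simp
  then have "N \<le> lookup t 0" using lt p(2) n by simp
  then show "N \<le> lookup t i" using i by auto
 qed auto
 ultimately show ?thesis by blast
qed

text \<open>Chart 0 makes the exponents of x_1 and x_2 in the numerator large, chart 1 those of x_0
  and x_2; over a common denominator both numerators are the same polynomial, so the denominator
  cancels. Zero is listed apart because for negative \<open>n\<close> there is no form of degree
  \<open>n\<close> to represent it.\<close>

lemma global_sections:
 fixes v :: "(nat, 'k::field) mpoly fract"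
 assumes v: "!!P. P \<in> proj_points xyz ==> v \<in> loc xyz n P"
 shows "v = 0 \<or> (\<exists>k a. int k = n & a \<in> forms xyz k & v = to_fract a)"
proof (cases "v = 0")
 case False
 let ?X = "xm xyz :: 'k xpoly"
 have On: "v \<in> On xyz n B" for B using v by (simp add: On_def)
 obtain N0 where N0: "\<forall>N\<ge>N0. \<exists>p k. p \<in> forms xyz k & int k = n + int (3 * N) &
  v = to_fract p / to_fract ?X ^ N & (\<forall>t\<in>keys p. \<forall>i\<in>{0, 1, 2} - {0}. N \<le> lookup t i)"
  using On_plane_numerator[OF _ _ On, of "{0}"] by auto
 obtain N1 where N1: "\<forall>N\<ge>N1. \<exists>p k. p \<in> forms xyz k & int k = n + int (3 * N) &
  v = to_fract p / to_fract ?X ^ N & (\<forall>t\<in>keys p. \<forall>i\<in>{0, 1, 2} - {1}. N \<le> lookup t i)"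
  using On_plane_numerator[OF _ _ On, of "{1}"] by auto
 define N where "N = N0 + N1"
 obtain p k where p: "p \<in> forms xyz k" "int k = n + int (3 * N)" "v = to_fract p / to_fract ?X ^ N"
  "\<forall>t\<in>keys p. \<forall>i\<in>{0, 1, 2} - {0}. N \<le> lookup t i"
  using N0[rule_format, of N] by (auto simp: N_def)
 obtain q where q: "v = to_fract q / to_fract ?X ^ N"
  "\<forall>t\<in>keys q. \<forall>i\<in>{0, 1, 2} - {1}. N \<le> lookup t i"
  using N1[rule_format, of N] by (auto simp: N_def)
 have "p = q" using p(3) q(1) fraction_numerator_eq by metis
 then have lk: "N \<le> lookup t i" if "t \<in> keys p" "i \<in> xyz" for t i
  using p(4) q(2) that unfolding xyz_eq by auto
 have "lookup (expo xyz N) i \<le> lookup u i" if "u \<in> keys p" for u i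
  using lk[OF that, of i] xyz_eq by (auto simp: lookup_expo)
 from divide_by_monomial[OF p(1) this]
 obtain g where g: "p = single (expo xyz N) 1 * g" "g \<in> forms xyz (k - mdeg (expo xyz N))"
  "mdeg (expo xyz N) \<le> k" using False p(3) by auto
 then have "int (k - mdeg (expo xyz N)) = n" using g(3) p(2) by (simp add: mdeg_expo)
 moreover have "v = to_fract g" unfolding p(3) g(1) by (simp flip: xm_power add: to_fract_power)
 ultimately show ?thesis using g(2) by blast
qed simp

subsection \<open>Vanishing on the plane\<close>

lemma plane_chart: "P \<in> proj_points xyz ==> \<exists>l\<in>{0, 1, 2}. mvar l \<notin> P"
 using proj_pointD(6)[of P xyz] unfolding xyz_eq by blast

text \<open>The lifts on the three standard charts differ by a 1-cocycle in O(n), which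
  \<open>laurent_H1\<close> splits. Thus every global section of the constant sheaf modulo O(n)
  lifts to a constant, which is the vanishing of the first cohomology of O(n).\<close>

lemma global_cousin:
 fixes a :: "(nat, 'k::field) mpoly set => 'k xpoly fract"
 assumes a: "!!P. P \<in> proj_points xyz ==>
   \<exists>U. openin (proj_top xyz) U & P \<in> U & (\<forall>Q\<in>U. a P - a Q \<in> loc xyz n Q)"
 shows "\<exists>e. \<forall>P\<in>proj_points xyz. e - a P \<in> loc xyz n P"
proof -
 have "\<exists>e. \<forall>P\<in>pbasic xyz (mvar l). e - a P \<in> loc xyz n P" if l: "l \<in> {0, 1, 2}" for l
 proof (rule affine_cousin[where m = 1])
  show "mvar l \<in> forms xyz 1" by (rule forms_mvar) (use l in auto)
  fix P :: "'k xpoly set" assume "P \<in> pbasic xyz (mvar l)"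
  then have "P \<in> proj_points xyz" by (simp add: pbasic_def)
  from a[OF this] obtain U where "openin (proj_top xyz) U" "P \<in> U"
   "\<forall>Q\<in>U. a P - a Q \<in> loc xyz n Q" by (elim exE conjE)
  then show "\<exists>U. openin (proj_top xyz) U & P \<in> U &
    (\<forall>Q\<in>U \<inter> pbasic xyz (mvar l). a P - a Q \<in> loc xyz n Q)"
   by (intro exI[of _ U]) simp
 qed auto
 then obtain e where e: "!!l P. l \<in> {0, 1, 2} ==> P \<in> proj_points xyz ==> mvar l \<notin> P ==>
   e l - a P \<in> loc xyz n P"
  unfolding pbasic_def by (metis (mono_tags, lifting) mem_Collect_eq)
 have On: "e l - e m \<in> On xyz n {l, m}" if lm: "l \<in> {0, 1, 2}" "m \<in> {0, 1, 2}" for l m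
  unfolding On_def
 proof (intro CollectI ballI impI)
  fix P :: "'k xpoly set" assume P: "P \<in> proj_points xyz" "\<forall>i\<in>{l, m}. mvar i \<notin> P"
  have "(e l - a P) - (e m - a P) \<in> loc xyz n P"
   by (rule loc_diff[OF P(1) e e]) (use lm P in auto)
  then show "e l - e m \<in> loc xyz n P" by simp
 qed
 obtain e' where e': "e' - e 0 \<in> On xyz n {0}" "e' - e 1 \<in> On xyz n {1}" "e' - e 2 \<in> On xyz n {2}"
  using laurent_H1[OF On On On] by auto
 have "e' - a P \<in> loc xyz n P" if P: "P \<in> proj_points xyz" for P
 proof -
  obtain l where l: "l \<in> {0, 1, 2}" "mvar l \<notin> P" using plane_chart[OF P] by blast
  have "e' - e l \<in> On xyz n {l}" using e' l(1) by auto
  then have "e' - e l \<in> loc xyz n P" using P l(2) by (simp add: On_def)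
  then have "(e' - e l) + (e l - a P) \<in> loc xyz n P" by (rule loc_add[OF P _ e[OF l(1) P l(2)]])
  then show ?thesis by simp
 qed
 then show ?thesis by blast
qed

text \<open>Covers of the plane by principal open sets, each inside the standard chart
  \<open>\<iota> x\<close>. As \<open>\<phi> x\<close> is nonzero, every intersection contains the
  generic point, so a cochain is a family of elements of the function field and the cocycle
  identities hold without reference to points.\<close>

locale plane_cover =
 fixes X :: "'x set" and \<phi> :: "'x => (nat, 'k::field) mpoly" and \<delta> \<iota> :: "'x => nat"
 assumes form: "x \<in> X ==> \<phi> x \<in> forms xyz (\<delta> x)"
  and pos: "x \<in> X ==> 0 < \<delta> x" and nonzero: "x \<in> X ==> \<phi> x ~= 0"
  and chart: "x \<in> X ==> \<iota> x \<in> {0, 1, 2}"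
   "x \<in> X ==> P \<in> proj_points xyz ==> \<phi> x \<notin> P ==> mvar (\<iota> x) \<notin> P"
  and cover: "P \<in> proj_points xyz ==> \<exists>x\<in>X. \<phi> x \<notin> P"
begin

abbreviation "pp \<equiv> proj_points xyz :: 'k xpoly set set"
abbreviation "L \<equiv> loc xyz"

definition pick :: "'k xpoly set => 'x" where
 "pick P = (SOME x. x \<in> X & \<phi> x \<notin> P)"

lemma pick: "P \<in> pp ==> pick P \<in> X" "P \<in> pp ==> \<phi> (pick P) \<notin> P"
 unfolding pick_def using someI_ex[OF cover[of P, unfolded Bex_def]] by auto

lemma open_D: "x \<in> X ==> openin (proj_top xyz) (pbasic xyz (\<phi> x))"
 using openin_pbasic form by blast

text \<open>With a fixed index \<open>x0\<close> the cocycle is the coboundary of the constants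
  \<open>f x0 x\<close>. These may be irregular, but \<open>f x0 (pick P)\<close> is locally
  constant modulo O(n) as a function of \<open>P\<close>, so \<open>global_cousin\<close> supplies
  one constant whose subtraction makes all of them regular.\<close>

theorem cech_H1:
 fixes f :: "'x => 'x => 'k xpoly fract"
 assumes coc: "!!x y z. x \<in> X ==> y \<in> X ==> z \<in> X ==> f y z - f x z + f x y = 0"
  and reg: "!!x y P. x \<in> X ==> y \<in> X ==> P \<in> pp ==> \<phi> x \<notin> P ==> \<phi> y \<notin> P ==> f x y \<in> L n P"
 shows "\<exists>g. (\<forall>x\<in>X. \<forall>P\<in>pp. \<phi> x \<notin> P --> g x \<in> L n P) & (\<forall>x\<in>X. \<forall>y\<in>X. f x y = g y - g x)"
proof (cases "X = {}")
 case False
 then obtain x0 where x0: "x0 \<in> X" by blast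
 define a where "a P = f x0 (pick P)" for P
 have diff: "f x0 y - f x0 x = f x y" if "x \<in> X" "y \<in> X" for x y
  using coc[OF x0 that] by (simp add: algebra_simps)
 have "\<exists>e. \<forall>P\<in>pp. e - a P \<in> L n P"
 proof (rule global_cousin)
  fix P assume P: "P \<in> pp"
  have "a P - a Q \<in> L n Q" if Q: "Q \<in> pbasic xyz (\<phi> (pick P))" for Q
  proof -
   have Q': "Q \<in> pp" "\<phi> (pick P) \<notin> Q" using Q by (auto simp: pbasic_def)
   have "f (pick Q) (pick P) \<in> L n Q" by (rule reg) (use pick P Q' in auto)
   then show ?thesis unfolding a_def using diff[OF pick(1)[OF Q'(1)] pick(1)[OF P]] by simp
  qed
  then show "\<exists>U. openin (proj_top xyz) U & P \<in> U & (\<forall>Q\<in>U. a P - a Q \<in> L n Q)"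
   using open_D[OF pick(1)[OF P]] pick(2)[OF P] P by (intro exI[of _ "pbasic xyz (\<phi> (pick P))"]) (auto simp: pbasic_def)
 qed
 then obtain e where e: "!!P. P \<in> pp ==> e - a P \<in> L n P" by blast
 define g where "g x = f x0 x - e" for x
 have "g x \<in> L n P" if x: "x \<in> X" and P: "P \<in> pp" "\<phi> x \<notin> P" for x P
 proof -
  have "f (pick P) x - (e - a P) \<in> L n P"
   by (rule loc_diff[OF P(1) reg e]) (use pick x P in auto)
  moreover have "f (pick P) x - (e - a P) = g x"
   using diff[OF pick(1)[OF P(1)] x] by (simp add: g_def a_def algebra_simps)
  ultimately show ?thesis by (simp only:)
 qed
 moreover have "f x y = g y - g x" if "x \<in> X" "y \<in> X" for x y using diff[OF that] by (simp add: g_def)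
 ultimately show ?thesis by blast
qed simp

text \<open>A cocycle \<open>f = \<delta> g\<close> with constants \<open>g\<close> is the coboundary of an \<open>\<O>(n)\<close>-valued cochain on \<open>D(h)\<close>:
  average \<open>g\<close> over a finite subcover with a partition of unity, then extend to the
  whole cover by \<open>affine_cousin\<close>.\<close>

lemma affine_H2:
 fixes f :: "'x => 'x => 'x => 'k xpoly fract"
 assumes h: "h \<in> forms xyz m" "0 < m" "h ~= 0"
  and g: "!!x y z. x \<in> X ==> y \<in> X ==> z \<in> X ==> f x y z = g y z - g x z + g x y"
  and reg: "!!x y z P. x \<in> X ==> y \<in> X ==> z \<in> X ==> P \<in> pp ==> \<phi> x \<notin> P ==> \<phi> y \<notin> P ==> \<phi> z \<notin> P ==> f x y z \<in> L n P"
 shows "\<exists>k. \<forall>x\<in>X. \<forall>y\<in>X. \<forall>P\<in>pp. h \<notin> P --> \<phi> x \<notin> P --> \<phi> y \<notin> P --> g x y - (k y - k x) \<in> L n P"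
proof -
 have "\<exists>x\<in>X. \<phi> x \<notin> P" if "P \<in> pbasic xyz h" for P using that cover by (auto simp: pbasic_def)
 from finite_subcover[OF form h(1,2) this]
 obtain T where T: "finite T" "T \<subseteq> X" "!!P. P \<in> pbasic xyz h ==> \<exists>x\<in>T. \<phi> x \<notin> P" by auto
 have TX: "x \<in> X" if "x \<in> T" for x using that T(2) by blast
 have "\<exists>k. \<forall>K P. k \<le> K --> P \<in> pbasic xyz (h * \<phi> x * \<phi> y) -->
   to_fract (\<phi> i) ^ K * f i x y \<in> L (n + int (K * \<delta> i)) P" if "i \<in> T" "x \<in> T" "y \<in> T" for i x y
 proof -
  have *: "i \<in> X" "x \<in> X" "y \<in> X" using that TX by auto
  have hx: "h * \<phi> x \<in> forms xyz (m + \<delta> x)" by (rule forms_mult[OF h(1) form[OF *(2)]])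
  show ?thesis
  proof (rule clear_denominator[OF forms_mult[OF hx form[OF *(3)]] _ _ form[OF *(1)] nonzero[OF *(1)]])
   show "0 < m + \<delta> x + \<delta> y" "h * \<phi> x * \<phi> y ~= 0" using h nonzero * by auto
   fix P assume P: "P \<in> pbasic xyz (h * \<phi> x * \<phi> y)" "\<phi> i \<notin> P"
   then have "P \<in> pp" "\<phi> x \<notin> P" "\<phi> y \<notin> P"
    using pbasic_mult[OF hx form[OF *(3)]] pbasic_mult[OF h(1) form[OF *(2)]] by (auto simp: pbasic_def)
   then show "f i x y \<in> L n P" using reg * P(2) by blast
  qed
 qed
 then obtain k1 where k1: "!!i x y K P. i \<in> T ==> x \<in> T ==> y \<in> T ==> k1 i x y \<le> K ==>
   P \<in> pbasic xyz (h * \<phi> x * \<phi> y) ==> to_fract (\<phi> i) ^ K * f i x y \<in> L (n + int (K * \<delta> i)) P"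
  by metis
 define K where "K = (\<Sum>(i, x, y)\<in>T \<times> T \<times> T. k1 i x y)"
 have K: "k1 i x y \<le> K" if "i \<in> T" "x \<in> T" "y \<in> T" for i x y
  using member_le_sum[of "(i, x, y)" "T \<times> T \<times> T" "%(i, x, y). k1 i x y"] that T(1) by (auto simp: K_def)
 obtain M c where c: "h ^ M = (\<Sum>i\<in>T. c i * \<phi> i ^ K)"
  "!!i. i \<in> T ==> c i = 0 \<or> (K * \<delta> i \<le> M * m & c i \<in> forms xyz (M * m - K * \<delta> i))"
  using partition_of_unity[OF form[OF TX] h(1,2) T(1,3), of K] by auto
 \<comment> \<open>The coboundary of the averages \<open>k0\<close> of the \<open>g i x\<close>
   differs from \<open>g x y\<close> by the average of the cocycle values \<open>f i x y\<close>,
   whose poles along the zeros of \<open>\<phi> i\<close> are cleared by the weights.\<close>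
 define k0 where "k0 x = (\<Sum>i\<in>T. to_fract (c i) * (to_fract (\<phi> i) ^ K * g i x)) / to_fract (h ^ M)" for x
 have hM: "to_fract (h ^ M) ~= 0" using h(3) by simp
 have one: "to_fract (h ^ M) = (\<Sum>i\<in>T. to_fract (c i) * to_fract (\<phi> i) ^ K)"
  unfolding c(1) by (simp add: to_fract_sum to_fract_power)
 have k0: "g x y - (k0 y - k0 x) \<in> L n P"
  if xy: "x \<in> T" "y \<in> T" and P: "P \<in> pp" "h \<notin> P" "\<phi> x \<notin> P" "\<phi> y \<notin> P" for x y P
 proof -
  have Ph: "P \<in> pbasic xyz h" using P by (simp add: pbasic_def)
  have hx: "h * \<phi> x \<in> forms xyz (m + \<delta> x)" by (rule forms_mult[OF h(1) form[OF TX[OF xy(1)]]])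
  have Pxy: "P \<in> pbasic xyz (h * \<phi> x * \<phi> y)"
   using P pbasic_mult[OF hx form[OF TX[OF xy(2)]]] pbasic_mult[OF h(1) form[OF TX[OF xy(1)]]] by (auto simp: pbasic_def)
  have "g x y = (\<Sum>i\<in>T. to_fract (c i) * to_fract (\<phi> i) ^ K * g x y) / to_fract (h ^ M)"
   using hM one by (simp add: sum_distrib_right[symmetric])
  then have "g x y - (k0 y - k0 x) = (\<Sum>i\<in>T. to_fract (c i) * to_fract (\<phi> i) ^ K * g x y) / to_fract (h ^ M) - (k0 y - k0 x)"
   by (rule arg_cong2[of _ _ _ _ "(-)", OF _ refl])
  also have "\<dots> = (\<Sum>i\<in>T. to_fract (c i) * (to_fract (\<phi> i) ^ K * (g x y - g i y + g i x))) / to_fract (h ^ M)"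
   unfolding k0_def by (simp add: diff_divide_distrib[symmetric] add_divide_distrib[symmetric]
     sum_subtractf[symmetric] sum.distrib[symmetric] algebra_simps)
  also have "\<dots> \<in> L n P"
  proof (rule weighted_sum_loc[OF Ph h(1) c(2)])
   fix i assume i: "i \<in> T"
   have "g x y - g i y + g i x = f i x y" using g[OF TX[OF i] TX[OF xy(1)] TX[OF xy(2)]] by simp
   then show "to_fract (\<phi> i) ^ K * (g x y - g i y + g i x) \<in> L (n + int (K * \<delta> i)) P"
    using k1[OF i xy K[OF i xy] Pxy] by simp
  qed
  finally show ?thesis .
 qed
 define tp where "tp P = (SOME i. i \<in> T & \<phi> i \<notin> P)" for P
 have tp: "tp P \<in> T" "\<phi> (tp P) \<notin> P" if "P \<in> pp" "h \<notin> P" for P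
  unfolding tp_def using someI_ex[of "%i. i \<in> T & \<phi> i \<notin> P"] T(3)[of P] that by (auto simp: pbasic_def)
 have "\<exists>e. \<forall>P\<in>pbasic xyz (h * \<phi> x). e - (k0 (tp P) + g (tp P) x) \<in> L n P" if x: "x \<in> X" for x
 proof (rule affine_cousin[OF forms_mult[OF h(1) form[OF x]]])
  show "0 < m + \<delta> x" "h * \<phi> x ~= 0" using h nonzero[OF x] by auto
  have D: "P \<in> pp & h \<notin> P & \<phi> x \<notin> P" if "P \<in> pbasic xyz (h * \<phi> x)" for P
   using that pbasic_mult[OF h(1) form[OF x]] by (auto simp: pbasic_def)
  fix P assume P: "P \<in> pbasic xyz (h * \<phi> x)"
  define i where "i = tp P"
  have i: "i \<in> T" "\<phi> i \<notin> P" using tp[of P] D[OF P] by (auto simp: i_def)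
  show "\<exists>U. openin (proj_top xyz) U & P \<in> U &
    (\<forall>Q\<in>U \<inter> pbasic xyz (h * \<phi> x). k0 (tp P) + g (tp P) x - (k0 (tp Q) + g (tp Q) x) \<in> L n Q)"
  proof (intro exI[of _ "pbasic xyz (\<phi> i)"] conjI ballI)
   show "openin (proj_top xyz) (pbasic xyz (\<phi> i))" by (rule open_D[OF TX[OF i(1)]])
   show "P \<in> pbasic xyz (\<phi> i)" using D[OF P] i by (auto simp: pbasic_def)
   fix Q assume "Q \<in> pbasic xyz (\<phi> i) \<inter> pbasic xyz (h * \<phi> x)"
   then have Q: "Q \<in> pp" "h \<notin> Q" "\<phi> x \<notin> Q" "\<phi> i \<notin> Q" using D[of Q] by (auto simp: pbasic_def)
   define j where "j = tp Q"
   have j: "j \<in> T" "\<phi> j \<notin> Q" using tp[OF Q(1,2)] by (auto simp: j_def)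
   have "(g i j - (k0 j - k0 i)) - f i j x \<in> L n Q"
    by (rule loc_diff[OF Q(1) k0[OF i(1) j(1) Q(1,2,4) j(2)] reg[OF TX[OF i(1)] TX[OF j(1)] x Q(1,4) j(2) Q(3)]])
   moreover have "(g i j - (k0 j - k0 i)) - f i j x = k0 i + g i x - (k0 j + g j x)"
    using g[OF TX[OF i(1)] TX[OF j(1)] x] by simp
   ultimately have "k0 i + g i x - (k0 j + g j x) \<in> L n Q" by (simp only:)
   then show "k0 (tp P) + g (tp P) x - (k0 (tp Q) + g (tp Q) x) \<in> L n Q" by (simp only: i_def j_def)
  qed
 qed
 then obtain k where k: "!!x P. x \<in> X ==> P \<in> pbasic xyz (h * \<phi> x) ==> k x - (k0 (tp P) + g (tp P) x) \<in> L n P"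
  by metis
 have "g x y - (k y - k x) \<in> L n P"
  if xy: "x \<in> X" "y \<in> X" and P: "P \<in> pp" "h \<notin> P" "\<phi> x \<notin> P" "\<phi> y \<notin> P" for x y P
 proof -
  have D: "P \<in> pbasic xyz (h * \<phi> z)" if "z \<in> X" "\<phi> z \<notin> P" for z
   using pbasic_mult[OF h(1) form[OF that(1)]] P that by (auto simp: pbasic_def)
  have i: "tp P \<in> T" "\<phi> (tp P) \<notin> P" using tp[OF P(1,2)] by auto
  have "(k x - (k0 (tp P) + g (tp P) x)) - (k y - (k0 (tp P) + g (tp P) y)) + f (tp P) x y \<in> L n P"
   by (rule loc_add[OF P(1) loc_diff[OF P(1) k[OF xy(1) D[OF xy(1) P(3)]] k[OF xy(2) D[OF xy(2) P(4)]]]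
      reg[OF TX[OF i(1)] xy P(1) i(2) P(3,4)]])
  moreover have "(k x - (k0 (tp P) + g (tp P) x)) - (k y - (k0 (tp P) + g (tp P) y)) + f (tp P) x y = g x y - (k y - k x)"
   using g[OF TX[OF i(1)] xy] by simp
  ultimately show ?thesis by (simp only:)
 qed
 then show ?thesis by blast
qed

text \<open>On each standard chart \<open>l\<close> a family \<open>k l\<close> makes the bounding
  constants \<open>g\<close> regular. On the overlap of two charts \<open>k l - k m\<close> does not
  depend on the index modulo O(n) and yields a constant \<open>h l m\<close>; the alternating sum of
  these is a section of O(n) on the triple overlap. \<open>laurent_H2\<close>, the source of the
  bound on \<open>n\<close>, splits it, and then the corrections on the charts can be
  matched.\<close>

theorem cech_H2:
 fixes f :: "'x => 'x => 'x => 'k xpoly fract"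
 assumes n: "- 2 \<le> n"
  and coc: "!!x y z w. x \<in> X ==> y \<in> X ==> z \<in> X ==> w \<in> X ==> f y z w - f x z w + f x y w - f x y z = 0"
  and reg: "!!x y z P. x \<in> X ==> y \<in> X ==> z \<in> X ==> P \<in> pp ==> \<phi> x \<notin> P ==> \<phi> y \<notin> P ==> \<phi> z \<notin> P ==> f x y z \<in> L n P"
 shows "\<exists>k. (\<forall>x\<in>X. \<forall>y\<in>X. \<forall>P\<in>pp. \<phi> x \<notin> P --> \<phi> y \<notin> P --> k x y \<in> L n P) &
  (\<forall>x\<in>X. \<forall>y\<in>X. \<forall>z\<in>X. f x y z = k y z - k x z + k x y)"
proof (cases "X = {}")
 case False
 then obtain t where t: "t \<in> X" by blast
 define g where "g x y = f t x y" for x y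
 have g: "f x y z = g y z - g x z + g x y" if "x \<in> X" "y \<in> X" "z \<in> X" for x y z
  using coc[OF t that] by (simp add: g_def algebra_simps)
 have "\<exists>k. \<forall>x\<in>X. \<forall>y\<in>X. \<forall>P\<in>pp. mvar l \<notin> P --> \<phi> x \<notin> P --> \<phi> y \<notin> P --> g x y - (k y - k x) \<in> L n P"
  if "l \<in> {0, 1, 2}" for l
  by (rule affine_H2[OF forms_mvar _ _ g reg]) (use that in auto)
 then obtain k where k: "!!l x y P. l \<in> {0, 1, 2} ==> x \<in> X ==> y \<in> X ==> P \<in> pp ==> mvar l \<notin> P ==> \<phi> x \<notin> P ==> \<phi> y \<notin> P ==>
   g x y - (k l y - k l x) \<in> L n P" by metis
 have "\<exists>e. \<forall>P\<in>pbasic xyz (mvar l * mvar m). e - (k l (pick P) - k m (pick P)) \<in> L n P"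
  if lm: "l \<in> {0, 1, 2}" "m \<in> {0, 1, 2}" for l m
 proof (rule affine_cousin)
  have v: "(mvar l :: 'k xpoly) \<in> forms xyz 1" "(mvar m :: 'k xpoly) \<in> forms xyz 1"
   by (rule forms_mvar; use lm in auto)+
  show "(mvar l * mvar m :: 'k xpoly) \<in> forms xyz (1 + 1)" by (rule forms_mult[OF v])
  have D: "P \<in> pp & mvar l \<notin> P & mvar m \<notin> P" if "P \<in> pbasic xyz (mvar l * mvar m)" for P :: "'k xpoly set"
   using that pbasic_mult[OF v] by (auto simp: pbasic_def)
  fix P :: "'k xpoly set" assume P: "P \<in> pbasic xyz (mvar l * mvar m)"
  have x: "pick P \<in> X" "\<phi> (pick P) \<notin> P" using pick D[OF P] by auto
  show "\<exists>U. openin (proj_top xyz) U & P \<in> U & (\<forall>Q\<in>U \<inter> pbasic xyz (mvar l * mvar m).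
    k l (pick P) - k m (pick P) - (k l (pick Q) - k m (pick Q)) \<in> L n Q)"
  proof (intro exI[of _ "pbasic xyz (\<phi> (pick P))"] conjI ballI)
   show "openin (proj_top xyz) (pbasic xyz (\<phi> (pick P)))" by (rule open_D[OF x(1)])
   show "P \<in> pbasic xyz (\<phi> (pick P))" using D[OF P] x by (auto simp: pbasic_def)
   fix Q assume "Q \<in> pbasic xyz (\<phi> (pick P)) \<inter> pbasic xyz (mvar l * mvar m)"
   then have Q: "Q \<in> pp" "mvar l \<notin> Q" "mvar m \<notin> Q" "\<phi> (pick P) \<notin> Q" using D[of Q] by (auto simp: pbasic_def)
   have y: "pick Q \<in> X" "\<phi> (pick Q) \<notin> Q" using pick Q(1) by auto
   have "(g (pick P) (pick Q) - (k l (pick Q) - k l (pick P))) - (g (pick P) (pick Q) - (k m (pick Q) - k m (pick P))) \<in> L n Q"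
    by (rule loc_diff[OF Q(1) k[OF lm(1) x(1) y(1) Q(1,2,4) y(2)] k[OF lm(2) x(1) y(1) Q(1,3,4) y(2)]])
   then show "k l (pick P) - k m (pick P) - (k l (pick Q) - k m (pick Q)) \<in> L n Q"
    by (simp add: algebra_simps)
  qed
 qed auto
 then obtain h where h0: "!!l m P. l \<in> {0, 1, 2} ==> m \<in> {0, 1, 2} ==> P \<in> pbasic xyz (mvar l * mvar m) ==>
   h l m - (k l (pick P) - k m (pick P)) \<in> L n P" by metis
 have h: "h l m - (k l x - k m x) \<in> L n P"
  if lm: "l \<in> {0, 1, 2}" "m \<in> {0, 1, 2}" and P: "P \<in> pp" "mvar l \<notin> P" "mvar m \<notin> P" and x: "x \<in> X" "\<phi> x \<notin> P" for l m P x
 proof -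
  have v: "(mvar l :: 'k xpoly) \<in> forms xyz 1" "(mvar m :: 'k xpoly) \<in> forms xyz 1"
   by (rule forms_mvar; use lm in auto)+
  have D: "P \<in> pbasic xyz (mvar l * mvar m)" using P pbasic_mult[OF v] by (auto simp: pbasic_def)
  have y: "pick P \<in> X" "\<phi> (pick P) \<notin> P" using pick P(1) by auto
  have "h l m - (k l (pick P) - k m (pick P)) + ((g (pick P) x - (k l x - k l (pick P))) - (g (pick P) x - (k m x - k m (pick P)))) \<in> L n P"
   by (rule loc_add[OF P(1) h0[OF lm D] loc_diff[OF P(1) k[OF lm(1) y(1) x(1) P(1,2) y(2) x(2)] k[OF lm(2) y(1) x(1) P(1,3) y(2) x(2)]]])
  then show ?thesis by (simp add: algebra_simps)
 qed
 have "h 0 1 - h 0 2 + h 1 2 \<in> On xyz n {0, 1, 2}" unfolding On_def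
 proof (intro CollectI ballI impI)
  fix P :: "'k xpoly set" assume P: "P \<in> pp" "\<forall>i\<in>{0, 1, 2}. mvar i \<notin> P"
  have y: "pick P \<in> X" "\<phi> (pick P) \<notin> P" using pick P(1) by auto
  have "(h 0 1 - (k 0 (pick P) - k 1 (pick P))) - (h 0 2 - (k 0 (pick P) - k 2 (pick P))) + (h 1 2 - (k 1 (pick P) - k 2 (pick P))) \<in> L n P"
   by (intro loc_add[OF P(1)] loc_diff[OF P(1)] h y P(1)) (use P in auto)
  then show "h 0 1 - h 0 2 + h 1 2 \<in> L n P" by (simp add: algebra_simps)
 qed
 from laurent_H2[OF n this] obtain a b c where abc: "h 0 1 - h 0 2 + h 1 2 = a + b + c"
  "a \<in> On xyz n {0, 1}" "b \<in> On xyz n {0, 2}" "c \<in> On xyz n {1, 2}" by blast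
 \<comment> \<open>The values \<open>h 0 1 - a\<close>, \<open>h 0 2 + b\<close> and
   \<open>h 1 2 - c\<close> satisfy the cocycle relation exactly, so they are the differences of
   constants \<open>\<eta> l\<close>, normalised by \<open>\<eta> 0 = 0\<close>.\<close>
 define \<eta> where "\<eta> l = (if l = 0 then 0 else if l = 1 then a - h 0 1 else - b - h 0 2)" for l :: nat
 have \<eta>: "(k l x - \<eta> l) - (k m x - \<eta> m) \<in> L n P" if lm: "l \<in> {0, 1, 2}" "m \<in> {0, 1, 2}" "l < m"
  and P: "P \<in> pp" "mvar l \<notin> P" "mvar m \<notin> P" and x: "x \<in> X" "\<phi> x \<notin> P" for l m P x
 proof -
  have "\<eta> l - \<eta> m - h l m \<in> On xyz n {l, m}"
  proof -
   consider "l = 0" "m = 1" | "l = 0" "m = 2" | "l = 1" "m = 2" using lm by fastforce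
   then show ?thesis
   proof cases
    case 1 then show ?thesis using On_uminus[OF abc(2)] by (simp add: \<eta>_def)
   next
    case 2 then show ?thesis using abc(3) by (simp add: \<eta>_def)
   next
    case 3
    have "a - h 0 1 - (- b - h 0 2) - h 1 2 = - c" using abc(1) by (simp add: algebra_simps)
    then show ?thesis using 3 On_uminus[OF abc(4)] by (simp add: \<eta>_def)
   qed
  qed
  then have "\<eta> l - \<eta> m - h l m \<in> L n P" using P by (auto simp: On_def)
  then have "- ((\<eta> l - \<eta> m - h l m) + (h l m - (k l x - k m x))) \<in> L n P"
   by (intro loc_uminus loc_add[OF P(1)] h lm P x)
  then show ?thesis by (simp add: algebra_simps)
 qed
 have \<eta>': "(k l x - \<eta> l) - (k m x - \<eta> m) \<in> L n P" if lm: "l \<in> {0, 1, 2}" "m \<in> {0, 1, 2}"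
  and P: "P \<in> pp" "mvar l \<notin> P" "mvar m \<notin> P" and x: "x \<in> X" "\<phi> x \<notin> P" for l m P x
 proof -
  consider "l < m" | "l = m" | "m < l" by linarith
  then show ?thesis
  proof cases
   case 3
   have "- ((k m x - \<eta> m) - (k l x - \<eta> l)) \<in> L n P" by (intro loc_uminus \<eta> lm P x 3)
   then show ?thesis by simp
  qed (use \<eta>[OF lm _ P x] loc_0[OF P(1)] in auto)
 qed
 \<comment> \<open>Each index uses the correction of a chart that contains its open set; on an
   overlap the corrections of two charts differ by a regular function, by the preceding
   fact.\<close>
 define \<kappa> where "\<kappa> x = k (\<iota> x) x - \<eta> (\<iota> x)" for x
 define k' where "k' x y = g x y - (\<kappa> y - \<kappa> x)" for x y
 have "k' x y \<in> L n P" if xy: "x \<in> X" "y \<in> X" and P: "P \<in> pp" "\<phi> x \<notin> P" "\<phi> y \<notin> P" for x y P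
 proof -
  note ix = chart(1)[OF xy(1)] chart(2)[OF xy(1) P(1,2)] and iy = chart(1)[OF xy(2)] chart(2)[OF xy(2) P(1,3)]
  have "(g x y - (k (\<iota> x) y - k (\<iota> x) x)) + ((k (\<iota> x) y - \<eta> (\<iota> x)) - (k (\<iota> y) y - \<eta> (\<iota> y))) \<in> L n P"
   by (rule loc_add[OF P(1) k[OF ix(1) xy P(1) ix(2) P(2,3)] \<eta>'[OF ix(1) iy(1) P(1) ix(2) iy(2) xy(2) P(3)]])
  then show ?thesis by (simp add: k'_def \<kappa>_def algebra_simps)
 qed
 moreover have "f x y z = k' y z - k' x z + k' x y" if "x \<in> X" "y \<in> X" "z \<in> X" for x y z
  using g[OF that] by (simp add: k'_def)
 ultimately show ?thesis by blast
qed simp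

end

section \<open>The determinantal complex\<close>

text \<open>For a matrix \<open>al\<close> with \<open>e + 2\<close> rows and \<open>e\<close> columns, \<open>Q u w\<close> is the determinant of \<open>(u | w | al)\<close>. Its
  matrix \<open>Q (unit a) (unit b)\<close> is skew with the signed maximal minors of \<open>al\<close> as entries. The resulting
  maps \<open>al\<close>, \<open>w \<mapsto> (Q (unit l) w)\<^sub>l\<close> and the transpose of \<open>al\<close> form a complex that becomes exact as soon as
  one of the minors is inverted.\<close>

declare add_2_eq_Suc' [simp del] add_2_eq_Suc [simp del] One_nat_def [simp del]

definition unit :: "nat => nat => 'a::zero_neq_one" where
 "unit l = (%i. if i = l then 1 else 0)"

definition QM :: "nat => (nat => nat => 'a::comm_ring_1) => (nat => 'a) => (nat => 'a) => 'a mat" where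
 "QM e al u w = mat (e + 2) (e + 2) (%(i, j). if j = 0 then u i else if j = 1 then w i else al i (j - 2))"

definition Q :: "nat => (nat => nat => 'a::comm_ring_1) => (nat => 'a) => (nat => 'a) => 'a" where
 "Q e al u w = det (QM e al u w)"

lemma QM_carrier: "QM e al u w \<in> carrier_mat (e + 2) (e + 2)"
 by (simp add: QM_def)

lemma sum_split2: "(\<Sum>k<e + 2. f k) = f 0 + f 1 + (\<Sum>k<e. f (k + 2))" for f :: "nat => 'a::comm_monoid_add"
 unfolding add_2_eq_Suc' sum.lessThan_Suc_shift by (simp add: add.assoc One_nat_def)

lemma cofactor_QM0: "i < e + 2 ==> cofactor (QM e al u w) i 0 = cofactor (QM e al u' w) i 0"
 unfolding cofactor_def
 by (rule arg_cong[of _ _ "%M. _ * det M"]) (auto simp: mat_delete_def QM_def intro!: eq_matI)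

lemma cofactor_QM1: "i < e + 2 ==> cofactor (QM e al u w) i 1 = cofactor (QM e al u w') i 1"
 unfolding cofactor_def
 by (rule arg_cong[of _ _ "%M. _ * det M"]) (auto simp: mat_delete_def QM_def intro!: eq_matI)

lemma Q_cofactor0: "Q e al u w = (\<Sum>i<e + 2. u i * cofactor (QM e al u' w) i 0)"
proof -
 have "Q e al u w = (\<Sum>i<e + 2. QM e al u w $$ (i, 0) * cofactor (QM e al u w) i 0)"
  unfolding Q_def by (rule laplace_expansion_column[OF QM_carrier]) simp
 also have "\<dots> = (\<Sum>i<e + 2. u i * cofactor (QM e al u' w) i 0)"
  by (intro sum.cong refl) (simp add: cofactor_QM0[of _ e al u w u'], simp add: QM_def)
 finally show ?thesis .
qed

lemma Q_cofactor1: "Q e al u w = (\<Sum>i<e + 2. w i * cofactor (QM e al u w') i 1)"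
proof -
 have "Q e al u w = (\<Sum>i<e + 2. QM e al u w $$ (i, 1) * cofactor (QM e al u w) i 1)"
  unfolding Q_def by (rule laplace_expansion_column[OF QM_carrier]) simp
 also have "\<dots> = (\<Sum>i<e + 2. w i * cofactor (QM e al u w') i 1)"
  by (intro sum.cong refl) (simp add: cofactor_QM1[of _ e al u w w'], simp add: QM_def)
 finally show ?thesis .
qed

lemma sum_unit: "(\<Sum>i<n. unit l i * f i) = (if l < n then f l else 0)" for f :: "nat => 'a::comm_ring_1"
proof -
 have "(\<Sum>i<n. unit l i * f i) = (\<Sum>i<n. if i = l then f i else 0)"
  by (intro sum.cong) (auto simp: unit_def)
 then show ?thesis by simp
qed

lemma Q_expand1: "Q e al u w = (\<Sum>i<e + 2. u i * Q e al (unit i) w)"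
proof -
 have "Q e al (unit i) w = cofactor (QM e al u w) i 0" if "i < e + 2" for i
  unfolding Q_cofactor0[of e al "unit i" w u] sum_unit using that by simp
 then show ?thesis unfolding Q_cofactor0[of e al u w u] by simp
qed

lemma Q_expand2: "Q e al u w = (\<Sum>i<e + 2. w i * Q e al u (unit i))"
proof -
 have "Q e al u (unit i) = cofactor (QM e al u w) i 1" if "i < e + 2" for i
  unfolding Q_cofactor1[of e al u "unit i" w] sum_unit using that by simp
 then show ?thesis unfolding Q_cofactor1[of e al u w w] by simp
qed

lemma Q_identical_cols:
 assumes "i ~= j" "i < e + 2" "j < e + 2" "!!r. r < e + 2 ==> QM e al u w $$ (r, i) = QM e al u w $$ (r, j)"
 shows "Q e al u w = 0"
proof -
 let ?T = "transpose_mat (QM e al u w)"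
 have "row ?T i = row ?T j" using assms by (intro eq_vecI) (auto simp: QM_def)
 moreover have "?T \<in> carrier_mat (e + 2) (e + 2)" using QM_carrier[of e al u w] by simp
 ultimately have "det ?T = 0" using det_identical_rows[of ?T "e + 2" i j] assms(1-3) by simp
 then show ?thesis unfolding Q_def using det_transpose[OF QM_carrier[of e al u w]] by simp
qed

lemma Q_same: "Q e al u u = 0"
 by (rule Q_identical_cols[of 0 1]) (auto simp: QM_def)

lemma Q_column1: "k < e ==> Q e al (%i. al i k) w = 0"
 by (rule Q_identical_cols[of 0 "k + 2"]) (auto simp: QM_def)

lemma Q_column2: "k < e ==> Q e al u (%i. al i k) = 0"
 by (rule Q_identical_cols[of 1 "k + 2"]) (auto simp: QM_def)

lemma Q_add1: "Q e al (%i. u i + u' i) w = Q e al u w + Q e al u' w"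
 using Q_cofactor0[of e al u w u] Q_cofactor0[of e al u' w u] Q_cofactor0[of e al "%i. u i + u' i" w u]
 by (simp add: sum.distrib[symmetric] distrib_right)

lemma Q_add2: "Q e al u (%i. w i + w' i) = Q e al u w + Q e al u w'"
 using Q_cofactor1[of e al u w w] Q_cofactor1[of e al u w' w] Q_cofactor1[of e al u "%i. w i + w' i" w]
 by (simp add: sum.distrib[symmetric] distrib_right)

lemma Q_scale2: "Q e al u (%i. c * w i) = c * Q e al u w"
 using Q_cofactor1[of e al u w w] Q_cofactor1[of e al u "%i. c * w i" w]
 by (simp add: sum_distrib_left mult.assoc)

lemma Q_diff2: "Q e al u (%i. w i - w' i) = Q e al u w - Q e al u w'"
 using Q_cofactor1[of e al u w w] Q_cofactor1[of e al u w' w] Q_cofactor1[of e al u "%i. w i - w' i" w]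
 by (simp add: sum_subtractf[symmetric] left_diff_distrib)

lemma Q_antisym: "Q e al u w = - Q e al w u"
proof -
 have "0 = Q e al (%i. u i + w i) (%i. u i + w i)" by (simp add: Q_same)
 also have "\<dots> = Q e al u w + Q e al w u" by (simp add: Q_add1 Q_add2 Q_same)
 finally show ?thesis by (simp add: eq_neg_iff_add_eq_0)
qed

lemma Q_sum2: "Q e al u (%i. \<Sum>k\<in>K. w k i) = (\<Sum>k\<in>K. Q e al u (w k))"
proof (induction K rule: infinite_finite_induct)
 case (insert x F) then show ?case by (simp add: Q_add2)
qed (use Q_scale2[of e al u 0] in auto)

lemma Q_image: "Q e al u (%i. \<Sum>k<e. al i k * c k) = 0"
proof -
 have "Q e al u (%i. \<Sum>k<e. al i k * c k) = Q e al u (%i. \<Sum>k<e. c k * al i k)" by (simp add: mult.commute)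
 also have "\<dots> = (\<Sum>k<e. c k * Q e al u (%i. al i k))" by (simp only: Q_sum2 Q_scale2)
 also have "\<dots> = 0" by (simp add: Q_column2)
 finally show ?thesis .
qed

lemma transpose_Q: "k < e ==> (\<Sum>l<e + 2. al l k * Q e al (unit l) w) = 0"
 using Q_expand1[of e al "%i. al i k" w] Q_column1[of k e al w] by simp

text \<open>The entries of the adjugate of (unit a | unit b | al).\<close>

definition QN :: "nat => (nat => nat => 'a::comm_ring_1) => nat => nat => nat => nat => 'a" where
 "QN e al a b i j = cofactor (QM e al (unit a) (unit b)) j i"

lemma QN_left:
 assumes "i < e + 2" "k < e + 2"
 shows "(\<Sum>j<e + 2. QN e al a b i j * QM e al (unit a) (unit b) $$ (j, k)) = (if i = k then Q e al (unit a) (unit b) else 0)"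
proof -
 let ?M = "QM e al (unit a) (unit b)"
 have "(adj_mat ?M * ?M) $$ (i, k) = (\<Sum>j<e + 2. QN e al a b i j * ?M $$ (j, k))"
  using assms QM_carrier[of e al "unit a" "unit b"]
  by (auto simp: adj_mat_def scalar_prod_def QN_def lessThan_atLeast0 intro!: sum.cong)
 then show ?thesis using adj_mat(3)[OF QM_carrier[of e al "unit a" "unit b"]] assms by (auto simp: Q_def)
qed

lemma QN_right:
 assumes "i < e + 2" "j < e + 2"
 shows "(\<Sum>k<e + 2. QM e al (unit a) (unit b) $$ (i, k) * QN e al a b k j) = (if i = j then Q e al (unit a) (unit b) else 0)"
proof -
 let ?M = "QM e al (unit a) (unit b)"
 have "(?M * adj_mat ?M) $$ (i, j) = (\<Sum>k<e + 2. ?M $$ (i, k) * QN e al a b k j)"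
  using assms QM_carrier[of e al "unit a" "unit b"]
  by (auto simp: adj_mat_def scalar_prod_def QN_def lessThan_atLeast0 intro!: sum.cong)
 then show ?thesis using adj_mat(2)[OF QM_carrier[of e al "unit a" "unit b"]] assms by (auto simp: Q_def)
qed

text \<open>The last e rows of the adjugate, applied to the columns of \<open>al\<close>, give the
  minor times the identity matrix: a left inverse of \<open>al\<close> up to that factor.\<close>

lemma QN_recover:
 assumes "k < e"
 shows "(\<Sum>j<e + 2. QN e al a b (k + 2) j * (\<Sum>k'<e. al j k' * c k')) = Q e al (unit a) (unit b) * c k"
proof -
 have al: "al j k' = QM e al (unit a) (unit b) $$ (j, k' + 2)" if "j < e + 2" "k' < e" for j k'
  using that by (simp add: QM_def)
 have "(\<Sum>j<e + 2. QN e al a b (k + 2) j * (\<Sum>k'<e. al j k' * c k')) =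
   (\<Sum>j<e + 2. \<Sum>k'<e. QN e al a b (k + 2) j * QM e al (unit a) (unit b) $$ (j, k' + 2) * c k')"
  unfolding sum_distrib_left by (intro sum.cong refl) (simp add: al mult.assoc)
 also have "\<dots> = (\<Sum>k'<e. (\<Sum>j<e + 2. QN e al a b (k + 2) j * QM e al (unit a) (unit b) $$ (j, k' + 2)) * c k')"
  by (subst sum.swap) (simp only: sum_distrib_right)
 also have "\<dots> = (\<Sum>k'<e. if k' = k then Q e al (unit a) (unit b) * c k else 0)"
  using assms by (intro sum.cong refl) (simp add: QN_left)
 finally show ?thesis using assms by simp
qed

text \<open>The difference \<open>y\<close> of the two sides, as a row vector, kills every column of
  (unit a | unit b | al): the first two because \<open>y a\<close> and \<open>y b\<close> vanish,
  the others because both sides are orthogonal to the columns of \<open>al\<close>. The determinant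
  is nonzero, so \<open>y\<close> is zero.\<close>

lemma Q_exact_middle:
 fixes z :: "nat => 'a::idom"
 assumes z: "!!k. k < e ==> (\<Sum>l<e + 2. al l k * z l) = 0" and ab: "a < e + 2" "b < e + 2"
  and q: "Q e al (unit a) (unit b) ~= 0" and l: "l < e + 2"
 shows "Q e al (unit l) (%i. z a * unit b i - z b * unit a i) = Q e al (unit a) (unit b) * z l"
proof -
 let ?q = "Q e al (unit a) (unit b)" and ?M = "QM e al (unit a) (unit b)"
 let ?w = "%i. z a * unit b i - z b * unit a i"
 define y where "y l = Q e al (unit l) ?w - ?q * z l" for l
 have Qw: "Q e al (unit l) ?w = z a * Q e al (unit l) (unit b) - z b * Q e al (unit l) (unit a)" for l
  by (simp add: Q_diff2 Q_scale2)
 have ya: "y a = 0" by (simp add: y_def Qw Q_same)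
 have yb: "y b = 0" using Q_antisym[of e al "unit b" "unit a"] by (simp add: y_def Qw Q_same)
 have col: "(\<Sum>i<e + 2. y i * ?M $$ (i, k)) = 0" if k: "k < e + 2" for k
 proof -
  consider "k = 0" | "k = 1" | k' where "k = k' + 2" "k' < e"
  proof -
   have "k = 0 \<or> k = 1 \<or> (k = (k - 2) + 2 & k - 2 < e)" using k by arith
   then show thesis using that by blast
  qed
  then show ?thesis
  proof cases
   case 1
   have "(\<Sum>i<e + 2. y i * ?M $$ (i, k)) = (\<Sum>i<e + 2. unit a i * y i)"
    by (intro sum.cong refl) (simp add: 1 QM_def)
   then show ?thesis using ya ab by (simp only: sum_unit) simp
  next
   case 2
   have "(\<Sum>i<e + 2. y i * ?M $$ (i, k)) = (\<Sum>i<e + 2. unit b i * y i)"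
    by (intro sum.cong refl) (simp add: 2 QM_def)
   then show ?thesis using yb ab by (simp only: sum_unit) simp
  next
   case 3
   have "(\<Sum>i<e + 2. y i * ?M $$ (i, k)) = (\<Sum>i<e + 2. al i k' * Q e al (unit i) ?w) - ?q * (\<Sum>i<e + 2. al i k' * z i)"
    unfolding sum_distrib_left sum_subtractf[symmetric]
    by (intro sum.cong refl) (use 3 in \<open>simp add: QM_def y_def algebra_simps\<close>)
   then show ?thesis using z[OF 3(2)] transpose_Q[OF 3(2)] by simp
  qed
 qed
 have "?q * y l = (\<Sum>i<e + 2. y i * (if i = l then ?q else 0))"
  using l by (simp add: if_distrib[of "%x. y _ * x"] cong: if_cong)
 also have "\<dots> = (\<Sum>i<e + 2. y i * (\<Sum>k<e + 2. ?M $$ (i, k) * QN e al a b k l))"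
  using l by (intro sum.cong refl) (simp add: QN_right)
 also have "\<dots> = (\<Sum>i<e + 2. \<Sum>k<e + 2. y i * ?M $$ (i, k) * QN e al a b k l)"
  by (simp only: sum_distrib_left mult.assoc)
 also have "\<dots> = (\<Sum>k<e + 2. (\<Sum>i<e + 2. y i * ?M $$ (i, k)) * QN e al a b k l)"
  by (subst sum.swap) (simp only: sum_distrib_right)
 also have "\<dots> = 0" by (rule sum.neutral) (simp add: col)
 finally have "y l = 0" using q by simp
 then show ?thesis by (simp add: y_def)
qed

text \<open>Cramer's rule for the matrix (unit a | unit b | al) and right-hand side
  \<open>w\<close>. The first two unknowns, multiplied by the determinant, are
  \<open>Q e al w (unit b)\<close> and \<open>Q e al (unit a) w\<close> and vanish; what remains
  expresses \<open>w\<close> by the columns of \<open>al\<close>.\<close>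

lemma Q_exact_left:
 fixes w :: "nat => 'a::comm_ring_1"
 assumes w: "!!l. l < e + 2 ==> Q e al (unit l) w = 0" and ab: "a < e + 2" "b < e + 2" and i: "i < e + 2"
 shows "Q e al (unit a) (unit b) * w i = (\<Sum>k<e. al i k * (\<Sum>j<e + 2. QN e al a b (k + 2) j * w j))"
proof -
 let ?M = "QM e al (unit a) (unit b)"
 define x where "x k = (\<Sum>j<e + 2. QN e al a b k j * w j)" for k
 have "x 0 = (\<Sum>j<e + 2. w j * cofactor ?M j 0)" by (simp add: x_def QN_def mult.commute)
 also have "\<dots> = Q e al w (unit b)" by (rule Q_cofactor0[symmetric])
 also have "\<dots> = 0" using Q_antisym[of e al w "unit b"] w[OF ab(2)] by simp
 finally have x0: "x 0 = 0" .
 have "x 1 = (\<Sum>j<e + 2. w j * cofactor ?M j 1)" by (simp add: x_def QN_def mult.commute)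
 also have "\<dots> = Q e al (unit a) w" by (rule Q_cofactor1[symmetric])
 also have "\<dots> = 0" using w[OF ab(1)] by simp
 finally have x1: "x 1 = 0" .
 have "Q e al (unit a) (unit b) * w i = (\<Sum>j<e + 2. (if i = j then Q e al (unit a) (unit b) else 0) * w j)"
  using i by (simp add: if_distrib[of "%x. x * w _"] cong: if_cong)
 also have "\<dots> = (\<Sum>j<e + 2. (\<Sum>k<e + 2. ?M $$ (i, k) * QN e al a b k j) * w j)"
  using i by (intro sum.cong refl) (simp add: QN_right)
 also have "\<dots> = (\<Sum>k<e + 2. ?M $$ (i, k) * x k)"
  unfolding x_def sum_distrib_left sum_distrib_right mult.assoc by (rule sum.swap)
 also have "\<dots> = (\<Sum>k<e. al i k * x (k + 2))"
  unfolding sum_split2 x0 x1 using i by (simp add: QM_def)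
 finally show ?thesis by (simp add: x_def)
qed

section \<open>Degrees of the determinants, comparison with the maximal minors\<close>

lemma det_forms:
 fixes A :: "('i, 'k::field) mpoly mat"
 assumes A: "A \<in> carrier_mat n n" and f: "!!i j. i < n ==> j < n ==> A $$ (i, j) \<in> forms I (\<delta> j)"
 shows "det A \<in> forms I (\<Sum>j<n. \<delta> j)"
 unfolding det_def'[OF A]
proof (rule forms_sum)
 fix p assume "p \<in> {p. p permutes {0..<n}}"
 then have p: "p permutes {0..<n}" by simp
 have "(\<Prod>i = 0..<n. A $$ (i, p i)) \<in> forms I (\<Sum>i = 0..<n. \<delta> (p i))"
  by (rule forms_prod) (use f permutes_in_image[OF p] in auto)
 also have "(\<Sum>i = 0..<n. \<delta> (p i)) = (\<Sum>j<n. \<delta> j)"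
  using sum.permute[OF p, of \<delta>] by (simp add: o_def lessThan_atLeast0)
 finally have "(\<Prod>i = 0..<n. A $$ (i, p i)) \<in> forms I (\<Sum>j<n. \<delta> j)" .
 then show "signof p * (\<Prod>i = 0..<n. A $$ (i, p i)) \<in> forms I (\<Sum>j<n. \<delta> j)"
  by (auto simp: sign_def forms_uminus)
qed

lemma unit_forms: "unit a i \<in> forms I 0"
 by (simp add: unit_def)

lemma Q_forms:
 assumes "!!i j. i < e + 2 ==> j < e ==> al i j \<in> forms I 1"
 shows "Q e al (unit a) (unit b) \<in> forms I e"
proof -
 have "det (QM e al (unit a) (unit b)) \<in> forms I (\<Sum>j<e + 2. if j < 2 then 0 else 1)"
  by (rule det_forms[OF QM_carrier]) (use assms unit_forms in \<open>auto simp: QM_def\<close>)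
 moreover have "(\<Sum>j<e + 2. if j < 2 then 0 else 1) = e" by (simp only: sum_split2) simp
 ultimately show ?thesis by (simp add: Q_def)
qed

text \<open>Deleting one of the columns of \<open>al\<close> leaves the two constant columns and e -
  1 linear ones.\<close>

lemma QN_forms:
 assumes al: "!!i j. i < e + 2 ==> j < e ==> al i j \<in> forms I 1" and k: "k < e" and j: "j < e + 2"
 shows "QN e al a b (k + 2) j \<in> forms I (e - 1)"
proof -
 let ?M = "mat_delete (QM e al (unit a) (unit b)) j (k + 2)"
 have "e + 2 - 1 = e + 1" by arith
 then have M: "?M \<in> carrier_mat (e + 1) (e + 1)"
  using mat_delete_carrier[OF QM_carrier[of e al "unit a" "unit b"], of j "k + 2"] by (simp only:)
 have "det ?M \<in> forms I (\<Sum>j<e + 1. if j < 2 then 0 else 1)"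
  by (rule det_forms[OF M]) (use al k j unit_forms in \<open>auto simp: QM_def mat_delete_def\<close>)
 moreover obtain e' where e': "e = Suc e'" using k by (cases e) auto
 have "(\<Sum>j<e + 1. if j < 2 then 0 else 1) = e - 1"
 proof -
  have "e + 1 = e' + 2" using e' by arith
  then show ?thesis by (simp only: sum_split2) (simp add: e')
 qed
 ultimately have "det ?M \<in> forms I (e - 1)" by simp
 then show ?thesis
  using forms_mult_const[of "det ?M" I "e - 1" "(-1) ^ (j + (k + 2))"]
  by (cases "even (j + (k + 2))") (auto simp: QN_def cofactor_def forms_uminus)
qed

text \<open>Expanding \<open>(unit a | unit b | al)\<close> along its first two columns leaves the minor of \<open>al\<close> without the rows
  \<open>a\<close> and \<open>b\<close>.\<close>

lemma maximal_minor_Q: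
 fixes A :: "'a::comm_ring_1 mat"
 assumes A: "A \<in> carrier_mat (e + 2) e" and R: "R \<subseteq> {..<e + 2}" "card R = e"
 shows "\<exists>a b. a < b & b < e + 2 & (det (submatrix A R UNIV) = Q e (%i j. A $$ (i, j)) (unit a) (unit b) \<or>
  det (submatrix A R UNIV) = - Q e (%i j. A $$ (i, j)) (unit a) (unit b))"
proof -
 have "card ({..<e + 2} - R) = 2" using R by (simp add: card_Diff_subset finite_subset)
 then obtain x y where xy: "{..<e + 2} - R = {x, y}" "x ~= y" by (auto simp: card_2_iff)
 define a where "a = min x y"
 define b where "b = max x y"
 have "a < b" "{a, b} = {x, y}" using xy(2) by (auto simp: a_def b_def min_def max_def)
 then have ab: "a < b" "{..<e + 2} - R = {a, b}" using xy(1) by simp_all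
 have b: "b < e + 2" using ab(2) by blast
 have R': "R = {..<e + 2} - {a, b}" using ab(2) R(1) by blast
 \<comment> \<open>The increasing enumeration of the rows other than \<open>a\<close> and
   \<open>b\<close>; once row \<open>a\<close> is deleted, row \<open>b\<close> has become row
   \<open>b - 1\<close>.\<close>
 define v where "v i = insert_index a (insert_index (b - 1) i)" for i
 have pick: "pick R i = v i" if i: "i < e" for i
 proof -
  have vR: "v i \<in> R" unfolding R' v_def insert_index_def using i ab(1) b by auto
  have lt: "{r \<in> R. r < v i} = {..<v i} - {a, b}"
   using vR unfolding R' by auto
  have "card ({..<v i} - {a, b}) = i"
  proof -
   consider "i < a" | "a \<le> i" "i < b - 1" | "b - 1 \<le> i" by linarith
   then show ?thesis
   proof cases
    case 1
    then have "{..<v i} - {a, b} = {..<i}" using ab(1) by (auto simp: v_def insert_index_def)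
    then show ?thesis by simp
   next
    case 2
    then have "{..<v i} - {a, b} = {..<Suc i} - {a}" using ab(1) by (auto simp: v_def insert_index_def)
    then show ?thesis using 2 by simp
   next
    case 3
    then have "{..<v i} - {a, b} = {..<Suc (Suc i)} - {a, b}" using ab(1) by (auto simp: v_def insert_index_def)
    then show ?thesis using 3 ab(1) by (simp add: card_Diff_subset)
   qed
  qed
  then show ?thesis using pick_card_in_set[OF vR] unfolding lt by simp
 qed
 let ?al = "%i j. A $$ (i, j)"
 let ?M = "QM e ?al (unit a) (unit b)"
 let ?M1 = "mat_delete ?M a 0"
 let ?M2 = "mat_delete ?M1 (b - 1) 0"
 have M1: "?M1 \<in> carrier_mat (Suc e) (Suc e)" by (simp add: mat_delete_def QM_def)
 have "Q e ?al (unit a) (unit b) = (\<Sum>i<e + 2. unit a i * cofactor ?M i 0)" by (rule Q_cofactor0)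
 also have "\<dots> = (-1) ^ a * det ?M1" unfolding sum_unit using ab b by (simp add: cofactor_def)
 also have "det ?M1 = (\<Sum>i<Suc e. ?M1 $$ (i, 0) * cofactor ?M1 i 0)"
  by (rule laplace_expansion_column[OF M1]) simp
 also have "\<dots> = (\<Sum>i<Suc e. unit (b - 1) i * cofactor ?M1 i 0)"
  by (intro sum.cong refl) (use ab(1) b in \<open>auto simp: mat_delete_def QM_def unit_def\<close>)
 also have "\<dots> = (-1) ^ (b - 1) * det ?M2" unfolding sum_unit using ab b by (simp add: cofactor_def)
 also have "?M2 = submatrix A R UNIV"
 proof (rule eq_matI)
  have dr: "dim_row (submatrix A R UNIV) = e" and dc: "dim_col (submatrix A R UNIV) = e"
   using A R by (auto simp: dim_submatrix set_le_in intro: arg_cong[of _ _ card])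
  show "dim_row ?M2 = dim_row (submatrix A R UNIV)" "dim_col ?M2 = dim_col (submatrix A R UNIV)"
   unfolding dr dc by (simp_all add: mat_delete_def QM_def)
  fix i j assume "i < dim_row (submatrix A R UNIV)" "j < dim_col (submatrix A R UNIV)"
  then have ij: "i < e" "j < e" unfolding dr dc by auto
  have "submatrix A R UNIV $$ (i, j) = A $$ (pick R i, pick UNIV j)"
   by (rule submatrix_index) (use ij dr dc in \<open>simp_all add: dim_submatrix\<close>)
  also have "\<dots> = A $$ (v i, j)" using pick[OF ij(1)] by (simp add: pick_UNIV)
  also have "\<dots> = ?M2 $$ (i, j)"
   using ij ab(1) b by (auto simp: mat_delete_def QM_def v_def insert_index_def)
  finally show "?M2 $$ (i, j) = submatrix A R UNIV $$ (i, j)" by simp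
 qed
 finally have "Q e ?al (unit a) (unit b) = (-1) ^ (a + (b - 1)) * det (submatrix A R UNIV)"
  by (simp add: power_add)
 then show ?thesis using ab(1) b by (intro exI[of _ a] exI[of _ b]) (cases "even (a + (b - 1))", auto)
qed

lemma Q_to_fract:
 fixes al :: "nat => nat => 'a::idom"
 shows "Q e (%i j. to_fract (al i j)) (%i. to_fract (u i)) (%i. to_fract (w i)) = to_fract (Q e al u w)"
proof -
 interpret comm_ring_hom "to_fract :: 'a => 'a fract" by unfold_locales auto
 have "QM e (%i j. to_fract (al i j)) (%i. to_fract (u i)) (%i. to_fract (w i)) = map_mat to_fract (QM e al u w)"
  by (auto simp: QM_def intro!: eq_matI)
 then show ?thesis unfolding Q_def by (simp only: hom_det)
qed

lemma to_fract_unit: "(%i. to_fract (unit a i)) = unit a"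
 by (auto simp: unit_def)

lemma QN_to_fract:
 fixes al :: "nat => nat => 'a::idom"
 assumes "i < e + 2" "j < e + 2"
 shows "QN e (%i j. to_fract (al i j)) a b i j = to_fract (QN e al a b i j)"
proof -
 interpret comm_ring_hom "to_fract :: 'a => 'a fract" by unfold_locales auto
 have "mat_delete (QM e (%i j. to_fract (al i j)) (unit a) (unit b)) j i =
   map_mat to_fract (mat_delete (QM e al (unit a) (unit b)) j i)"
  using assms by (auto simp: QM_def mat_delete_def unit_def intro!: eq_matI)
 then show ?thesis unfolding QN_def cofactor_def by (cases "even (j + i)") (simp_all only: hom_det, auto)
qed

section \<open>Exactness of the complex on stalks\<close>

lemma loc_open:
 assumes P: "P \<in> proj_points I" and v: "v \<in> loc I n P"
 shows "\<exists>f l. f \<in> forms I l & f \<notin> P & (\<forall>R\<in>proj_points I. f \<notin> R --> v \<in> loc I n R)"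
proof -
 obtain a f k l where "a \<in> forms I k" "f \<in> forms I l" "f \<notin> P" "int k = int l + n" "v = Fract a f"
  using v by (rule locE)
 then show ?thesis using locI by blast
qed

lemma loc_open_finite:
 assumes P: "P \<in> proj_points I" and A: "finite A" and v: "!!x. x \<in> A ==> v x \<in> loc I n P"
 shows "\<exists>f l. f \<in> forms I l & f \<notin> P & (\<forall>R\<in>proj_points I. f \<notin> R --> (\<forall>x\<in>A. v x \<in> loc I n R))"
 using A v
proof (induction A rule: finite_induct)
 case empty
 then show ?case using proj_pointD(4)[OF P] forms_1[of I] by (intro exI[of _ 1] exI[of _ 0]) auto
next
 case (insert x A)
 obtain f l where f: "f \<in> forms I l" "f \<notin> P" "!!R. R \<in> proj_points I ==> f \<notin> R ==> \<forall>x\<in>A. v x \<in> loc I n R"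
  using insert.IH insert.prems by auto
 obtain g m where g: "g \<in> forms I m" "g \<notin> P" "!!R. R \<in> proj_points I ==> g \<notin> R ==> v x \<in> loc I n R"
  using loc_open[OF P insert.prems[of x]] by auto
 have "f \<notin> R & g \<notin> R" if "R \<in> proj_points I" "f * g \<notin> R" for R
  using proj_pointD(7)[OF that(1) forms_polys[OF f(1)] forms_polys[OF g(1)]] that(2) by blast
 then show ?case
  using forms_mult[OF f(1) g(1)] forms_mult_notin[OF P f(1) g(1) f(2) g(2)] f(3) g(3)
  by (intro exI[of _ "f * g"] exI[of _ "l + m"]) auto
qed

text \<open>What is retained of the codimension is \<open>nondegenerate\<close>: at each point of
  the plane some maximal minor is a unit.\<close>

locale pencil =
 fixes e :: nat and al :: "nat => nat => (nat, 'k::field) mpoly"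
 assumes e_pos: "0 < e"
  and linear: "!!i j. i < e + 2 ==> j < e ==> al i j \<in> forms xyz 1"
  and nondegenerate: "!!P. P \<in> proj_points xyz ==> \<exists>a<e + 2. \<exists>b<e + 2. Q e al (unit a) (unit b) \<notin> P"
begin

abbreviation "pp \<equiv> proj_points xyz :: 'k xpoly set set"
abbreviation "L \<equiv> loc xyz"

definition aT :: "(nat => 'k xpoly fract) => nat => 'k xpoly fract" where
 "aT z k = (\<Sum>l<e + 2. to_fract (al l k) * z l)"

definition aM :: "(nat => 'k xpoly fract) => nat => 'k xpoly fract" where
 "aM c i = (\<Sum>k<e. to_fract (al i k) * c k)"

definition BB :: "(nat => 'k xpoly fract) => nat => 'k xpoly fract" where
 "BB w l = (if l < e + 2 then Q e (%i j. to_fract (al i j)) (unit l) w else 0)"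

text \<open>The stalk at \<open>P\<close> of the kernel of the transpose on O(m)^(e+2). Vectors are
  padded with zeros from index e + 2 on, so that equality of vectors is equality of
  functions.\<close>

definition G :: "int => 'k xpoly set => (nat => 'k xpoly fract) set" where
 "G m P = {z. (\<forall>l. z l \<in> L m P) & (\<forall>l\<ge>e + 2. z l = 0) & (\<forall>k<e. aT z k = 0)}"

lemma Q_units: "Q e (%i j. to_fract (al i j)) (unit a) (unit b) = to_fract (Q e al (unit a) (unit b))"
 using Q_to_fract[of e al "unit a" "unit b"] by (simp only: to_fract_unit)

lemma Q_form: "Q e al (unit a) (unit b) \<in> forms xyz e"
 by (rule Q_forms[OF linear])

lemma BB_expand: "l < e + 2 ==> BB w l = (\<Sum>i<e + 2. w i * to_fract (Q e al (unit l) (unit i)))"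
 unfolding BB_def by (subst Q_expand2) (simp add: Q_units)

lemma BB_add: "BB (%i. w i + w' i) l = BB w l + BB w' l"
 and BB_diff: "BB (%i. w i - w' i) l = BB w l - BB w' l"
 and BB_scale: "BB (%i. c * w i) l = c * BB w l"
 by (simp_all add: BB_def Q_add2 Q_diff2 Q_scale2)

lemma aM_add: "aM (%k. c k + c' k) i = aM c i + aM c' i"
 and aM_diff: "aM (%k. c k - c' k) i = aM c i - aM c' i"
 by (simp_all add: aM_def algebra_simps sum.distrib sum_subtractf)

lemma aT_add: "aT (%l. z l + z' l) k = aT z k + aT z' k"
 and aT_diff: "aT (%l. z l - z' l) k = aT z k - aT z' k"
 and aT_uminus: "aT (%l. - z l) k = - aT z k"
 and aT_scale: "aT (%l. c * z l) k = c * aT z k"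
 by (simp_all add: aT_def algebra_simps sum.distrib sum_subtractf sum_negf sum_distrib_left)

lemma BB_aM: "BB (aM c) l = 0"
 using Q_image[of e "%i j. to_fract (al i j)" "unit l" c] by (simp add: BB_def aM_def[abs_def])

lemma aT_BB:
 assumes "k < e" shows "aT (BB w) k = 0"
proof -
 have "aT (BB w) k = (\<Sum>l<e + 2. to_fract (al l k) * Q e (%i j. to_fract (al i j)) (unit l) w)"
  unfolding aT_def by (rule sum.cong) (auto simp: BB_def)
 then show ?thesis using transpose_Q[OF assms] by simp
qed

lemma BB_cong: "(!!i. i < e + 2 ==> w i = w' i) ==> BB w l = BB w' l"
 by (cases "l < e + 2") (simp_all add: BB_expand, simp add: BB_def)

lemma BB_loc:
 assumes P: "P \<in> pp" and w: "!!i. i < e + 2 ==> w i \<in> L m P"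
 shows "BB w l \<in> L (m + int e) P"
proof (cases "l < e + 2")
 case True
 show ?thesis unfolding BB_expand[OF True]
 proof (rule loc_sum[OF P])
  fix i assume "i \<in> {..<e + 2}"
  then show "w i * to_fract (Q e al (unit l) (unit i)) \<in> L (m + int e) P"
   using loc_mult[OF P w loc_form[OF P Q_form]] by simp
 qed
qed (use loc_0[OF P] in \<open>simp add: BB_def\<close>)

lemma aT_loc: "P \<in> pp ==> k < e ==> (!!l. l < e + 2 ==> z l \<in> L m P) ==> aT z k \<in> L (m + 1) P"
 unfolding aT_def by (rule loc_sum) (auto intro!: loc_form_mult[OF _ linear])

lemma aM_loc: "P \<in> pp ==> i < e + 2 ==> (!!k. k < e ==> c k \<in> L m P) ==> aM c i \<in> L (m + 1) P"
 unfolding aM_def by (rule loc_sum) (auto intro!: loc_form_mult[OF _ linear])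

lemma BB_G:
 assumes P: "P \<in> pp" and w: "!!i. i < e + 2 ==> w i \<in> L m P"
 shows "BB w \<in> G (m + int e) P"
 unfolding G_def using BB_loc[OF assms] aT_BB by (auto simp: BB_def)

lemma unit_loc: "P \<in> pp ==> x \<in> L m P ==> x * unit a i \<in> L m P"
 by (auto simp: unit_def loc_0)

text \<open>The preimage is the two-term vector of \<open>Q_exact_middle\<close>, divided by a minor
  that is a unit at \<open>P\<close>.\<close>

lemma G_lift:
 assumes P: "P \<in> pp" and z: "z \<in> G m P"
 shows "\<exists>w. (\<forall>i. w i \<in> L (m - int e) P) & (\<forall>i\<ge>e + 2. w i = 0) & BB w = z"
proof -
 obtain a b where ab: "a < e + 2" "b < e + 2" "Q e al (unit a) (unit b) \<notin> P"
  using nondegenerate[OF P] by blast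
 let ?q = "Q e al (unit a) (unit b)"
 have q0: "?q ~= 0" using nonzero_if_notin[OF P ab(3)] .
 have zl: "z l \<in> L m P" "!!l. l \<ge> e + 2 ==> z l = 0" "!!k. k < e ==> aT z k = 0" for l
  using z by (auto simp: G_def)
 define y where "y i = z a * unit b i - z b * unit a i" for i
 define w where "w i = 1 / to_fract ?q * y i" for i
 have "BB w l = z l" for l
 proof (cases "l < e + 2")
  case True
  have "BB y l = to_fract ?q * z l"
   unfolding BB_def y_def using True
   Q_exact_middle[of e "%i j. to_fract (al i j)" z a b l, OF _ ab(1,2) _ True] zl(3) q0
   by (simp add: Q_units aT_def)
  then show ?thesis using q0 BB_scale[of "1 / to_fract ?q" y l] by (simp add: w_def[abs_def])
 qed (use zl in \<open>simp add: BB_def\<close>)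
 moreover have "w i \<in> L (m - int e) P" for i
 proof -
  have "y i \<in> L m P" unfolding y_def by (intro loc_diff[OF P] unit_loc[OF P] zl)
  then have "y i / to_fract ?q \<in> L (m - int e) P" by (rule loc_form_divide[OF P Q_form ab(3)]) simp
  then show ?thesis by (simp add: w_def)
 qed
 moreover have "w i = 0" if "i \<ge> e + 2" for i using that ab by (auto simp: w_def y_def unit_def)
 ultimately show ?thesis by (intro exI[of _ w]) auto
qed

lemma QN_form: "k < e ==> j < e + 2 ==> QN e al a b (k + 2) j \<in> forms xyz (e - 1)"
 by (rule QN_forms[OF linear])

lemma QN_sum_loc:
 assumes P: "P \<in> pp" and k: "k < e" and w: "!!i. i < e + 2 ==> w i \<in> L m P" and q: "Q e al (unit a) (unit b) \<notin> P"
 shows "(\<Sum>j<e + 2. to_fract (QN e al a b (k + 2) j) * w j) / to_fract (Q e al (unit a) (unit b)) \<in> L (m - 1) P"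
proof -
 have "(\<Sum>j<e + 2. to_fract (QN e al a b (k + 2) j) * w j) \<in> L (int (e - 1) + m) P"
  by (rule loc_sum[OF P]) (auto intro!: loc_form_mult[OF P QN_form] k w)
 then show ?thesis by (rule loc_form_divide[OF P Q_form q]) (use e_pos in \<open>simp add: of_nat_diff\<close>)
qed

lemma BB_exact:
 assumes P: "P \<in> pp" and w: "!!i. i < e + 2 ==> w i \<in> L m P" and B: "!!l. l < e + 2 ==> BB w l = 0"
 shows "\<exists>c. (\<forall>k. c k \<in> L (m - 1) P) & (\<forall>i<e + 2. w i = aM c i)"
proof -
 obtain a b where ab: "a < e + 2" "b < e + 2" "Q e al (unit a) (unit b) \<notin> P"
  using nondegenerate[OF P] by blast
 let ?q = "Q e al (unit a) (unit b)"
 have q0: "?q ~= 0" using nonzero_if_notin[OF P ab(3)] .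
 define c where "c k = (if k < e then (\<Sum>j<e + 2. to_fract (QN e al a b (k + 2) j) * w j) / to_fract ?q else 0)" for k
 have "w i = aM c i" if i: "i < e + 2" for i
 proof -
  have B': "Q e (%i j. to_fract (al i j)) (unit l) w = 0" if "l < e + 2" for l
   using B[OF that] that by (simp only: BB_def if_True)
  have "to_fract ?q * w i = (\<Sum>k<e. to_fract (al i k) * (\<Sum>j<e + 2. QN e (%i j. to_fract (al i j)) a b (k + 2) j * w j))"
   using Q_exact_left[of e "%i j. to_fract (al i j)" w a b i, OF B' ab(1,2) i] unfolding Q_units .
  also have "\<dots> = (\<Sum>k<e. to_fract (al i k) * (\<Sum>j<e + 2. to_fract (QN e al a b (k + 2) j) * w j))"
   by (intro sum.cong refl arg_cong2[of _ _ _ _ "(*)"] QN_to_fract) auto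
  also have "\<dots> = (\<Sum>k<e. to_fract ?q * (to_fract (al i k) * c k))"
   by (rule sum.cong) (use q0 in \<open>simp_all add: c_def\<close>)
  also have "\<dots> = to_fract ?q * aM c i" by (simp add: aM_def sum_distrib_left)
  finally show ?thesis using q0 by simp
 qed
 moreover have "c k \<in> L (m - 1) P" for k
 proof (cases "k < e")
  case True
  then show ?thesis unfolding c_def using QN_sum_loc[OF P True w ab(3)] by (simp only: if_True)
 next
  case False
  then show ?thesis using loc_0[OF P] by (simp add: c_def)
 qed
 ultimately show ?thesis by blast
qed

text \<open>On the stalk the matrix has a regular left inverse, made of rows of the adjugate divided
  by an invertible minor; so \<open>c\<close> inherits regularity from its image.\<close>

lemma aM_reflects:
 assumes P: "P \<in> pp" and w: "!!i. i < e + 2 ==> aM c i \<in> L m P" and k: "k < e"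
 shows "c k \<in> L (m - 1) P"
proof -
 obtain a b where ab: "a < e + 2" "b < e + 2" "Q e al (unit a) (unit b) \<notin> P"
  using nondegenerate[OF P] by blast
 let ?q = "Q e al (unit a) (unit b)"
 have q0: "?q ~= 0" using nonzero_if_notin[OF P ab(3)] .
 have "(\<Sum>j<e + 2. to_fract (QN e al a b (k + 2) j) * aM c j) =
   (\<Sum>j<e + 2. QN e (%i j. to_fract (al i j)) a b (k + 2) j * aM c j)"
  by (intro sum.cong refl arg_cong2[of _ _ _ _ "(*)"] QN_to_fract[symmetric]) (use k in auto)
 also have "\<dots> = to_fract ?q * c k"
  unfolding aM_def using QN_recover[OF k, of "%i j. to_fract (al i j)" a b c] by (simp only: Q_units)
 finally have "c k = (\<Sum>j<e + 2. to_fract (QN e al a b (k + 2) j) * aM c j) / to_fract ?q"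
  using q0 by simp
 then show ?thesis using QN_sum_loc[OF P k w ab(3)] by simp
qed

text \<open>Locally \<open>z = BB w\<close> with \<open>w\<close> in \<open>\<O>(m - e)\<close>, and two choices of \<open>w\<close> differ by an element of
  \<open>\<O>(m - e - 1)\<^sup>e\<close>. As the first cohomology of this sheaf vanishes, \<open>w\<close> can be chosen globally.\<close>

theorem G_no_sections:
 assumes m: "m < int e" and z: "!!P. P \<in> pp ==> z \<in> G m P"
 shows "z = (%_. 0)"
proof -
 have "\<forall>P\<in>pp. \<exists>w. (\<forall>i. w i \<in> L (m - int e) P) & (\<forall>i\<ge>e + 2. w i = 0) & BB w = z"
  using G_lift[OF _ z] by blast
 then obtain w where w: "!!P i. P \<in> pp ==> w P i \<in> L (m - int e) P" "!!P. P \<in> pp ==> BB (w P) = z"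
  by metis
 have gen: "{0} \<in> pp" by (rule generic_point) (use xyz_eq in auto)
 \<comment> \<open>The lift at the generic point serves as reference. Every other lift differs from
   it by \<open>aM\<close> of a vector \<open>c P\<close> over the function field, and these vectors
   are locally constant modulo O(m - e - 1).\<close>
 define w0 where "w0 = w {0}"
 have w0: "w0 i \<in> L (m - int e) {0}" "BB w0 = z" for i using w gen by (auto simp: w0_def)
 have sub: "x \<in> L n {0}" if xP: "P \<in> pp" "x \<in> L n P" for x n P
 proof -
  obtain a f k l where a: "a \<in> forms xyz k" "f \<in> forms xyz l" "f \<notin> P" "int k = int l + n" "x = Fract a f"
   using xP(2) by (rule locE)
  have "f \<notin> {0}" using nonzero_if_notin[OF xP(1) a(3)] by simp
  from locI[OF a(1,2) this a(4)] show ?thesis unfolding a(5) .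
 qed
 have "\<exists>c. \<forall>i<e + 2. w P i - w0 i = aM c i" if P: "P \<in> pp" for P
 proof -
  have "\<exists>c. (\<forall>k. c k \<in> L (m - int e - 1) {0}) & (\<forall>i<e + 2. w P i - w0 i = aM c i)"
  proof (rule BB_exact[OF gen])
   show "w P i - w0 i \<in> L (m - int e) {0}" for i
    by (rule loc_diff[OF gen sub[OF P w(1)[OF P]] w0(1)])
   show "BB (%i. w P i - w0 i) l = 0" for l unfolding BB_diff w(2)[OF P] w0(2) by simp
  qed
  then show ?thesis by blast
 qed
 then obtain c where c: "!!P i. P \<in> pp ==> i < e + 2 ==> w P i - w0 i = aM (c P) i" by metis
 have "\<exists>x. \<forall>P\<in>pp. x - c P k \<in> L (m - int e - 1) P" if k: "k < e" for k
 proof (rule global_cousin)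
  fix P assume P: "P \<in> pp"
  obtain f l where f: "f \<in> forms xyz l" "f \<notin> P"
   "!!R. R \<in> pp ==> f \<notin> R ==> \<forall>i\<in>{..<e + 2}. w P i \<in> L (m - int e) R"
   using loc_open_finite[OF P, of "{..<e + 2}" "w P" "m - int e"] w(1)[OF P] by auto
  have "c P k - c R k \<in> L (m - int e - 1) R" if R: "R \<in> pbasic xyz f" for R
  proof -
   have R': "R \<in> pp" "f \<notin> R" using R by (auto simp: pbasic_def)
   show ?thesis
   proof (rule aM_reflects[OF R'(1) _ k])
    fix i assume i: "i < e + 2"
    have "aM (%k. c P k - c R k) i = w P i - w R i"
     unfolding aM_diff using c[OF P i] c[OF R'(1) i] by (simp add: algebra_simps)
    then show "aM (%k. c P k - c R k) i \<in> L (m - int e) R"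
     using loc_diff[OF R'(1) _ w(1)[OF R'(1)]] f(3)[OF R'] i by simp
   qed
  qed
  then show "\<exists>U. openin (proj_top xyz) U & P \<in> U & (\<forall>R\<in>U. c P k - c R k \<in> L (m - int e - 1) R)"
   using openin_pbasic[OF f(1)] f(2) P by (intro exI[of _ "pbasic xyz f"]) (auto simp: pbasic_def)
 qed
 then obtain x where x: "!!k P. k < e ==> P \<in> pp ==> x k - c P k \<in> L (m - int e - 1) P" by metis
 define w' where "w' i = w0 i + aM x i" for i
 have "w' i = 0" if i: "i < e + 2" for i
 proof -
  have "w' i \<in> L (m - int e) P" if P: "P \<in> pp" for P
  proof -
   have "w' i = w P i + aM (%k. x k - c P k) i"
    unfolding aM_diff w'_def using c[OF P i] by (simp add: algebra_simps)
   moreover have "aM (%k. x k - c P k) i \<in> L (m - int e - 1 + 1) P" by (rule aM_loc[OF P i x[OF _ P]])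
   ultimately show ?thesis using loc_add[OF P w(1)[OF P]] by simp
  qed
  \<comment> \<open>The degree m - e is negative.\<close>
  from global_sections[OF this] show ?thesis using m by auto
 qed
 then have "BB w' l = BB (%_. 0) l" for l by (intro BB_cong) simp
 moreover have "BB (%_. 0) l = 0" for l using BB_scale[of 0 "%_. 0" l] by simp
 moreover have "BB w' l = z l" for l
  unfolding w'_def[abs_def] BB_add w0(2) using BB_aM[of x l] by simp
 ultimately show ?thesis by (intro ext) metis
qed

end

section \<open>Dimension count for the transpose on forms\<close>

lemma finite_monomials: "finite I ==> finite (monomials I d)"
 by (rule finite_subset[OF _ finite_bounded_exponents(1)[of I d]])
  (auto simp: monomials_def intro: lookup_le_mdeg)

lemma mdeg_plane: "keys t \<subseteq> xyz ==>
 mdeg t = lookup t 0 + lookup t 1 + lookup t (2::nat)"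
proof -
 assume "keys t \<subseteq> xyz"
 then have "mdeg t = (\<Sum>i\<in>{0, 1, 2}. lookup t i)"
  unfolding mdeg_def xyz_eq by (intro sum.mono_neutral_left) (auto simp: in_keys_iff)
 then show ?thesis by simp
qed

text \<open>Two exponents determine the third. The count is doubled to avoid the division in the
  binomial coefficient.\<close>

lemma card_plane_monomials: "2 * card (monomials xyz j) = (j + 1) * (j + 2)"
proof -
 let ?f = "%t. (lookup t (0::nat), lookup t 1)"
 have "bij_betw ?f (monomials xyz j) (SIGMA a:{..j}. {..j - a})"
  unfolding bij_betw_def
 proof
  show "inj_on ?f (monomials xyz j)"
  proof (rule inj_onI)
   fix s t assume st: "s \<in> monomials xyz j" "t \<in> monomials xyz j" "?f s = ?f t"
   show "s = t"
   proof (rule poly_mapping_eqI)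
    fix i
    have "lookup s 2 = lookup t 2"
     using st mdeg_plane[of s] mdeg_plane[of t] by (simp add: monomials_def)
    moreover have "lookup s i = 0 & lookup t i = 0" if "\<not> i < 3"
     using st that by (auto simp: monomials_def in_keys_iff subset_iff)
    moreover have "i = 0 \<or> i = 1 \<or> i = 2" if "i < 3" using that by linarith
    ultimately show "lookup s i = lookup t i" using st(3) by fastforce
   qed
  qed
  show "?f ` monomials xyz j = (SIGMA a:{..j}. {..j - a})"
  proof (intro equalityI subsetI)
   fix x assume "x \<in> ?f ` monomials xyz j"
   then show "x \<in> (SIGMA a:{..j}. {..j - a})" using mdeg_plane by (auto simp: monomials_def)
  next
   fix x assume "x \<in> (SIGMA a:{..j}. {..j - a})"
   then obtain a b where ab: "x = (a, b)" "a \<le> j" "b \<le> j - a" by auto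
   define t where "t = single 0 a + single 1 b + single (2::nat) (j - a - b)"
   have "keys t \<subseteq> xyz"
    unfolding xyz_eq by (auto simp: t_def in_keys_iff lookup_add lookup_single when_def split: if_splits)
   moreover have "mdeg t = j" using ab by (simp add: t_def mdeg_add)
   moreover have "?f t = x" by (simp add: t_def ab lookup_add lookup_single)
   ultimately show "x \<in> ?f ` monomials xyz j" unfolding monomials_def by blast
  qed
 qed
 then have "card (monomials xyz j) = card (SIGMA a:{..j}. {..j - a})" by (rule bij_betw_same_card)
 also have "\<dots> = (\<Sum>a\<le>j. Suc (j - a))" by simp
 finally have "card (monomials xyz j) = (\<Sum>a\<le>j. Suc (j - a))" .
 moreover have "2 * (\<Sum>a\<le>j. Suc (j - a)) = (j + 1) * (j + 2)"
 proof (induction j)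
  case (Suc j)
  have "(\<Sum>a\<le>Suc j. Suc (Suc j - a)) = Suc (Suc j) + (\<Sum>a\<le>j. Suc (j - a))"
   by (subst sum.atMost_Suc_shift) simp
  then have "2 * (\<Sum>a\<le>Suc j. Suc (Suc j - a)) = 2 * Suc (Suc j) + 2 * (\<Sum>a\<le>j. Suc (j - a))" by simp
  also have "\<dots> = (Suc j + 1) * (Suc j + 2)" unfolding Suc by (simp add: algebra_simps)
  finally show ?case .
 qed simp
 ultimately show ?thesis by simp
qed

lemma family_independent:
 fixes f :: "'a => ('i, 'k::field) mpoly"
 assumes A: "finite A" and triv: "!!c a. (\<Sum>a\<in>A. single 0 (c a) * f a) = 0 ==> a \<in> A ==> c a = 0"
 shows "inj_on f A" "mpoly.independent (f ` A)"
proof -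
 show inj: "inj_on f A"
 proof (rule inj_onI, rule ccontr)
  fix a b assume ab: "a \<in> A" "b \<in> A" "f a = f b" "a ~= b"
  define c where "c x = (if x = a then 1 else if x = b then - 1 else (0::'k))" for x
  have "(\<Sum>x\<in>A. single 0 (c x) * f x) = (\<Sum>x\<in>{a, b}. single 0 (c x) * f x)"
   by (rule sum.mono_neutral_right) (use ab A in \<open>auto simp: c_def\<close>)
  also have "\<dots> = single 0 1 * f a + single 0 (- 1) * f a"
   using ab by (simp add: c_def)
  also have "\<dots> = 0" by (simp add: single_uminus)
  finally have "c a = 0" using triv ab by blast
  then show False by (simp add: c_def)
 qed
 show "mpoly.independent (f ` A)"
 proof
  assume "mpoly.dependent (f ` A)"
  then obtain u where u: "\<exists>v\<in>f ` A. u v ~= 0" "(\<Sum>v\<in>f ` A. single 0 (u v) * v) = 0"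
   using mpoly.dependent_finite[of "f ` A"] A by auto
  then have "(\<Sum>a\<in>A. single 0 (u (f a)) * f a) = 0" by (simp add: sum.reindex[OF inj])
  then have "u (f a) = 0" if "a \<in> A" for a using triv[of "%a. u (f a)"] that by blast
  then show False using u(1) by auto
 qed
qed

lemma independent_spans:
 fixes S T :: "('i, 'k::field) mpoly set"
 assumes "finite T" "mpoly.independent S" "S \<subseteq> mpoly.span T" "card T \<le> card S"
 shows "T \<subseteq> mpoly.span S"
proof (rule ccontr)
 assume "\<not> T \<subseteq> mpoly.span S"
 then obtain b where b: "b \<in> T" "b \<notin> mpoly.span S" by blast
 then have "mpoly.independent (insert b S)" using mpoly.independent_insert assms(2) mpoly.span_base by metis
 moreover have "insert b S \<subseteq> mpoly.span T" using assms(3) b mpoly.span_base by auto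
 ultimately have "finite (insert b S) & card (insert b S) \<le> card T"
  by (rule mpoly.independent_span_bound[OF assms(1)])
 moreover have "b \<notin> S" using b(2) mpoly.span_base by blast
 ultimately show False using assms(4) by auto
qed

lemma poly_sum_monomials:
 "f = (\<Sum>t\<in>keys f. single 0 (lookup f t) * single t 1)"
 for f :: "('i, 'k::field) mpoly"
 by (rule poly_mapping_eqI) (auto simp: mult_single lookup_sum lookup_single when_def in_keys_iff)

text \<open>A vector of polynomials is encoded as a single polynomial with the help of the unused variables
  from 3 on.\<close>

definition enc :: "nat => (nat => (nat, 'k::field) mpoly) => 'k xpoly" where
 "enc e p = (\<Sum>k<e. mvar (3 + k) * p k)"

lemma enc_sum: "enc e (%k. \<Sum>x\<in>F. p x k) = (\<Sum>x\<in>F. enc e (p x))"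
 unfolding enc_def sum_distrib_left by (rule sum.swap)

lemma enc_scale: "enc e (%k. c * p k) = c * enc e p"
 by (simp add: enc_def sum_distrib_left mult.left_commute)

lemma enc_diff: "enc e (%k. p k - q k) = enc e p - enc e q"
 by (simp add: enc_def right_diff_distrib sum_subtractf)

text \<open>The variables of index 3 and above do not occur in the \<open>p k\<close>, so the
  summands of the encoding have disjoint sets of monomials and cannot cancel.\<close>

lemma enc_inject:
 fixes p :: "nat => (nat, 'k::field) mpoly"
 assumes p: "!!k. k < e ==> p k \<in> polys xyz" and 0: "enc e p = 0" and k: "k < e"
 shows "p k = 0"
proof (rule ccontr)
 assume "p k ~= 0"
 then obtain t where t: "t \<in> keys (p k)" by (metis all_not_in_conv keys_eq_empty)
 let ?s = "%k. single (3 + k) (1::nat)"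
 have kt: "keys t \<subseteq> xyz" using p[OF k] t by (auto simp: polys_def)
 have "lookup (mvar (3 + k') * p k') (?s k + t) = (if k' = k then lookup (p k) t else 0)"
  if k': "k' < e" for k'
 proof (cases "k' = k")
  case False
  have "?s k + t \<notin> keys (mvar (3 + k') * p k')"
  proof
   assume "?s k + t \<in> keys (mvar (3 + k') * p k')"
   then obtain u where "?s k + t = ?s k' + u" unfolding mvar_def keys_times_monomial by blast
   then have "lookup (?s k + t) (3 + k') = lookup (?s k' + u) (3 + k')" by simp
   then have "lookup t (3 + k') ~= 0" using False by (auto simp: lookup_add lookup_single)
   then show False using kt by (auto simp: in_keys_iff subset_iff)
  qed
  then show ?thesis using False by (simp add: in_keys_iff)
 qed (simp add: mvar_def lookup_times_monomial)
 then have "lookup (enc e p) (?s k + t) = lookup (p k) t"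
  using k unfolding enc_def lookup_sum by simp
 then show False using t 0 by (simp add: in_keys_iff)
qed

lemma monomial_factor:
 assumes "keys t \<subseteq> I" "j \<le> mdeg t"
 shows "\<exists>u v. t = u + v & u \<in> monomials I j & keys v \<subseteq> I & mdeg v = mdeg t - j"
 using assms
proof (induction j)
 case 0
 then show ?case by (intro exI[of _ 0] exI[of _ t]) (auto simp: monomials_def)
next
 case (Suc j)
 then obtain u v where uv: "t = u + v" "u \<in> monomials I j" "keys v \<subseteq> I" "mdeg v = mdeg t - j"
  by auto
 then have "mdeg v ~= 0" using Suc.prems by simp
 then obtain i where i: "i \<in> keys v" unfolding mdeg_def by (meson sum.neutral all_not_in_conv)
 define v' where "v' = v - single i 1"
 have v: "v = single i 1 + v'"
  by (rule poly_mapping_eqI) (use i in \<open>auto simp: v'_def lookup_add lookup_minus lookup_single when_def in_keys_iff\<close>)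
 have "keys v' \<subseteq> keys v" by (auto simp: v'_def in_keys_iff lookup_minus)
 moreover have "mdeg v = 1 + mdeg v'" by (subst v) (simp add: mdeg_add)
 moreover have "u + single i 1 \<in> monomials I (Suc j)"
  using uv(2,3) i keys_add[of u "single i 1"] by (auto simp: monomials_def mdeg_add)
 moreover have "t = (u + single i 1) + v'" using uv(1) v by (simp add: add.assoc)
 ultimately show ?case using uv(3,4)
  by (intro exI[of _ "u + single i 1"] exI[of _ v']) auto
qed

context pencil
begin

text \<open>The transpose of \<open>al\<close> maps \<open>e + 2\<close> forms of degree \<open>e - 1\<close> to \<open>e\<close> forms of degree \<open>e\<close>. It is injective by
  \<open>G_no_sections\<close>, and both spaces have dimension \<open>e (e + 1) (e + 2) / 2\<close>.\<close>

lemma transpose_surjective: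
 assumes k0: "k0 < e" and u: "u \<in> monomials xyz e"
 shows "\<exists>x. (\<forall>l<e + 2. x l \<in> forms xyz (e - 1)) &
  (\<forall>k<e. (\<Sum>l<e + 2. al l k * x l) = (if k = k0 then single u 1 else 0))"
proof -
 let ?m1 = "monomials xyz (e - 1)" and ?m = "monomials xyz e"
 have fin: "finite ?m1" "finite ?m" by (auto intro: finite_monomials)
 define A where "A = {..<e + 2} \<times> ?m1"
 define B where "B = {..<e} \<times> ?m"
 have AB: "finite A" "finite B" using fin by (auto simp: A_def B_def)
 define \<Psi> where "\<Psi> lt = enc e (%k. al (fst lt) k * single (snd lt) 1)" for lt
 define \<Theta> where "\<Theta> ku = mvar (3 + fst ku) * (single (snd ku) 1 :: 'k xpoly)" for ku
 define X where "X c l = (\<Sum>t\<in>?m1. single t (c (l, t)))" for c :: "nat \<times> (nat \<Rightarrow>\<^sub>0 nat) => 'k" and l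
 have X: "X c l \<in> forms xyz (e - 1)" for c l
  unfolding X_def by (intro forms_sum forms_single) (auto simp: monomials_def)
 have alX: "(\<Sum>l<e + 2. al l k * X c l) \<in> polys xyz" if "k < e" for c k
  using that by (intro polys_sum polys_mult forms_polys[OF linear] forms_polys[OF X]) auto
 have comb: "(\<Sum>a\<in>A. single 0 (c a) * \<Psi> a) = enc e (%k. \<Sum>l<e + 2. al l k * X c l)" for c
 proof -
  have "(\<Sum>a\<in>A. single 0 (c a) * \<Psi> a) =
    (\<Sum>l<e + 2. \<Sum>t\<in>?m1. enc e (%k. single 0 (c (l, t)) * (al l k * single t 1)))"
   unfolding A_def sum.cartesian_product' \<Psi>_def enc_scale by simp
  also have "\<dots> = enc e (%k. \<Sum>l<e + 2. \<Sum>t\<in>?m1. single 0 (c (l, t)) * (al l k * single t 1))"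
   by (simp only: enc_sum)
  also have "(%k. \<Sum>l<e + 2. \<Sum>t\<in>?m1. single 0 (c (l, t)) * (al l k * single t 1)) =
    (%k. \<Sum>l<e + 2. al l k * X c l)"
   unfolding X_def sum_distrib_left
   by (intro ext sum.cong refl) (simp add: mult.left_commute[of _ "al _ _"] mult_single)
  finally show ?thesis .
 qed
 have indep: "inj_on \<Psi> A" "mpoly.independent (\<Psi> ` A)"
 proof -
  have triv: "c a = 0" if 0: "(\<Sum>a\<in>A. single 0 (c a) * \<Psi> a) = 0" and a: "a \<in> A" for c a
  proof -
   have al0: "(\<Sum>l<e + 2. al l k * X c l) = 0" if "k < e" for k
    by (rule enc_inject[OF alX _ that]) (use 0 comb in simp_all)
   define z where "z l = (if l < e + 2 then to_fract (X c l) else 0)" for l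
   have z0: "z = (%_. 0)"
   proof (rule G_no_sections)
    show "int (e - 1) < int e" using e_pos by simp
    fix P assume P: "P \<in> pp"
    have "aT z k = 0" if k: "k < e" for k
    proof -
     have "aT z k = to_fract (\<Sum>l<e + 2. al l k * X c l)"
      unfolding aT_def to_fract_sum by (rule sum.cong) (auto simp: z_def)
     then show ?thesis using al0[OF k] by simp
    qed
    then show "z \<in> G (int (e - 1)) P" using loc_form[OF P X] loc_0[OF P] by (auto simp: G_def z_def)
   qed
   have "X c l = 0" if "l < e + 2" for l using fun_cong[OF z0, of l] that unfolding z_def by simp
   moreover obtain l t where lt: "a = (l, t)" "l < e + 2" "t \<in> ?m1" using a by (auto simp: A_def)
   moreover have "lookup (X c l) t = c (l, t)"
    using lt(3) fin(1) by (simp add: X_def lookup_sum lookup_single when_def)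
   ultimately show ?thesis by simp
  qed
  show "inj_on \<Psi> A" by (rule family_independent(1)[where f = \<Psi>, OF AB(1)]) (rule triv)
  show "mpoly.independent (\<Psi> ` A)" by (rule family_independent(2)[where f = \<Psi>, OF AB(1)]) (rule triv)
 qed
 have span: "\<Psi> ` A \<subseteq> mpoly.span (\<Theta> ` B)"
 proof
  fix y assume "y \<in> \<Psi> ` A"
  then obtain l t where y: "y = enc e (%k. al l k * single t 1)" "l < e + 2" "t \<in> ?m1"
   by (auto simp: \<Psi>_def A_def)
  define p where "p k = al l k * single t (1::'k)" for k
  have pf: "p k \<in> forms xyz e" if "k < e" for k
  proof -
   have "p k \<in> forms xyz (1 + (e - 1))" unfolding p_def
    by (rule forms_mult[OF linear[OF y(2) that] forms_single]) (use y(3) in \<open>auto simp: monomials_def\<close>)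
   then show ?thesis using e_pos by simp
  qed
  have "mvar (3 + k) * p k \<in> mpoly.span (\<Theta> ` B)" if k: "k < e" for k
  proof -
   have "mvar (3 + k) * p k = (\<Sum>v\<in>keys (p k). single 0 (lookup (p k) v) * \<Theta> (k, v))"
    by (subst poly_sum_monomials[of "p k"]) (simp add: sum_distrib_left \<Theta>_def mult.left_commute)
   also have "\<dots> \<in> mpoly.span (\<Theta> ` B)"
   proof (intro mpoly.span_sum mpoly.span_scale mpoly.span_base imageI)
    fix v assume "v \<in> keys (p k)"
    then show "(k, v) \<in> B" using pf[OF k] k by (auto simp: B_def monomials_def forms_def polys_def)
   qed
   finally show ?thesis .
  qed
  then show "y \<in> mpoly.span (\<Theta> ` B)"
   unfolding y(1) enc_def p_def[symmetric] by (intro mpoly.span_sum) auto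
 qed
 have "card (\<Theta> ` B) \<le> card B" using AB card_image_le by blast
 \<comment> \<open>e slots with (e + 1)(e + 2)/2 monomials each, against e + 2 slots with e(e + 1)/2
   monomials each.\<close>
 also have "card B = card A"
 proof -
  obtain e' where e': "e = e' + 1" using e_pos by (metis Suc_eq_plus1 Suc_pred)
  have "2 * card B = e * ((e + 1) * (e + 2))"
   unfolding B_def card_cartesian_product using card_plane_monomials[of e] by simp
  moreover have "2 * card A = (e + 2) * (e * (e + 1))"
   unfolding A_def card_cartesian_product using card_plane_monomials[of "e - 1"] by (simp add: e' algebra_simps)
  ultimately have "2 * card B = 2 * card A" by (simp only: mult_ac)
  then show ?thesis by simp
 qed
 also have "card A = card (\<Psi> ` A)" using card_image[OF indep(1)] by simp
 finally have "\<Theta> ` B \<subseteq> mpoly.span (\<Psi> ` A)"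
  using independent_spans[OF finite_imageI[OF AB(2)] indep(2) span] by simp
 then have "\<Theta> (k0, u) \<in> mpoly.span (\<Psi> ` A)" using k0 u by (auto simp: B_def)
 then obtain r where "\<Theta> (k0, u) = (\<Sum>v\<in>\<Psi> ` A. single 0 (r v) * v)"
  unfolding mpoly.span_finite[OF finite_imageI[OF AB(1)]] by auto
 then have "\<Theta> (k0, u) = (\<Sum>a\<in>A. single 0 (r (\<Psi> a)) * \<Psi> a)" by (simp add: sum.reindex[OF indep(1)])
 then have eq: "\<Theta> (k0, u) = enc e (%k. \<Sum>l<e + 2. al l k * X (%a. r (\<Psi> a)) l)" unfolding comb .
 define \<delta> where "\<delta> k = (if k = k0 then single u (1::'k) else 0)" for k
 have "enc e \<delta> = (\<Sum>k<e. if k = k0 then mvar (3 + k) * single u 1 else 0)"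
  unfolding enc_def by (rule sum.cong) (auto simp: \<delta>_def)
 then have "enc e \<delta> = \<Theta> (k0, u)" using k0 by (simp add: \<Theta>_def)
 then have z: "enc e (%k. (\<Sum>l<e + 2. al l k * X (%a. r (\<Psi> a)) l) - \<delta> k) = 0"
  using eq by (simp add: enc_diff)
 have "\<delta> k \<in> polys xyz" for k using u by (auto simp: \<delta>_def monomials_def intro: polys_single)
 then have "(\<Sum>l<e + 2. al l k * X (%a. r (\<Psi> a)) l) - \<delta> k = 0" if "k < e" for k
  by (intro enc_inject[OF _ z that] polys_diff alX)
 then show ?thesis using X by (intro exI[of _ "X (%a. r (\<Psi> a))"]) (auto simp: \<delta>_def)
qed

definition tsec :: "nat => (nat \<Rightarrow>\<^sub>0 nat) => nat => 'k xpoly" where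
 "tsec k0 u = (SOME x. (\<forall>l<e + 2. x l \<in> forms xyz (e - 1)) &
  (\<forall>k<e. (\<Sum>l<e + 2. al l k * x l) = (if k = k0 then single u 1 else 0)))"

lemma tsec:
 assumes "k0 < e" "u \<in> monomials xyz e"
 shows "l < e + 2 ==> tsec k0 u l \<in> forms xyz (e - 1)"
  "k < e ==> (\<Sum>l<e + 2. al l k * tsec k0 u l) = (if k = k0 then single u 1 else 0)"
 using someI_ex[OF transpose_surjective[OF assms]] unfolding tsec_def by blast+

lemma aT_tsec:
 assumes "k0 < e" "u \<in> monomials xyz e" "k < e"
 shows "(\<Sum>l<e + 2. to_fract (al l k) * to_fract (tsec k0 u l)) = (if k = k0 then to_fract (single u 1) else 0)"
proof -
 have "(\<Sum>l<e + 2. to_fract (al l k) * to_fract (tsec k0 u l)) = to_fract (\<Sum>l<e + 2. al l k * tsec k0 u l)"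
  by (simp only: to_fract_sum to_fract_mult)
 then show ?thesis using tsec(2)[OF assms] by (simp only:) simp
qed

text \<open>A right inverse of \<open>aT\<close> that is regular where the monomial \<open>u\<close>
  does not vanish: \<open>tsec k u\<close> is a preimage of the vector with \<open>u\<close> in slot
  \<open>k\<close> and zeros elsewhere.\<close>

definition rinv :: "(nat \<Rightarrow>\<^sub>0 nat) => (nat => 'k xpoly fract) => nat => 'k xpoly fract" where
 "rinv u h l = (if l < e + 2 then \<Sum>k<e. to_fract (tsec k u l) * h k / to_fract (single u 1) else 0)"

lemma aT_rinv:
 assumes u: "u \<in> monomials xyz e" and k: "k < e"
 shows "aT (rinv u h) k = h k"
proof -
 let ?u = "to_fract (single u 1 :: 'k xpoly)"
 have u0: "?u ~= 0" by (simp, metis lookup_single_eq lookup_zero one_neq_zero)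
 have "aT (rinv u h) k = (\<Sum>l<e + 2. \<Sum>k'<e. to_fract (al l k) * to_fract (tsec k' u l) * (h k' / ?u))"
  unfolding aT_def rinv_def sum_distrib_left by (rule sum.cong) (auto simp: sum_distrib_left mult.assoc)
 also have "\<dots> = (\<Sum>k'<e. (\<Sum>l<e + 2. to_fract (al l k) * to_fract (tsec k' u l)) * (h k' / ?u))"
  by (subst sum.swap) (simp only: sum_distrib_right)
 also have "\<dots> = (\<Sum>k'<e. if k' = k then h k else 0)"
  by (rule sum.cong) (use u0 in \<open>auto simp: aT_tsec[OF _ u k]\<close>)
 also have "\<dots> = h k" using k by simp
 finally show ?thesis .
qed

lemma rinv_loc:
 assumes P: "P \<in> pp" and u: "u \<in> monomials xyz e" "single u 1 \<notin> P"
  and h: "!!k. k < e ==> h k \<in> L (m + 1) P"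
 shows "rinv u h l \<in> L m P"
proof (cases "l < e + 2")
 case True
 have uf: "single u 1 \<in> forms xyz e" by (rule forms_single) (use u in \<open>auto simp: monomials_def\<close>)
 have "to_fract (tsec k u l) * h k / to_fract (single u 1) \<in> L m P" if k: "k < e" for k
 proof -
  have "to_fract (tsec k u l) * h k \<in> L (m + int e) P"
   by (rule loc_form_mult[OF P tsec(1)[OF k u(1) True] h[OF k]]) (use e_pos in \<open>simp add: of_nat_diff\<close>)
  then show ?thesis by (rule loc_form_divide[OF P uf u(2)]) simp
 qed
 then show ?thesis unfolding rinv_def using True by (simp only: if_True) (intro loc_sum[OF P], auto)
qed (use loc_0[OF P] in \<open>simp add: rinv_def\<close>)

text \<open>Every monomial of degree at least e is the product of one of degree e, for which a
  preimage is known, and a cofactor.\<close>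

lemma aT_forms_surjective:
 assumes j: "e \<le> j" and y: "!!k. k < e ==> y k \<in> forms xyz j"
 shows "\<exists>x. (\<forall>l<e + 2. x l \<in> forms xyz (j - 1)) & (\<forall>k<e. (\<Sum>l<e + 2. al l k * x l) = y k)"
proof -
 have "\<exists>u v. t = u + v & u \<in> monomials xyz e & v \<in> monomials xyz (j - e)"
  if "t \<in> monomials xyz j" for t
  using monomial_factor[of t xyz e] that j unfolding monomials_def by fastforce
 then obtain \<mu> \<nu> where \<mu>: "!!t. t \<in> monomials xyz j ==> t = \<mu> t + \<nu> t"
  "!!t. t \<in> monomials xyz j ==> \<mu> t \<in> monomials xyz e"
  "!!t. t \<in> monomials xyz j ==> \<nu> t \<in> monomials xyz (j - e)" by metis
 have ky: "t \<in> monomials xyz j" if "k < e" "t \<in> keys (y k)" for k t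
  using y[OF that(1)] that(2) by (auto simp: forms_def polys_def monomials_def)
 define x where "x l = (\<Sum>k0<e. \<Sum>t\<in>keys (y k0).
   single (\<nu> t) (lookup (y k0) t) * tsec k0 (\<mu> t) l)" for l
 have "x l \<in> forms xyz (j - 1)" if l: "l < e + 2" for l unfolding x_def
 proof (intro forms_sum)
  fix k0 t assume k0: "k0 \<in> {..<e}" and t: "t \<in> keys (y k0)"
  have t': "t \<in> monomials xyz j" using ky k0 t by auto
  have "single (\<nu> t) (lookup (y k0) t) * tsec k0 (\<mu> t) l \<in> forms xyz ((j - e) + (e - 1))"
   by (intro forms_mult forms_single tsec(1)) (use k0 l \<mu>[OF t'] in \<open>auto simp: monomials_def\<close>)
  then show "single (\<nu> t) (lookup (y k0) t) * tsec k0 (\<mu> t) l \<in> forms xyz (j - 1)"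
   using j e_pos by simp
 qed
 moreover have "(\<Sum>l<e + 2. al l k * x l) = y k" if k: "k < e" for k
 proof -
  have "(\<Sum>l<e + 2. al l k * x l) = (\<Sum>l<e + 2. \<Sum>k0<e. \<Sum>t\<in>keys (y k0).
    single (\<nu> t) (lookup (y k0) t) * (al l k * tsec k0 (\<mu> t) l))"
   unfolding x_def sum_distrib_left by (simp only: mult.left_commute)
  also have "\<dots> = (\<Sum>k0<e. \<Sum>l<e + 2. \<Sum>t\<in>keys (y k0).
    single (\<nu> t) (lookup (y k0) t) * (al l k * tsec k0 (\<mu> t) l))" by (rule sum.swap)
  also have "\<dots> = (\<Sum>k0<e. \<Sum>t\<in>keys (y k0). \<Sum>l<e + 2.
    single (\<nu> t) (lookup (y k0) t) * (al l k * tsec k0 (\<mu> t) l))"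
   by (rule sum.cong[OF refl]) (rule sum.swap)
  also have "\<dots> = (\<Sum>k0<e. \<Sum>t\<in>keys (y k0).
    single (\<nu> t) (lookup (y k0) t) * (if k = k0 then single (\<mu> t) 1 else 0))"
   unfolding sum_distrib_left[symmetric] by (intro sum.cong refl arg_cong2[of _ _ _ _ "(*)"] tsec(2) k \<mu>(2) ky) auto
  also have "\<dots> = (\<Sum>k0<e. if k0 = k then \<Sum>t\<in>keys (y k).
    single (\<nu> t) (lookup (y k) t) * single (\<mu> t) 1 else 0)"
   by (rule sum.cong) auto
  also have "\<dots> = (\<Sum>t\<in>keys (y k). single (\<nu> t) (lookup (y k) t) * single (\<mu> t) 1)"
   using k by simp
  also have "\<dots> = (\<Sum>t\<in>keys (y k). single 0 (lookup (y k) t) * single t 1)"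
  proof (rule sum.cong[OF refl])
   fix t assume "t \<in> keys (y k)"
   then have "t = \<mu> t + \<nu> t" using \<mu>(1) ky k by blast
   then show "single (\<nu> t) (lookup (y k) t) * single (\<mu> t) 1 =
     single 0 (lookup (y k) t) * single t 1"
    by (simp add: mult_single add.commute[of "\<nu> t"])
  qed
  also have "\<dots> = y k" by (rule poly_sum_monomials[symmetric])
  finally show ?thesis .
 qed
 ultimately show ?thesis by blast
qed

end

section \<open>Cohomology of the kernel sheaf\<close>

locale pencil_cover = pencil e al + cov: plane_cover X \<phi> \<delta> \<iota>
 for e :: nat and al :: "nat => nat => (nat, 'k::field) mpoly"
  and X :: "'x set" and \<phi> :: "'x => 'k xpoly" and \<delta> \<iota> :: "'x => nat"
begin

lemma G_D:
 assumes "z \<in> G m P"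
 shows "z l \<in> L m P" "e + 2 \<le> l ==> z l = 0" "k < e ==> aT z k = 0"
 using assms by (auto simp: G_def)

text \<open>Global sections of O(m + 1) are forms of degree m + 1 or zero. In negative degree there
  is nothing to lift; from degree e on the transpose is onto.\<close>

lemma global_lift:
 assumes m: "int e \<le> m + 1 \<or> m + 1 < 0" and y: "!!k P. k < e ==> P \<in> pp ==> y k \<in> L (m + 1) P"
 shows "\<exists>z. (\<forall>l. \<forall>P\<in>pp. z l \<in> L m P) & (\<forall>l\<ge>e + 2. z l = 0) & (\<forall>k<e. aT z k = y k)"
proof (cases "m + 1 < 0")
 case True
 have "y k = 0" if k: "k < e" for k using global_sections[OF y[OF k]] True by auto
 then show ?thesis using loc_0 by (intro exI[of _ "%_. 0"]) (auto simp: aT_def)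
next
 case False
 define j where "j = nat (m + 1)"
 have j: "e \<le> j" "int j = m + 1" using m False by (auto simp: j_def)
 have "\<exists>Y. Y \<in> forms xyz j & y k = to_fract Y" if k: "k < e" for k
 proof -
  consider "y k = 0" | k' a where "int k' = m + 1" "a \<in> forms xyz k'" "y k = to_fract a"
   using global_sections[OF y[OF k]] by blast
  then show ?thesis
  proof cases
   case 1 then show ?thesis by (intro exI[of _ 0]) auto
  next
   case 2
   moreover have "k' = j" using 2(1) j by simp
   ultimately show ?thesis by blast
  qed
 qed
 then obtain Y where Y: "!!k. k < e ==> Y k \<in> forms xyz j" "!!k. k < e ==> y k = to_fract (Y k)" by metis
 obtain x where x: "!!l. l < e + 2 ==> x l \<in> forms xyz (j - 1)" "!!k. k < e ==> (\<Sum>l<e + 2. al l k * x l) = Y k"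
  using aT_forms_surjective[where y = Y, OF j(1) Y(1)] by auto
 define z where "z l = (if l < e + 2 then to_fract (x l) else 0)" for l
 have "aT z k = y k" if k: "k < e" for k
 proof -
  have "aT z k = to_fract (\<Sum>l<e + 2. al l k * x l)"
   unfolding aT_def to_fract_sum by (rule sum.cong) (auto simp: z_def)
  then show ?thesis using x(2)[OF k] Y(2)[OF k] by simp
 qed
 moreover have "z l \<in> L m P" if P: "P \<in> pp" for l P
 proof -
  have "int (j - 1) = m" using j e_pos by simp
  then show ?thesis using loc_form[OF P x(1), of l] loc_0[OF P] by (auto simp: z_def)
 qed
 ultimately show ?thesis by (intro exI[of _ z]) (auto simp: z_def)
qed

text \<open>A splitting of the cocycle in O(m)^(e+2) leaves the kernel, but its image under
  \<open>aT\<close> is the same for all indices, hence a global section of O(m + 1)^e. Subtracting a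
  global lift of this section returns to the kernel.\<close>

theorem G_H1:
 fixes f :: "'x => 'x => nat => 'k xpoly fract"
 assumes m: "int e \<le> m + 1 \<or> m + 1 < 0"
  and coc: "!!x y z l. x \<in> X ==> y \<in> X ==> z \<in> X ==> f y z l - f x z l + f x y l = 0"
  and reg: "!!x y P. x \<in> X ==> y \<in> X ==> P \<in> pp ==> \<phi> x \<notin> P ==> \<phi> y \<notin> P ==> f x y \<in> G m P"
 shows "\<exists>g. (\<forall>x\<in>X. \<forall>P\<in>pp. \<phi> x \<notin> P --> g x \<in> G m P) & (\<forall>x\<in>X. \<forall>y\<in>X. \<forall>l. f x y l = g y l - g x l)"
proof -
 have gen: "{0} \<in> pp" by (rule generic_point) (use xyz_eq in auto)
 have "\<exists>g. (\<forall>x\<in>X. \<forall>P\<in>pp. \<phi> x \<notin> P --> g x \<in> L m P) & (\<forall>x\<in>X. \<forall>y\<in>X. f x y l = g y - g x)" for l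
  by (rule cov.cech_H1[OF coc G_D(1)[OF reg]])
 then obtain g0 where g0: "!!x l P. x \<in> X ==> P \<in> pp ==> \<phi> x \<notin> P ==> g0 l x \<in> L m P"
  "!!x y l. x \<in> X ==> y \<in> X ==> f x y l = g0 l y - g0 l x" by metis
 define g1 where "g1 x l = (if l < e + 2 then g0 l x else 0)" for x l
 have f0: "f x y l = 0" if "x \<in> X" "y \<in> X" "e + 2 \<le> l" for x y l
  using G_D(2)[OF reg[OF that(1,2) gen] that(3)] cov.nonzero that(1,2) by auto
 have g1: "g1 x l \<in> L m P" if "x \<in> X" "P \<in> pp" "\<phi> x \<notin> P" for x l P
  using g0(1)[OF that] loc_0[OF that(2)] by (auto simp: g1_def)
 have fg: "f x y l = g1 y l - g1 x l" if "x \<in> X" "y \<in> X" for x y l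
  using g0(2)[OF that] f0[OF that] by (auto simp: g1_def)
 obtain x0 where x0: "x0 \<in> X" using cov.cover[OF gen] by blast
 define y where "y k = aT (g1 x0) k" for k
 have yx: "aT (g1 x) k = y k" if "x \<in> X" "k < e" for x k
 proof -
  have "aT (%l. g1 x l - g1 x0 l) k = aT (f x0 x) k" using fg[OF x0 that(1)] by (simp add: aT_def)
  also have "\<dots> = 0" using G_D(3)[OF reg[OF x0 that(1) gen]] cov.nonzero x0 that by auto
  finally show ?thesis by (simp add: aT_diff y_def)
 qed
 have "y k \<in> L (m + 1) P" if k: "k < e" and P: "P \<in> pp" for k P
 proof -
  obtain x where x: "x \<in> X" "\<phi> x \<notin> P" using cov.cover[OF P] by blast
  show ?thesis unfolding yx[OF x(1) k, symmetric] by (rule aT_loc[OF P k g1[OF x(1) P x(2)]])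
 qed
 from global_lift[where y = y, OF m this] obtain z where z: "!!l P. P \<in> pp ==> z l \<in> L m P" "!!l. l \<ge> e + 2 ==> z l = 0"
  "!!k. k < e ==> aT z k = y k" by auto
 define g where "g x l = g1 x l - z l" for x l
 have "g x \<in> G m P" if x: "x \<in> X" "P \<in> pp" "\<phi> x \<notin> P" for x P
 proof -
  have "aT (g x) k = 0" if "k < e" for k
   unfolding g_def[abs_def] aT_diff using yx[OF x(1) that] z(3)[OF that] by simp
  moreover have "g x l \<in> L m P" for l unfolding g_def by (rule loc_diff[OF x(2) g1[OF x] z(1)[OF x(2)]])
  ultimately show ?thesis using z(2) by (auto simp: G_def g_def g1_def)
 qed
 moreover have "f x y l = g y l - g x l" if "x \<in> X" "y \<in> X" for x y l using fg[OF that] by (simp add: g_def)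
 ultimately show ?thesis by blast
qed

lemma mvar_power_monomial: "l \<in> {0, 1, 2} ==> single l e \<in> monomials xyz e"
 by (auto simp: monomials_def)

text \<open>Now \<open>aT\<close> of a splitting in O(m)^(e+2) is a 1-cocycle in O(m + 1)^e, which
  splits in turn. Its splitting is lifted on each member of the cover separately, where the variable
  of index \<open>\<iota> x\<close> is invertible and \<open>rinv\<close> is regular.\<close>

theorem G_H2:
 fixes f :: "'x => 'x => 'x => nat => 'k xpoly fract"
 assumes m: "- 2 \<le> m"
  and coc: "!!x y z w l. x \<in> X ==> y \<in> X ==> z \<in> X ==> w \<in> X ==> f y z w l - f x z w l + f x y w l - f x y z l = 0"
  and reg: "!!x y z P. x \<in> X ==> y \<in> X ==> z \<in> X ==> P \<in> pp ==> \<phi> x \<notin> P ==> \<phi> y \<notin> P ==> \<phi> z \<notin> P ==> f x y z \<in> G m P"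
 shows "\<exists>g. (\<forall>x\<in>X. \<forall>y\<in>X. \<forall>P\<in>pp. \<phi> x \<notin> P --> \<phi> y \<notin> P --> g x y \<in> G m P) &
  (\<forall>x\<in>X. \<forall>y\<in>X. \<forall>z\<in>X. \<forall>l. f x y z l = g y z l - g x z l + g x y l)"
proof -
 have gen: "{0} \<in> pp" by (rule generic_point) (use xyz_eq in auto)
 have "\<exists>g. (\<forall>x\<in>X. \<forall>y\<in>X. \<forall>P\<in>pp. \<phi> x \<notin> P --> \<phi> y \<notin> P --> g x y \<in> L m P) &
   (\<forall>x\<in>X. \<forall>y\<in>X. \<forall>z\<in>X. f x y z l = g y z - g x z + g x y)" for l
  by (rule cov.cech_H2[OF m coc G_D(1)[OF reg]])
 then obtain g0 where g0: "!!x y l P. x \<in> X ==> y \<in> X ==> P \<in> pp ==> \<phi> x \<notin> P ==> \<phi> y \<notin> P ==> g0 l x y \<in> L m P"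
  "!!x y z l. x \<in> X ==> y \<in> X ==> z \<in> X ==> f x y z l = g0 l y z - g0 l x z + g0 l x y" by metis
 define g1 where "g1 x y l = (if l < e + 2 then g0 l x y else 0)" for x y l
 have nz: "\<phi> x \<notin> {0}" if "x \<in> X" for x using cov.nonzero[OF that] by simp
 have g1: "g1 x y l \<in> L m P" if "x \<in> X" "y \<in> X" "P \<in> pp" "\<phi> x \<notin> P" "\<phi> y \<notin> P" for x y l P
  using g0(1)[OF that] loc_0[OF that(3)] by (auto simp: g1_def)
 have fg: "f x y z l = g1 y z l - g1 x z l + g1 x y l" if "x \<in> X" "y \<in> X" "z \<in> X" for x y z l
  using g0(2)[OF that] G_D(2)[OF reg[OF that gen nz nz nz]] that by (auto simp: g1_def not_less)
 have "\<exists>h. (\<forall>x\<in>X. \<forall>P\<in>pp. \<phi> x \<notin> P --> h x \<in> L (m + 1) P) & (\<forall>x\<in>X. \<forall>y\<in>X. aT (g1 x y) k = h y - h x)"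
  if k: "k < e" for k
 proof (rule cov.cech_H1)
  fix x y z assume xyz: "x \<in> X" "y \<in> X" "z \<in> X"
  have "aT (g1 y z) k - aT (g1 x z) k + aT (g1 x y) k = aT (%l. g1 y z l - g1 x z l + g1 x y l) k"
   by (simp add: aT_add[of "%l. g1 y z l - g1 x z l"] aT_diff)
  also have "\<dots> = aT (f x y z) k" using fg[OF xyz] by (simp add: aT_def)
  also have "\<dots> = 0" by (rule G_D(3)[OF reg[OF xyz gen nz nz nz] k]) (use xyz in auto)
  finally show "aT (g1 y z) k - aT (g1 x z) k + aT (g1 x y) k = 0" .
 next
  fix x y P assume "x \<in> X" "y \<in> X" "P \<in> pp" "\<phi> x \<notin> P" "\<phi> y \<notin> P"
  then show "aT (g1 x y) k \<in> L (m + 1) P" by (intro aT_loc k g1)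
 qed
 then have "\<forall>k. \<exists>h. k < e --> (\<forall>x\<in>X. \<forall>P\<in>pp. \<phi> x \<notin> P --> h x \<in> L (m + 1) P) & (\<forall>x\<in>X. \<forall>y\<in>X. aT (g1 x y) k = h y - h x)"
  by blast
 then obtain h0 where h0: "!!k x P. k < e ==> x \<in> X ==> P \<in> pp ==> \<phi> x \<notin> P ==> h0 k x \<in> L (m + 1) P"
  "!!k x y. k < e ==> x \<in> X ==> y \<in> X ==> aT (g1 x y) k = h0 k y - h0 k x" by metis
 define h where "h x = rinv (single (\<iota> x) e) (%k. h0 k x)" for x
 have aTh: "aT (h x) k = h0 k x" if "x \<in> X" "k < e" for x k
  unfolding h_def using aT_rinv[OF mvar_power_monomial that(2)] cov.chart(1)[OF that(1)] by simp
 have h: "h x l \<in> L m P" if x: "x \<in> X" "P \<in> pp" "\<phi> x \<notin> P" for x l P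
 proof -
  have "mvar (\<iota> x) \<in> forms xyz 1" by (rule forms_mvar) (use cov.chart(1)[OF x(1)] in auto)
  then have "single (single (\<iota> x) e) 1 \<notin> P"
   using forms_power_notin[OF x(2) _ cov.chart(2)[OF x], of 1 e] by (simp add: mvar_power)
  from rinv_loc[OF x(2) mvar_power_monomial[OF cov.chart(1)[OF x(1)]] this h0(1)[OF _ x]]
  show ?thesis unfolding h_def .
 qed
 define g where "g x y l = g1 x y l - (h y l - h x l)" for x y l
 have "g x y \<in> G m P" if xy: "x \<in> X" "y \<in> X" "P \<in> pp" "\<phi> x \<notin> P" "\<phi> y \<notin> P" for x y P
 proof -
  have "aT (g x y) k = 0" if k: "k < e" for k
  proof -
   have "aT (g x y) k = aT (g1 x y) k - (aT (h y) k - aT (h x) k)"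
    unfolding g_def[abs_def] aT_diff ..
   then show ?thesis using h0(2)[OF k xy(1,2)] aTh xy k by simp
  qed
  moreover have "g x y l \<in> L m P" for l
   unfolding g_def by (intro loc_diff[OF xy(3)] g1 h xy)
  moreover have "g x y l = 0" if "e + 2 \<le> l" for l using that by (simp add: g_def g1_def h_def rinv_def)
  ultimately show ?thesis by (auto simp: G_def)
 qed
 moreover have "f x y z l = g y z l - g x z l + g x y l" if "x \<in> X" "y \<in> X" "z \<in> X" for x y z l
  using fg[OF that] by (simp add: g_def)
 ultimately show ?thesis by blast
qed

end

section \<open>Sections of the cokernel\<close>

lemma mk_module_sel [simp]: "carrier (mk_module A pl z sm) = A" "add (mk_module A pl z sm) = pl"
 "zero (mk_module A pl z sm) = z" "smult (mk_module A pl z sm) = sm"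
 by (simp_all add: mk_module_def)

definition fam :: "nat => 'p set => (nat => 'v) => nat => 'p => 'v" where
 "fam n U w = (\<lambda>i\<in>{..<n}. cst U (w i))"

lemma fam_eq_iff: "p \<in> U ==> fam n U w = fam n U w' \<longleftrightarrow> (\<forall>i<n. w i = w' i)"
proof
 assume p: "p \<in> U"
 show "\<forall>i<n. w i = w' i" if "fam n U w = fam n U w'"
 proof (intro allI impI)
  fix i assume i: "i < n"
  have "fam n U w i = fam n U w' i" using that by simp
  then show "w i = w' i" using i cst_eq[OF p, of "w i" "w' i"] by (simp add: fam_def)
 qed
qed (auto simp: fam_def)

lemma direct_power_O_carrier:
 assumes U: "openin (proj_top I) U"
 shows "carrier (sec (direct_power n (proj_O I m)) U) = {fam n U w | w. \<forall>i<n. \<forall>P\<in>U. w i \<in> loc I m P}"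
proof (intro equalityI subsetI)
 fix s assume "s \<in> carrier (sec (direct_power n (proj_O I m)) U)"
 then have s: "s \<in> {..<n} \<rightarrow>\<^sub>E O_sections I m U" by (simp add: direct_power_def proj_O_def)
 then have "\<forall>i. \<exists>v. i < n --> s i = cst U v & (\<forall>P\<in>U. v \<in> loc I m P)"
  using O_sections_eq[OF U] by (auto simp: PiE_def Pi_def)
 then obtain w where w: "!!i. i < n ==> s i = cst U (w i) & (\<forall>P\<in>U. w i \<in> loc I m P)" by metis
 then have "s = fam n U w" using s by (auto simp: fam_def PiE_def extensional_def fun_eq_iff)
 then show "s \<in> {fam n U w | w. \<forall>i<n. \<forall>P\<in>U. w i \<in> loc I m P}" using w by blast
next
 fix s assume "s \<in> {fam n U w | w. \<forall>i<n. \<forall>P\<in>U. w i \<in> loc I m P}"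
 then show "s \<in> carrier (sec (direct_power n (proj_O I m)) U)"
  by (auto simp: direct_power_def proj_O_def fam_def cst_O_sections[OF U])
qed

lemma direct_power_O_add:
 "fam n U w \<oplus>\<^bsub>sec (direct_power n (proj_O I m)) U\<^esub> fam n U w' = fam n U (%i. w i + w' i)"
 by (auto simp: direct_power_def proj_O_def fam_def cst_lift2 intro!: restrict_ext)

lemma direct_power_O_zero: "\<zero>\<^bsub>sec (direct_power n (proj_O I m)) U\<^esub> = fam n U (%_. 0)"
 by (auto simp: direct_power_def proj_O_def fam_def cst_def)

lemma direct_power_O_smult:
 "cst U x \<odot>\<^bsub>sec (direct_power n (proj_O I m)) U\<^esub> fam n U w = fam n U (%i. x * w i)"
 by (auto simp: direct_power_def proj_O_def fam_def cst_lift2 intro!: restrict_ext)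

lemma direct_power_O_res: "V \<subseteq> U ==> res (direct_power n (proj_O I m)) U V (fam n U w) = fam n V w"
 by (auto simp: direct_power_def proj_O_def fam_def restrict_cst intro!: restrict_ext)

section \<open>The cokernel presheaf, its germs and the associated sheaf\<close>

locale matrix_pencil =
 fixes e :: nat and \<alpha> :: "(nat, 'k::field) mpoly mat"
 assumes dim: "\<alpha> \<in> carrier_mat (e + 2) e"
  and pencil: "pencil e (%i j. \<alpha> $$ (i, j))"
begin

sublocale pencil e "%i j. \<alpha> $$ (i, j)"
 by (rule pencil)

abbreviation "PP \<equiv> proj xyz :: ('k xpoly set, (nat, 'k) proj_fun) ringed_space"
abbreviation "EE \<equiv> direct_power e (proj_O xyz (int e - 1)) :: ('k xpoly set, (nat, 'k) proj_fun, nat => (nat, 'k) proj_fun) mod_presheaf"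
abbreviation "FF \<equiv> direct_power (e + 2) (proj_O xyz (int e)) :: ('k xpoly set, (nat, 'k) proj_fun, nat => (nat, 'k) proj_fun) mod_presheaf"
abbreviation "CC \<equiv> coker_presheaf EE FF (matrix_map \<alpha>)"
abbreviation "KK \<equiv> coker_sheaf PP EE FF (matrix_map \<alpha>)"

abbreviation opn :: "'k xpoly set set => bool" where
 "opn \<equiv> openin (proj_top xyz)"

definition regE :: "'k xpoly set set => (nat => 'k xpoly fract) => bool" where
 "regE U c \<longleftrightarrow> (\<forall>k<e. \<forall>P\<in>U. c k \<in> L (int e - 1) P)"

definition regF :: "'k xpoly set set => (nat => 'k xpoly fract) => bool" where
 "regF U w \<longleftrightarrow> (\<forall>i<e + 2. \<forall>P\<in>U. w i \<in> L (int e) P)"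

definition coset :: "'k xpoly set set => (nat => 'k xpoly fract) => (nat => (nat, 'k) proj_fun) set" where
 "coset U w = {fam (e + 2) U (%i. aM c i + w i) | c. regE U c}"

lemma opn_pp: "opn U ==> P \<in> U ==> P \<in> pp"
 using open_subset_points by blast

lemma regE_add: "opn U ==> regE U c ==> regE U c' ==> regE U (%k. c k + c' k)"
 and regE_diff: "opn U ==> regE U c ==> regE U c' ==> regE U (%k. c k - c' k)"
 and regE_0: "opn U ==> regE U (%_. 0)"
 and regF_add: "opn U ==> regF U w ==> regF U w' ==> regF U (%k. w k + w' k)"
 and regF_0: "opn U ==> regF U (%_. 0)"
 unfolding regE_def regF_def by (simp_all add: loc_add loc_diff loc_0 opn_pp[of U])

lemma regE_subset: "regE U c ==> V \<subseteq> U ==> regE V c"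
 and regF_subset: "regF U w ==> V \<subseteq> U ==> regF V w"
 by (auto simp: regE_def regF_def)

lemma FF_carrier: "opn U ==> carrier (sec FF U) = {fam (e + 2) U w | w. regF U w}"
 by (simp add: direct_power_O_carrier regF_def)

lemma aM_0: "aM (%_. 0) i = 0"
 by (simp add: aM_def)

lemma aM_scale: "aM (%k. x * c k) i = x * aM c i"
 by (simp add: aM_def sum_distrib_left mult.left_commute)

lemma matrix_image:
 assumes U: "opn U"
 shows "matrix_map \<alpha> U ` carrier (sec EE U) = coset U (%_. 0)"
proof -
 have "matrix_map \<alpha> U (fam e U c) = fam (e + 2) U (%i. aM c i + 0)" for c
  using dim unfolding matrix_map_def fam_def
  by (auto simp: aM_def to_fract_def cst_def intro!: restrict_ext)
 then have "matrix_map \<alpha> U ` {fam e U c | c. regE U c} = coset U (%_. 0)"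
  unfolding coset_def setcompr_eq_image image_image by simp
 then show ?thesis unfolding direct_power_O_carrier[OF U] regE_def .
qed

lemma coset_r_coset:
 assumes U: "opn U"
 shows "matrix_map \<alpha> U ` carrier (sec EE U) +>\<^bsub>sec FF U\<^esub> fam (e + 2) U w = coset U w"
proof -
 have "coset U (%_. 0) +>\<^bsub>sec FF U\<^esub> fam (e + 2) U w =
   (%a. a \<oplus>\<^bsub>sec FF U\<^esub> fam (e + 2) U w) ` coset U (%_. 0)"
  unfolding a_r_coset_def' by (rule UNION_singleton_eq_range)
 also have "\<dots> = coset U w"
  unfolding coset_def setcompr_eq_image image_image direct_power_O_add by simp
 finally show ?thesis unfolding matrix_image[OF U] .
qed

lemma coset_shift:
 assumes U: "opn U" and c: "regE U c"
 shows "coset U (%i. aM c i + w i) = coset U w"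
proof (intro equalityI subsetI)
 fix s assume "s \<in> coset U (%i. aM c i + w i)"
 then obtain c' where c': "s = fam (e + 2) U (%i. aM c' i + (aM c i + w i))" "regE U c'"
  by (auto simp: coset_def)
 then have "s = fam (e + 2) U (%i. aM (%k. c' k + c k) i + w i)" by (simp add: aM_add add.assoc)
 then show "s \<in> coset U w" using regE_add[OF U c'(2) c] unfolding coset_def by blast
next
 fix s assume "s \<in> coset U w"
 then obtain c' where c': "s = fam (e + 2) U (%i. aM c' i + w i)" "regE U c'"
  by (auto simp: coset_def)
 then have "s = fam (e + 2) U (%i. aM (%k. c' k - c k) i + (aM c i + w i))" by (simp add: aM_diff)
 then show "s \<in> coset U (%i. aM c i + w i)" using regE_diff[OF U c'(2) c] unfolding coset_def by blast
qed

lemma coset_cong: "(!!i. i < e + 2 ==> w i = w' i) ==> coset U w = coset U w'"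
proof -
 assume "!!i. i < e + 2 ==> w i = w' i"
 then have "fam (e + 2) U (%i. aM c i + w i) = fam (e + 2) U (%i. aM c i + w' i)" for c
  by (auto simp: fam_def intro!: restrict_ext)
 then show ?thesis by (simp add: coset_def)
qed

lemma coset_self:
 assumes "opn U" shows "fam (e + 2) U w \<in> coset U w"
proof -
 have "fam (e + 2) U w = fam (e + 2) U (%i. aM (%_. 0) i + w i)" unfolding aM_0 add_0_left ..
 then show ?thesis unfolding coset_def using regE_0[OF assms] by blast
qed

lemma coset_eqD:
 assumes U: "opn U" "p \<in> U" and eq: "coset U w = coset U w'"
 shows "\<exists>c. regE U c & (\<forall>i<e + 2. w i = aM c i + w' i)"
proof -
 have "fam (e + 2) U w \<in> coset U w'" using coset_self[OF U(1), of w] eq by simp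
 then obtain c where c: "regE U c" "fam (e + 2) U w = fam (e + 2) U (%i. aM c i + w' i)"
  unfolding coset_def by auto
 show ?thesis using c(1) c(2)[unfolded fam_eq_iff[OF U(2)]] by (intro exI[of _ c] conjI)
qed

lemma CC_carrier:
 assumes U: "opn U"
 shows "carrier (sec CC U) = {coset U w | w. regF U w}"
proof -
 have "carrier (sec CC U) = a_rcosets\<^bsub>sec FF U\<^esub> (matrix_map \<alpha> U ` carrier (sec EE U))"
  by (simp add: coker_presheaf_def Let_def)
 also have "\<dots> = (\<Union>a\<in>{fam (e + 2) U w | w. regF U w}. {matrix_map \<alpha> U ` carrier (sec EE U) +>\<^bsub>sec FF U\<^esub> a})"
  unfolding A_RCOSETS_def' FF_carrier[OF U] ..
 also have "\<dots> = {coset U w | w. regF U w}"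
  unfolding UNION_singleton_eq_range setcompr_eq_image image_image coset_r_coset[OF U] ..
 finally show ?thesis .
qed

lemma CC_res:
 assumes U: "opn U" and V: "opn V" "V \<subseteq> U"
 shows "res CC U V (coset U w) = coset V w"
proof -
 have *: "matrix_map \<alpha> V ` carrier (sec EE V) +>\<^bsub>sec FF V\<^esub> res FF U V a = coset V w" if aC: "a \<in> coset U w" for a
 proof -
  obtain c where c: "a = fam (e + 2) U (%i. aM c i + w i)" "regE U c" using aC by (auto simp: coset_def)
  show ?thesis unfolding c(1) direct_power_O_res[OF V(2)] coset_r_coset[OF V(1)]
   by (rule coset_shift[OF V(1) regE_subset[OF c(2) V(2)]])
 qed
 have "coset U w ~= {}" using coset_self[OF U] by blast
 then show ?thesis unfolding coker_presheaf_def Let_def by (simp add: *)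
qed

lemma CC_add:
 assumes U: "opn U"
 shows "coset U w \<oplus>\<^bsub>sec CC U\<^esub> coset U w' = coset U (%i. w i + w' i)"
proof -
 have "set_add (sec FF U) (coset U w) (coset U w') = coset U (%i. w i + w' i)"
 proof (intro equalityI subsetI)
  fix s assume "s \<in> set_add (sec FF U) (coset U w) (coset U w')"
  then obtain a b where "a \<in> coset U w" "b \<in> coset U w'" "s = a \<oplus>\<^bsub>sec FF U\<^esub> b"
   unfolding set_add_def' by auto
  then obtain c c' where c: "regE U c" "regE U c'"
   "s = fam (e + 2) U (%i. aM c i + w i) \<oplus>\<^bsub>sec FF U\<^esub> fam (e + 2) U (%i. aM c' i + w' i)"
   unfolding coset_def by auto
  have "s = fam (e + 2) U (%i. aM (%k. c k + c' k) i + (w i + w' i))"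
   unfolding c(3) direct_power_O_add aM_add by (simp add: algebra_simps)
  then show "s \<in> coset U (%i. w i + w' i)" using regE_add[OF U c(1,2)] unfolding coset_def by blast
 next
  fix s assume "s \<in> coset U (%i. w i + w' i)"
  then obtain c where c: "regE U c" "s = fam (e + 2) U (%i. aM c i + (w i + w' i))" unfolding coset_def by blast
  have "s = fam (e + 2) U (%i. aM c i + w i) \<oplus>\<^bsub>sec FF U\<^esub> fam (e + 2) U w'"
   unfolding c(2) direct_power_O_add by (simp add: add.assoc)
  moreover have "fam (e + 2) U (%i. aM c i + w i) \<in> coset U w" using c(1) unfolding coset_def by blast
  ultimately show "s \<in> set_add (sec FF U) (coset U w) (coset U w')"
   unfolding set_add_def' using coset_self[OF U, of w'] by auto
 qed
 then show ?thesis unfolding coker_presheaf_def Let_def by simp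
qed

lemma CC_zero: "opn U ==> \<zero>\<^bsub>sec CC U\<^esub> = coset U (%_. 0)"
 unfolding coker_presheaf_def Let_def by (simp add: matrix_image)

lemma CC_smult:
 assumes U: "opn U" and x: "!!P. P \<in> U ==> x \<in> L 0 P"
 shows "cst U x \<odot>\<^bsub>sec CC U\<^esub> coset U w = coset U (%i. x * w i)"
proof -
 have *: "matrix_map \<alpha> U ` carrier (sec EE U) +>\<^bsub>sec FF U\<^esub> (cst U x \<odot>\<^bsub>sec FF U\<^esub> a) = coset U (%i. x * w i)"
  if aC: "a \<in> coset U w" for a
 proof -
  obtain c where c: "a = fam (e + 2) U (%i. aM c i + w i)" "regE U c" using aC by (auto simp: coset_def)
  have "regE U (%k. x * c k)" unfolding regE_def
  proof (intro allI impI ballI)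
   fix k P assume "k < e" and P: "P \<in> U"
   then have "c k \<in> L (int e - 1) P" using c(2) by (simp add: regE_def)
   then show "x * c k \<in> L (int e - 1) P" by (rule loc_mult'[OF opn_pp[OF U P] x[OF P]]) simp
  qed
  then show ?thesis unfolding c(1) direct_power_O_smult coset_r_coset[OF U] distrib_left aM_scale[symmetric]
   by (rule coset_shift[OF U])
 qed
 have "coset U w ~= {}" using coset_self[OF U] by blast
 then show ?thesis unfolding coker_presheaf_def Let_def by (simp add: *)
qed

text \<open>The germs of the cokernel at a point correspond to the vectors \<open>BB w\<close> in the stalk of the kernel of \<open>aT\<close>.\<close>

definition Germ :: "'k xpoly set => (nat => 'k xpoly fract) =>
  ('k xpoly set set \<times> (nat => (nat, 'k) proj_fun) set) set" where
 "Germ p z = {(V, t). opn V & p \<in> V & (\<exists>w. regF V w & t = coset V w & BB w = z)}"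

lemma coset_BB:
 assumes "opn U" "p \<in> U" "coset U w = coset U w'"
 shows "BB w = BB w'"
proof
 fix l
 obtain c where c: "\<forall>i<e + 2. w i = aM c i + w' i" using coset_eqD[OF assms] by blast
 then have "BB w l = BB (%i. aM c i + w' i) l" by (intro BB_cong) simp
 also have "\<dots> = BB w' l" by (simp add: BB_add BB_aM)
 finally show "BB w l = BB w' l" .
qed

lemma regular_neighbourhood:
 assumes "p \<in> pp" "finite A" "!!x. x \<in> A ==> v x \<in> L n p" "opn U" "p \<in> U"
 shows "\<exists>W. opn W & p \<in> W & W \<subseteq> U & (\<forall>x\<in>A. \<forall>q\<in>W. v x \<in> L n q)"
proof -
 obtain f l where f: "f \<in> forms xyz l" "f \<notin> p" "!!R. R \<in> pp ==> f \<notin> R ==> \<forall>x\<in>A. v x \<in> L n R"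
  using loc_open_finite[where v = v, OF assms(1-3)] by auto
 show ?thesis
  by (intro exI[of _ "U \<inter> pbasic xyz f"])
   (use assms(1,4,5) f openin_pbasic[OF f(1)] in \<open>auto simp: pbasic_def\<close>)
qed

text \<open>If two sections have the same image under \<open>BB\<close>, they differ, by exactness
  on the stalk at \<open>p\<close>, by the image of a vector regular at \<open>p\<close>; it is
  regular on a neighbourhood, where the cosets then coincide. Conversely \<open>BB\<close> kills the
  image of \<open>aM\<close>.\<close>

lemma germ_coset:
 assumes U: "opn U" "p \<in> U" and w: "regF U w"
 shows "germ PP CC p U (coset U w) = Germ p (BB w)"
proof (intro equalityI subsetI)
 fix Vt assume "Vt \<in> germ PP CC p U (coset U w)"
 then obtain V t W where V: "Vt = (V, t)" "opn V" "p \<in> V" "t \<in> carrier (sec CC V)"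
  and W: "opn W" "p \<in> W" "W \<subseteq> U \<inter> V" "res CC U W (coset U w) = res CC V W t"
  unfolding germ_def by auto
 obtain w' where w': "regF V w'" "t = coset V w'" using V(4) CC_carrier[OF V(2)] by auto
 have "coset W w = coset W w'"
  using W(4) unfolding w'(2) CC_res[OF U(1) W(1) order_trans[OF W(3) Int_lower1]]
   CC_res[OF V(2) W(1) order_trans[OF W(3) Int_lower2]] .
 then have "BB w = BB w'" using coset_BB[OF W(1,2)] by blast
 then show "Vt \<in> Germ p (BB w)" unfolding Germ_def V(1) using V(2,3) w' by auto
next
 fix Vt assume "Vt \<in> Germ p (BB w)"
 then obtain V w' where V: "Vt = (V, coset V w')" "opn V" "p \<in> V" "regF V w'" "BB w' = BB w"
  unfolding Germ_def by auto
 have p: "p \<in> pp" using opn_pp[OF U] .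
 have "\<exists>c. (\<forall>k. c k \<in> L (int e - 1) p) & (\<forall>i<e + 2. w i - w' i = aM c i)"
 proof (rule BB_exact[OF p])
  show "w i - w' i \<in> L (int e) p" if "i < e + 2" for i
   using w V(4) U(2) V(3) that loc_diff[OF p] by (auto simp: regF_def)
  show "BB (%i. w i - w' i) l = 0" for l unfolding BB_diff using V(5) by simp
 qed
 then obtain c where c: "!!k. c k \<in> L (int e - 1) p" "\<forall>i<e + 2. w i - w' i = aM c i" by blast
 have UV: "opn (U \<inter> V)" "p \<in> U \<inter> V" using U V by auto
 obtain W where W: "opn W" "p \<in> W" "W \<subseteq> U \<inter> V" "\<forall>k\<in>{..<e}. \<forall>q\<in>W. c k \<in> L (int e - 1) q"
  using regular_neighbourhood[where v = c, OF p _ c(1) UV, of "{..<e}"] by auto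
 have "coset W w = coset W (%i. aM c i + w' i)" by (rule coset_cong) (use c(2) in \<open>simp add: algebra_simps\<close>)
 also have "\<dots> = coset W w'" by (rule coset_shift[OF W(1)]) (use W(4) in \<open>simp add: regE_def\<close>)
 finally have "res CC U W (coset U w) = res CC V W (coset V w')"
  using CC_res[OF U(1) W(1)] CC_res[OF V(2) W(1)] W(3) by simp
 moreover have "coset V w' \<in> carrier (sec CC V)" using CC_carrier[OF V(2)] V(4) by auto
 ultimately show "Vt \<in> germ PP CC p U (coset U w)" unfolding germ_def V(1) using V(2,3) W by auto
qed

lemma Germ_member_inject:
 assumes eq: "Germ p z = Germ p z'" and Vt: "(V, t) \<in> Germ p z"
 shows "z = z'"
proof -
 have Vt': "(V, t) \<in> Germ p z'" using Vt unfolding eq .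
 obtain w where w: "opn V" "p \<in> V" "t = coset V w" "BB w = z" using Vt unfolding Germ_def by auto
 obtain w' where w': "t = coset V w'" "BB w' = z'" using Vt' unfolding Germ_def by auto
 have "BB w = BB w'" by (rule coset_BB[OF w(1,2)]) (use w(3) w'(1) in simp)
 then show ?thesis using w(4) w'(2) by simp
qed

lemma Germ_inject:
 assumes eq: "Germ p z = Germ p z'" and "Germ p z ~= {}"
 shows "z = z'"
proof -
 obtain x where "x \<in> Germ p z" using assms(2) by (auto simp only: ex_in_conv[symmetric])
 then have "(fst x, snd x) \<in> Germ p z" by simp
 then show ?thesis by (rule Germ_member_inject[OF eq])
qed

text \<open>A lift of \<open>z\<close> through \<open>BB\<close> at \<open>p\<close> has entries in
  O(e), since \<open>BB\<close> raises degrees by e, and it stays regular near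
  \<open>p\<close>.\<close>

lemma Germ_nonempty:
 assumes p: "p \<in> pp" and z: "z \<in> G (2 * int e) p" and U: "opn U" "p \<in> U"
 shows "\<exists>V w. opn V & p \<in> V & V \<subseteq> U & regF V w & BB w = z"
proof -
 obtain w where w: "!!i. w i \<in> L (2 * int e - int e) p" "BB w = z" using G_lift[OF p z] by auto
 obtain W where "opn W" "p \<in> W" "W \<subseteq> U" "\<forall>i\<in>{..<e + 2}. \<forall>q\<in>W. w i \<in> L (2 * int e - int e) q"
  using regular_neighbourhood[where v = w, OF p _ w(1) U, of "{..<e + 2}"] by auto
 then show ?thesis using w(2) by (intro exI[of _ W] exI[of _ w]) (auto simp: regF_def)
qed

definition ksec :: "'k xpoly set set => (nat => 'k xpoly fract) =>
  'k xpoly set => ('k xpoly set set \<times> (nat => (nat, 'k) proj_fun) set) set" where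
 "ksec U z = (\<lambda>p\<in>U. Germ p z)"

text \<open>Locally a section is represented by some \<open>w\<close>, and \<open>BB w\<close> can
  be read off at the generic point, which lies in every nonempty neighbourhood. So all local
  representatives yield the same vector \<open>z\<close>; conversely such a vector lifts locally
  through \<open>BB\<close>.\<close>

lemma KK_carrier:
 assumes U: "opn U"
 shows "carrier (sec KK U) = {ksec U z | z. \<forall>p\<in>U. z \<in> G (2 * int e) p}"
proof (intro equalityI subsetI)
 fix \<sigma> assume "\<sigma> \<in> carrier (sec KK U)"
 then have \<sigma>: "\<sigma> \<in> extensional U" "!!p. p \<in> U ==> \<exists>V. opn V & p \<in> V & V \<subseteq> U &
   (\<exists>t\<in>carrier (sec CC V). \<forall>q\<in>V. \<sigma> q = germ PP CC q V t)"
  by (simp_all add: coker_sheaf_def sheafify_def)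
 have loc: "\<exists>V w. opn V & p \<in> V & V \<subseteq> U & regF V w & (\<forall>q\<in>V. \<sigma> q = Germ q (BB w))" if p: "p \<in> U" for p
 proof -
  obtain V t where V: "opn V" "p \<in> V" "V \<subseteq> U" "t \<in> carrier (sec CC V)" "\<forall>q\<in>V. \<sigma> q = germ PP CC q V t"
   using \<sigma>(2)[OF p] by auto
  obtain w where w: "regF V w" "t = coset V w" using V(4) CC_carrier[OF V(1)] by auto
  have "\<sigma> q = Germ q (BB w)" if "q \<in> V" for q
   using V(5) germ_coset[OF V(1) that w(1)] that w(2) by simp
  then show ?thesis using V(1-3) w(1) by (intro exI[of _ V] exI[of _ w]) simp
 qed
 define z where "z = (if U = {} then (%_. 0) else (SOME z. \<sigma> {0} = Germ {0} z))"
 have *: "\<sigma> p = Germ p z & z \<in> G (2 * int e) p" if p: "p \<in> U" for p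
 proof -
  obtain V w where V: "opn V" "p \<in> V" "V \<subseteq> U" "regF V w" "\<forall>q\<in>V. \<sigma> q = Germ q (BB w)"
   using loc[OF p] by auto
  have 0: "{0} \<in> V" by (rule generic_in_open[OF V(1,2)])
  have "\<sigma> {0} = Germ {0} (BB w)" using 0 V(5) by blast
  then have "\<sigma> {0} = Germ {0} (SOME z. \<sigma> {0} = Germ {0} z)" by (rule someI[where x = "BB w"])
  moreover have "z = (SOME z. \<sigma> {0} = Germ {0} z)" using p unfolding z_def by (metis empty_iff)
  ultimately have eq: "Germ {0} (BB w) = Germ {0} z" using bspec[OF V(5) 0] by metis
  have "(V, coset V w) \<in> Germ {0} (BB w)" unfolding Germ_def
   by (intro CollectI case_prodI conjI exI[of _ w] refl V(1,4) 0)
  then have zw: "BB w = z" by (rule Germ_member_inject[OF eq])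
  have "BB w \<in> G (int e + int e) p" by (rule BB_G[OF opn_pp[OF V(1,2)]]) (use V in \<open>auto simp: regF_def\<close>)
  then have G: "z \<in> G (2 * int e) p" unfolding zw mult_2 .
  have "\<sigma> p = Germ p z" using bspec[OF V(5,2)] unfolding zw .
  then show ?thesis using G by (rule conjI)
 qed
 have "\<sigma> = ksec U z" using \<sigma>(1) * by (auto simp: ksec_def extensional_def fun_eq_iff)
 then show "\<sigma> \<in> {ksec U z | z. \<forall>p\<in>U. z \<in> G (2 * int e) p}" using * by blast
next
 fix \<sigma> assume "\<sigma> \<in> {ksec U z | z. \<forall>p\<in>U. z \<in> G (2 * int e) p}"
 then obtain z where z: "\<sigma> = ksec U z" "!!p. p \<in> U ==> z \<in> G (2 * int e) p" by blast
 have "\<exists>V. opn V & p \<in> V & V \<subseteq> U & (\<exists>t\<in>carrier (sec CC V). \<forall>q\<in>V. \<sigma> q = germ PP CC q V t)" if p: "p \<in> U" for p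
 proof -
  obtain V w where V: "opn V" "p \<in> V" "V \<subseteq> U" "regF V w" "BB w = z"
   using Germ_nonempty[OF opn_pp[OF U p] z(2)[OF p] U p] by (elim exE conjE)
  have "coset V w \<in> carrier (sec CC V)" using CC_carrier[OF V(1)] V(4) by auto
  moreover have "\<sigma> q = germ PP CC q V (coset V w)" if "q \<in> V" for q
   using germ_coset[OF V(1) that V(4)] that V(3,5) by (auto simp: z(1) ksec_def)
  ultimately show ?thesis
   by (intro exI[of _ V] conjI bexI[of _ "coset V w"] V(1-3) ballI)
 qed
 then show "\<sigma> \<in> carrier (sec KK U)" by (simp add: coker_sheaf_def sheafify_def z(1) ksec_def)
qed

lemma ksec_inject:
 assumes U: "opn U" "p \<in> U" and z: "z \<in> G (2 * int e) p" and eq: "ksec U z = ksec U z'"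
 shows "z = z'"
proof -
 have "Germ p z = Germ p z'" using fun_cong[OF eq, of p] U(2) by (simp add: ksec_def)
 moreover have "Germ p z ~= {}"
  using Germ_nonempty[OF opn_pp[OF U] z U] by (auto simp: Germ_def)
 ultimately show ?thesis by (rule Germ_inject)
qed

text \<open>Operations on germs are unions over all representatives; there is at least one, and if
  each gives the same set, the union is that set.\<close>

lemma Germ_op:
 assumes p: "p \<in> pp" and z: "z \<in> G (2 * int e) p" and *: "!!V t. (V, t) \<in> Germ p z ==> h V t = R"
 shows "(\<Union>(V, t)\<in>Germ p z. h V t) = R"
proof -
 have "opn pp" using openin_topspace[of "proj_top xyz"] by (simp add: topspace_proj_top)
 then have "Germ p z ~= {}" using Germ_nonempty[OF p z _ p] by (auto simp: Germ_def)
 then show ?thesis using * by auto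
qed

lemma germ_add_Germ:
 assumes p: "p \<in> pp" and z: "z \<in> G (2 * int e) p" "z' \<in> G (2 * int e) p"
 shows "germ_add PP CC p (Germ p z) (Germ p z') = Germ p (%l. z l + z' l)"
 unfolding germ_add_def
proof (rule Germ_op[OF p z(1)], rule Germ_op[OF p z(2)])
 fix U s V t assume "(U, s) \<in> Germ p z" "(V, t) \<in> Germ p z'"
 then obtain w w' where w: "opn U" "p \<in> U" "regF U w" "s = coset U w" "BB w = z"
  and w': "opn V" "p \<in> V" "regF V w'" "t = coset V w'" "BB w' = z'" unfolding Germ_def by auto
 have UV: "opn (U \<inter> V)" "p \<in> U \<inter> V" using w w' by auto
 have "regF (U \<inter> V) (%i. w i + w' i)"
  by (rule regF_add[OF UV(1)]) (use w w' regF_subset in auto)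
 moreover have "BB (%i. w i + w' i) = (%l. z l + z' l)" using w(5) w'(5) by (auto simp: BB_add fun_eq_iff)
 ultimately show "germ PP CC p (U \<inter> V) (res CC U (U \<inter> V) s \<oplus>\<^bsub>sec CC (U \<inter> V)\<^esub> res CC V (U \<inter> V) t) = Germ p (%l. z l + z' l)"
  using CC_res[OF w(1) UV(1)] CC_res[OF w'(1) UV(1)] CC_add[OF UV(1)] germ_coset[OF UV] w(4) w'(4) by simp
qed

lemma germ_smult_Germ:
 assumes U: "opn U" "p \<in> U" and z: "z \<in> G (2 * int e) p" and x: "!!P. P \<in> U ==> x \<in> L 0 P"
 shows "germ_smult PP CC p U (cst U x) (Germ p z) = Germ p (%l. x * z l)"
 unfolding germ_smult_def
proof (rule Germ_op[OF opn_pp[OF U] z])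
 fix V t assume "(V, t) \<in> Germ p z"
 then obtain w where w: "opn V" "p \<in> V" "regF V w" "t = coset V w" "BB w = z" unfolding Germ_def by auto
 have UV: "opn (U \<inter> V)" "p \<in> U \<inter> V" using U w by auto
 have "regF (U \<inter> V) (%i. x * w i)" unfolding regF_def
 proof (intro allI impI ballI)
  fix i P assume "i < e + 2" and P: "P \<in> U \<inter> V"
  then have "w i \<in> L (int e) P" using w(3) by (simp add: regF_def)
  then show "x * w i \<in> L (int e) P" using loc_mult'[OF opn_pp[OF U(1)] x] P by auto
 qed
 moreover have "BB (%i. x * w i) = (%l. x * z l)" using w(5) by (auto simp: BB_scale fun_eq_iff)
 ultimately show "germ PP CC p (U \<inter> V) (rs_res PP U (U \<inter> V) (cst U x) \<odot>\<^bsub>sec CC (U \<inter> V)\<^esub> res CC V (U \<inter> V) t) = Germ p (%l. x * z l)"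
  using CC_res[OF w(1) UV(1)] CC_smult[OF UV(1)] germ_coset[OF UV] x w(4)
  by (simp add: restrict_cst)
qed

lemma KK_add:
 assumes U: "opn U" and z: "!!p. p \<in> U ==> z \<in> G (2 * int e) p" "!!p. p \<in> U ==> z' \<in> G (2 * int e) p"
 shows "ksec U z \<oplus>\<^bsub>sec KK U\<^esub> ksec U z' = ksec U (%l. z l + z' l)"
 using germ_add_Germ[OF opn_pp[OF U] z]
 by (auto simp: coker_sheaf_def sheafify_def ksec_def intro!: restrict_ext)

lemma KK_zero:
 assumes U: "opn U"
 shows "\<zero>\<^bsub>sec KK U\<^esub> = ksec U (%_. 0)"
proof -
 have "BB (%i. 0 * 0) l = 0" for l by (subst BB_scale) simp
 then have "BB (%_. 0) = (%_. 0)" by (simp add: fun_eq_iff)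
 then have "germ PP CC p U \<zero>\<^bsub>sec CC U\<^esub> = Germ p (%_. 0)" if "p \<in> U" for p
  unfolding CC_zero[OF U] using germ_coset[OF U that regF_0[OF U]] by simp
 then show ?thesis by (auto simp: coker_sheaf_def sheafify_def ksec_def intro!: restrict_ext)
qed

lemma KK_smult:
 assumes U: "opn U" and z: "!!p. p \<in> U ==> z \<in> G (2 * int e) p" and x: "!!P. P \<in> U ==> x \<in> L 0 P"
 shows "cst U x \<odot>\<^bsub>sec KK U\<^esub> ksec U z = ksec U (%l. x * z l)"
 using germ_smult_Germ[OF U _ z x]
 by (auto simp: coker_sheaf_def sheafify_def ksec_def intro!: restrict_ext)

lemma KK_res: "V \<subseteq> U ==> res KK U V (ksec U z) = ksec V z"
 by (auto simp: coker_sheaf_def sheafify_def ksec_def fun_eq_iff)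

end

section \<open>The \<open>d\<close>-uple embedding\<close>

lemma prod_keys_superset:
 assumes "finite K" "keys t \<subseteq> K"
 shows "(\<Prod>i\<in>keys t. \<sigma> i ^ lookup t i) = (\<Prod>i\<in>K. \<sigma> i ^ lookup t i)"
 using assms by (intro prod.mono_neutral_left) (auto simp: in_keys_iff)

lemma prod_keys_add:
 fixes \<sigma> :: "'i => 'a::comm_semiring_1"
 shows "(\<Prod>i\<in>keys (s + t). \<sigma> i ^ lookup (s + t) i) =
  (\<Prod>i\<in>keys s. \<sigma> i ^ lookup s i) * (\<Prod>i\<in>keys t. \<sigma> i ^ lookup t i)"
proof -
 let ?K = "keys s \<union> keys t"
 have K: "finite ?K" by simp
 show ?thesis
  unfolding prod_keys_superset[OF K Poly_Mapping.keys_add] prod_keys_superset[OF K Un_upper1]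
   prod_keys_superset[OF K Un_upper2]
  unfolding prod.distrib[symmetric] lookup_add power_add ..
qed

lemma subst_poly_superset:
 assumes "finite T" "keys f \<subseteq> T"
 shows "subst_poly \<sigma> f = (\<Sum>t\<in>T. single 0 (lookup f t) *
   (\<Prod>i\<in>keys t. \<sigma> i ^ lookup t i))"
 unfolding subst_poly_def using assms by (intro sum.mono_neutral_left) (auto simp: in_keys_iff)

lemma subst_poly_add: "subst_poly \<sigma> (f + g) = subst_poly \<sigma> f + subst_poly \<sigma> g"
proof -
 let ?T = "keys f \<union> keys g"
 have T: "finite ?T" by simp
 show ?thesis
  unfolding subst_poly_superset[OF T keys_add] subst_poly_superset[OF T Un_upper1]
   subst_poly_superset[OF T Un_upper2] sum.distrib[symmetric] lookup_add single_add distrib_right ..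
qed

lemma subst_poly_0 [simp]: "subst_poly \<sigma> 0 = 0"
 by (simp add: subst_poly_def)

lemma subst_poly_sum: "subst_poly \<sigma> (sum f F) = (\<Sum>x\<in>F. subst_poly \<sigma> (f x))"
 by (induction F rule: infinite_finite_induct) (simp_all add: subst_poly_add)

lemma subst_poly_single: "subst_poly \<sigma> (single t c) =
  single 0 c * (\<Prod>i\<in>keys t. \<sigma> i ^ lookup t i)"
 by (subst subst_poly_superset[of "{t}"]) simp_all

lemma poly_sum_singles: "f = (\<Sum>t\<in>keys f. single t (lookup f t))"
 for f :: "('i, 'k::field) mpoly"
proof -
 have "single 0 c * single t 1 = single t c" for c :: 'k and t :: "'i \<Rightarrow>\<^sub>0 nat"
  by (simp add: mult_single)
 then show ?thesis using poly_sum_monomials[of f] by simp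
qed

lemma subst_poly_mult:
 fixes \<sigma> :: "'i => ('j, 'k::field) mpoly"
 shows "subst_poly \<sigma> (f * g) = subst_poly \<sigma> f * subst_poly \<sigma> g"
proof -
 have 1: "subst_poly \<sigma> (single s c * single t c') =
   subst_poly \<sigma> (single s c) * subst_poly \<sigma> (single t c')" for s t c c'
 proof -
  have "single 0 (c * c') = single 0 c * (single 0 c' :: ('j, 'k) mpoly)"
   by (simp add: mult_single)
  then show ?thesis unfolding mult_single subst_poly_single prod_keys_add by (simp add: ac_simps)
 qed
 have "f * g = (\<Sum>s\<in>keys f. \<Sum>t\<in>keys g.
   single s (lookup f s) * single t (lookup g t))"
  by (subst (1) poly_sum_singles[of f], subst (1) poly_sum_singles[of g]) (simp add: sum_product)
 then have "subst_poly \<sigma> (f * g) = subst_poly \<sigma> (\<Sum>s\<in>keys f. single s (lookup f s)) *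
   subst_poly \<sigma> (\<Sum>t\<in>keys g. single t (lookup g t))"
  by (simp only: subst_poly_sum 1 sum_product)
 then show ?thesis by (simp only: poly_sum_singles[symmetric])
qed

lemma subst_poly_const [simp]: "subst_poly \<sigma> (single 0 c) = single 0 c"
 by (simp add: subst_poly_single)

lemma subst_poly_1 [simp]: "subst_poly \<sigma> 1 = 1"
 using subst_poly_const[of \<sigma> 1] by (simp only: single_one)

lemma subst_poly_mvar [simp]: "subst_poly \<sigma> (mvar i) = \<sigma> i"
 by (simp add: mvar_def subst_poly_single single_one)

lemma subst_poly_power: "subst_poly \<sigma> (f ^ n) = subst_poly \<sigma> f ^ n"
 by (induction n) (simp_all add: subst_poly_mult)

lemma subst_poly_prod: "subst_poly \<sigma> (prod f F) = (\<Prod>x\<in>F. subst_poly \<sigma> (f x))"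
 by (induction F rule: infinite_finite_induct) (simp_all add: subst_poly_mult)

lemma subst_poly_comp: "subst_poly \<tau> (subst_poly \<sigma> f) = subst_poly (%i. subst_poly \<tau> (\<sigma> i)) f"
 unfolding subst_poly_def[of \<sigma>] subst_poly_def[of "%i. subst_poly \<tau> (\<sigma> i)"]
 by (simp only: subst_poly_sum subst_poly_mult subst_poly_const subst_poly_prod subst_poly_power)

lemma subst_poly_single_form:
 assumes "keys t \<subseteq> J" "!!i. i \<in> J ==> \<sigma> i \<in> forms I d"
 shows "subst_poly \<sigma> (single t c) \<in> forms I (d * mdeg t)"
proof -
 have "(\<Prod>m\<in>keys t. \<sigma> m ^ lookup t m) \<in>
   forms I (\<Sum>m\<in>keys t. lookup t m * d)"
  by (rule forms_prod, rule forms_power, rule assms(2)) (rule subsetD[OF assms(1)])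
 moreover have "(\<Sum>m\<in>keys t. lookup t m * d) = d * mdeg t"
  by (simp add: mdeg_def sum_distrib_left mult.commute)
 ultimately show ?thesis
  unfolding subst_poly_single by (intro forms_mult_const) (simp only:)
qed

lemma subst_poly_sum_singles:
 "subst_poly \<sigma> f = (\<Sum>t\<in>keys f. subst_poly \<sigma> (single t (lookup f t)))"
 by (subst poly_sum_singles[of f]) (rule subst_poly_sum)

lemma subst_poly_forms:
 assumes f: "f \<in> forms J l" and \<sigma>: "!!i. i \<in> J ==> \<sigma> i \<in> forms I d"
 shows "subst_poly \<sigma> f \<in> forms I (d * l)"
 unfolding subst_poly_sum_singles[of \<sigma> f]
proof (rule forms_sum)
 fix t assume "t \<in> keys f"
 then have t: "keys t \<subseteq> J" "mdeg t = l" using f by (auto simp: forms_def polys_def)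
 show "subst_poly \<sigma> (single t (lookup f t)) \<in> forms I (d * l)"
  using subst_poly_single_form[OF t(1) \<sigma>, where c = "lookup f t"] t(2) by simp
qed

lemma subst_poly_polys:
 assumes f: "f \<in> polys J" and \<sigma>: "!!i. i \<in> J ==> \<sigma> i \<in> forms I d"
 shows "subst_poly \<sigma> f \<in> polys I"
 unfolding subst_poly_sum_singles[of \<sigma> f]
proof (rule polys_sum)
 fix t assume "t \<in> keys f"
 then have t: "keys t \<subseteq> J" using f by (auto simp: polys_def)
 show "subst_poly \<sigma> (single t (lookup f t)) \<in> polys I"
  by (rule forms_polys[OF subst_poly_single_form[OF t \<sigma>]])
qed

lemma subst_poly_hom_component:
 assumes d: "0 < d" and f: "f \<in> polys J" and \<sigma>: "!!i. i \<in> J ==> \<sigma> i \<in> forms I d"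
 shows "subst_poly \<sigma> (hom_component n f) = hom_component (d * n) (subst_poly \<sigma> f)"
proof -
 obtain D where D: "!!t. t \<in> keys f ==> mdeg t < D" using degree_bound by blast
 define D' where "D' = max D (Suc n)"
 have D': "(\<Sum>n<D'. hom_component n f) = f" by (rule sum_hom_components) (use D in \<open>force simp: D'_def\<close>)
 have "hom_component (d * n) (subst_poly \<sigma> f) = (\<Sum>k<D'. hom_component (d * n) (subst_poly \<sigma> (hom_component k f)))"
  by (subst D'[symmetric]) (simp only: subst_poly_sum hom_component_sum)
 also have "\<dots> = (\<Sum>k<D'. if k = n then subst_poly \<sigma> (hom_component k f) else 0)"
 proof (rule sum.cong[OF refl])
  fix k
  have "hom_component (d * n) (subst_poly \<sigma> (hom_component k f)) =
    (if d * n = d * k then subst_poly \<sigma> (hom_component k f) else 0)"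
   by (rule hom_component_form[OF subst_poly_forms[OF hom_component_forms[OF f] \<sigma>]])
  then show "hom_component (d * n) (subst_poly \<sigma> (hom_component k f)) = (if k = n then subst_poly \<sigma> (hom_component k f) else 0)"
   using d by auto
 qed
 also have "\<dots> = subst_poly \<sigma> (hom_component n f)" by (simp add: D'_def)
 finally show ?thesis by simp
qed

lemma uple_pull_add: "uple_pull (f + g) = uple_pull f + uple_pull g"
 and uple_pull_mult: "uple_pull (f * g) = uple_pull f * uple_pull g"
 and uple_pull_sum: "uple_pull (sum h F) = (\<Sum>x\<in>F. uple_pull (h x))"
 and uple_pull_0 [simp]: "uple_pull 0 = 0"
 and uple_pull_1 [simp]: "uple_pull 1 = 1"
 and uple_pull_const [simp]: "uple_pull (single 0 c) = single 0 c"
 and uple_pull_mvar [simp]: "uple_pull (mvar m) = single m 1"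
 and uple_pull_power: "uple_pull (p ^ n) = uple_pull p ^ n"
 by (simp_all add: uple_pull_def subst_poly_add subst_poly_mult subst_poly_sum subst_poly_power)

lemma monomial_form: "m \<in> monomials I d ==> single m 1 \<in> forms I d"
 by (rule forms_single) (simp_all add: monomials_def)

lemma uple_pull_forms: "f \<in> forms (monomials I d) l ==> uple_pull f \<in> forms I (d * l)"
 unfolding uple_pull_def by (erule subst_poly_forms) (rule monomial_form)

lemma uple_pull_polys: "f \<in> polys (monomials I d) ==> uple_pull f \<in> polys I"
 unfolding uple_pull_def by (erule subst_poly_polys) (rule monomial_form)

lemma uple_pull_hom_component:
 "0 < d ==> f \<in> polys (monomials I d) ==> uple_pull (hom_component n f) = hom_component (d * n) (uple_pull f)"
 unfolding uple_pull_def by (erule (1) subst_poly_hom_component) (rule monomial_form)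

text \<open>Factors of degree d are split off one at a time; each of them is the pullback of a
  coordinate.\<close>

lemma uple_pull_onto_monomial:
 assumes "keys t \<subseteq> I" "mdeg t = d * l"
 shows "\<exists>s. keys s \<subseteq> monomials I d & mdeg s = l &
  uple_pull (single s 1 :: ('i \<Rightarrow>\<^sub>0 nat, 'k::field) mpoly) = single t 1"
 using assms
proof (induction l arbitrary: t)
 case 0
 then have "mdeg t = 0" by simp
 then have "lookup t i = 0" for i using lookup_le_mdeg[of t i] by simp
 then have "t = 0" by (simp add: poly_mapping_eqI)
 then show ?case by (intro exI[of _ 0]) (simp add: single_one)
next
 case (Suc l)
 obtain u v where uv: "t = u + v" "u \<in> monomials I d" "keys v \<subseteq> I" "mdeg v = mdeg t - d"
  using monomial_factor[OF Suc.prems(1), of d] Suc.prems(2) by auto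
 then have "mdeg v = d * l" using Suc.prems(2) by simp
 then obtain s where s: "keys s \<subseteq> monomials I d" "mdeg s = l"
   "uple_pull (single s 1 :: ('i \<Rightarrow>\<^sub>0 nat, 'k) mpoly) = single v 1"
  using Suc.IH[OF uv(3)] by blast
 have "single (single u 1 + s) 1 = mvar u * (single s 1 :: ('i \<Rightarrow>\<^sub>0 nat, 'k) mpoly)"
  by (simp add: mvar_def mult_single)
 then have "uple_pull (single (single u 1 + s) 1 :: ('i \<Rightarrow>\<^sub>0 nat, 'k) mpoly) = single t 1"
  by (simp add: uple_pull_mult s(3) uv(1) mult_single)
 moreover have "keys (single u 1 + s) \<subseteq> monomials I d"
  using keys_add[of "single u 1" s] s(1) uv(2) by auto
 ultimately show ?case using s(2) by (intro exI[of _ "single u 1 + s"]) (simp add: mdeg_add)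
qed

lemma uple_pull_onto:
 fixes f :: "('i, 'k::field) mpoly"
 assumes "f \<in> forms I (d * l)"
 shows "\<exists>g. g \<in> forms (monomials I d) l & uple_pull g = f"
proof -
 have "\<forall>t\<in>keys f. \<exists>s. keys s \<subseteq> monomials I d & mdeg s = l &
  uple_pull (single s 1 :: ('i \<Rightarrow>\<^sub>0 nat, 'k) mpoly) = single t 1"
  using assms by (intro ballI uple_pull_onto_monomial) (auto simp: forms_def polys_def)
 from bchoice[OF this] obtain s where s: "!!t. t \<in> keys f ==> keys (s t) \<subseteq> monomials I d & mdeg (s t) = l &
  uple_pull (single (s t) 1 :: ('i \<Rightarrow>\<^sub>0 nat, 'k) mpoly) = single t 1" by blast
 let ?g = "\<Sum>t\<in>keys f. single 0 (lookup f t) * single (s t) 1"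
 have "?g \<in> forms (monomials I d) l" using s by (intro forms_sum forms_mult_const forms_single) auto
 moreover have "uple_pull ?g = f"
 proof -
  have "uple_pull ?g = (\<Sum>t\<in>keys f. single 0 (lookup f t) * single t 1)"
   unfolding uple_pull_sum uple_pull_mult uple_pull_const using s by (intro sum.cong) auto
  then show ?thesis using poly_sum_monomials[of f] by simp
 qed
 ultimately show ?thesis by blast
qed

section \<open>The embedding on points and on local rings\<close>

lemma uple_point_memI: "g \<in> polys (monomials I d) ==> g \<in> uple_point I d P \<longleftrightarrow> uple_pull g \<in> P"
 by (simp add: uple_point_def)

lemma uple_point_pideal:
 assumes "pideal I P" shows "pideal (monomials I d) (uple_point I d P)"
 unfolding pideal_def
proof (intro conjI ballI)
 show "uple_point I d P \<subseteq> polys (monomials I d)" "0 \<in> uple_point I d P"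
  using pidealD(2)[OF assms] by (auto simp: uple_point_def)
 fix f assume f: "f \<in> uple_point I d P"
 show "f + g \<in> uple_point I d P" if "g \<in> uple_point I d P" for g
  using f that pidealD(3)[OF assms] by (simp add: uple_point_def uple_pull_add polys_add)
 show "g * f \<in> uple_point I d P" if "g \<in> polys (monomials I d)" for g
  using f that pidealD(4)[OF assms _ uple_pull_polys[OF that]] by (simp add: uple_point_def uple_pull_mult polys_mult)
qed

lemma uple_point_pprime:
 assumes "pprime I P" shows "pprime (monomials I d) (uple_point I d P)"
 unfolding pprime_def
proof (intro conjI ballI impI)
 show "pideal (monomials I d) (uple_point I d P)" by (rule uple_point_pideal[OF pprimeD(1)[OF assms]])
 show "1 \<notin> uple_point I d P" using pprimeD(2)[OF assms] by (simp add: uple_point_def)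
 fix f g :: "('a \<Rightarrow>\<^sub>0 nat, 'b) mpoly" assume f: "f \<in> polys (monomials I d)" and g: "g \<in> polys (monomials I d)" and fg: "f * g \<in> uple_point I d P"
 have "uple_pull f * uple_pull g \<in> P" using fg by (simp add: uple_point_def uple_pull_mult)
 then show "f \<in> uple_point I d P \<or> g \<in> uple_point I d P"
  using pprimeD(3)[OF assms uple_pull_polys[OF f] uple_pull_polys[OF g]] f g by (simp add: uple_point_def)
qed

lemma uple_point_homog:
 assumes "0 < d" "homog P" shows "homog (uple_point I d P)"
 using assms by (auto simp: homog_def uple_point_def uple_pull_hom_component polys_hom_component)

text \<open>If x_i is not in \<open>P\<close>, the coordinate that pulls back to x_i^d is not in the
  image of \<open>P\<close>.\<close>

lemma uple_point_closed:
 assumes d: "0 < d" and P: "P \<in> proj_points I"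
 shows "uple_point I d P \<in> proj_points (monomials I d)"
 unfolding proj_points_iff
proof (intro conjI)
 show "pprime (monomials I d) (uple_point I d P)" by (rule uple_point_pprime[OF proj_pointD(1)[OF P]])
 show "homog (uple_point I d P)" by (rule uple_point_homog[OF d proj_pointD(3)[OF P]])
 obtain i where i: "i \<in> I" "mvar i \<notin> P" using proj_pointD(6)[OF P] by blast
 have m: "single i d \<in> monomials I d" using i d by (simp add: monomials_def)
 have "mvar i ^ d \<notin> P" by (rule forms_power_notin[OF P forms_mvar[OF i(1)] i(2)])
 then have "mvar (single i d) \<notin> uple_point I d P" by (simp add: uple_point_def mvar_power)
 then show "\<not> mvar ` monomials I d \<subseteq> uple_point I d P" using m by blast
qed

lemma preim_proj: "preim (proj I) h V = {p \<in> proj_points I. h p \<in> V}"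
 by (simp add: preim_def topspace_proj_top)

lemma preim_pbasic:
 assumes "0 < d" "F \<in> polys (monomials I d)"
 shows "preim (proj I) (uple_point I d) (pbasic (monomials I d) F) = pbasic I (uple_pull F)"
 using uple_point_closed[OF assms(1)] assms(2) by (auto simp: preim_proj pbasic_def uple_point_memI)

lemma openin_preim:
 assumes d: "0 < d" and V: "openin (proj_top (monomials I d)) V"
 shows "openin (proj_top I) (preim (proj I) (uple_point I d) V)"
proof -
 obtain T where T: "T \<subseteq> (\<Union>n. forms (monomials I d) n)" "V = {P \<in> proj_points (monomials I d). \<not> T \<subseteq> P}"
  using V unfolding openin_proj_top by auto
 have f: "\<exists>n. f \<in> forms (monomials I d) n" if "f \<in> T" for f using T(1) that by auto
 have "uple_pull ` T \<subseteq> (\<Union>n. forms I n)"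
 proof
  fix g assume "g \<in> uple_pull ` T"
  then obtain f where "f \<in> T" "g = uple_pull f" by auto
  then obtain n where "g \<in> forms I (d * n)" using f uple_pull_forms by metis
  then show "g \<in> (\<Union>n. forms I n)" by auto
 qed
 moreover have "preim (proj I) (uple_point I d) V = {P \<in> proj_points I. \<not> uple_pull ` T \<subseteq> P}"
 proof -
  have "T \<subseteq> uple_point I d P \<longleftrightarrow> uple_pull ` T \<subseteq> P" for P
  proof -
   have "f \<in> uple_point I d P \<longleftrightarrow> uple_pull f \<in> P" if fT: "f \<in> T" for f
   proof -
    obtain n where "f \<in> forms (monomials I d) n" using f[OF fT] by auto
    then show ?thesis by (intro uple_point_memI forms_polys)
   qed
   then show ?thesis by auto
  qed
  then show ?thesis unfolding preim_proj T(2) using uple_point_closed[OF d] by auto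
 qed
 ultimately show ?thesis unfolding openin_proj_top by (intro exI[of _ "uple_pull ` T"] conjI)
qed

lemma preim_Union: "preim (proj I) h (\<Union>\<C>) = (\<Union>V\<in>\<C>. preim (proj I) h V)"
 and preim_Int: "preim (proj I) h (V \<inter> W) = preim (proj I) h V \<inter> preim (proj I) h W"
 by (auto simp: preim_proj)

lemma uple_local_Fract:
 assumes P: "P \<in> proj_points I" and a: "a \<in> polys (monomials I d)" and f: "f \<in> polys (monomials I d)" "uple_pull f \<notin> P"
 shows "uple_local I d P (Fract a f) = Fract (uple_pull a) (uple_pull f)"
 unfolding uple_local_def
proof (rule the_equality)
 show "\<exists>a'\<in>polys (monomials I d). \<exists>f'\<in>polys (monomials I d). uple_pull f' \<notin> P & Fract a f = Fract a' f' &
   Fract (uple_pull a) (uple_pull f) = Fract (uple_pull a') (uple_pull f')"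
  using a f by blast
next
 fix w assume "\<exists>a'\<in>polys (monomials I d). \<exists>f'\<in>polys (monomials I d). uple_pull f' \<notin> P & Fract a f = Fract a' f' &
   w = Fract (uple_pull a') (uple_pull f')"
 then obtain a' f' where *: "uple_pull f' \<notin> P" "Fract a f = Fract a' f'" "w = Fract (uple_pull a') (uple_pull f')"
  by blast
 have 0: "uple_pull f ~= 0" "uple_pull f' ~= 0" using f(2) *(1) nonzero_if_notin[OF P] by auto
 then have "f ~= 0" "f' ~= 0" by auto
 then have "a * f' = a' * f" using *(2) by (simp add: eq_fract)
 then have "uple_pull a * uple_pull f' = uple_pull a' * uple_pull f" by (simp add: uple_pull_mult[symmetric])
 then show "w = Fract (uple_pull a) (uple_pull f)" using *(3) 0 by (simp add: eq_fract)
qed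

text \<open>The local pullback at the generic point. It agrees with the local pullback at any
  \<open>P\<close> on the stalk at the image of \<open>P\<close>, so one map serves all points. On
  the whole function field of the target it is only partially meaningful; its laws are therefore
  stated for elements regular at an image point.\<close>

definition pullf :: "'i::linorder set => nat => ('i \<Rightarrow>\<^sub>0 nat, 'k::field) mpoly fract => ('i, 'k) mpoly fract" where
 "pullf I d = uple_local I d {0}"

lemma pullf_Fract:
 assumes "P \<in> proj_points I" "a \<in> polys (monomials I d)" "f \<in> polys (monomials I d)" "uple_pull f \<notin> P"
 shows "pullf I d (Fract a f) = Fract (uple_pull a) (uple_pull f)"
proof -
 have "I ~= {}" using proj_pointD(6)[OF assms(1)] by auto
 then show ?thesis unfolding pullf_def
  using assms nonzero_if_notin[OF assms(1)] by (intro uple_local_Fract generic_point) auto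
qed

lemma locE_uple:
 assumes P: "P \<in> proj_points I" and v: "v \<in> loc (monomials I d) n (uple_point I d P)"
 shows "\<exists>a f k l. v = Fract a f & a \<in> forms (monomials I d) k & f \<in> forms (monomials I d) l & int k = int l + n &
  uple_pull f \<notin> P & pullf I d v = Fract (uple_pull a) (uple_pull f) & uple_pull f ~= 0 & f ~= 0"
proof -
 obtain a f k l where *: "v = Fract a f" "a \<in> forms (monomials I d) k" "f \<in> forms (monomials I d) l" "int k = int l + n"
  "f \<notin> uple_point I d P" using v by (rule locE) blast
 then have f: "uple_pull f \<notin> P" using uple_point_memI[OF forms_polys[OF *(3)]] by blast
 have f0: "uple_pull f ~= 0" using nonzero_if_notin[OF P f] .
 then have "f ~= 0" by auto
 then show ?thesis using * f f0 pullf_Fract[OF P forms_polys[OF *(2)] forms_polys[OF *(3)] f] by blast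
qed

lemma uple_local_eq_pullf:
 assumes P: "P \<in> proj_points I" and v: "v \<in> loc (monomials I d) n (uple_point I d P)"
 shows "uple_local I d P v = pullf I d v"
proof -
 obtain a f k l where *: "v = Fract a f" "a \<in> forms (monomials I d) k" "f \<in> forms (monomials I d) l" "uple_pull f \<notin> P"
   "pullf I d v = Fract (uple_pull a) (uple_pull f)"
  using locE_uple[OF assms] by blast
 show ?thesis unfolding *(5) unfolding *(1)
  by (rule uple_local_Fract[OF P forms_polys[OF *(2)] forms_polys[OF *(3)] *(4)])
qed

lemma pullf_loc:
 assumes P: "P \<in> proj_points I" and v: "v \<in> loc (monomials I d) n (uple_point I d P)"
 shows "pullf I d v \<in> loc I (int d * n) P"
proof -
 obtain a f k l where *: "a \<in> forms (monomials I d) k" "f \<in> forms (monomials I d) l" "int k = int l + n" "uple_pull f \<notin> P"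
   "pullf I d v = Fract (uple_pull a) (uple_pull f)"
  using locE_uple[OF assms] by blast
 have "int (d * k) = int (d * l) + int d * n" by (simp add: *(3) distrib_left)
 then show ?thesis unfolding *(5) using *(4) by (intro locI[OF uple_pull_forms[OF *(1)] uple_pull_forms[OF *(2)]])
qed

lemma pullf_form:
 fixes P :: "('i::linorder, 'k::field) mpoly set" and a :: "('i \<Rightarrow>\<^sub>0 nat, 'k) mpoly"
 assumes P: "P \<in> proj_points I" and "a \<in> polys (monomials I d)"
 shows "pullf I d (to_fract a) = to_fract (uple_pull a)"
proof -
 have "uple_pull 1 \<notin> P" using proj_pointD(4)[OF P] by simp
 then show ?thesis unfolding to_fract_def by (subst pullf_Fract[OF assms polys_1]) simp_all
qed

lemma pullf_add:
 assumes P: "P \<in> proj_points I" and v: "v \<in> loc (monomials I d) n (uple_point I d P)" and w: "w \<in> loc (monomials I d) m (uple_point I d P)"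
 shows "pullf I d (v + w) = pullf I d v + pullf I d w"
  and "pullf I d (v * w) = pullf I d v * pullf I d w"
proof -
 obtain a f k l where v: "v = Fract a f" "a \<in> forms (monomials I d) k" "f \<in> forms (monomials I d) l" "uple_pull f \<notin> P"
   "pullf I d v = Fract (uple_pull a) (uple_pull f)" "uple_pull f ~= 0" "f ~= 0"
  using locE_uple[OF P v] by blast
 obtain b g k' l' where w: "w = Fract b g" "b \<in> forms (monomials I d) k'" "g \<in> forms (monomials I d) l'" "uple_pull g \<notin> P"
   "pullf I d w = Fract (uple_pull b) (uple_pull g)" "uple_pull g ~= 0" "g ~= 0"
  using locE_uple[OF P w] by blast
 note pol = forms_polys[OF v(2)] forms_polys[OF v(3)] forms_polys[OF w(2)] forms_polys[OF w(3)]
 have fg: "f * g \<in> polys (monomials I d)" "uple_pull (f * g) \<notin> P"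
  using pol polys_mult proj_pointD(7)[OF P uple_pull_polys[OF pol(2)] uple_pull_polys[OF pol(4)]] v(4) w(4)
  by (auto simp: uple_pull_mult)
 have "v + w = Fract (a * g + b * f) (f * g)" using v w by (simp add: add_fract)
 then have "pullf I d (v + w) = Fract (uple_pull (a * g + b * f)) (uple_pull (f * g))"
  using pullf_Fract[OF P polys_add[OF polys_mult[OF pol(1,4)] polys_mult[OF pol(3,2)]] fg] by simp
 then show "pullf I d (v + w) = pullf I d v + pullf I d w"
  using v w by (simp add: add_fract uple_pull_add uple_pull_mult)
 have "v * w = Fract (a * b) (f * g)" using v w by simp
 then have "pullf I d (v * w) = Fract (uple_pull (a * b)) (uple_pull (f * g))"
  using pullf_Fract[OF P polys_mult[OF pol(1,3)] fg] by simp
 then show "pullf I d (v * w) = pullf I d v * pullf I d w"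
  using v w by (simp add: uple_pull_mult)
qed

lemma uple_sheaf_map_cst:
 assumes "!!Q. Q \<in> V ==> v \<in> loc (monomials I d) 0 Q"
 shows "uple_sheaf_map I d V (cst V v) = cst (preim (proj I) (uple_point I d) V) (pullf I d v)"
 unfolding uple_sheaf_map_def cst_def[of "preim (proj I) (uple_point I d) V"]
proof (rule restrict_ext)
 fix P assume "P \<in> preim (proj I) (uple_point I d) V"
 then have P: "P \<in> proj_points I" "uple_point I d P \<in> V" by (auto simp: preim_proj)
 show "uple_local I d P (cst V v (uple_point I d P)) = pullf I d v"
  using uple_local_eq_pullf[OF P(1) assms[OF P(2)]] P(2) by simp
qed

section \<open>Sheaves whose sections are vectors\<close>

text \<open>\<Phi> is not assumed injective: over an open set with empty preimage it identifies all
  vectors.\<close>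

lemma vector_sections:
 fixes G :: "('a, 'b) ring_scheme" and \<Phi> :: "(nat => 'v::ab_group_add) => 'a"
 assumes C: "carrier G = {\<Phi> z | z. R z}" and add: "!!z z'. R z ==> R z' ==> \<Phi> z \<oplus>\<^bsub>G\<^esub> \<Phi> z' = \<Phi> (%l. z l + z' l)"
  and zero: "\<zero>\<^bsub>G\<^esub> = \<Phi> (%_. 0)"
  and R: "R (%_. 0)" "!!z z'. R z ==> R z' ==> R (%l. z l + z' l)" "!!z. R z ==> R (%l. - z l)"
 shows vector_sections_group: "abelian_group G"
  and vector_sections_uminus: "R z ==> \<ominus>\<^bsub>G\<^esub> \<Phi> z = \<Phi> (%l. - z l)"
  and vector_sections_finsum: "(!!i. i \<in> A ==> R (h i)) ==> finsum G (%i. \<Phi> (h i)) A = \<Phi> (%l. \<Sum>i\<in>A. h i l)"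
proof -
 have mem: "\<Phi> z \<in> carrier G" if "R z" for z using C that by auto
 have ex: "\<exists>z. x = \<Phi> z & R z" if "x \<in> carrier G" for x using C that by auto
 show G: "abelian_group G"
 proof (rule abelian_groupI)
  fix x y assume "x \<in> carrier G" "y \<in> carrier G"
  then obtain z z' where z: "x = \<Phi> z" "R z" "y = \<Phi> z'" "R z'" using ex by metis
  show "x \<oplus>\<^bsub>G\<^esub> y \<in> carrier G" unfolding z(1,3) add[OF z(2,4)] by (rule mem[OF R(2)[OF z(2,4)]])
  show "x \<oplus>\<^bsub>G\<^esub> y = y \<oplus>\<^bsub>G\<^esub> x" unfolding z(1,3) add[OF z(2,4)] add[OF z(4,2)] by (simp only: add.commute)
 next
  fix x y w assume "x \<in> carrier G" "y \<in> carrier G" "w \<in> carrier G"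
  then obtain z z' z'' where z: "x = \<Phi> z" "R z" "y = \<Phi> z'" "R z'" "w = \<Phi> z''" "R z''" using ex by metis
  show "x \<oplus>\<^bsub>G\<^esub> y \<oplus>\<^bsub>G\<^esub> w = x \<oplus>\<^bsub>G\<^esub> (y \<oplus>\<^bsub>G\<^esub> w)"
   unfolding z(1,3,5) add[OF z(2,4)] add[OF z(4,6)] add[OF R(2)[OF z(2,4)] z(6)] add[OF z(2) R(2)[OF z(4,6)]]
   by (simp only: add.assoc)
 next
  fix x assume "x \<in> carrier G"
  then obtain z where z: "x = \<Phi> z" "R z" using ex by metis
  show "\<zero>\<^bsub>G\<^esub> \<oplus>\<^bsub>G\<^esub> x = x" unfolding zero z(1) add[OF R(1) z(2)] by simp
  show "\<exists>y\<in>carrier G. y \<oplus>\<^bsub>G\<^esub> x = \<zero>\<^bsub>G\<^esub>"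
   by (rule bexI[OF _ mem[OF R(3)[OF z(2)]]]) (simp add: z(1) add[OF R(3)[OF z(2)] z(2)] zero)
 qed (simp add: zero mem R(1))
 interpret abelian_group G by (rule G)
 show "\<ominus>\<^bsub>G\<^esub> \<Phi> z = \<Phi> (%l. - z l)" if z: "R z"
  by (rule minus_equality) (simp_all add: add[OF R(3)[OF z] z] zero mem R(3) z)
 have sum: "R (%l. \<Sum>i\<in>A. h i l)" if "!!i. i \<in> A ==> R (h i)" for A and h :: "'c => nat => 'v"
  using that by (induction A rule: infinite_finite_induct) (simp_all add: R)
 show "finsum G (%i. \<Phi> (h i)) A = \<Phi> (%l. \<Sum>i\<in>A. h i l)" if "!!i. i \<in> A ==> R (h i)"
  using that
 proof (induction A rule: infinite_finite_induct)
  case (insert x A)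
  then have "finsum G (%i. \<Phi> (h i)) (insert x A) = \<Phi> (h x) \<oplus>\<^bsub>G\<^esub> \<Phi> (%l. \<Sum>i\<in>A. h i l)"
   by (subst finsum_insert) (auto intro!: mem)
  then show ?case using insert by (simp add: add[OF _ sum])
 qed (simp_all add: zero)
qed

text \<open>The common pattern of the pushforward, its twists and the free modules: a section over
  \<open>V\<close> is one vector lying in \<open>S p\<close> for all \<open>p\<close> in
  \<open>pts V\<close>, encoded by \<open>\<Phi> V\<close>. The set \<open>pts V\<close> is
  \<open>V\<close> itself or its preimage in the plane; in the latter case it may be empty for
  nonempty \<open>V\<close>, and \<open>trivial\<close> then leaves a single section.\<close>

locale vector_sheaf =
 fixes J :: "'j::linorder set" and F :: "(('j, 'k::field) mpoly set, ('j, 'k) proj_fun, 's) mod_presheaf"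
  and pts :: "('j, 'k) mpoly set set => 'p set" and S :: "'p => (nat => 'v::field) set"
  and \<Phi> :: "('j, 'k) mpoly set set => (nat => 'v) => 's"
 assumes pts_Union: "pts (\<Union>\<C>) = (\<Union>V\<in>\<C>. pts V)" and pts_Int: "pts (V \<inter> W) = pts V \<inter> pts W"
  and irreducible: "openin (proj_top J) V ==> openin (proj_top J) W ==> pts V ~= {} ==> pts W ~= {} ==> pts (V \<inter> W) ~= {}"
  and S_0: "openin (proj_top J) V ==> p \<in> pts V ==> (%_. 0) \<in> S p"
  and S_add: "openin (proj_top J) V ==> p \<in> pts V ==> z \<in> S p ==> z' \<in> S p ==> (%l. z l + z' l) \<in> S p"
  and S_uminus: "openin (proj_top J) V ==> p \<in> pts V ==> z \<in> S p ==> (%l. - z l) \<in> S p"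
  and carrier: "openin (proj_top J) V ==> carrier (sec F V) = {\<Phi> V z | z. \<forall>p\<in>pts V. z \<in> S p}"
  and add: "openin (proj_top J) V ==> (!!p. p \<in> pts V ==> z \<in> S p) ==> (!!p. p \<in> pts V ==> z' \<in> S p) ==>
   \<Phi> V z \<oplus>\<^bsub>sec F V\<^esub> \<Phi> V z' = \<Phi> V (%l. z l + z' l)"
  and zero: "openin (proj_top J) V ==> \<zero>\<^bsub>sec F V\<^esub> = \<Phi> V (%_. 0)"
  and res: "openin (proj_top J) U ==> openin (proj_top J) V ==> V \<subseteq> U ==> (!!p. p \<in> pts U ==> z \<in> S p) ==>
   res F U V (\<Phi> U z) = \<Phi> V z"
  and inject: "openin (proj_top J) V ==> p \<in> pts V ==> z \<in> S p ==> z' \<in> S p ==> \<Phi> V z = \<Phi> V z' ==> z = z'"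
  and trivial: "openin (proj_top J) V ==> pts V = {} ==> \<Phi> V z = \<Phi> V z'"
begin

abbreviation opn :: "('j, 'k) mpoly set set => bool" where
 "opn \<equiv> openin (proj_top J)"

definition reg :: "('j, 'k) mpoly set set => (nat => 'v) => bool" where
 "reg V z \<longleftrightarrow> (\<forall>p\<in>pts V. z \<in> S p)"

lemma pts_mono: "V \<subseteq> U ==> pts V \<subseteq> pts U"
 using pts_Int[of V U] by (auto simp: Int_absorb2)

lemma reg_mono: "reg U z ==> V \<subseteq> U ==> reg V z"
 using pts_mono[of V U] by (auto simp: reg_def)

lemma carrier_reg: "opn V ==> carrier (sec F V) = {\<Phi> V z | z. reg V z}"
 by (simp add: carrier reg_def)

lemma reg_closed:
 assumes "opn V"
 shows reg_0: "reg V (%_. 0)" and reg_add: "reg V z ==> reg V z' ==> reg V (%l. z l + z' l)"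
  and reg_uminus: "reg V z ==> reg V (%l. - z l)"
 using S_0[OF assms] S_add[OF assms] S_uminus[OF assms] by (simp_all add: reg_def)

lemma add_reg: "opn V ==> reg V z ==> reg V z' ==> \<Phi> V z \<oplus>\<^bsub>sec F V\<^esub> \<Phi> V z' = \<Phi> V (%l. z l + z' l)"
 by (rule add) (auto simp: reg_def)

lemma res_reg: "opn U ==> opn V ==> V \<subseteq> U ==> reg U z ==> res F U V (\<Phi> U z) = \<Phi> V z"
 by (rule res) (auto simp: reg_def)

lemma sections:
 assumes V: "opn V"
 shows sections_group: "abelian_group (sec F V)"
  and sections_uminus: "reg V z ==> \<ominus>\<^bsub>sec F V\<^esub> \<Phi> V z = \<Phi> V (%l. - z l)"
  and sections_finsum: "(!!i. i \<in> A ==> reg V (h i)) ==>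
   finsum (sec F V) (%i. \<Phi> V (h i)) A = \<Phi> V (%l. \<Sum>i\<in>A. h i l)"
proof -
 note * = carrier_reg[OF V] add_reg[OF V] zero[OF V] reg_0[OF V] reg_add[OF V] reg_uminus[OF V]
 show "abelian_group (sec F V)" by (rule vector_sections_group[of "sec F V" "\<Phi> V" "reg V"]) (fact *)+
 show "\<ominus>\<^bsub>sec F V\<^esub> \<Phi> V z = \<Phi> V (%l. - z l)" if "reg V z"
  by (rule vector_sections_uminus[of "sec F V" "\<Phi> V" "reg V"]) (fact * that)+
 show "finsum (sec F V) (%i. \<Phi> V (h i)) A = \<Phi> V (%l. \<Sum>i\<in>A. h i l)" if "!!i. i \<in> A ==> reg V (h i)"
  by (rule vector_sections_finsum[of "sec F V" "\<Phi> V" "reg V"]) (fact * that)+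
qed

lemma eq_sections:
 assumes V: "opn V" "reg V z" "reg V z'" and eq: "pts V ~= {} ==> z = z'"
 shows "\<Phi> V z = \<Phi> V z'"
 using trivial[OF V(1)] eq by (cases "pts V = {}") auto

lemma sections_inject:
 assumes V: "opn V" "reg V z" "reg V z'" "pts V ~= {}" and eq: "\<Phi> V z = \<Phi> V z'"
 shows "z = z'"
proof -
 obtain p where "p \<in> pts V" using V(4) by auto
 then show ?thesis using inject[OF V(1) _ _ _ eq] V(2,3) by (auto simp: reg_def)
qed

lemma separated:
 assumes \<C>: "\<forall>V\<in>\<C>. opn V" and s: "s \<in> carrier (sec F (\<Union>\<C>))" "t \<in> carrier (sec F (\<Union>\<C>))"
  and eq: "\<forall>V\<in>\<C>. res F (\<Union>\<C>) V s = res F (\<Union>\<C>) V t"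
 shows "s = t"
proof -
 have U: "opn (\<Union>\<C>)" using \<C> by (intro openin_Union) auto
 obtain z where z: "s = \<Phi> (\<Union>\<C>) z" "reg (\<Union>\<C>) z" using s(1) carrier_reg[OF U] by auto
 obtain z' where z': "t = \<Phi> (\<Union>\<C>) z'" "reg (\<Union>\<C>) z'" using s(2) carrier_reg[OF U] by auto
 show ?thesis unfolding z(1) z'(1)
 proof (rule eq_sections[OF U z(2) z'(2)])
  assume "pts (\<Union>\<C>) ~= {}"
  then obtain V where V: "V \<in> \<C>" "pts V ~= {}" unfolding pts_Union by auto
  have oV: "opn V" using V(1) \<C> by auto
  have sub: "V \<subseteq> \<Union>\<C>" using V(1) by auto
  have "\<Phi> V z = \<Phi> V z'" using bspec[OF eq V(1)]
   unfolding z(1) z'(1) res_reg[OF U oV sub z(2)] res_reg[OF U oV sub z'(2)] .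
  then show "z = z'" by (rule sections_inject[OF oV reg_mono[OF z(2) sub] reg_mono[OF z'(2) sub] V(2)])
 qed
qed

text \<open>Two pieces with points have a common point by \<open>irreducible\<close>, so their
  vectors coincide; a piece without points has only one section and imposes no condition.\<close>

lemma glue:
 assumes \<C>: "\<forall>V\<in>\<C>. opn V" and s: "\<forall>V\<in>\<C>. \<sigma> V \<in> carrier (sec F V)"
  and eq: "\<forall>V\<in>\<C>. \<forall>W\<in>\<C>. res F V (V \<inter> W) (\<sigma> V) = res F W (V \<inter> W) (\<sigma> W)"
 shows "\<exists>s\<in>carrier (sec F (\<Union>\<C>)). \<forall>V\<in>\<C>. res F (\<Union>\<C>) V s = \<sigma> V"
proof -
 have U: "opn (\<Union>\<C>)" using \<C> by (intro openin_Union) auto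
 have oV: "opn V" if "V \<in> \<C>" for V using that \<C> by auto
 have "\<forall>V\<in>\<C>. \<exists>z. \<sigma> V = \<Phi> V z & reg V z"
 proof
  fix V assume V: "V \<in> \<C>"
  show "\<exists>z. \<sigma> V = \<Phi> V z & reg V z" using bspec[OF s V] carrier_reg[OF oV[OF V]] by auto
 qed
 from bchoice[OF this] obtain z where z: "!!V. V \<in> \<C> ==> \<sigma> V = \<Phi> V (z V)" "!!V. V \<in> \<C> ==> reg V (z V)" by blast
 have "\<exists>u. \<forall>V\<in>\<C>. pts V ~= {} --> z V = u"
 proof (cases "\<exists>V\<in>\<C>. pts V ~= {}")
  case True
  then obtain V where V: "V \<in> \<C>" "pts V ~= {}" by auto
  have "z W = z V" if W: "W \<in> \<C>" "pts W ~= {}" for W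
  proof -
   have VW: "opn (V \<inter> W)" using oV V W by auto
   have "\<Phi> (V \<inter> W) (z V) = \<Phi> (V \<inter> W) (z W)"
    using bspec[OF bspec[OF eq V(1)] W(1)]
    unfolding z(1)[OF V(1)] z(1)[OF W(1)] res_reg[OF oV[OF V(1)] VW Int_lower1 z(2)[OF V(1)]]
     res_reg[OF oV[OF W(1)] VW Int_lower2 z(2)[OF W(1)]] .
   then have "z V = z W"
    by (rule sections_inject[OF VW reg_mono[OF z(2)[OF V(1)] Int_lower1] reg_mono[OF z(2)[OF W(1)] Int_lower2]
      irreducible[OF oV[OF V(1)] oV[OF W(1)] V(2) W(2)]])
   then show ?thesis by simp
  qed
  then show ?thesis by (intro exI[of _ "z V"] ballI impI)
 qed auto
 then obtain u where u: "!!V. V \<in> \<C> ==> pts V ~= {} ==> z V = u" by blast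
 have reg: "reg V u" if V: "V \<in> \<C>" for V
  using z(2)[OF V] u[OF V] by (cases "pts V = {}") (auto simp: reg_def)
 then have ru: "reg (\<Union>\<C>) u" unfolding reg_def pts_Union by auto
 have "res F (\<Union>\<C>) V (\<Phi> (\<Union>\<C>) u) = \<sigma> V" if V: "V \<in> \<C>" for V
 proof -
  have sub: "V \<subseteq> \<Union>\<C>" using V by auto
  show ?thesis unfolding res_reg[OF U oV[OF V] sub ru] z(1)[OF V]
   by (rule eq_sections[OF oV[OF V] reg[OF V] z(2)[OF V]]) (simp add: u[OF V])
 qed
 moreover have "\<Phi> (\<Union>\<C>) u \<in> carrier (sec F (\<Union>\<C>))" using carrier_reg[OF U] ru by auto
 ultimately show ?thesis by (intro bexI[of _ "\<Phi> (\<Union>\<C>) u"] ballI)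
qed

end

text \<open>\<rho> carries the scalars of the ringed space into the field of the vectors. Its laws
  are assumed only for scalars that are regular on an open set with a point in \<open>pts\<close>,
  since the pullback along the embedding is a partial homomorphism of function fields.\<close>

locale vector_module_sheaf = vector_sheaf J F pts S \<Phi>
 for J :: "'j::linorder set" and F :: "(('j, 'k::field) mpoly set, ('j, 'k) proj_fun, 's) mod_presheaf"
  and pts :: "('j, 'k) mpoly set set => 'p set" and S :: "'p => (nat => 'v::field) set"
  and \<Phi> :: "('j, 'k) mpoly set set => (nat => 'v) => 's" +
 fixes \<rho> :: "('j, 'k) mpoly fract => 'v"
 assumes \<rho>_1: "\<rho> 1 = 1"
  and \<rho>_add: "opn V ==> p \<in> pts V ==> (!!Q. Q \<in> V ==> x \<in> loc J 0 Q) ==> (!!Q. Q \<in> V ==> y \<in> loc J 0 Q) ==> \<rho> (x + y) = \<rho> x + \<rho> y"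
  and \<rho>_mult: "opn V ==> p \<in> pts V ==> (!!Q. Q \<in> V ==> x \<in> loc J 0 Q) ==> (!!Q. Q \<in> V ==> y \<in> loc J 0 Q) ==> \<rho> (x * y) = \<rho> x * \<rho> y"
  and S_scale: "opn V ==> p \<in> pts V ==> (!!Q. Q \<in> V ==> x \<in> loc J 0 Q) ==> z \<in> S p ==> (%l. \<rho> x * z l) \<in> S p"
  and smult: "opn V ==> (!!Q. Q \<in> V ==> x \<in> loc J 0 Q) ==> (!!p. p \<in> pts V ==> z \<in> S p) ==>
   cst V x \<odot>\<^bsub>sec F V\<^esub> \<Phi> V z = \<Phi> V (%l. \<rho> x * z l)"
begin

definition scal :: "('j, 'k) mpoly set set => ('j, 'k) mpoly fract => bool" where
 "scal V x \<longleftrightarrow> (\<forall>Q\<in>V. x \<in> loc J 0 Q)"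

lemma reg_scale: "opn V ==> scal V x ==> reg V z ==> reg V (%l. \<rho> x * z l)"
 using S_scale[of V _ x z] by (simp add: reg_def scal_def)

lemma smult_reg: "opn V ==> scal V x ==> reg V z ==> cst V x \<odot>\<^bsub>sec F V\<^esub> \<Phi> V z = \<Phi> V (%l. \<rho> x * z l)"
 by (rule smult) (auto simp: reg_def scal_def)

lemma \<rho>_hom: "opn V ==> pts V ~= {} ==> scal V x ==> scal V y ==> \<rho> (x + y) = \<rho> x + \<rho> y & \<rho> (x * y) = \<rho> x * \<rho> y"
 using \<rho>_add[of V _ x y] \<rho>_mult[of V _ x y] by (auto simp: scal_def)

lemma scal_closed: "opn V ==> scal V 1" "opn V ==> scal V x ==> scal V y ==> scal V (x + y)"
  "opn V ==> scal V x ==> scal V y ==> scal V (x * y)"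
 unfolding scal_def using open_subset_points[of J V] loc_1[of _ J] loc_add[of _ J x 0 y] loc_mult'[of _ J x 0 y 0 0]
 by auto

lemma scalars: "opn V ==> carrier (rs_ring (proj J) V) = {cst V x | x. scal V x}"
 by (simp add: O_sections_eq scal_def)

lemma is_module:
 assumes V: "opn V"
 shows "module (rs_ring (proj J) V) (sec F V)"
proof -
 have ex: "\<exists>z. s = \<Phi> V z & reg V z" if "s \<in> carrier (sec F V)" for s using that carrier_reg[OF V] by auto
 have mem: "\<Phi> V z \<in> carrier (sec F V)" if "reg V z" for z using that carrier_reg[OF V] by auto
 have exr: "\<exists>x. a = cst V x & scal V x" if "a \<in> carrier (rs_ring (proj J) V)" for a
  using that unfolding scalars[OF V] by auto
 have lin: "cst V x \<oplus>\<^bsub>rs_ring (proj J) V\<^esub> cst V y = cst V (x + y)" "cst V x \<otimes>\<^bsub>rs_ring (proj J) V\<^esub> cst V y = cst V (x * y)"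
  for x y by (simp_all add: cst_lift2)
 have one: "\<one>\<^bsub>rs_ring (proj J) V\<^esub> = cst V 1" by (simp add: proj_def cst_def)
 note sc = smult_reg[OF V] and rs = reg_scale[OF V]
 show ?thesis
 proof (rule moduleI)
  show "cring (rs_ring (proj J) V)" by (rule cring_proj[OF V])
  show "abelian_group (sec F V)" by (rule sections_group[OF V])
 next
  fix a s assume "a \<in> carrier (rs_ring (proj J) V)" "s \<in> carrier (sec F V)"
  then obtain x z where x: "a = cst V x" "scal V x" and z: "s = \<Phi> V z" "reg V z" using ex exr by metis
  show "a \<odot>\<^bsub>sec F V\<^esub> s \<in> carrier (sec F V)"
   unfolding x(1) z(1) sc[OF x(2) z(2)] by (rule mem[OF rs[OF x(2) z(2)]])
 next
  fix s assume "s \<in> carrier (sec F V)"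
  then obtain z where z: "s = \<Phi> V z" "reg V z" using ex by metis
  show "\<one>\<^bsub>rs_ring (proj J) V\<^esub> \<odot>\<^bsub>sec F V\<^esub> s = s"
   unfolding one z(1) sc[OF scal_closed(1)[OF V] z(2)] \<rho>_1 by simp
 next
  fix a b s assume "a \<in> carrier (rs_ring (proj J) V)" "b \<in> carrier (rs_ring (proj J) V)" "s \<in> carrier (sec F V)"
  then obtain x y z where x: "a = cst V x" "scal V x" and y: "b = cst V y" "scal V y" and z: "s = \<Phi> V z" "reg V z"
   using ex exr by metis
  note xy = scal_closed(2,3)[OF V x(2) y(2)]
  show "(a \<oplus>\<^bsub>rs_ring (proj J) V\<^esub> b) \<odot>\<^bsub>sec F V\<^esub> s = a \<odot>\<^bsub>sec F V\<^esub> s \<oplus>\<^bsub>sec F V\<^esub> b \<odot>\<^bsub>sec F V\<^esub> s"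
   unfolding x(1) y(1) z(1) lin sc[OF x(2) z(2)] sc[OF y(2) z(2)] sc[OF xy(1) z(2)] add_reg[OF V rs[OF x(2) z(2)] rs[OF y(2) z(2)]]
   by (rule eq_sections[OF V rs[OF xy(1) z(2)] reg_add[OF V rs[OF x(2) z(2)] rs[OF y(2) z(2)]]])
    (simp add: \<rho>_hom[OF V _ x(2) y(2)] distrib_right)
  show "(a \<otimes>\<^bsub>rs_ring (proj J) V\<^esub> b) \<odot>\<^bsub>sec F V\<^esub> s = a \<odot>\<^bsub>sec F V\<^esub> (b \<odot>\<^bsub>sec F V\<^esub> s)"
   unfolding x(1) y(1) z(1) lin sc[OF y(2) z(2)] sc[OF x(2) rs[OF y(2) z(2)]] sc[OF xy(2) z(2)]
   by (rule eq_sections[OF V rs[OF xy(2) z(2)] rs[OF x(2) rs[OF y(2) z(2)]]])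
    (simp add: \<rho>_hom[OF V _ x(2) y(2)] mult.assoc)
 next
  fix a s t assume "a \<in> carrier (rs_ring (proj J) V)" "s \<in> carrier (sec F V)" "t \<in> carrier (sec F V)"
  then obtain x z z' where x: "a = cst V x" "scal V x" and z: "s = \<Phi> V z" "reg V z" "t = \<Phi> V z'" "reg V z'"
   using ex exr by metis
  show "a \<odot>\<^bsub>sec F V\<^esub> (s \<oplus>\<^bsub>sec F V\<^esub> t) = a \<odot>\<^bsub>sec F V\<^esub> s \<oplus>\<^bsub>sec F V\<^esub> a \<odot>\<^bsub>sec F V\<^esub> t"
   unfolding x(1) z(1,3) add_reg[OF V z(2,4)] sc[OF x(2) z(2)] sc[OF x(2) z(4)]
    sc[OF x(2) reg_add[OF V z(2,4)]] add_reg[OF V rs[OF x(2) z(2)] rs[OF x(2) z(4)]]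
   by (simp only: distrib_left)
 qed
qed

theorem is_sheaf: "sheaf_of_modules (proj J) F"
 unfolding sheaf_of_modules_def rs_proj
proof (intro conjI allI impI ballI)
 fix U assume U: "opn U"
 show "module (rs_ring (proj J) U) (sec F U)" by (rule is_module[OF U])
next
 fix U s assume U: "opn U" and "s \<in> carrier (sec F U)"
 then obtain z where z: "s = \<Phi> U z" "reg U z" using carrier_reg[OF U] by auto
 show "res F U U s = s" unfolding z(1) by (rule res_reg[OF U U order_refl z(2)])
next
 fix U V assume "opn U & opn V & V \<subseteq> U"
 then have U: "opn U" and V: "opn V" "V \<subseteq> U" by auto
 fix s assume "s \<in> carrier (sec F U)"
 then obtain z where z: "s = \<Phi> U z" "reg U z" using carrier_reg[OF U] by auto
 show "res F U V s \<in> carrier (sec F V)"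
  unfolding z(1) res_reg[OF U V z(2)] carrier_reg[OF V(1)] using reg_mono[OF z(2) V(2)] by auto
next
 fix U V s t assume "opn U & opn V & V \<subseteq> U" and st: "s \<in> carrier (sec F U)" "t \<in> carrier (sec F U)"
 then have U: "opn U" and V: "opn V" "V \<subseteq> U" by auto
 obtain z where z: "s = \<Phi> U z" "reg U z" using st(1) carrier_reg[OF U] by auto
 obtain z' where z': "t = \<Phi> U z'" "reg U z'" using st(2) carrier_reg[OF U] by auto
 show "res F U V (s \<oplus>\<^bsub>sec F U\<^esub> t) = res F U V s \<oplus>\<^bsub>sec F V\<^esub> res F U V t"
   unfolding z(1) z'(1) add_reg[OF U z(2) z'(2)] res_reg[OF U V z(2)] res_reg[OF U V z'(2)]
    res_reg[OF U V reg_add[OF U z(2) z'(2)]] add_reg[OF V(1) reg_mono[OF z(2) V(2)] reg_mono[OF z'(2) V(2)]] ..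
next
 fix U V assume "opn U & opn V & V \<subseteq> U"
 then have U: "opn U" and V: "opn V" "V \<subseteq> U" by auto
 fix r s assume "r \<in> O_sections J 0 U" "s \<in> carrier (sec F U)"
 then obtain x z where x: "r = cst U x" "scal U x" and z: "s = \<Phi> U z" "reg U z"
  unfolding carrier_reg[OF U] O_sections_eq[OF U] scal_def by auto
 have xV: "scal V x" using x(2) V(2) by (auto simp: scal_def)
 show "res F U V (r \<odot>\<^bsub>sec F U\<^esub> s) = restrict r V \<odot>\<^bsub>sec F V\<^esub> res F U V s"
  unfolding x(1) z(1) restrict_cst[OF V(2)] smult_reg[OF U x(2) z(2)] res_reg[OF U V z(2)]
   res_reg[OF U V reg_scale[OF U x(2) z(2)]] smult_reg[OF V(1) xV reg_mono[OF z(2) V(2)]] ..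
next
 fix U V W assume "opn U & opn V & opn W & W \<subseteq> V & V \<subseteq> U"
 then have U: "opn U" and V: "opn V" "V \<subseteq> U" and W: "opn W" "W \<subseteq> V" "W \<subseteq> U" by auto
 fix s assume "s \<in> carrier (sec F U)"
 then obtain z where z: "s = \<Phi> U z" "reg U z" using carrier_reg[OF U] by auto
 show "res F V W (res F U V s) = res F U W s"
  unfolding z(1) res_reg[OF U V z(2)] res_reg[OF U W(1,3) z(2)] by (rule res_reg[OF V(1) W(1,2) reg_mono[OF z(2) V(2)]])
next
 fix \<C> s t assume "\<forall>V\<in>\<C>. opn V" "s \<in> carrier (sec F (\<Union>\<C>))" "t \<in> carrier (sec F (\<Union>\<C>))"
  "\<forall>V\<in>\<C>. res F (\<Union>\<C>) V s = res F (\<Union>\<C>) V t"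
 then show "s = t" by (rule separated)
next
 fix \<C> \<sigma> assume "\<forall>V\<in>\<C>. opn V" and *: "(\<forall>V\<in>\<C>. \<sigma> V \<in> carrier (sec F V)) &
  (\<forall>V\<in>\<C>. \<forall>W\<in>\<C>. res F V (V \<inter> W) (\<sigma> V) = res F W (V \<inter> W) (\<sigma> W))"
 then show "\<exists>s\<in>carrier (sec F (\<Union>\<C>)). \<forall>V\<in>\<C>. res F (\<Union>\<C>) V s = \<sigma> V"
  by (intro glue conjunct1[OF *] conjunct2[OF *])
qed

end

section \<open>The pushforward and its twists\<close>

context pencil
begin

lemma G_0: "p \<in> pp ==> (%_. 0) \<in> G m p"
 by (simp add: G_def loc_0 aT_def)

lemma G_add: "p \<in> pp ==> z \<in> G m p ==> z' \<in> G m p ==> (%l. z l + z' l) \<in> G m p"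
 by (simp add: G_def loc_add aT_add)

lemma G_uminus: "z \<in> G m p ==> (%l. - z l) \<in> G m p"
 by (simp add: G_def loc_uminus aT_uminus)

lemma G_scale: "p \<in> pp ==> x \<in> L n p ==> z \<in> G m p ==> k = n + m ==> (%l. x * z l) \<in> G k p"
 by (simp add: G_def loc_mult aT_scale)

end

locale uple_pencil = matrix_pencil e \<alpha> for e and \<alpha> :: "(nat, 'k::field) mpoly mat" +
 fixes d :: nat assumes d: "d = e + 1"
begin

abbreviation "mons \<equiv> monomials xyz d"
abbreviation "Dm \<equiv> basic_open mons"
abbreviation pre :: "'k ypoly set set => 'k xpoly set set" where
 "pre \<equiv> preim PP (uple_point xyz d)"
abbreviation "UF \<equiv> uple_pushforward xyz d KK"
abbreviation opm :: "'k ypoly set set => bool" where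
 "opm \<equiv> openin (proj_top mons)"
abbreviation \<rho> :: "'k ypoly fract => 'k xpoly fract" where
 "\<rho> \<equiv> pullf xyz d"

lemma d_pos: "0 < d"
 by (simp add: d)

lemma opn_pre: "opm V ==> opn (pre V)"
 by (rule openin_preim[OF d_pos])

lemma pre_pp: "p \<in> pre V ==> p \<in> pp" "p \<in> pre V ==> uple_point xyz d p \<in> V"
 by (simp_all add: preim_proj)

lemma generic_pp: "({0} :: 'k xpoly set) \<in> pp"
 by (rule generic_point) (simp add: lessThan_empty_iff)

lemma generic_pre: "opm V ==> p \<in> pre V ==> {0} \<in> pre V"
 by (rule generic_in_open[OF opn_pre])

lemma pre_irreducible: "opm V ==> opm W ==> pre V ~= {} ==> pre W ~= {} ==> pre (V \<inter> W) ~= {}"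
 using generic_pre[of V] generic_pre[of W] unfolding preim_Int by auto

lemma UF_sec: "carrier (sec UF V) = carrier (sec KK (pre V))" "add (sec UF V) = add (sec KK (pre V))"
 "zero (sec UF V) = zero (sec KK (pre V))" "smult (sec UF V) r s = smult (sec KK (pre V)) (uple_sheaf_map xyz d V r) s"
 "res UF V W = res KK (pre V) (pre W)"
 by (simp_all add: uple_pushforward_def pushforward_def Let_def)

sublocale uf: vector_module_sheaf mons UF pre "G (2 * int e)" "%V. ksec (pre V)" \<rho>
proof
 show "\<rho> 1 = 1" using pullf_form[OF generic_pp polys_1] by (simp add: to_fract_def One_fract_def)
 fix V W :: "'k ypoly set set"
 show "pre (V \<inter> W) = pre V \<inter> pre W" by (rule preim_Int)
 show "opm V ==> opm W ==> pre V ~= {} ==> pre W ~= {} ==> pre (V \<inter> W) ~= {}" by (rule pre_irreducible)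
next
 fix \<C> :: "'k ypoly set set set"
 show "pre (\<Union>\<C>) = \<Union> (pre ` \<C>)" by (rule preim_Union)
next
 fix V :: "'k ypoly set set" and p and z z' :: "nat => 'k xpoly fract"
 assume V: "opm V" and p: "p \<in> pre V"
 show "(%_. 0) \<in> G (2 * int e) p" by (rule G_0[OF pre_pp(1)[OF p]])
 assume z: "z \<in> G (2 * int e) p"
 show "(%l. - z l) \<in> G (2 * int e) p" by (rule G_uminus[OF z])
 assume z': "z' \<in> G (2 * int e) p"
 show "(%l. z l + z' l) \<in> G (2 * int e) p" by (rule G_add[OF pre_pp(1)[OF p] z z'])
 assume "ksec (pre V) z = ksec (pre V) z'"
 then show "z = z'" by (rule ksec_inject[OF opn_pre[OF V] p z])
next
 fix V :: "'k ypoly set set" assume V: "opm V"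
 show "carrier (sec UF V) = {ksec (pre V) z |z. \<forall>p\<in>pre V. z \<in> G (2 * int e) p}"
  unfolding UF_sec by (rule KK_carrier[OF opn_pre[OF V]])
 show "\<zero>\<^bsub>sec UF V\<^esub> = ksec (pre V) (%_. 0)" unfolding UF_sec by (rule KK_zero[OF opn_pre[OF V]])
next
 fix V :: "'k ypoly set set" and z z' :: "nat => 'k xpoly fract"
 assume V: "opm V" "pre V = {}"
 show "ksec (pre V) z = ksec (pre V) z'" unfolding V(2) ksec_def by (rule restrict_ext) simp
next
 fix V :: "'k ypoly set set" and z z' :: "nat => 'k xpoly fract"
 assume V: "opm V" and z: "!!p. p \<in> pre V ==> z \<in> G (2 * int e) p" "!!p. p \<in> pre V ==> z' \<in> G (2 * int e) p"
 show "ksec (pre V) z \<oplus>\<^bsub>sec UF V\<^esub> ksec (pre V) z' = ksec (pre V) (%l. z l + z' l)"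
  unfolding UF_sec by (rule KK_add[OF opn_pre[OF V]]) (fact z)+
next
 fix U V :: "'k ypoly set set" and z :: "nat => 'k xpoly fract"
 assume "V \<subseteq> U"
 then show "res UF U V (ksec (pre U) z) = ksec (pre V) z" unfolding UF_sec by (intro KK_res) (auto simp: preim_proj)
next
 fix V :: "'k ypoly set set" and p x y
 assume V: "opm V" and p: "p \<in> pre V" and x: "!!Q. Q \<in> V ==> x \<in> loc mons 0 Q" and y: "!!Q. Q \<in> V ==> y \<in> loc mons 0 Q"
 show "\<rho> (x + y) = \<rho> x + \<rho> y" "\<rho> (x * y) = \<rho> x * \<rho> y"
  using pullf_add[OF pre_pp(1)[OF p] x[OF pre_pp(2)[OF p]] y[OF pre_pp(2)[OF p]]] .
next
 fix V :: "'k ypoly set set" and p x and z :: "nat => 'k xpoly fract"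
 assume V: "opm V" and p: "p \<in> pre V" and x: "!!Q. Q \<in> V ==> x \<in> loc mons 0 Q" and z: "z \<in> G (2 * int e) p"
 show "(%l. \<rho> x * z l) \<in> G (2 * int e) p"
  using G_scale[OF pre_pp(1)[OF p] pullf_loc[OF pre_pp(1)[OF p] x[OF pre_pp(2)[OF p]]] z] by simp
next
 fix V :: "'k ypoly set set" and x and z :: "nat => 'k xpoly fract"
 assume V: "opm V" and x: "!!Q. Q \<in> V ==> x \<in> loc mons 0 Q" and z: "!!p. p \<in> pre V ==> z \<in> G (2 * int e) p"
 have sm: "uple_sheaf_map xyz d V (cst V x) = cst (pre V) (\<rho> x)" by (rule uple_sheaf_map_cst) (rule x)
 show "cst V x \<odot>\<^bsub>sec UF V\<^esub> ksec (pre V) z = ksec (pre V) (%l. \<rho> x * z l)"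
  unfolding UF_sec sm
 proof (rule KK_smult[OF opn_pre[OF V]])
  show "z \<in> G (2 * int e) p" if "p \<in> pre V" for p by (rule z[OF that])
  show "\<rho> x \<in> L 0 p" if "p \<in> pre V" for p
   using pullf_loc[OF pre_pp(1)[OF that] x[OF pre_pp(2)[OF that]]] by simp
 qed
qed

section \<open>The twists as sheaves of vectors\<close>

lemma Fract_powi:
 fixes a b :: "('i::linorder, 'k) mpoly"
 assumes "a ~= 0" "b ~= 0"
 shows "Fract a b powi j = (if 0 \<le> j then Fract (a ^ nat j) (b ^ nat j) else Fract (b ^ nat (- j)) (a ^ nat (- j)))"
 using assms by (auto simp: Fract_conv_to_fract power_int_def to_fract_power power_divide)

definition mfr :: "(nat \<Rightarrow>\<^sub>0 nat) => 'k xpoly fract" where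
 "mfr m = to_fract (single m 1)"

lemma single_nonzero [simp]: "single m (1 :: 'k) ~= 0"
 by (metis lookup_single_eq lookup_zero zero_neq_one)

lemma mono_nonzero [simp]: "mfr m ~= 0"
 by (simp add: mfr_def)

lemma transition_cst: "transition i k j W = cst W (Fract (mvar k) (mvar i) powi j)"
 by (simp add: transition_def cst_def)

lemma powi_loc:
 assumes P: "P \<in> proj_points I" and f: "f \<in> forms I n" "f \<notin> P"
 shows "to_fract f powi j \<in> loc I (int n * j) P"
proof (cases "0 \<le> j")
 case True
 have "to_fract (f ^ nat j) \<in> loc I (int (nat j * n)) P" by (rule loc_form[OF P forms_power[OF f(1)]])
 then show ?thesis using True by (simp add: power_int_def to_fract_power mult.commute)
next
 case False
 have "1 / to_fract (f ^ nat (- j)) \<in> loc I (- int (nat (- j) * n)) P"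
  by (rule loc_inverse[OF P forms_power[OF f(1)] forms_power_notin[OF P f]])
 then show ?thesis using False by (simp add: power_int_def to_fract_power mult.commute field_simps)
qed

lemma transition_loc:
 fixes R :: "'k ypoly set"
 assumes R: "R \<in> proj_points mons" and m: "i \<in> mons" "mvar i \<notin> R" "k \<in> mons" "mvar k \<notin> R"
 shows "Fract (mvar k) (mvar i) powi j \<in> loc mons 0 R"
proof -
 have "(Fract (mvar k) (mvar i) :: 'k ypoly fract) powi j = to_fract (mvar k) powi j * to_fract (mvar i) powi (- j)"
  unfolding Fract_conv_to_fract power_int_divide_distrib by (simp add: power_int_minus divide_inverse)
 moreover have "to_fract (mvar k) powi j * to_fract (mvar i) powi (- j) \<in> loc mons 0 R"
  by (rule loc_mult'[OF R powi_loc[OF R forms_mvar[OF m(3)] m(4)] powi_loc[OF R forms_mvar[OF m(1)] m(2)]]) simp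
 ultimately show ?thesis by simp
qed

lemma \<rho>_transition:
 assumes m: "i \<in> mons" "k \<in> mons"
 shows "\<rho> (Fract (mvar k) (mvar i) powi j) = (mfr k / mfr i) powi j"
proof -
 have p: "\<rho> (Fract (mvar k ^ n) (mvar i ^ n)) = Fract (single k 1 ^ n) (single i 1 ^ n)"
  if "i \<in> mons" "k \<in> mons" for i k and n :: nat
  using pullf_Fract[OF generic_pp polys_power[OF forms_polys[OF forms_mvar[OF that(2)]]] polys_power[OF forms_polys[OF forms_mvar[OF that(1)]]]]
  by (simp add: uple_pull_power)
 have "mfr k / mfr i = Fract (single k 1) (single i 1)"
  by (simp add: mfr_def Fract_conv_to_fract)
 then show ?thesis using m by (simp add: Fract_powi p)
qed

text \<open>A section of the j-th twist is one vector \<open>v\<close> of degree 2e + dj. Its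
  component on the chart of the coordinate \<open>i\<close> is \<open>v\<close> divided by the j-th
  power of the monomial \<open>i\<close>, which has degree d and is a unit there; the transition
  functions are the ratios of these powers.\<close>

definition twsec :: "int => 'k ypoly set set => (nat => 'k xpoly fract) =>
  (nat \<Rightarrow>\<^sub>0 nat) => 'k xpoly set => ('k xpoly set set \<times> (nat => (nat, 'k) proj_fun) set) set" where
 "twsec j V v = (\<lambda>i\<in>mons. ksec (pre (V \<inter> Dm i)) (%l. mfr i powi (- j) * v l))"

lemma basic_open: "i \<in> mons ==> opm (Dm i)"
 using openin_pbasic[OF forms_mvar] by (simp add: pbasic_def basic_open_def)

lemma pre_basic_open: "i \<in> mons ==> pre (Dm i) = pbasic xyz (single i 1)"
 using preim_pbasic[OF d_pos forms_polys[OF forms_mvar]] by (simp add: pbasic_def basic_open_def)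

lemma twist_degree: "m = 2 * int e + int d * j ==> i \<in> mons ==> p \<in> pp ==> single i 1 \<notin> p ==>
  (%l. mfr i powi (- j) * v l) \<in> G (2 * int e) p \<longleftrightarrow> v \<in> G m p"
proof -
 assume m: "m = 2 * int e + int d * j" and i: "i \<in> mons" and p: "p \<in> pp" "single i 1 \<notin> p"
 have *: "mfr i powi t \<in> L (int d * t) p" for t
  unfolding mfr_def by (rule powi_loc[OF p(1) monomial_form[OF i] p(2)])
 show ?thesis
 proof
  assume v: "(%l. mfr i powi (- j) * v l) \<in> G (2 * int e) p"
  have "(%l. mfr i powi j * (mfr i powi (- j) * v l)) \<in> G m p"
   by (rule G_scale[OF p(1) * v]) (simp add: m)
  moreover have "mfr i powi j * (mfr i powi (- j) * v l) = v l" for l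
   by (simp add: power_int_minus)
  ultimately show "v \<in> G m p" by simp
 next
  assume v: "v \<in> G m p"
  show "(%l. mfr i powi (- j) * v l) \<in> G (2 * int e) p" by (rule G_scale[OF p(1) * v]) (simp add: m)
 qed
qed

lemma twist_chart: "p \<in> pp ==> \<exists>i\<in>mons. single i 1 \<notin> p & mvar i \<notin> uple_point xyz d p"
proof -
 assume p: "p \<in> pp"
 obtain i where i: "i \<in> mons" "mvar i \<notin> uple_point xyz d p"
  using proj_pointD(6)[OF uple_point_closed[OF d_pos p]] by auto
 then show ?thesis using uple_point_memI[OF forms_polys[OF forms_mvar[OF i(1)]]] by (intro bexI[of _ i]) auto
qed

lemma twsec_reg:
 assumes v: "!!p. p \<in> pre V ==> v \<in> G (2 * int e + int d * j) p" and i: "i \<in> mons"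
 shows "uf.reg (V \<inter> Dm i) (%l. mfr i powi (- j) * v l)"
 unfolding uf.reg_def preim_Int pre_basic_open[OF i]
proof
 fix p assume "p \<in> pre V \<inter> pbasic xyz (single i 1)"
 then have p: "p \<in> pre V" "p \<in> pp" "single i 1 \<notin> p" by (auto simp: pbasic_def)
 show "(%l. mfr i powi (- j) * v l) \<in> G (2 * int e) p" using twist_degree[OF refl i p(2,3)] v[OF p(1)] by simp
qed

text \<open>Compatibility with the transition functions says that \<open>mfr i powi j\<close> times
  the i-th component is the same vector on all charts with nonempty preimage. This vector is
  \<open>v\<close>, and its regularity at \<open>p\<close> is tested on a chart containing
  \<open>p\<close>.\<close>

lemma twist_carrier:
 assumes V: "opm V"
 shows "carrier (sec (twist mons j UF) V) = {twsec j V v | v. \<forall>p\<in>pre V. v \<in> G (2 * int e + int d * j) p}"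
proof (intro equalityI subsetI)
 have Vi: "opm (V \<inter> Dm i)" if "i \<in> mons" for i using V basic_open[OF that] by auto
 have Vik: "opm (V \<inter> Dm i \<inter> Dm k)" if "i \<in> mons" "k \<in> mons" for i k
  using V basic_open that by auto
 have sub: "V \<inter> Dm i \<inter> Dm k \<subseteq> V \<inter> Dm i"
  "V \<inter> Dm i \<inter> Dm k \<subseteq> V \<inter> Dm k" for i k by auto
 have sc: "uf.scal (V \<inter> Dm i \<inter> Dm k) (Fract (mvar k) (mvar i) powi j)"
  if "i \<in> mons" "k \<in> mons" for i k unfolding uf.scal_def
  using transition_loc[OF _ that(1) _ that(2)] by (auto simp: basic_open_def)
 {
  fix s assume "s \<in> carrier (sec (twist mons j UF) V)"
  then have s: "s \<in> extensional mons" "!!i. i \<in> mons ==> s i \<in> carrier (sec UF (V \<inter> Dm i))"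
   and tr: "!!i k. i \<in> mons ==> k \<in> mons ==>
    res UF (V \<inter> Dm i) (V \<inter> Dm i \<inter> Dm k) (s i) =
    transition i k j (V \<inter> Dm i \<inter> Dm k) \<odot>\<^bsub>sec UF (V \<inter> Dm i \<inter> Dm k)\<^esub>
    res UF (V \<inter> Dm k) (V \<inter> Dm i \<inter> Dm k) (s k)"
   by (auto simp: twist_def Let_def PiE_def)
  have "\<forall>i\<in>mons. \<exists>z. s i = ksec (pre (V \<inter> Dm i)) z & uf.reg (V \<inter> Dm i) z"
  proof
   fix i assume i: "i \<in> mons"
   show "\<exists>z. s i = ksec (pre (V \<inter> Dm i)) z & uf.reg (V \<inter> Dm i) z"
    using s(2)[OF i] uf.carrier_reg[OF Vi[OF i]] by auto
  qed
  from bchoice[OF this] obtain z where z: "!!i. i \<in> mons ==> s i = ksec (pre (V \<inter> Dm i)) (z i)"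
   "!!i. i \<in> mons ==> uf.reg (V \<inter> Dm i) (z i)" by blast
  have "\<exists>v. \<forall>i\<in>mons. pre (V \<inter> Dm i) ~= {} --> z i = (%l. mfr i powi (- j) * v l)"
  proof (cases "\<exists>k\<in>mons. pre (V \<inter> Dm k) ~= {}")
   case True
   then obtain k where k: "k \<in> mons" "pre (V \<inter> Dm k) ~= {}" by auto
   have "z i = (%l. mfr i powi (- j) * (mfr k powi j * z k l))" if i: "i \<in> mons" "pre (V \<inter> Dm i) ~= {}" for i
   proof -
    let ?W = "V \<inter> Dm i \<inter> Dm k"
    note W = Vik[OF i(1) k(1)]
    note ri = uf.reg_mono[OF z(2)[OF i(1)] sub(1)] and rk = uf.reg_mono[OF z(2)[OF k(1)] sub(2)]
    have "ksec (pre ?W) (z i) = ksec (pre ?W) (%l. \<rho> (Fract (mvar k) (mvar i) powi j) * z k l)"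
     using tr[OF i(1) k(1)]
     unfolding z(1)[OF i(1)] z(1)[OF k(1)] uf.res_reg[OF Vi[OF i(1)] W sub(1) z(2)[OF i(1)]]
      uf.res_reg[OF Vi[OF k(1)] W sub(2) z(2)[OF k(1)]] transition_cst uf.smult_reg[OF W sc[OF i(1) k(1)] rk] .
    moreover have "pre ?W ~= {}"
     using pre_irreducible[OF Vi[OF i(1)] Vi[OF k(1)] i(2) k(2)] unfolding preim_Int by auto
    ultimately have "z i = (%l. \<rho> (Fract (mvar k) (mvar i) powi j) * z k l)"
     by (intro uf.sections_inject[OF W ri uf.reg_scale[OF W sc[OF i(1) k(1)] rk]])
    then show ?thesis unfolding \<rho>_transition[OF i(1) k(1)] power_int_divide_distrib
     by (simp add: power_int_minus divide_inverse mult.commute mult.left_commute)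
   qed
   then show ?thesis by (intro exI[of _ "%l. mfr k powi j * z k l"] ballI impI)
  qed auto
  then obtain v where v: "!!i. i \<in> mons ==> pre (V \<inter> Dm i) ~= {} ==> z i = (%l. mfr i powi (- j) * v l)"
   by blast
  have vG: "v \<in> G (2 * int e + int d * j) p" if p: "p \<in> pre V" for p
  proof -
   obtain i where i: "i \<in> mons" "single i 1 \<notin> p" using twist_chart[OF pre_pp(1)[OF p]] by auto
   have pi: "p \<in> pre (V \<inter> Dm i)"
    unfolding preim_Int pre_basic_open[OF i(1)] using p i(2) pre_pp(1)[OF p] by (auto simp: pbasic_def)
   then have "z i \<in> G (2 * int e) p" using z(2)[OF i(1)] by (auto simp: uf.reg_def)
   moreover have "z i = (%l. mfr i powi (- j) * v l)" by (rule v[OF i(1)]) (use pi in auto)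
   ultimately show ?thesis using twist_degree[OF refl i(1) pre_pp(1)[OF p] i(2), of j v] by simp
  qed
  have "s = twsec j V v"
  proof
   fix i show "s i = twsec j V v i"
   proof (cases "i \<in> mons")
    case i: True
    show ?thesis unfolding z(1)[OF i] twsec_def using i
     by (simp add: uf.eq_sections[OF Vi[OF i] z(2)[OF i] twsec_reg[where v = v and V = V and j = j, OF vG i] v[OF i]])
   qed (use s(1) in \<open>auto simp: twsec_def extensional_def\<close>)
  qed
  then show "s \<in> {twsec j V v | v. \<forall>p\<in>pre V. v \<in> G (2 * int e + int d * j) p}" using vG by auto
 }
 fix s assume "s \<in> {twsec j V v | v. \<forall>p\<in>pre V. v \<in> G (2 * int e + int d * j) p}"
 then obtain v where v: "s = twsec j V v" "!!p. p \<in> pre V ==> v \<in> G (2 * int e + int d * j) p" by auto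
 have si: "s i = ksec (pre (V \<inter> Dm i)) (%l. mfr i powi (- j) * v l)" if "i \<in> mons" for i
  using that by (simp add: v(1) twsec_def)
 have r: "uf.reg (V \<inter> Dm i) (%l. mfr i powi (- j) * v l)" if "i \<in> mons" for i
  by (rule twsec_reg[OF _ that]) (rule v(2))
 have "s i \<in> carrier (sec UF (V \<inter> Dm i))" if i: "i \<in> mons" for i
  unfolding si[OF i] uf.carrier_reg[OF Vi[OF i]] using r[OF i] by auto
 moreover have "res UF (V \<inter> Dm i) (V \<inter> Dm i \<inter> Dm k) (s i) =
    transition i k j (V \<inter> Dm i \<inter> Dm k) \<odot>\<^bsub>sec UF (V \<inter> Dm i \<inter> Dm k)\<^esub>
    res UF (V \<inter> Dm k) (V \<inter> Dm i \<inter> Dm k) (s k)" if i: "i \<in> mons" and k: "k \<in> mons" for i k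
  unfolding si[OF i] si[OF k] transition_cst uf.res_reg[OF Vi[OF i] Vik[OF i k] sub(1) r[OF i]]
   uf.res_reg[OF Vi[OF k] Vik[OF i k] sub(2) r[OF k]]
   uf.smult_reg[OF Vik[OF i k] sc[OF i k] uf.reg_mono[OF r[OF k] sub(2)]] \<rho>_transition[OF i k]
   power_int_divide_distrib by (simp add: power_int_minus field_simps)
 ultimately show "s \<in> carrier (sec (twist mons j UF) V)"
  by (auto simp: twist_def Let_def PiE_def v(1) twsec_def)
qed

sublocale tw: vector_sheaf mons "twist mons j UF" pre "G (2 * int e + int d * j)" "twsec j" for j
proof
 fix V W :: "'k ypoly set set"
 show "pre (V \<inter> W) = pre V \<inter> pre W" by (rule preim_Int)
 show "opm V ==> opm W ==> pre V ~= {} ==> pre W ~= {} ==> pre (V \<inter> W) ~= {}" by (rule pre_irreducible)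
next
 fix \<C> :: "'k ypoly set set set"
 show "pre (\<Union>\<C>) = \<Union> (pre ` \<C>)" by (rule preim_Union)
next
 fix V :: "'k ypoly set set" and p and z z' :: "nat => 'k xpoly fract"
 let ?G = "G (2 * int e + int d * j)"
 assume V: "opm V" and p: "p \<in> pre V"
 show "(%_. 0) \<in> ?G p" by (rule G_0[OF pre_pp(1)[OF p]])
 assume z: "z \<in> ?G p"
 show "(%l. - z l) \<in> ?G p" by (rule G_uminus[OF z])
 assume z': "z' \<in> ?G p"
 show "(%l. z l + z' l) \<in> ?G p" by (rule G_add[OF pre_pp(1)[OF p] z z'])
 assume eq: "twsec j V z = twsec j V z'"
 obtain i where i: "i \<in> mons" "single i 1 \<notin> p" using twist_chart[OF pre_pp(1)[OF p]] by auto
 have pi: "p \<in> pre (V \<inter> Dm i)"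
  unfolding preim_Int pre_basic_open[OF i(1)] using p i(2) pre_pp(1)[OF p] by (auto simp: pbasic_def)
 have "ksec (pre (V \<inter> Dm i)) (%l. mfr i powi (- j) * z l) = ksec (pre (V \<inter> Dm i)) (%l. mfr i powi (- j) * z' l)"
  using fun_cong[OF eq, of i] i(1) by (simp add: twsec_def)
 moreover have "opm (V \<inter> Dm i)" using V basic_open[OF i(1)] by auto
 moreover have "(%l. mfr i powi (- j) * z l) \<in> G (2 * int e) p"
  using twist_degree[OF refl i(1) pre_pp(1)[OF p] i(2)] z by simp
 ultimately have "(%l. mfr i powi (- j) * z l) = (%l. mfr i powi (- j) * z' l)"
  by (intro ksec_inject[OF opn_pre pi])
 then have "mfr i powi (- j) * z l = mfr i powi (- j) * z' l" for l by (rule fun_cong)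
 then show "z = z'" by (auto simp: fun_eq_iff)
next
 fix V :: "'k ypoly set set" assume V: "opm V"
 show "carrier (sec (twist mons j UF) V) = {twsec j V z |z. \<forall>p\<in>pre V. z \<in> G (2 * int e + int d * j) p}"
  by (rule twist_carrier[OF V])
 have "\<zero>\<^bsub>sec UF (V \<inter> Dm i)\<^esub> = ksec (pre (V \<inter> Dm i)) (%_. 0)" if "i \<in> mons" for i
  by (rule uf.zero) (use V basic_open[OF that] in auto)
 then show "\<zero>\<^bsub>sec (twist mons j UF) V\<^esub> = twsec j V (%_. 0)"
  by (auto simp: twist_def Let_def twsec_def intro!: restrict_ext)
next
 fix V :: "'k ypoly set set" and z z' :: "nat => 'k xpoly fract"
 assume V: "opm V" "pre V = {}"
 then have "ksec (pre (V \<inter> Dm i)) w = ksec (pre (V \<inter> Dm i)) w'" if "i \<in> mons" for i w w'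
  by (intro uf.trivial) (use V basic_open[OF that] preim_Int[of xyz _ V] in auto)
 then show "twsec j V z = twsec j V z'" unfolding twsec_def by (intro restrict_ext)
next
 fix V :: "'k ypoly set set" and z z' :: "nat => 'k xpoly fract"
 assume V: "opm V" and z: "!!p. p \<in> pre V ==> z \<in> G (2 * int e + int d * j) p" "!!p. p \<in> pre V ==> z' \<in> G (2 * int e + int d * j) p"
 have "ksec (pre (V \<inter> Dm i)) (%l. mfr i powi (- j) * z l) \<oplus>\<^bsub>sec UF (V \<inter> Dm i)\<^esub>
   ksec (pre (V \<inter> Dm i)) (%l. mfr i powi (- j) * z' l) =
   ksec (pre (V \<inter> Dm i)) (%l. mfr i powi (- j) * (z l + z' l))" if i: "i \<in> mons" for i
 proof -
  have "uf.reg (V \<inter> Dm i) (%l. mfr i powi (- j) * z l)"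
   "uf.reg (V \<inter> Dm i) (%l. mfr i powi (- j) * z' l)"
   by (rule twsec_reg[OF _ i], fact z)+
  moreover have "opm (V \<inter> Dm i)" using V basic_open[OF i] by auto
  ultimately show ?thesis unfolding distrib_left by (intro uf.add_reg)
 qed
 then show "twsec j V z \<oplus>\<^bsub>sec (twist mons j UF) V\<^esub> twsec j V z' = twsec j V (%l. z l + z' l)"
  by (auto simp: twist_def Let_def twsec_def intro!: restrict_ext)
next
 fix U V :: "'k ypoly set set" and z :: "nat => 'k xpoly fract"
 assume U: "opm U" and V: "opm V" "V \<subseteq> U" and z: "!!p. p \<in> pre U ==> z \<in> G (2 * int e + int d * j) p"
 have "res UF (U \<inter> Dm i) (V \<inter> Dm i) (ksec (pre (U \<inter> Dm i)) (%l. mfr i powi (- j) * z l)) =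
   ksec (pre (V \<inter> Dm i)) (%l. mfr i powi (- j) * z l)" if i: "i \<in> mons" for i
 proof -
  have "uf.reg (U \<inter> Dm i) (%l. mfr i powi (- j) * z l)" by (rule twsec_reg[OF _ i]) (fact z)
  moreover have "opm (U \<inter> Dm i)" "opm (V \<inter> Dm i)" using U V basic_open[OF i] by auto
  moreover have "V \<inter> Dm i \<subseteq> U \<inter> Dm i" using V(2) by auto
  ultimately show ?thesis by (intro uf.res_reg)
 qed
 then show "res (twist mons j UF) U V (twsec j U z) = twsec j V z"
  by (auto simp: twist_def Let_def twsec_def intro!: restrict_ext)
qed

end

section \<open>Cech cohomology\<close>

definition alt_sum :: "('x list => nat => 'v::ab_group_add) => 'x list => nat => 'v" where
 "alt_sum u xs l = (\<Sum>k<length xs. if even k then u (omit k xs) l else - u (omit k xs) l)"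

lemma omit_simplices: "xs \<in> simplices T (Suc q) ==> k < length xs ==> omit k xs \<in> simplices T q"
 using set_take_subset[of k xs] set_drop_subset[of "Suc k" xs] by (auto simp: simplices_def omit_def)

lemma set_omit: "set (omit k xs) \<subseteq> set xs"
 using set_take_subset[of k xs] set_drop_subset[of "Suc k" xs] by (auto simp: omit_def)

lemma cap_omit: "cap \<U> xs \<subseteq> cap \<U> (omit k xs)"
 using set_omit[of k xs] by (auto simp: cap_def)

lemma openin_cap:
 assumes "pt_cover T \<U>" "xs \<in> simplices T q"
 shows "openin T (cap \<U> xs)"
proof -
 have "xs ~= []" using assms(2) by (auto simp: simplices_def)
 then show ?thesis unfolding cap_def
  using assms by (intro openin_INT2) (auto simp: pt_cover_def simplices_def)
qed

context vector_sheaf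
begin

abbreviation smp :: "nat => ('j, 'k) mpoly set list set" where
 "smp \<equiv> simplices (proj_top J)"

lemma cobdry_vector:
 assumes \<U>: "pt_cover (proj_top J) \<U>" and xs: "xs \<in> smp (Suc q)"
  and u: "!!ys. ys \<in> smp q ==> f ys = \<Phi> (cap \<U> ys) (u ys) & reg (cap \<U> ys) (u ys)"
 shows "cobdry F \<U> f xs = \<Phi> (cap \<U> xs) (alt_sum u xs)" and "reg (cap \<U> xs) (alt_sum u xs)"
proof -
 let ?C = "cap \<U> xs"
 have C: "opn ?C" by (rule openin_cap[OF \<U> xs])
 let ?h = "%k l. if even k then u (omit k xs) l else - u (omit k xs) l"
 interpret A: abelian_group "sec F ?C" by (rule sections_group[OF C])
 have o: "opn (cap \<U> (omit k xs))" "reg (cap \<U> (omit k xs)) (u (omit k xs))" "reg ?C (u (omit k xs))"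
  "f (omit k xs) = \<Phi> (cap \<U> (omit k xs)) (u (omit k xs))" if "k < length xs" for k
  using openin_cap[OF \<U> omit_simplices[OF xs that]] u[OF omit_simplices[OF xs that]] reg_mono[OF _ cap_omit] by auto
 have h: "reg ?C (?h k)" if "k < length xs" for k using o(3)[OF that] reg_uminus[OF C] by (cases "even k") simp_all
 have t: "(let t = res F (cap \<U> (omit k xs)) ?C (f (omit k xs)) in if even k then t else \<ominus>\<^bsub>sec F ?C\<^esub> t) = \<Phi> ?C (?h k)"
  if k: "k < length xs" for k
  unfolding o(4)[OF k] res_reg[OF o(1)[OF k] C cap_omit o(2)[OF k]] Let_def
  by (simp add: sections_uminus[OF C o(3)[OF k]])
 have "cobdry F \<U> f xs = finsum (sec F ?C) (%k. \<Phi> ?C (?h k)) {..<length xs}"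
  unfolding cobdry_def
 proof (rule A.finsum_cong'[OF refl])
  show "(%k. \<Phi> ?C (?h k)) \<in> {..<length xs} \<rightarrow> carrier (sec F ?C)"
   unfolding carrier_reg[OF C] using h by auto
 qed (simp add: t)
 also have "\<dots> = \<Phi> ?C (%l. \<Sum>k<length xs. ?h k l)" by (rule sections_finsum[OF C]) (simp add: h)
 finally show "cobdry F \<U> f xs = \<Phi> ?C (alt_sum u xs)" unfolding alt_sum_def .
 have "reg ?C (%l. \<Sum>k\<in>A. ?h k l)" if "A \<subseteq> {..<length xs}" for A
 proof -
  have "finite A" using that finite_subset by auto
  then show ?thesis using that
  proof (induction A)
   case (insert k A)
   then show ?case using reg_add[OF C h[of k], of "%l. \<Sum>k\<in>A. ?h k l"] by simp
  qed (simp add: reg_0[OF C])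
 qed
 then show "reg ?C (alt_sum u xs)" unfolding alt_sum_def[abs_def] by simp
qed

text \<open>Being a coboundary, for cochains given by vectors. Equations are asked only on
  intersections with a point in \<open>pts\<close>, since over the others all sections
  agree.\<close>

definition solvable :: "(('j, 'k) mpoly set => ('j, 'k) mpoly set set) => nat => (('j, 'k) mpoly set list => nat => 'v) => bool" where
 "solvable \<W> q u \<longleftrightarrow> (case q of
   0 => \<forall>xs\<in>smp 0. pts (cap \<W> xs) ~= {} --> u xs = (%_. 0)
  | Suc r => \<exists>g. (\<forall>xs\<in>smp r. reg (cap \<W> xs) (g xs)) &
   (\<forall>xs\<in>smp q. pts (cap \<W> xs) ~= {} --> u xs = alt_sum g xs))"

lemma solvable_cobdry:
 assumes \<W>: "pt_cover (proj_top J) \<W>" and s: "solvable \<W> q t"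
  and f: "!!xs. xs \<in> smp q ==> f xs = \<Phi> (cap \<W> xs) (t xs) & reg (cap \<W> xs) (t xs)"
 shows "is_cobdry (proj J) F \<W> q f"
proof (cases q)
 case 0
 have "f xs = \<zero>\<^bsub>sec F (cap \<W> xs)\<^esub>" if xs: "xs \<in> smp 0" for xs
 proof -
  have C: "opn (cap \<W> xs)" by (rule openin_cap[OF \<W> xs])
  have "\<Phi> (cap \<W> xs) (t xs) = \<Phi> (cap \<W> xs) (%_. 0)"
   by (rule eq_sections[OF C]) (use f[of xs] xs 0 s reg_0[OF C] in \<open>simp_all add: solvable_def\<close>)
  then show ?thesis using f[of xs] xs 0 zero[OF C] by simp
 qed
 then show ?thesis using 0 by (simp add: is_cobdry_def)
next
 case (Suc r)
 obtain g where g: "!!xs. xs \<in> smp r ==> reg (cap \<W> xs) (g xs)"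
  "!!xs. xs \<in> smp q ==> pts (cap \<W> xs) ~= {} ==> t xs = alt_sum g xs"
  using s unfolding solvable_def Suc by auto
 let ?g = "%xs. \<Phi> (cap \<W> xs) (g xs)"
 have "?g \<in> cochains (proj J) F \<W> r"
  unfolding cochains_def rs_proj
 proof
  fix xs assume xs: "xs \<in> smp r"
  show "?g xs \<in> carrier (sec F (cap \<W> xs))" using carrier_reg[OF openin_cap[OF \<W> xs]] g(1)[OF xs] by auto
 qed
 moreover have "f xs = cobdry F \<W> ?g xs" if xs: "xs \<in> smp (Suc r)" for xs
 proof -
  have C: "opn (cap \<W> xs)" by (rule openin_cap[OF \<W> xs])
  have G: "?g ys = \<Phi> (cap \<W> ys) (g ys) & reg (cap \<W> ys) (g ys)" if "ys \<in> smp r" for ys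
   using g(1)[OF that] by simp
  note c = cobdry_vector[OF \<W> xs, where f = ?g and u = g, OF G]
  have "\<Phi> (cap \<W> xs) (t xs) = \<Phi> (cap \<W> xs) (alt_sum g xs)"
   by (rule eq_sections[OF C]) (use f[of xs] xs Suc c(2) g(2)[of xs] in simp_all)
  then show ?thesis using f[of xs] xs Suc c(1) by simp
 qed
 ultimately show ?thesis unfolding is_cobdry_def Suc rs_proj by auto
qed

lemma cochain_vector:
 assumes \<U>: "pt_cover (proj_top J) \<U>" and f: "f \<in> cochains (proj J) F \<U> q"
 shows "\<exists>u. \<forall>xs\<in>smp q. f xs = \<Phi> (cap \<U> xs) (u xs) & reg (cap \<U> xs) (u xs)"
proof (rule bchoice, rule ballI)
 fix xs assume xs: "xs \<in> smp q"
 have "f xs \<in> carrier (sec F (cap \<U> xs))" using f xs by (auto simp: cochains_def)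
 then show "\<exists>u. f xs = \<Phi> (cap \<U> xs) u & reg (cap \<U> xs) u" using carrier_reg[OF openin_cap[OF \<U> xs]] by auto
qed

text \<open>Two cocycles are compared on a common refinement, taken from any cofinal class
  \<open>Sp\<close> of covers; their difference is a cocycle of vectors there and is solved by
  assumption. So there is at most one class, and the zero cochain on the trivial cover provides
  one.\<close>

lemma cohomology_zeroI:
 assumes refine: "!!\<U>. pt_cover (proj_top J) \<U> ==> \<exists>\<W>. pt_cover (proj_top J) \<W> & Sp \<W> & (\<forall>x\<in>proj_points J. \<W> x \<subseteq> \<U> x)"
  and solve: "!!\<W> t. pt_cover (proj_top J) \<W> ==> Sp \<W> ==>
   \<forall>xs\<in>smp q. reg (cap \<W> xs) (t xs) ==>
   \<forall>xs\<in>smp (Suc q). pts (cap \<W> xs) ~= {} --> alt_sum t xs = (%_. 0) ==> solvable \<W> q t"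
 shows "cohomology_zero (proj J) F q"
proof -
 define Z where "Z = cocycles (proj J) F q"
 have rel: "(c, c') \<in> cohomologous (proj J) F q" if c: "c \<in> Z" "c' \<in> Z" for c c'
 proof -
  obtain \<U> f \<V> g where cc: "c = (\<U>, f)" "c' = (\<V>, g)" by (cases c, cases c')
  have \<U>: "pt_cover (proj_top J) \<U>" "f \<in> cochains (proj J) F \<U> q"
    "!!xs. xs \<in> smp (Suc q) ==> cobdry F \<U> f xs = \<zero>\<^bsub>sec F (cap \<U> xs)\<^esub>"
   and \<V>: "pt_cover (proj_top J) \<V>" "g \<in> cochains (proj J) F \<V> q"
    "!!xs. xs \<in> smp (Suc q) ==> cobdry F \<V> g xs = \<zero>\<^bsub>sec F (cap \<V> xs)\<^esub>"
   using c unfolding cc Z_def cocycles_def rs_proj by auto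
  have "pt_cover (proj_top J) (%x. \<U> x \<inter> \<V> x)" using \<U>(1) \<V>(1) by (auto simp: pt_cover_def)
  then obtain \<W> where W: "pt_cover (proj_top J) \<W>" "Sp \<W>" "!!x. x \<in> proj_points J ==> \<W> x \<subseteq> \<U> x \<inter> \<V> x"
   using refine[of "%x. \<U> x \<inter> \<V> x"] by auto
  have sub: "cap \<W> xs \<subseteq> cap \<U> xs" "cap \<W> xs \<subseteq> cap \<V> xs" if "xs \<in> smp r" for xs r
   using W(3) that by (fastforce simp: cap_def simplices_def topspace_proj_top)+
  obtain u where u: "!!xs. xs \<in> smp q ==> f xs = \<Phi> (cap \<U> xs) (u xs) & reg (cap \<U> xs) (u xs)"
   using cochain_vector[OF \<U>(1,2)] by auto
  obtain w where w: "!!xs. xs \<in> smp q ==> g xs = \<Phi> (cap \<V> xs) (w xs) & reg (cap \<V> xs) (w xs)"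
   using cochain_vector[OF \<V>(1,2)] by auto
  have cu: "alt_sum u xs = (%_. 0)" if xs: "xs \<in> smp (Suc q)" "pts (cap \<U> xs) ~= {}" for xs
  proof (rule sections_inject)
   show C: "opn (cap \<U> xs)" by (rule openin_cap[OF \<U>(1) xs(1)])
   show "\<Phi> (cap \<U> xs) (alt_sum u xs) = \<Phi> (cap \<U> xs) (%_. 0)"
    using cobdry_vector(1)[OF \<U>(1) xs(1), of f u, OF u] \<U>(3)[OF xs(1)] zero[OF C] by simp
   show "reg (cap \<U> xs) (alt_sum u xs)" by (rule cobdry_vector(2)[OF \<U>(1) xs(1), of f u, OF u])
   show "reg (cap \<U> xs) (%_. 0)" by (rule reg_0[OF C])
  qed (rule xs(2))
  have cw: "alt_sum w xs = (%_. 0)" if xs: "xs \<in> smp (Suc q)" "pts (cap \<V> xs) ~= {}" for xs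
  proof (rule sections_inject)
   show C: "opn (cap \<V> xs)" by (rule openin_cap[OF \<V>(1) xs(1)])
   show "\<Phi> (cap \<V> xs) (alt_sum w xs) = \<Phi> (cap \<V> xs) (%_. 0)"
    using cobdry_vector(1)[OF \<V>(1) xs(1), of g w, OF w] \<V>(3)[OF xs(1)] zero[OF C] by simp
   show "reg (cap \<V> xs) (alt_sum w xs)" by (rule cobdry_vector(2)[OF \<V>(1) xs(1), of g w, OF w])
   show "reg (cap \<V> xs) (%_. 0)" by (rule reg_0[OF C])
  qed (rule xs(2))
  define t where "t xs l = u xs l + - w xs l" for xs l
  have tr: "reg (cap \<W> xs) (u xs)" "reg (cap \<W> xs) (w xs)" "reg (cap \<W> xs) (%l. - w xs l)" "reg (cap \<W> xs) (t xs)"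
   if xs: "xs \<in> smp q" for xs
  proof -
   note C = openin_cap[OF W(1) xs]
   show u1: "reg (cap \<W> xs) (u xs)" using reg_mono[OF conjunct2[OF u[OF xs]] sub(1)[OF xs]] .
   show w1: "reg (cap \<W> xs) (w xs)" using reg_mono[OF conjunct2[OF w[OF xs]] sub(2)[OF xs]] .
   show w2: "reg (cap \<W> xs) (%l. - w xs l)" by (rule reg_uminus[OF C w1])
   show "reg (cap \<W> xs) (t xs)" unfolding t_def[abs_def] by (rule reg_add[OF C u1 w2])
  qed
  have "solvable \<W> q t"
  proof (rule solve[OF W(1,2)])
   show "\<forall>xs\<in>smp q. reg (cap \<W> xs) (t xs)" using tr(4) by auto
   show "\<forall>xs\<in>smp (Suc q). pts (cap \<W> xs) ~= {} --> alt_sum t xs = (%_. 0)"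
   proof (intro ballI impI)
    fix xs assume xs: "xs \<in> smp (Suc q)" "pts (cap \<W> xs) ~= {}"
    have "alt_sum u xs = (%_. 0)" "alt_sum w xs = (%_. 0)"
     using cu[OF xs(1)] cw[OF xs(1)] xs(2) pts_mono[OF sub(1)[OF xs(1)]] pts_mono[OF sub(2)[OF xs(1)]] by auto
    moreover have "alt_sum t xs l = alt_sum u xs l - alt_sum w xs l" for l
     unfolding alt_sum_def t_def by (simp only: sum_subtractf[symmetric]) (rule sum.cong, auto)
    ultimately show "alt_sum t xs = (%_. 0)" by (simp add: fun_eq_iff)
   qed
  qed
  moreover have "res F (cap \<U> xs) (cap \<W> xs) (f xs) \<ominus>\<^bsub>sec F (cap \<W> xs)\<^esub> res F (cap \<V> xs) (cap \<W> xs) (g xs) =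
    \<Phi> (cap \<W> xs) (t xs) & reg (cap \<W> xs) (t xs)" if xs: "xs \<in> smp q" for xs
  proof -
   note C = openin_cap[OF W(1) xs]
   show ?thesis
    unfolding conjunct1[OF u[OF xs]] conjunct1[OF w[OF xs]] a_minus_def
     res_reg[OF openin_cap[OF \<U>(1) xs] C sub(1)[OF xs] conjunct2[OF u[OF xs]]]
     res_reg[OF openin_cap[OF \<V>(1) xs] C sub(2)[OF xs] conjunct2[OF w[OF xs]]]
     sections_uminus[OF C tr(2)[OF xs]] add_reg[OF C tr(1,3)[OF xs]] t_def[abs_def]
    using tr(4)[OF xs] by (simp add: t_def[abs_def])
  qed
  ultimately have "is_cobdry (proj J) F \<W> q (%xs. res F (cap \<U> xs) (cap \<W> xs) (f xs) \<ominus>\<^bsub>sec F (cap \<W> xs)\<^esub>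
    res F (cap \<V> xs) (cap \<W> xs) (g xs))"
   by (rule solvable_cobdry[OF W(1)])
  then show ?thesis unfolding cohomologous_def cc rs_proj topspace_proj_top
   using c W(1,3) unfolding cc Z_def mem_Collect_eq prod.case by (intro conjI exI[of _ \<W>] ballI)
 qed
 have sub: "cohomologous (proj J) F q \<subseteq> Z \<times> Z" unfolding cohomologous_def Z_def by auto
 have "Z ~= {}"
 proof -
  let ?U = "%_::('j, 'k) mpoly set. proj_points J :: ('j, 'k) mpoly set set"
  let ?f = "%xs. \<Phi> (cap ?U xs) (%_. 0)"
  have U: "pt_cover (proj_top J) ?U"
   unfolding pt_cover_def topspace_proj_top[symmetric] using openin_topspace by blast
  have f: "?f ys = \<Phi> (cap ?U ys) (%_. 0) & reg (cap ?U ys) (%_. 0)" if "ys \<in> smp r" for ys r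
   using reg_0[OF openin_cap[OF U that]] by simp
  have "?f \<in> cochains (proj J) F ?U q"
   unfolding cochains_def rs_proj
  proof
   fix xs assume xs: "xs \<in> smp q"
   show "?f xs \<in> carrier (sec F (cap ?U xs))" using carrier_reg[OF openin_cap[OF U xs]] f[OF xs] by auto
  qed
  moreover have "cobdry F ?U ?f xs = \<zero>\<^bsub>sec F (cap ?U xs)\<^esub>" if xs: "xs \<in> smp (Suc q)" for xs
  proof -
   have "alt_sum (%_ _. 0 :: 'v) xs = (%_. 0)" by (rule ext) (simp add: alt_sum_def cong: if_cong)
   then show ?thesis
    using cobdry_vector(1)[OF U xs, of ?f "%_ _. 0", OF f] zero[OF openin_cap[OF U xs]] by simp
  qed
  ultimately have "(?U, ?f) \<in> Z" using U by (simp add: Z_def cocycles_def)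
  then show ?thesis by auto
 qed
 then obtain c where c: "c \<in> Z" by auto
 have cl: "cohomologous (proj J) F q `` {c} = Z" if "c \<in> Z" for c
  using rel[OF that] sub by auto
 have "cohomology (proj J) F q = {Z}"
  unfolding cohomology_def Z_def[symmetric] quotient_def using cl c by auto
 then show ?thesis unfolding cohomology_zero_def by simp
qed

end


section \<open>Vanishing of the cohomology of the twists\<close>

lemma simplices_lists:
 "xs \<in> simplices T 0 \<longleftrightarrow> (\<exists>x\<in>topspace T. xs = [x])"
 "xs \<in> simplices T 1 \<longleftrightarrow> (\<exists>x\<in>topspace T. \<exists>y\<in>topspace T. xs = [x, y])"
 "xs \<in> simplices T 2 \<longleftrightarrow> (\<exists>x\<in>topspace T. \<exists>y\<in>topspace T. \<exists>z\<in>topspace T. xs = [x, y, z])"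
 "x \<in> topspace T ==> y \<in> topspace T ==> z \<in> topspace T ==> w \<in> topspace T ==> [x, y, z, w] \<in> simplices T 3"
 by (auto simp: simplices_def length_Suc_conv numeral_eq_Suc One_nat_def)

lemma alt_sum_lists:
 "alt_sum u [x, y] l = u [y] l - u [x] l"
 "alt_sum u [x, y, z] l = u [y, z] l - u [x, z] l + u [x, y] l"
 "alt_sum u [x, y, z, w] l = u [y, z, w] l - u [x, z, w] l + u [x, y, w] l - u [x, y, z] l"
 by (simp_all add: alt_sum_def omit_def One_nat_def)

lemma cap_lists: "cap \<U> [x] = \<U> x" "cap \<U> [x, y] = \<U> x \<inter> \<U> y" "cap \<U> [x, y, z] = \<U> x \<inter> (\<U> y \<inter> \<U> z)"
 "cap \<U> [x, y, z, w] = \<U> x \<inter> (\<U> y \<inter> (\<U> z \<inter> \<U> w))"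
 by (simp_all add: cap_def)

context uple_pencil
begin

text \<open>The covers of the target that restrict to a \<open>plane_cover\<close>; members that
  miss the plane are exempt.\<close>

definition special :: "('k ypoly set => 'k ypoly set set) => bool" where
 "special \<W> \<longleftrightarrow> (\<forall>x\<in>proj_points mons. pre (\<W> x) ~= {} --> (\<exists>f n i. f \<in> forms xyz n & 0 < n & f ~= 0 & i \<in> {0, 1, 2} &
  pre (\<W> x) = pbasic xyz f & (\<forall>P\<in>pp. f \<notin> P --> mvar i \<notin> P)))"

text \<open>Each member is shrunk to the principal open set of F y_i, with y_i a coordinate that
  does not vanish at the point. On the plane y_i becomes a monomial of degree d > 0: a variable
  dividing it provides the standard chart, and the degree is positive even when F is
  constant.\<close>

lemma special_refinement:
 assumes \<U>: "pt_cover (proj_top mons) \<U>"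
 shows "\<exists>\<W>. pt_cover (proj_top mons) \<W> & special \<W> & (\<forall>x\<in>proj_points mons. \<W> x \<subseteq> \<U> x)"
proof -
 have "\<forall>x\<in>proj_points mons. \<exists>F. (\<exists>n i. F \<in> forms mons n & i \<in> mons & mvar i \<notin> x & F \<notin> x & pbasic mons F \<subseteq> \<U> x)"
 proof
  fix x :: "'k ypoly set" assume x: "x \<in> proj_points mons"
  then have "opm (\<U> x)" "x \<in> \<U> x" using \<U> by (auto simp: pt_cover_def topspace_proj_top)
  then obtain F n where F: "F \<in> forms mons n" "x \<in> pbasic mons F" "pbasic mons F \<subseteq> \<U> x" by (rule open_pbasic)
  obtain i where "i \<in> mons" "mvar i \<notin> x" using proj_pointD(6)[OF x] by auto
  then show "\<exists>F. (\<exists>n i. F \<in> forms mons n & i \<in> mons & mvar i \<notin> x & F \<notin> x & pbasic mons F \<subseteq> \<U> x)"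
   using F by (intro exI[of _ F] exI[of _ n] exI[of _ i]) (auto simp: pbasic_def)
 qed
 from bchoice[OF this] obtain F where F: "!!x. x \<in> proj_points mons ==>
  \<exists>n i. F x \<in> forms mons n & i \<in> mons & mvar i \<notin> x & F x \<notin> x & pbasic mons (F x) \<subseteq> \<U> x" by blast
 have "\<forall>x\<in>proj_points mons. \<exists>i. (\<exists>n. F x \<in> forms mons n & i \<in> mons & mvar i \<notin> x & F x \<notin> x & pbasic mons (F x) \<subseteq> \<U> x)"
  using F by auto
 from bchoice[OF this] obtain i where i: "!!x. x \<in> proj_points mons ==>
  \<exists>n. F x \<in> forms mons n & i x \<in> mons & mvar (i x) \<notin> x & F x \<notin> x & pbasic mons (F x) \<subseteq> \<U> x" by blast
 define \<W> where "\<W> x = pbasic mons (F x * mvar (i x))" for x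
 have W: "\<W> x = pbasic mons (F x) \<inter> pbasic mons (mvar (i x))" "opm (\<W> x)" if x: "x \<in> proj_points mons" for x
 proof -
  obtain n where n: "F x \<in> forms mons n" "i x \<in> mons" using i[OF x] by auto
  show "\<W> x = pbasic mons (F x) \<inter> pbasic mons (mvar (i x))" unfolding \<W>_def by (rule pbasic_mult[OF n(1) forms_mvar[OF n(2)]])
  show "opm (\<W> x)" unfolding \<W>_def by (rule openin_pbasic[OF forms_mult[OF n(1) forms_mvar[OF n(2)]]])
 qed
 have "x \<in> \<W> x & \<W> x \<subseteq> \<U> x" if x: "x \<in> proj_points mons" for x
  unfolding W(1)[OF x] using i[OF x] x by (auto simp: pbasic_def)
 moreover have "special \<W>"
  unfolding special_def
 proof (intro ballI impI)
  fix x :: "'k ypoly set" assume x: "x \<in> proj_points mons" and ne: "pre (\<W> x) ~= {}"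
  obtain n where n: "F x \<in> forms mons n" "i x \<in> mons" using i[OF x] by auto
  let ?f = "uple_pull (F x) * single (i x) 1"
  have pb: "pre (\<W> x) = pbasic xyz ?f"
   using preim_pbasic[OF d_pos polys_mult[OF forms_polys[OF n(1)] forms_polys[OF forms_mvar[OF n(2)]]]]
   unfolding \<W>_def by (simp add: uple_pull_mult)
  have f: "?f \<in> forms xyz (d * n + d)" by (rule forms_mult[OF uple_pull_forms[OF n(1)] monomial_form[OF n(2)]])
  obtain P where P: "P \<in> pp" "?f \<notin> P" using ne unfolding pb by (auto simp: pbasic_def)
  have "mdeg (i x) = d" "keys (i x) \<subseteq> xyz" using n(2) by (auto simp: monomials_def)
  then have "keys (i x) ~= {}" using d_pos by (auto simp: mdeg_def)
  then obtain a where a: "a \<in> keys (i x)" by (auto simp only: ex_in_conv[symmetric])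
  then have a3: "a \<in> xyz" using \<open>keys (i x) \<subseteq> xyz\<close> by auto
  define v where "v = i x - single a 1"
  have iv: "i x = single a 1 + v"
   by (rule poly_mapping_eqI) (use a in \<open>auto simp: v_def lookup_add lookup_minus lookup_single when_def in_keys_iff\<close>)
  have "keys v \<subseteq> keys (i x)" by (auto simp: v_def in_keys_iff lookup_minus)
  then have "keys v \<subseteq> xyz" using \<open>keys (i x) \<subseteq> xyz\<close> by (rule order_trans)
  then have g: "uple_pull (F x) * single v 1 \<in> polys xyz"
   by (intro polys_mult polys_single forms_polys[OF uple_pull_forms[OF n(1)]])
  have fg: "?f = (uple_pull (F x) * single v 1) * mvar a"
   unfolding iv by (simp add: mvar_def mult_single mult.assoc add.commute)
  have "mvar a \<notin> R" if "R \<in> pp" "?f \<notin> R" for R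
  proof
   assume "mvar a \<in> R"
   then have "?f \<in> R" unfolding fg by (rule pidealD(4)[OF proj_pointD(2)[OF that(1)] _ g])
   then show False using that(2) by simp
  qed
  then show "\<exists>f n i. f \<in> forms xyz n & 0 < n & f ~= 0 & i \<in> {0, 1, 2} &
    pre (\<W> x) = pbasic xyz f & (\<forall>P\<in>pp. f \<notin> P --> mvar i \<notin> P)"
   using f pb a3 nonzero_if_notin[OF P] d_pos
   by (intro exI[of _ ?f] exI[of _ "d * n + d"] exI[of _ a]) (auto simp: xyz_eq)
 qed
 ultimately show ?thesis using W(2) by (intro exI[of _ \<W>]) (auto simp: pt_cover_def topspace_proj_top)
qed

text \<open>Points whose neighbourhood misses the plane are removed from the index set. The others
  still cover the plane, because \<open>P\<close> lies in the preimage of the neighbourhood of its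
  image.\<close>

lemma special_cover:
 assumes \<W>: "pt_cover (proj_top mons) \<W>" "special \<W>"
 defines "X \<equiv> {x \<in> proj_points mons. pre (\<W> x) ~= {}}"
 shows "\<exists>\<phi> \<delta> \<iota>. pencil_cover e (%i j. \<alpha> $$ (i, j)) X \<phi> \<delta> \<iota> & (\<forall>x\<in>X. pre (\<W> x) = pbasic xyz (\<phi> x))"
proof -
 have "\<forall>x\<in>X. \<exists>t. fst t \<in> forms xyz (fst (snd t)) & 0 < fst (snd t) & fst t ~= 0 & snd (snd t) \<in> {0, 1, 2} &
  pre (\<W> x) = pbasic xyz (fst t) & (\<forall>P\<in>pp. fst t \<notin> P --> mvar (snd (snd t)) \<notin> P)"
 proof
  fix x assume "x \<in> X"
  then have "\<exists>f n i. f \<in> forms xyz n & 0 < n & f ~= 0 & i \<in> {0, 1, 2} &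
   pre (\<W> x) = pbasic xyz f & (\<forall>P\<in>pp. f \<notin> P --> mvar i \<notin> P)"
   using \<W>(2) unfolding X_def special_def by auto
  then obtain f n i where "f \<in> forms xyz n & 0 < n & f ~= 0 & i \<in> {0, 1, 2} &
   pre (\<W> x) = pbasic xyz f & (\<forall>P\<in>pp. f \<notin> P --> mvar i \<notin> P)" by (elim exE)
  then show "\<exists>t. fst t \<in> forms xyz (fst (snd t)) & 0 < fst (snd t) & fst t ~= 0 & snd (snd t) \<in> {0, 1, 2} &
   pre (\<W> x) = pbasic xyz (fst t) & (\<forall>P\<in>pp. fst t \<notin> P --> mvar (snd (snd t)) \<notin> P)"
   by (intro exI[of _ "(f, n, i)"]) simp
 qed
 from bchoice[OF this] obtain t where t: "\<forall>x\<in>X. fst (t x) \<in> forms xyz (fst (snd (t x))) & 0 < fst (snd (t x)) &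
  fst (t x) ~= 0 & snd (snd (t x)) \<in> {0, 1, 2} &
  pre (\<W> x) = pbasic xyz (fst (t x)) & (\<forall>P\<in>pp. fst (t x) \<notin> P --> mvar (snd (snd (t x))) \<notin> P)" by (elim exE)
 have "plane_cover X (%x. fst (t x)) (%x. fst (snd (t x))) (%x. snd (snd (t x)))"
 proof
  fix P assume P: "P \<in> pp"
  let ?x = "uple_point xyz d P"
  have x: "?x \<in> proj_points mons" by (rule uple_point_closed[OF d_pos P])
  then have "?x \<in> \<W> ?x" using \<W>(1) by (auto simp: pt_cover_def topspace_proj_top)
  then have Px: "P \<in> pre (\<W> ?x)" using P by (simp add: preim_proj)
  then have xX: "?x \<in> X" using x by (auto simp: X_def)
  then have "P \<in> pbasic xyz (fst (t ?x))" using t Px by auto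
  then show "\<exists>x\<in>X. fst (t x) \<notin> P" using xX by (auto simp: pbasic_def)
 qed (use t in auto)
 then have "pencil_cover e (%i j. \<alpha> $$ (i, j)) X (%x. fst (t x)) (%x. fst (snd (t x))) (%x. snd (snd (t x)))"
  using pencil by (intro pencil_cover.intro)
 then show ?thesis using t by blast
qed

text \<open>Members of the cover that meet the plane meet each other on it, so all values of the
  cocycle are one vector, which is regular on the whole plane.\<close>

lemma cohomology_H0:
 assumes j: "j < 0"
 shows "cohomology_zero (proj mons) (twist mons j UF) 0"
proof (rule tw.cohomology_zeroI[where Sp = special, OF special_refinement])
 fix \<W> and t :: "'k ypoly set list => nat => 'k xpoly fract"
 assume W: "pt_cover (proj_top mons) \<W>" "special \<W>"
  and reg: "\<forall>xs\<in>simplices (proj_top mons) 0. tw.reg j (cap \<W> xs) (t xs)"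
  and coc: "\<forall>xs\<in>simplices (proj_top mons) (Suc 0). pre (cap \<W> xs) ~= {} --> alt_sum t xs = (%_. 0)"
 have op: "opm (\<W> x)" "x \<in> \<W> x" if "x \<in> proj_points mons" for x
  using W(1) that by (auto simp: pt_cover_def topspace_proj_top)
 have "t [x] = (%_. 0)" if x: "x \<in> proj_points mons" "pre (\<W> x) ~= {}" for x
 proof (rule G_no_sections)
  \<comment> \<open>The degree is at most 2e - (e + 1) = e - 1.\<close>
  have "int d * j \<le> int d * (- 1)" using j by (intro mult_left_mono) auto
  then show "2 * int e + int d * j < int e" using d by simp
  fix P assume P: "P \<in> pp"
  let ?y = "uple_point xyz d P"
  have y: "?y \<in> proj_points mons" by (rule uple_point_closed[OF d_pos P])
  have Py: "P \<in> pre (\<W> ?y)" using P op(2)[OF y] by (simp add: preim_proj)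
  have "pre (cap \<W> [x, ?y]) ~= {}" unfolding cap_lists using pre_irreducible[OF op(1)[OF x(1)] op(1)[OF y] x(2)] Py by auto
  then have "alt_sum t [x, ?y] = (%_. 0)"
   using coc x(1) y simplices_lists(2)[of "[x, ?y]" "proj_top mons"] by (auto simp: One_nat_def topspace_proj_top)
  then have "t [?y] l - t [x] l = 0" for l unfolding alt_sum_lists(1)[symmetric] by simp
  then have "t [x] = t [?y]" by (simp add: fun_eq_iff)
  moreover have "tw.reg j (\<W> ?y) (t [?y])"
   using reg y simplices_lists(1)[of "[?y]" "proj_top mons"] by (auto simp: topspace_proj_top cap_lists)
  ultimately show "t [x] \<in> G (2 * int e + int d * j) P" using Py by (auto simp: tw.reg_def)
 qed
 then have "t xs = (%_. 0)" if "xs \<in> simplices (proj_top mons) 0" "pre (cap \<W> xs) ~= {}" for xs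
  using that unfolding simplices_lists topspace_proj_top by (elim bexE) (simp add: cap_lists)
 then show "tw.solvable j \<W> 0 t" by (simp add: tw.solvable_def)
qed

lemma cohomology_H1: "cohomology_zero (proj mons) (twist mons j UF) 1"
proof (rule tw.cohomology_zeroI[where Sp = special, OF special_refinement])
 fix \<W> and t :: "'k ypoly set list => nat => 'k xpoly fract"
 assume W: "pt_cover (proj_top mons) \<W>" "special \<W>"
  and reg: "\<forall>xs\<in>simplices (proj_top mons) 1. tw.reg j (cap \<W> xs) (t xs)"
  and coc: "\<forall>xs\<in>simplices (proj_top mons) (Suc 1). pre (cap \<W> xs) ~= {} --> alt_sum t xs = (%_. 0)"
 have op: "opm (\<W> x)" "x \<in> \<W> x" if "x \<in> proj_points mons" for x
  using W(1) that by (auto simp: pt_cover_def topspace_proj_top)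
 define X where "X = {x \<in> proj_points mons. pre (\<W> x) ~= {}}"
 obtain \<phi> \<delta> \<iota> where c: "pencil_cover e (%i j. \<alpha> $$ (i, j)) X \<phi> \<delta> \<iota>" "\<forall>x\<in>X. pre (\<W> x) = pbasic xyz (\<phi> x)"
  using special_cover[OF W] unfolding X_def[symmetric] by (elim exE conjE)
 interpret pencil_cover e "%i j. \<alpha> $$ (i, j)" X \<phi> \<delta> \<iota> by (rule c(1))
 have XD: "x \<in> proj_points mons" "pre (\<W> x) ~= {}" if "x \<in> X" for x using that by (auto simp: X_def)
 have "\<exists>g. (\<forall>x\<in>X. \<forall>P\<in>pp. \<phi> x \<notin> P --> g x \<in> G (2 * int e + int d * j) P) & (\<forall>x\<in>X. \<forall>y\<in>X. \<forall>l. t [x, y] l = g y l - g x l)"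
 proof (rule G_H1)
  \<comment> \<open>For j \<ge> -1 the left-hand alternative holds, with equality at 2e - (e + 1) +
    1 = e; for j \<le> -2 the degree plus one is at most 2e - 2(e + 1) + 1 = -1.\<close>
  show "int e \<le> 2 * int e + int d * j + 1 \<or> 2 * int e + int d * j + 1 < 0"
  proof (cases "- 1 \<le> j")
   case True
   then have "int d * (- 1) \<le> int d * j" by (intro mult_left_mono) auto
   then show ?thesis using d by simp
  next
   case False
   then have "int d * j \<le> int d * (- 2)" by (intro mult_left_mono) auto
   then show ?thesis using d by simp
  qed
 next
  fix x y z l assume x: "x \<in> X" "y \<in> X" "z \<in> X"
  note o = op(1)[OF XD(1)[OF x(1)]] op(1)[OF XD(1)[OF x(2)]] op(1)[OF XD(1)[OF x(3)]]
  have "pre (cap \<W> [x, y, z]) ~= {}" unfolding cap_lists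
   by (rule pre_irreducible[OF o(1) openin_Int[OF o(2,3)] XD(2)[OF x(1)] pre_irreducible[OF o(2,3) XD(2)[OF x(2)] XD(2)[OF x(3)]]])
  moreover have "[x, y, z] \<in> simplices (proj_top mons) (Suc 1)"
   using XD(1) x simplices_lists(3)[of "[x, y, z]" "proj_top mons"] by (auto simp: topspace_proj_top numeral_2_eq_2 One_nat_def)
  ultimately have "alt_sum t [x, y, z] = (%_. 0)" using coc by auto
  then show "t [y, z] l - t [x, z] l + t [x, y] l = 0" unfolding alt_sum_lists(2)[symmetric] by simp
 next
  fix x y P assume x: "x \<in> X" "y \<in> X" and P: "P \<in> pp" "\<phi> x \<notin> P" "\<phi> y \<notin> P"
  have "[x, y] \<in> simplices (proj_top mons) 1"
   using XD(1) x simplices_lists(2)[of "[x, y]" "proj_top mons"] by (auto simp: topspace_proj_top)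
  then have "tw.reg j (\<W> x \<inter> \<W> y) (t [x, y])" using reg by (auto simp: cap_lists)
  moreover have "P \<in> pre (\<W> x \<inter> \<W> y)"
   unfolding preim_Int bspec[OF c(2) x(1)] bspec[OF c(2) x(2)] using P by (simp add: pbasic_def)
  ultimately show "t [x, y] \<in> G (2 * int e + int d * j) P" by (auto simp: tw.reg_def)
 qed
 then obtain g where g: "\<forall>x\<in>X. \<forall>P\<in>pp. \<phi> x \<notin> P --> g x \<in> G (2 * int e + int d * j) P"
  "\<forall>x\<in>X. \<forall>y\<in>X. \<forall>l. t [x, y] l = g y l - g x l" by (elim exE conjE)
 have "tw.reg j (cap \<W> xs) (g (hd xs))" if xs: "xs \<in> simplices (proj_top mons) 0" for xs
 proof -
  obtain x where x: "x \<in> proj_points mons" "xs = [x]" using xs unfolding simplices_lists(1) topspace_proj_top by auto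
  show ?thesis unfolding tw.reg_def x(2) cap_lists list.sel
  proof
   fix P assume P: "P \<in> pre (\<W> x)"
   then have xX: "x \<in> X" using x(1) by (auto simp: X_def)
   have "P \<in> pbasic xyz (\<phi> x)" using P unfolding bspec[OF c(2) xX] .
   then have "P \<in> pp" "\<phi> x \<notin> P" by (auto simp: pbasic_def)
   then show "g x \<in> G (2 * int e + int d * j) P" using bspec[OF bspec[OF g(1) xX]] by simp
  qed
 qed
 moreover have "t xs = alt_sum (%xs. g (hd xs)) xs" if xs: "xs \<in> simplices (proj_top mons) 1" and ne: "pre (cap \<W> xs) ~= {}" for xs
 proof -
  obtain x y where x: "x \<in> proj_points mons" "y \<in> proj_points mons" "xs = [x, y]"
   using xs unfolding simplices_lists(2) topspace_proj_top by auto
  have X: "x \<in> X" "y \<in> X" using ne x(1,2) unfolding X_def x(3) cap_lists preim_Int by auto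
  show ?thesis unfolding x(3)
   by (rule ext) (simp only: alt_sum_lists list.sel spec[OF bspec[OF bspec[OF g(2) X(1)] X(2)]])
 qed
 ultimately show "tw.solvable j \<W> 1 t"
  unfolding tw.solvable_def One_nat_def nat.case by (intro exI[of _ "%xs. g (hd xs)"] conjI ballI impI)
qed

lemma cohomology_H2:
 assumes j: "- 2 \<le> j"
 shows "cohomology_zero (proj mons) (twist mons j UF) 2"
proof (rule tw.cohomology_zeroI[where Sp = special, OF special_refinement])
 fix \<W> and t :: "'k ypoly set list => nat => 'k xpoly fract"
 assume W: "pt_cover (proj_top mons) \<W>" "special \<W>"
  and reg: "\<forall>xs\<in>simplices (proj_top mons) 2. tw.reg j (cap \<W> xs) (t xs)"
  and coc: "\<forall>xs\<in>simplices (proj_top mons) (Suc 2). pre (cap \<W> xs) ~= {} --> alt_sum t xs = (%_. 0)"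
 have op: "opm (\<W> x)" "x \<in> \<W> x" if "x \<in> proj_points mons" for x
  using W(1) that by (auto simp: pt_cover_def topspace_proj_top)
 define X where "X = {x \<in> proj_points mons. pre (\<W> x) ~= {}}"
 obtain \<phi> \<delta> \<iota> where c: "pencil_cover e (%i j. \<alpha> $$ (i, j)) X \<phi> \<delta> \<iota>" "\<forall>x\<in>X. pre (\<W> x) = pbasic xyz (\<phi> x)"
  using special_cover[OF W] unfolding X_def[symmetric] by (elim exE conjE)
 interpret pencil_cover e "%i j. \<alpha> $$ (i, j)" X \<phi> \<delta> \<iota> by (rule c(1))
 have XD: "x \<in> proj_points mons" "pre (\<W> x) ~= {}" if "x \<in> X" for x using that by (auto simp: X_def)
 have "\<exists>g. (\<forall>x\<in>X. \<forall>y\<in>X. \<forall>P\<in>pp. \<phi> x \<notin> P --> \<phi> y \<notin> P --> g x y \<in> G (2 * int e + int d * j) P) &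
  (\<forall>x\<in>X. \<forall>y\<in>X. \<forall>z\<in>X. \<forall>l. t [x, y, z] l = g y z l - g x z l + g x y l)"
 proof (rule G_H2)
  \<comment> \<open>The least degree is 2e - 2(e + 1) = -2, just within the range of
    \<open>laurent_H2\<close>.\<close>
  have "int d * (- 2) \<le> int d * j" using j by (intro mult_left_mono) auto
  then show "- 2 \<le> 2 * int e + int d * j" using d by simp
 next
  fix x y z w l assume x: "x \<in> X" "y \<in> X" "z \<in> X" "w \<in> X"
  note o = op(1)[OF XD(1)[OF x(1)]] op(1)[OF XD(1)[OF x(2)]] op(1)[OF XD(1)[OF x(3)]] op(1)[OF XD(1)[OF x(4)]]
  have "pre (\<W> y \<inter> (\<W> z \<inter> \<W> w)) ~= {}"
   by (rule pre_irreducible[OF o(2) openin_Int[OF o(3,4)] XD(2)[OF x(2)] pre_irreducible[OF o(3,4) XD(2)[OF x(3)] XD(2)[OF x(4)]]])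
  then have "pre (cap \<W> [x, y, z, w]) ~= {}" unfolding cap_lists
   by (rule pre_irreducible[OF o(1) openin_Int[OF o(2) openin_Int[OF o(3,4)]] XD(2)[OF x(1)]])
  moreover have "[x, y, z, w] \<in> simplices (proj_top mons) (Suc 2)"
   using XD(1) x simplices_lists(4)[of x "proj_top mons" y z w] by (auto simp: topspace_proj_top)
  ultimately have "alt_sum t [x, y, z, w] = (%_. 0)" using coc by auto
  then show "t [y, z, w] l - t [x, z, w] l + t [x, y, w] l - t [x, y, z] l = 0" unfolding alt_sum_lists(3)[symmetric] by simp
 next
  fix x y z P assume x: "x \<in> X" "y \<in> X" "z \<in> X" and P: "P \<in> pp" "\<phi> x \<notin> P" "\<phi> y \<notin> P" "\<phi> z \<notin> P"
  have "[x, y, z] \<in> simplices (proj_top mons) 2"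
   using XD(1) x simplices_lists(3)[of "[x, y, z]" "proj_top mons"] by (auto simp: topspace_proj_top)
  then have "tw.reg j (\<W> x \<inter> (\<W> y \<inter> \<W> z)) (t [x, y, z])" using reg by (auto simp: cap_lists)
  moreover have "P \<in> pre (\<W> x \<inter> (\<W> y \<inter> \<W> z))"
   unfolding preim_Int bspec[OF c(2) x(1)] bspec[OF c(2) x(2)] bspec[OF c(2) x(3)] using P by (simp add: pbasic_def)
  ultimately show "t [x, y, z] \<in> G (2 * int e + int d * j) P" by (auto simp: tw.reg_def)
 qed
 then obtain g where g: "\<forall>x\<in>X. \<forall>y\<in>X. \<forall>P\<in>pp. \<phi> x \<notin> P --> \<phi> y \<notin> P --> g x y \<in> G (2 * int e + int d * j) P"
  "\<forall>x\<in>X. \<forall>y\<in>X. \<forall>z\<in>X. \<forall>l. t [x, y, z] l = g y z l - g x z l + g x y l" by (elim exE conjE)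
 have "tw.reg j (cap \<W> xs) (g (hd xs) (hd (tl xs)))" if xs: "xs \<in> simplices (proj_top mons) 1" for xs
 proof -
  obtain x y where x: "x \<in> proj_points mons" "y \<in> proj_points mons" "xs = [x, y]"
   using xs unfolding simplices_lists(2) topspace_proj_top by auto
  show ?thesis unfolding tw.reg_def x(3) cap_lists list.sel
  proof
   fix P assume P: "P \<in> pre (\<W> x \<inter> \<W> y)"
   then have X: "x \<in> X" "y \<in> X" using x(1,2) unfolding X_def preim_Int by auto
   have "P \<in> pbasic xyz (\<phi> x)" "P \<in> pbasic xyz (\<phi> y)"
    using P unfolding preim_Int bspec[OF c(2) X(1)] bspec[OF c(2) X(2)] by auto
   then have "P \<in> pp" "\<phi> x \<notin> P" "\<phi> y \<notin> P" by (auto simp: pbasic_def)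
   then show "g x y \<in> G (2 * int e + int d * j) P" using bspec[OF bspec[OF bspec[OF g(1) X(1)] X(2)]] by simp
  qed
 qed
 moreover have "t xs = alt_sum (%xs. g (hd xs) (hd (tl xs))) xs"
  if xs: "xs \<in> simplices (proj_top mons) 2" and ne: "pre (cap \<W> xs) ~= {}" for xs
 proof -
  obtain x y z where x: "x \<in> proj_points mons" "y \<in> proj_points mons" "z \<in> proj_points mons" "xs = [x, y, z]"
   using xs unfolding simplices_lists(3) topspace_proj_top by auto
  have X: "x \<in> X" "y \<in> X" "z \<in> X" using ne x(1-3) unfolding X_def x(4) cap_lists preim_Int by auto
  show ?thesis unfolding x(4)
   by (rule ext) (simp only: alt_sum_lists list.sel spec[OF bspec[OF bspec[OF bspec[OF g(2) X(1)] X(2)] X(3)]])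
 qed
 ultimately show "tw.solvable j \<W> 2 t"
  unfolding tw.solvable_def numeral_2_eq_2 nat.case One_nat_def by (intro exI[of _ "%xs. g (hd xs) (hd (tl xs))"] conjI ballI impI)
qed

end

section \<open>Support and dimension\<close>

text \<open>Near \<open>p\<close> all sections restrict to the only section over a set without
  points, so there is a single germ at \<open>p\<close>.\<close>

lemma (in vector_sheaf) germ_trivial:
 assumes W: "opn W" "p \<in> W" "pts W = {}" and U: "opn U" "p \<in> U" and s: "s \<in> carrier (sec F U)"
 shows "germ (proj J) F p U s = {(V, t). opn V & p \<in> V & t \<in> carrier (sec F V)}"
proof -
 have "\<exists>W. opn W & p \<in> W & W \<subseteq> U \<inter> V & res F U W s = res F V W t"
  if V: "opn V" "p \<in> V" "t \<in> carrier (sec F V)" for V t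
 proof -
  let ?W = "U \<inter> V \<inter> W"
  have o: "opn ?W" "?W \<subseteq> U" "?W \<subseteq> V" using U V W by auto
  obtain z where z: "s = \<Phi> U z" "reg U z" using s unfolding carrier_reg[OF U(1)] by auto
  obtain z' where z': "t = \<Phi> V z'" "reg V z'" using V(3) unfolding carrier_reg[OF V(1)] by auto
  have "pts ?W = {}" using pts_mono[of ?W W] W(3) by auto
  then have "res F U ?W s = res F V ?W t"
   unfolding z(1) z'(1) res_reg[OF U(1) o(1,2) z(2)] res_reg[OF V(1) o(1,3) z'(2)] by (rule trivial[OF o(1)])
  then show ?thesis using U V W o by (intro exI[of _ ?W] conjI) auto
 qed
 then show ?thesis unfolding germ_def rs_proj by auto
qed

section \<open>Irreducible closed sets and their vanishing ideals\<close>

lemma closedin_proj: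
 fixes S :: "('j::linorder, 'k::field) mpoly set"
 assumes "S \<subseteq> (\<Union>n. forms J n)"
 shows "closedin (subtopology (proj_top J) Z) {Q \<in> proj_points J. Q \<in> Z & S \<subseteq> Q}"
proof -
 have "openin (proj_top J) {Q \<in> proj_points J. \<not> S \<subseteq> Q}" unfolding openin_proj_top using assms by blast
 moreover have "proj_points J - {Q \<in> proj_points J. S \<subseteq> Q} = {Q \<in> proj_points J. \<not> S \<subseteq> Q}" by blast
 ultimately have "closedin (proj_top J) {Q \<in> proj_points J. S \<subseteq> Q}" by (simp add: closedin_def topspace_proj_top)
 then show ?thesis unfolding closedin_subtopology by (intro exI[of _ "{Q \<in> proj_points J. S \<subseteq> Q}"]) blast
qed

lemma closedin_projE:
 fixes C :: "('j::linorder, 'k::field) mpoly set set"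
 assumes "closedin (subtopology (proj_top J) Z) C"
 shows "\<exists>S. S \<subseteq> (\<Union>n. forms J n) & C = {Q \<in> proj_points J. Q \<in> Z & S \<subseteq> Q}"
proof -
 obtain K where K: "closedin (proj_top J) K" "C = K \<inter> Z" using assms unfolding closedin_subtopology by auto
 then have "openin (proj_top J) (proj_points J - K)" "K \<subseteq> proj_points J" unfolding closedin_def topspace_proj_top by auto
 then obtain S where S: "S \<subseteq> (\<Union>n. forms J n)" "proj_points J - K = {Q \<in> proj_points J. \<not> S \<subseteq> Q}" unfolding openin_proj_top by auto
 have "C = {Q \<in> proj_points J. Q \<in> Z & S \<subseteq> Q}"
 proof (rule Set.set_eqI)
  fix R
  have "R \<in> proj_points J - K \<longleftrightarrow> R \<in> {Q \<in> proj_points J. \<not> S \<subseteq> Q}" using S(2) by simp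
  then show "R \<in> C \<longleftrightarrow> R \<in> {Q \<in> proj_points J. Q \<in> Z & S \<subseteq> Q}"
   using K(2) \<open>K \<subseteq> proj_points J\<close> by auto
 qed
 then show ?thesis using S(1) by auto
qed

definition vanishing :: "'j set => ('j, 'k::field) mpoly set set => ('j, 'k) mpoly set" where
 "vanishing J C = {f \<in> polys J. \<forall>Q\<in>C. f \<in> Q}"

lemma vanishing_prime:
 fixes C :: "('j::linorder, 'k::field) mpoly set set"
 assumes C: "irreducible_closed (subtopology (proj_top J) Z) C"
 shows "pprime J (vanishing J C)" "vanishing J C \<subset> irrelevant J" "{Q \<in> proj_points J. Q \<in> Z & vanishing J C \<subseteq> Q} = C"
proof -
 obtain S where S: "S \<subseteq> (\<Union>n. forms J n)" "C = {Q \<in> proj_points J. Q \<in> Z & S \<subseteq> Q}"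
  using closedin_projE[of J Z C] C unfolding irreducible_closed_def by auto
 obtain Q where Q: "Q \<in> C" "Q \<in> proj_points J" using C S(2) unfolding irreducible_closed_def by auto
 have pt: "R \<in> proj_points J" if "R \<in> C" for R using that S(2) by auto
 have SI: "S \<subseteq> vanishing J C"
 proof
  fix f assume f: "f \<in> S"
  then obtain n where "f \<in> forms J n" using S(1) by auto
  then show "f \<in> vanishing J C" using f forms_polys[of f J n] unfolding vanishing_def S(2) by auto
 qed
 show "{R \<in> proj_points J. R \<in> Z & vanishing J C \<subseteq> R} = C"
 proof
  show "{R \<in> proj_points J. R \<in> Z & vanishing J C \<subseteq> R} \<subseteq> C" using SI unfolding S(2) by auto
  show "C \<subseteq> {R \<in> proj_points J. R \<in> Z & vanishing J C \<subseteq> R}" using S(2) by (auto simp: vanishing_def)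
 qed
 have "vanishing J C \<subseteq> Q" using Q(1) by (auto simp: vanishing_def)
 then show "vanishing J C \<subset> irrelevant J" using proj_point_irrelevant[OF Q(2)] by (rule subset_psubset_trans)
 show "pprime J (vanishing J C)"
 proof (rule homog_primeI)
  have id: "pideal J R" "homog R" if "R \<in> C" for R using proj_pointD(2,3)[OF pt[OF that]] .
  show "pideal J (vanishing J C)" unfolding pideal_def vanishing_def
   using pidealD(2)[OF id(1)] pidealD(3)[OF id(1)] pidealD(4)[OF id(1)] by (simp add: polys_add polys_mult Ball_def)
  show "homog (vanishing J C)" unfolding homog_def
  proof (intro ballI allI)
   fix f n assume "f \<in> vanishing J C"
   then show "hom_component n f \<in> vanishing J C"
    using id(2) by (simp add: vanishing_def polys_hom_component homog_def)
  qed
  show "1 \<notin> vanishing J C" using Q proj_pointD(4)[OF Q(2)] by (auto simp: vanishing_def)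
  fix f g m n assume f: "f \<in> forms J m" and g: "g \<in> forms J n" and fg: "f * g \<in> vanishing J C"
  let ?A = "C \<inter> {R \<in> proj_points J. R \<in> Z & {f} \<subseteq> R}" and ?B = "C \<inter> {R \<in> proj_points J. R \<in> Z & {g} \<subseteq> R}"
  have cl: "closedin (subtopology (proj_top J) Z) C" using C by (simp add: irreducible_closed_def)
  have A: "closedin (subtopology (proj_top J) Z) ?A" by (rule closedin_Int[OF cl closedin_proj]) (use f in auto)
  have B: "closedin (subtopology (proj_top J) Z) ?B" by (rule closedin_Int[OF cl closedin_proj]) (use g in auto)
  have "f \<in> R \<or> g \<in> R" if R: "R \<in> C" for R
   using proj_pointD(7)[OF pt[OF R] forms_polys[OF f] forms_polys[OF g]] fg R by (simp add: vanishing_def)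
  then have "C = ?A \<union> ?B" using S(2) by auto
  then have "C = ?A \<or> C = ?B" using C A B unfolding irreducible_closed_def by meson
  then show "f \<in> vanishing J C \<or> g \<in> vanishing J C"
   using forms_polys[OF f] forms_polys[OF g] unfolding vanishing_def by auto
 qed
qed

text \<open>A closed subset of \<open>Z\<close> that contains \<open>Q\<close> contains every point
  of \<open>Z\<close> above \<open>Q\<close>, so in a decomposition the member containing
  \<open>Q\<close> is everything.\<close>

lemma point_closure_irreducible:
 fixes Q :: "('j::linorder, 'k::field) mpoly set"
 assumes Q: "Q \<in> proj_points J" "Q \<in> Z"
 shows "irreducible_closed (subtopology (proj_top J) Z) {R \<in> proj_points J. R \<in> Z & Q \<subseteq> R}"
 unfolding irreducible_closed_def
proof (intro conjI allI impI)
 let ?S = "Q \<inter> (\<Union>n. forms J n)"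
 have S: "?S \<subseteq> R \<longleftrightarrow> Q \<subseteq> R" if R: "R \<in> proj_points J" for R
 proof
  assume *: "?S \<subseteq> R"
  show "Q \<subseteq> R"
  proof
   fix f assume f: "f \<in> Q"
   have "hom_component n f \<in> Q" for n using proj_pointD(3)[OF Q(1)] f by (simp add: homog_def)
   moreover have "hom_component n f \<in> forms J n" for n
    by (rule hom_component_forms[OF pidealD(1)[OF proj_pointD(2)[OF Q(1)] f]])
   ultimately have "hom_component n f \<in> R" for n using * by blast
   then show "f \<in> R" by (rule homog_memI[OF proj_pointD(2)[OF R]])
  qed
 qed auto
 have "{R \<in> proj_points J. R \<in> Z & Q \<subseteq> R} = {R \<in> proj_points J. R \<in> Z & ?S \<subseteq> R}" using S by auto
 then show "closedin (subtopology (proj_top J) Z) {R \<in> proj_points J. R \<in> Z & Q \<subseteq> R}"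
  using closedin_proj[of ?S J Z] by auto
 show "{R \<in> proj_points J. R \<in> Z & Q \<subseteq> R} ~= {}" using Q by auto
 fix A B assume AB: "closedin (subtopology (proj_top J) Z) A & closedin (subtopology (proj_top J) Z) B &
  {R \<in> proj_points J. R \<in> Z & Q \<subseteq> R} = A \<union> B"
 have sub: "{R \<in> proj_points J. R \<in> Z & Q \<subseteq> R} \<subseteq> K" if K: "closedin (subtopology (proj_top J) Z) K" "Q \<in> K" for K
 proof -
  obtain T where "K = {R \<in> proj_points J. R \<in> Z & T \<subseteq> R}" using closedin_projE[OF K(1)] by auto
  then show ?thesis using K(2) by auto
 qed
 have "Q \<in> A \<union> B" using AB Q by auto
 then show "{R \<in> proj_points J. R \<in> Z & Q \<subseteq> R} = A \<or> {R \<in> proj_points J. R \<in> Z & Q \<subseteq> R} = B"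
  using sub[of A] sub[of B] AB by auto
qed

text \<open>The substitution maps into a domain, and because \<sigma> has constant positive degree
  it respects homogeneous components.\<close>

lemma kernel_prime:
 fixes \<sigma> :: "'i => ('j::linorder, 'k::field) mpoly"
 assumes \<sigma>: "!!i. i \<in> J ==> \<sigma> i \<in> forms I d" and d: "0 < d"
 shows "pprime J {f \<in> polys J. subst_poly \<sigma> f = 0}" "homog {f \<in> polys J. subst_poly \<sigma> f = 0}"
 unfolding pprime_def pideal_def homog_def
 by (auto simp: subst_poly_add subst_poly_mult polys_add polys_mult polys_hom_component
   subst_poly_hom_component[OF d _ \<sigma>] hom_component_0)

text \<open>The ideal generated by the variables in \<open>A\<close>, written as the kernel of the
  substitution that sets them to 0; in this form primality and homogeneity come from
  \<open>kernel_prime\<close>.\<close>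

definition coordinate_prime :: "nat set => (nat, 'k::field) mpoly set" where
 "coordinate_prime A = {f \<in> polys xyz. subst_poly (%i. if i \<in> A then 0 else mvar i) f = 0}"

lemma coordinate_prime:
 shows coordinate_prime_point: "i < 3 ==> i \<notin> A ==> (coordinate_prime A :: (nat, 'k::field) mpoly set) \<in> proj_points xyz"
  and mvar_coordinate_prime: "i < 3 ==> (mvar i ^ n :: 'k xpoly) \<in> coordinate_prime A \<longleftrightarrow> i \<in> A & 0 < n"
  and coordinate_prime_mono: "A \<subseteq> B ==> (coordinate_prime A :: 'k xpoly set) \<subseteq> coordinate_prime B"
proof -
 show mem: "(mvar i ^ n :: 'k xpoly) \<in> coordinate_prime A \<longleftrightarrow> i \<in> A & 0 < n" if "i < 3" for i n
 proof -
  have "(mvar i ^ n :: 'k xpoly) \<in> polys xyz" by (rule forms_polys[OF forms_power[OF forms_mvar]]) (use that in simp)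
  then show ?thesis unfolding coordinate_prime_def by (simp add: subst_poly_power power_0_left)
 qed
 have \<sigma>: "(if i \<in> A then 0 else mvar i :: 'k xpoly) \<in> forms xyz 1" if "i \<in> xyz" for i
  using that by (simp add: forms_mvar)
 have "pprime xyz (coordinate_prime A :: 'k xpoly set)" "homog (coordinate_prime A :: 'k xpoly set)"
  unfolding coordinate_prime_def by (rule kernel_prime[OF \<sigma>]; simp)+
 then show "(coordinate_prime A :: 'k xpoly set) \<in> proj_points xyz" if "i < 3" "i \<notin> A"
  unfolding proj_points_iff using that mem[of i 1] by auto
 show "(coordinate_prime A :: 'k xpoly set) \<subseteq> coordinate_prime B" if "A \<subseteq> B"
 proof
  fix f :: "'k xpoly" assume f: "f \<in> coordinate_prime A"
  have "(%i. if i \<in> B then 0 else mvar i :: 'k xpoly) = (%i. subst_poly (%i. if i \<in> B then 0 else mvar i) (if i \<in> A then 0 else mvar i))"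
   using that by (auto simp: fun_eq_iff)
  then have "subst_poly (%i. if i \<in> B then 0 else mvar i) f =
    subst_poly (%i. if i \<in> B then 0 else mvar i) (subst_poly (%i. if i \<in> A then 0 else mvar i) f)"
   unfolding subst_poly_comp by (rule arg_cong[where f = "%\<tau>. subst_poly \<tau> f"])
  then show "f \<in> coordinate_prime B" using f by (simp add: coordinate_prime_def)
 qed
qed

section \<open>Support and dimension of the pushforward\<close>

context uple_pencil
begin

text \<open>The closure of the image of the plane. Instead of lifting its points to the plane, the
  argument uses that each of their neighbourhoods has nonempty preimage.\<close>

definition kernel_locus :: "'k ypoly set set" where
 "kernel_locus = {R \<in> proj_points mons. \<forall>f\<in>polys mons. uple_pull f = 0 --> f \<in> R}"

lemma uple_point_locus: "P \<in> pp ==> uple_point xyz d P \<in> kernel_locus"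
 using uple_point_closed[OF d_pos] proj_pointD(5) by (auto simp: kernel_locus_def uple_point_def)

lemma pre_nonempty:
 assumes R: "R \<in> kernel_locus" and W: "opm W" "R \<in> W"
 shows "pre W ~= {}"
proof -
 obtain F n where F: "F \<in> forms mons n" "R \<in> pbasic mons F" "pbasic mons F \<subseteq> W" using W by (rule open_pbasic)
 have "uple_pull F ~= 0" using R F(2) forms_polys[OF F(1)] by (auto simp: kernel_locus_def pbasic_def)
 then have "{0} \<in> pre (pbasic mons F)" unfolding preim_pbasic[OF d_pos forms_polys[OF F(1)]]
  unfolding pbasic_def using generic_pp by auto
 then show ?thesis using F(3) by (auto simp: preim_proj)
qed

lemma nonzero_section: "\<exists>z. z ~= (%_. 0) & (\<forall>P\<in>pp. z \<in> G (2 * int e) P)"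
proof -
 obtain a b where ab: "a < e + 2" "Q e (%i j. \<alpha> $$ (i, j)) (unit a) (unit b) \<notin> {0}" using nondegenerate[OF generic_pp] by auto
 \<comment> \<open>\<open>BB\<close> of a unit vector has degree e; the factor x_0^e raises it to
   2e.\<close>
 define z where "z = BB (%i. to_fract (mvar 0 ^ e) * unit b i)"
 have "z a = to_fract (mvar 0 ^ e) * to_fract (Q e (%i j. \<alpha> $$ (i, j)) (unit a) (unit b))"
  unfolding z_def BB_scale using ab(1) by (simp add: BB_def Q_units)
 then have "z a ~= 0" using ab(2) by (simp add: to_fract_power)
 moreover have "z \<in> G (2 * int e) P" if P: "P \<in> pp" for P
 proof -
  have "to_fract (mvar 0 ^ e) \<in> L (int e) P" using loc_form[OF P forms_power[OF forms_mvar[of 0 xyz], of e]] by simp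
  then have "z \<in> G (int e + int e) P" unfolding z_def by (intro BB_G[OF P] unit_loc[OF P])
  then show ?thesis by simp
 qed
 ultimately show ?thesis by (intro exI[of _ z]) auto
qed

text \<open>If \<open>R\<close> omits an element of the kernel of the pullback, it omits a
  homogeneous component of it, whose principal open set has empty preimage and makes all germs at
  \<open>R\<close> equal. At a point of the locus every neighbourhood meets the plane, so a nonzero
  global section has a nonzero germ.\<close>

lemma support_UF: "support (proj mons) UF = kernel_locus"
proof (intro equalityI subsetI)
 fix R assume "R \<in> support (proj mons) UF"
 then obtain U s where R: "R \<in> proj_points mons" and U: "opm U" "R \<in> U" and s: "s \<in> carrier (sec UF U)"
  and ne: "germ (proj mons) UF R U s ~= germ (proj mons) UF R U \<zero>\<^bsub>sec UF U\<^esub>"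
  unfolding support_def by (auto simp: topspace_proj_top)
 have "f \<in> R" if f: "f \<in> polys mons" "uple_pull f = 0" for f
 proof (rule homog_memI[OF proj_pointD(2)[OF R]], rule ccontr)
  fix n assume nin: "hom_component n f \<notin> R"
  have F: "hom_component n f \<in> forms mons n" by (rule hom_component_forms[OF f(1)])
  have "uple_pull (hom_component n f) = 0" unfolding uple_pull_hom_component[OF d_pos f(1)] f(2) by (rule hom_component_0)
  then have "pre (pbasic mons (hom_component n f)) = {}"
   unfolding preim_pbasic[OF d_pos forms_polys[OF F]] using proj_pointD(5) by (auto simp: pbasic_def)
  note W = openin_pbasic[OF F] _ this
  have RW: "R \<in> pbasic mons (hom_component n f)" using R nin by (simp add: pbasic_def)
  have z: "\<zero>\<^bsub>sec UF U\<^esub> \<in> carrier (sec UF U)"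
   unfolding uf.zero[OF U(1)] uf.carrier_reg[OF U(1)] using uf.reg_0[OF U(1)] by auto
  show False using ne unfolding uf.germ_trivial[OF W(1) RW W(3) U s] uf.germ_trivial[OF W(1) RW W(3) U z] by simp
 qed
 then show "R \<in> kernel_locus" using R by (auto simp: kernel_locus_def)
next
 fix R assume R: "R \<in> kernel_locus"
 then have Rp: "R \<in> proj_points mons" by (simp add: kernel_locus_def)
 have U: "opm (proj_points mons)" unfolding topspace_proj_top[symmetric] by (rule openin_topspace)
 obtain z where z: "z ~= (%_. 0)" "\<forall>P\<in>pp. z \<in> G (2 * int e) P" using nonzero_section by auto
 let ?U = "proj_points mons :: 'k ypoly set set"
 have rz: "uf.reg ?U z" using z(2) pre_pp(1) by (auto simp: uf.reg_def)
 have s: "ksec (pre ?U) z \<in> carrier (sec UF ?U)" unfolding uf.carrier_reg[OF U] using rz by auto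
 have "(?U, ksec (pre ?U) z) \<in> germ (proj mons) UF R ?U (ksec (pre ?U) z)"
  unfolding germ_def rs_proj using U Rp s by auto
 moreover have "(?U, ksec (pre ?U) z) \<notin> germ (proj mons) UF R ?U \<zero>\<^bsub>sec UF ?U\<^esub>"
 proof
  assume "(?U, ksec (pre ?U) z) \<in> germ (proj mons) UF R ?U \<zero>\<^bsub>sec UF ?U\<^esub>"
  then obtain W where W: "opm W" "R \<in> W" "W \<subseteq> ?U" "res UF ?U W \<zero>\<^bsub>sec UF ?U\<^esub> = res UF ?U W (ksec (pre ?U) z)"
   unfolding germ_def rs_proj by auto
  have "ksec (pre W) (%_. 0) = ksec (pre W) z"
   using W(4) unfolding uf.zero[OF U] uf.res_reg[OF U W(1,3) rz] uf.res_reg[OF U W(1,3) uf.reg_0[OF U]] .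
  then have "(%_. 0) = z"
   by (rule uf.sections_inject[OF W(1) uf.reg_0[OF W(1)] uf.reg_mono[OF rz W(3)] pre_nonempty[OF R W(1,2)]])
  then show False using z(1) by simp
 qed
 ultimately have "germ (proj mons) UF R ?U (ksec (pre ?U) z) ~= germ (proj mons) UF R ?U \<zero>\<^bsub>sec UF ?U\<^esub>" by auto
 then show "R \<in> support (proj mons) UF"
  unfolding support_def rs_proj topspace_proj_top using U Rp s by auto
qed

text \<open>The vanishing ideals in reverse order, with the irrelevant ideal on top, form a chain of
  n + 1 strict inclusions. Its first member contains the kernel of the pullback, which maps into a
  polynomial ring in three variables, so \<open>prime_chain_length\<close> bounds n + 1 by
  3.\<close>

lemma chain_length:
 assumes C: "!!i. i \<le> n ==> irreducible_closed (subtopology (proj_top mons) kernel_locus) (C i)"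
  and less: "!!i. i < n ==> C i \<subset> C (Suc i)"
 shows "n \<le> 2"
proof -
 define P where "P i = (if i \<le> n then vanishing mons (C (n - i)) else irrelevant mons)" for i
 have "n + 1 \<le> card xyz"
 proof (rule prime_chain_length[where \<theta> = uple_pull and J = mons and P = P])
  show "finite xyz" by simp
  show "uple_pull f \<in> polys xyz" if "f \<in> polys mons" for f :: "'k ypoly" by (rule uple_pull_polys[OF that])
  show "pprime mons (P i)" if "i \<le> n + 1" for i
  proof (cases "i \<le> n")
   case True then show ?thesis using vanishing_prime(1)[OF C[of "n - i"]] by (simp add: P_def)
  next
   case False then show ?thesis unfolding P_def by (simp add: pprime_irrelevant)
  qed
  show "P i \<subset> P (Suc i)" if i: "i < n + 1" for i
  proof (cases "i = n")
   case True
   then show ?thesis using vanishing_prime(2)[OF C[of 0]] by (simp add: P_def)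
  next
   case False
   then have i': "Suc (n - Suc i) = n - i" "n - Suc i < n" "n - i \<le> n" "n - Suc i \<le> n" "Suc i \<le> n" "i \<le> n" using i by auto
   have lt: "C (n - Suc i) \<subset> C (n - i)" using less[OF i'(2)] unfolding i'(1) .
   have "vanishing mons (C (n - i)) \<subseteq> vanishing mons (C (n - Suc i))" using lt by (auto simp: vanishing_def)
   moreover have "vanishing mons (C (n - i)) ~= vanishing mons (C (n - Suc i))"
   proof
    assume eq: "vanishing mons (C (n - i)) = vanishing mons (C (n - Suc i))"
    have "C (n - i) = C (n - Suc i)"
     using vanishing_prime(3)[OF C[OF i'(3)]] vanishing_prime(3)[OF C[OF i'(4)]] unfolding eq by (rule trans[OF sym])
    then show False using lt by simp
   qed
   ultimately show ?thesis unfolding P_def using i'(5,6) by (simp add: psubset_eq)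
  qed
  fix f :: "'k ypoly" assume f: "f \<in> polys mons" "uple_pull f = 0"
  have "C n \<subseteq> kernel_locus" using vanishing_prime(3)[OF C[OF order_refl]] by auto
  then show "f \<in> P 0" using f by (auto simp: P_def vanishing_def kernel_locus_def)
 qed (simp_all only: uple_pull_add uple_pull_mult uple_pull_const)
 then show ?thesis by simp
qed

lemma krull_dim: "has_sheaf_dim (proj mons) UF 2"
proof -
 let ?T = "subtopology (proj_top mons) kernel_locus"
 \<comment> \<open>The chain consists of the images of a coordinate point, a coordinate line and the
   plane, as closures of their generic points.\<close>
 define A where "A i = (if i = 0 then {0, 1} else if i = 1 then {0} else {} :: nat set)" for i :: nat
 define R where "R i = uple_point xyz d (coordinate_prime (A i) :: 'k xpoly set)" for i
 define C where "C i = {S \<in> proj_points mons. S \<in> kernel_locus & R i \<subseteq> S}" for i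
 have P: "(coordinate_prime (A i) :: 'k xpoly set) \<in> pp" for i by (rule coordinate_prime_point[of 2]) (auto simp: A_def)
 have R: "R i \<in> kernel_locus" "R i \<in> proj_points mons" for i
  unfolding R_def using uple_point_locus[OF P] uple_point_closed[OF d_pos P] by auto
 have irr: "irreducible_closed ?T (C i)" for i unfolding C_def by (rule point_closure_irreducible[OF R(2,1)])
 have "C i \<subset> C (Suc i)" if i: "i < 2" for i
 proof -
  have AA: "A (Suc i) \<subseteq> A i" using i by (auto simp: A_def)
  have sub: "R (Suc i) \<subseteq> R i" using coordinate_prime_mono[OF AA] by (auto simp: R_def uple_point_def)
  obtain a where a: "a < 3" "a \<in> A i" "a \<notin> A (Suc i)"
  proof (cases "i = 0")
   case True then show ?thesis using that[of 1] by (simp add: A_def One_nat_def)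
  next
   case False then show ?thesis using that[of 0] i by (simp add: A_def One_nat_def)
  qed
  have m: "single a d \<in> mons" using a(1) by (simp add: monomials_def)
  have y: "mvar (single a d) \<in> polys mons" by (rule forms_polys[OF forms_mvar[OF m]])
  have "mvar (single a d) \<in> R i" "mvar (single a d) \<notin> R (Suc i)"
   unfolding R_def uple_point_memI[OF y] uple_pull_mvar mvar_power[symmetric] mvar_coordinate_prime[OF a(1)]
   using a d_pos by auto
  then have "R i \<in> C i" "R (Suc i) \<in> C (Suc i)" "R (Suc i) \<notin> C i" using R by (auto simp: C_def)
  moreover have "C i \<subseteq> C (Suc i)" using sub by (auto simp: C_def)
  ultimately show ?thesis by blast
 qed
 then have "\<exists>C. (\<forall>i\<le>2. irreducible_closed ?T (C i)) & (\<forall>i<2. C i \<subset> C (Suc i))"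
  using irr by (intro exI[of _ C]) simp
 moreover have "n \<le> 2" if ch: "\<exists>C. (\<forall>i\<le>n. irreducible_closed ?T (C i)) & (\<forall>i<n. C i \<subset> C (Suc i))" for n
 proof -
  obtain C where "\<forall>i\<le>n. irreducible_closed ?T (C i)" "\<forall>i<n. C i \<subset> C (Suc i)" using ch by (elim exE conjE)
  then show ?thesis by (intro chain_length[of n C]) simp_all
 qed
 ultimately show ?thesis unfolding has_sheaf_dim_def has_krull_dim_def Let_def support_UF rs_proj by (intro conjI allI impI)
qed

end

section \<open>Graded submodules are finitely generated\<close>

lemma dickson:
 fixes f :: "'a => 'i => nat"
 assumes "finite J"
 shows "\<exists>S'. S' \<subseteq> S & finite S' & (\<forall>t\<in>S. \<exists>s\<in>S'. \<forall>i\<in>J. f s i \<le> f t i)"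
 using assms
proof (induction "card J" arbitrary: J S)
 case 0
 then have "J = {}" by simp
 show ?case
 proof (cases "S = {}")
  case False
  then obtain s where "s \<in> S" by auto
  then show ?thesis using \<open>J = {}\<close> by (intro exI[of _ "{s}"]) auto
 qed auto
next
 case (Suc m)
 show ?case
 proof (cases "S = {}")
  case False
  then obtain s0 where s0: "s0 \<in> S" by auto
  define slice where "slice x c = {t \<in> S. f t x = c}" for x c
  have "\<forall>x\<in>J. \<forall>c. \<exists>S'. S' \<subseteq> slice x c & finite S' & (\<forall>t\<in>slice x c. \<exists>s\<in>S'. \<forall>i\<in>J - {x}. f s i \<le> f t i)"
  proof (intro ballI allI)
   fix x c assume "x \<in> J"
   then have "m = card (J - {x})" "finite (J - {x})" using Suc(2,3) by auto
   then show "\<exists>S'. S' \<subseteq> slice x c & finite S' & (\<forall>t\<in>slice x c. \<exists>s\<in>S'. \<forall>i\<in>J - {x}. f s i \<le> f t i)"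
    by (rule Suc(1))
  qed
  then obtain T where T: "!!x c. x \<in> J ==> T x c \<subseteq> slice x c & finite (T x c) &
   (\<forall>t\<in>slice x c. \<exists>s\<in>T x c. \<forall>i\<in>J - {x}. f s i \<le> f t i)" by metis
  let ?S' = "insert s0 (\<Union>x\<in>J. \<Union>c<f s0 x. T x c)"
  have "?S' \<subseteq> S" using s0 T unfolding slice_def by blast
  moreover have "finite ?S'" using T Suc(3) by auto
  moreover have "\<exists>s\<in>?S'. \<forall>i\<in>J. f s i \<le> f t i" if t: "t \<in> S" for t
  proof (cases "\<forall>i\<in>J. f s0 i \<le> f t i")
   case False
   then obtain x where x: "x \<in> J" "f t x < f s0 x" by (meson not_le)
   have "t \<in> slice x (f t x)" using t by (simp add: slice_def)
   then obtain s where s: "s \<in> T x (f t x)" "\<forall>i\<in>J - {x}. f s i \<le> f t i" using T[OF x(1)] by blast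
   have "f s x = f t x" using s(1) T[OF x(1), of "f t x"] by (auto simp: slice_def)
   then have "\<forall>i\<in>J. f s i \<le> f t i" using s(2) by auto
   moreover have "s \<in> ?S'" using s(1) x by auto
   ultimately show ?thesis by blast
  qed blast
  ultimately show ?thesis by (intro exI[of _ ?S'] conjI ballI)
 qed auto
qed

text \<open>A Groebner basis argument. The leading position of a vector is its first nonzero
  component with the largest monomial there; Dickson's lemma leaves finitely many leading monomials
  in each component, and division by vectors that realise them ends with remainder zero.\<close>

lemma graded_submodule_finite:
 fixes M :: "nat => (nat => ('j::linorder, 'k::field) mpoly) set"
 assumes J: "finite J" and form: "!!k b i. b \<in> M k ==> b i \<in> forms J k" and zero: "!!k b i. b \<in> M k ==> n \<le> i ==> b i = 0"
  and diff: "!!k b b'. b \<in> M k ==> b' \<in> M k ==> (%i. b i - b' i) \<in> M k"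
  and mult: "!!k l b r. b \<in> M k ==> r \<in> forms J l ==> (%i. r * b i) \<in> M (l + k)"
 shows "\<exists>B. finite B & (\<forall>x\<in>B. snd x \<in> M (fst x)) & (\<forall>k. \<forall>a\<in>M k. \<exists>r.
  (\<forall>x\<in>B. r x = 0 \<or> fst x \<le> k & r x \<in> forms J (k - fst x)) & (\<forall>i. a i = (\<Sum>x\<in>B. r x * snd x i)))"
proof -
 define lead where "lead a i t \<longleftrightarrow> (\<forall>i'<i. a i' = 0) & a i ~= 0 & t = Max (keys (a i))"
  for a :: "nat => ('j, 'k) mpoly" and i t
 define \<Lambda> where "\<Lambda> i = {t. \<exists>x. snd x \<in> M (fst x) & lead (snd x) i t}" for i
 have "\<forall>i. \<exists>S'. S' \<subseteq> \<Lambda> i & finite S' & (\<forall>t\<in>\<Lambda> i. \<exists>s\<in>S'. \<forall>v\<in>J. lookup s v \<le> lookup t v)"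
  using dickson[OF J, where f = lookup] by blast
 from choice[OF this] obtain S where S: "!!i. S i \<subseteq> \<Lambda> i" "!!i. finite (S i)"
  "!!i t. t \<in> \<Lambda> i ==> \<exists>s\<in>S i. \<forall>v\<in>J. lookup s v \<le> lookup t v" by blast
 define \<beta> where "\<beta> i t = (SOME x. snd x \<in> M (fst x) & lead (snd x) i t)" for i t
 have \<beta>: "snd (\<beta> i t) \<in> M (fst (\<beta> i t)) & lead (snd (\<beta> i t)) i t" if "t \<in> \<Lambda> i" for i t
  unfolding \<beta>_def using that unfolding \<Lambda>_def mem_Collect_eq by (rule someI_ex)
 define B where "B = (\<Union>i<n. \<beta> i ` S i)"
 have finB: "finite B" unfolding B_def using S(2) by auto
 have B: "snd x \<in> M (fst x)" if x: "x \<in> B" for x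
 proof -
  obtain i t where "t \<in> S i" "x = \<beta> i t" using x unfolding B_def by auto
  then show ?thesis using \<beta>[of t i] S(1)[of i] by auto
 qed
 have keysJ: "keys t \<subseteq> J" "mdeg t = k" if "b \<in> M k" "t \<in> keys (b i)" for b k t i
  using form[OF that(1), of i] that(2) by (auto simp: forms_def polys_def)
 have rep: "\<exists>r. (\<forall>x\<in>B. r x = 0 \<or> fst x \<le> k & r x \<in> forms J (k - fst x)) & (\<forall>i. a i = (\<Sum>x\<in>B. r x * snd x i))"
  if "a \<in> M k" for k a
 proof -
  \<comment> \<open>The positions from the leading one on. They are finite in number because the
    degree \<open>k\<close> is fixed, and each reduction removes at least the leading one; their
    number is the termination measure.\<close>
  define pos where "pos a = {(i', t'). i' < n & t' \<in> monomials J k &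
   (\<exists>i t. t \<in> keys (a i) & (i < i' \<or> i = i' & t' \<le> t))}" for a :: "nat => ('j, 'k) mpoly"
  have fin: "finite (pos a)" for a
   by (rule finite_subset[of _ "{..<n} \<times> monomials J k"]) (auto simp: pos_def finite_monomials[OF J])
  show ?thesis using that
  proof (induction "card (pos a)" arbitrary: a rule: less_induct)
   case less
   note aM = less.prems
   show ?case
   proof (cases "\<exists>i. a i ~= 0")
    case False
    then show ?thesis by (intro exI[of _ "%_. 0"]) simp
   next
    case True
    define i where "i = (LEAST i. a i ~= 0)"
    have i: "a i ~= 0" unfolding i_def using True by (rule LeastI_ex)
    have lt: "a i' = 0" if "i' < i" for i' using not_less_Least[of i' "%i. a i ~= 0"] that unfolding i_def by auto
    have ni: "i < n" using i zero[OF aM, of i] by (meson not_le)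
    define t where "t = Max (keys (a i))"
    have tk: "t \<in> keys (a i)" unfolding t_def by (rule Max_in) (use i in auto)
    have tmax: "t' \<le> t" if "t' \<in> keys (a i)" for t' unfolding t_def by (rule Max_ge) (use that in auto)
    have "lead a i t" unfolding lead_def t_def using i lt by simp
    then have "t \<in> \<Lambda> i" unfolding \<Lambda>_def using aM by (intro CollectI exI[of _ "(k, a)"]) simp
    then obtain s where s: "s \<in> S i" "\<forall>v\<in>J. lookup s v \<le> lookup t v" using S(3) by blast
    define x where "x = \<beta> i s"
    have xB: "x \<in> B" using s(1) ni unfolding B_def x_def by auto
    have bM: "snd x \<in> M (fst x)" and bl: "lead (snd x) i s" using \<beta>[of s i] s(1) S(1)[of i] unfolding x_def by auto
    have b0: "snd x i ~= 0" "!!i'. i' < i ==> snd x i' = 0" using bl by (simp_all add: lead_def)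
    have sk: "s \<in> keys (snd x i)" using bl b0(1) unfolding lead_def by (metis Max_in finite_keys keys_eq_empty)
    have smax: "s' \<le> s" if "s' \<in> keys (snd x i)" for s' using bl that unfolding lead_def by simp
    define u where "u = t - s"
    have tu: "t = u + s"
    proof (rule poly_mapping_eqI)
     fix v
     have "lookup s v \<le> lookup t v"
      using s(2) subsetD[OF keysJ(1)[OF bM sk], of v] by (cases "v \<in> keys s") (auto simp: in_keys_iff)
     then show "lookup t v = lookup (u + s) v" by (simp add: u_def lookup_add lookup_minus)
    qed
    have deg: "mdeg t = k" "mdeg s = fst x" "k = mdeg u + fst x" "keys u \<subseteq> J"
    proof -
     show "mdeg t = k" "mdeg s = fst x" using keysJ(2)[OF aM tk] keysJ(2)[OF bM sk] .
     then show "k = mdeg u + fst x" using tu by (simp add: mdeg_add)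
     show "keys u \<subseteq> J" using keysJ(1)[OF aM tk] by (auto simp: u_def in_keys_iff lookup_minus)
    qed
    define c where "c = lookup (a i) t / lookup (snd x i) s"
    let ?m = "single u c"
    have mf: "?m \<in> forms J (mdeg u)" by (rule forms_single[OF deg(4) refl])
    define a' where "a' j = a j - ?m * snd x j" for j
    have a'M: "a' \<in> M k"
    proof -
     have "(%i. ?m * snd x i) \<in> M k" using mult[OF bM mf] deg(3) by simp
     then show ?thesis unfolding a'_def[abs_def] by (rule diff[OF aM])
    qed
    have mfac: "?m * snd x j = single u 1 * (single 0 c * snd x j)" for j
     by (simp add: mult_single mult.assoc[symmetric])
    have cl: "lookup (?m * snd x j) (u + v) = c * lookup (snd x j) v" for j v
     unfolding mfac lookup_times_monomial 
     by (simp add: mult_map_scale_conv_mult[symmetric] map.rep_eq when_def)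
    have a'i: "t' < t" if t': "t' \<in> keys (a' i)" for t'
    proof -
     have "keys (a' i) \<subseteq> keys (a i) \<union> keys (?m * snd x i)"
      unfolding a'_def by (rule keys_diff)
     then have "t' \<in> keys (a i) \<or> t' \<in> keys (?m * snd x i)" using t' by auto
     then have "t' \<le> t"
     proof
      assume "t' \<in> keys (?m * snd x i)"
      then obtain v where v: "t' = u + v" "v \<in> keys (single 0 c * snd x i)"
       unfolding mfac keys_times_monomial by auto
      then have "lookup (?m * snd x i) (u + v) ~= 0"
       unfolding mfac lookup_times_monomial by (simp add: in_keys_iff)
      then have "v \<in> keys (snd x i)" unfolding cl by (simp add: in_keys_iff)
      then show "t' \<le> t" unfolding v(1) tu by (intro add_left_mono smax)
     qed (rule tmax)
     moreover have "t' ~= t"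
     proof
      assume "t' = t"
      have "lookup (a' i) t = lookup (a i) t - c * lookup (snd x i) s"
       unfolding a'_def lookup_minus cl[of i s, folded tu] ..
      also have "\<dots> = 0" using sk by (simp add: c_def in_keys_iff)
      finally show False using t' \<open>t' = t\<close> by (simp add: in_keys_iff)
     qed
     ultimately show ?thesis by simp
    qed
    have a'0: "a' j = 0" if "j < i" for j using lt[OF that] b0(2)[OF that] by (simp add: a'_def)
    have "pos a' \<subset> pos a"
    proof
     show "pos a' \<subseteq> pos a"
     proof
      fix y assume "y \<in> pos a'"
      then obtain i' t' j v where y: "y = (i', t')" "i' < n" "t' \<in> monomials J k" "v \<in> keys (a' j)"
       "j < i' \<or> j = i' & t' \<le> v" unfolding pos_def by auto
      have "i \<le> j" using a'0[of j] y(4) by (cases "j < i") auto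
      then have "i < i' \<or> i = i' & t' \<le> t" using y(5) a'i[of v] y(4) by (cases "j = i") auto
      then show "y \<in> pos a" unfolding pos_def using y(1-3) tk by blast
     qed
     have "(i, t) \<in> pos a" unfolding pos_def using ni tk keysJ[OF aM tk] by (auto simp: monomials_def)
     moreover have "(i, t) \<notin> pos a'"
     proof
      assume "(i, t) \<in> pos a'"
      then obtain j v where "v \<in> keys (a' j)" "j < i \<or> j = i & t \<le> v" unfolding pos_def by auto
      then show False using a'0[of j] a'i[of v] by auto
     qed
     ultimately show "pos a' ~= pos a" by auto
    qed
    then have "card (pos a') < card (pos a)" by (rule psubset_card_mono[OF fin])
    then obtain r where r: "\<forall>x\<in>B. r x = 0 \<or> fst x \<le> k & r x \<in> forms J (k - fst x)"
     "\<forall>i. a' i = (\<Sum>x\<in>B. r x * snd x i)" using less.hyps[OF _ a'M] by blast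
    define r' where "r' y = (if y = x then r x + ?m else r y)" for y
    have kx: "fst x \<le> k" "?m \<in> forms J (k - fst x)" using deg(3) mf by auto
    have "r' y = 0 \<or> fst y \<le> k & r' y \<in> forms J (k - fst y)" if "y \<in> B" for y
    proof (cases "y = x")
     case True
     have "r x \<in> forms J (k - fst x)" using bspec[OF r(1) xB] by auto
     then show ?thesis using True kx forms_add by (auto simp: r'_def)
    qed (use bspec[OF r(1) that] in \<open>simp add: r'_def\<close>)
    moreover have "a j = (\<Sum>y\<in>B. r' y * snd y j)" for j
    proof -
     have "(\<Sum>y\<in>B. r' y * snd y j) = (\<Sum>y\<in>B. r y * snd y j + (if y = x then ?m * snd x j else 0))"
      by (rule sum.cong) (auto simp: r'_def distrib_right)
     also have "\<dots> = a' j + ?m * snd x j" unfolding sum.distrib r(2)[rule_format, symmetric] using finB xB by simp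
     finally show ?thesis by (simp add: a'_def)
    qed
    ultimately show ?thesis by (intro exI[of _ r'] conjI ballI allI)
   qed
  qed
 qed
 show ?thesis using finB B rep by (intro exI[of _ B] conjI ballI allI)
qed

section \<open>Coherence\<close>

text \<open>Finite type in terms of vectors: the generators may be indexed by any finite set, and
  the representation has to hold only if \<open>W'\<close> has a point in
  \<open>pts\<close>.\<close>

lemma (in vector_module_sheaf) locally_fgI:
 assumes R: "!!W. opn W ==> W \<subseteq> U0 ==> R W \<subseteq> carrier (sec F W)"
  and loc: "!!q. q \<in> U0 ==> \<exists>V (A :: 'x set) g. opn V & q \<in> V & V \<subseteq> U0 & finite A & (\<forall>x\<in>A. reg V (g x) & \<Phi> V (g x) \<in> R V) &
   (\<forall>W z q'. opn W --> W \<subseteq> V --> reg W z --> \<Phi> W z \<in> R W --> q' \<in> W -->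
    (\<exists>W' c. opn W' & q' \<in> W' & W' \<subseteq> W & (\<forall>x\<in>A. scal W' (c x)) &
     (pts W' ~= {} --> z = (%l. \<Sum>x\<in>A. \<rho> (c x) * g x l))))"
 shows "locally_fg (proj J) F R U0"
 unfolding locally_fg_def rs_proj
proof
 fix q assume "q \<in> U0"
 from loc[OF this] obtain V and A :: "'x set" and g where V: "opn V" "q \<in> V" "V \<subseteq> U0" "finite A"
  "\<forall>x\<in>A. reg V (g x) & \<Phi> V (g x) \<in> R V"
  and gen: "\<forall>W z q'. opn W --> W \<subseteq> V --> reg W z --> \<Phi> W z \<in> R W --> q' \<in> W -->
    (\<exists>W' c. opn W' & q' \<in> W' & W' \<subseteq> W & (\<forall>x\<in>A. scal W' (c x)) &
     (pts W' ~= {} --> z = (%l. \<Sum>x\<in>A. \<rho> (c x) * g x l)))" by (elim exE conjE)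
 obtain h where h: "bij_betw h {..<card A} A" using ex_bij_betw_nat_finite[OF V(4)] by (auto simp: atLeast0LessThan)
 have hA: "h i \<in> A" if "i < card A" for i using bij_betwE[OF h] that by auto
 have ex: "\<exists>W'. opn W' & q' \<in> W' & W' \<subseteq> W & (\<exists>c. (\<forall>i<card A. c i \<in> O_sections J 0 W') &
   res F W W' r = (\<Oplus>\<^bsub>sec F W'\<^esub>i\<in>{..<card A}. c i \<odot>\<^bsub>sec F W'\<^esub> res F V W' (\<Phi> V (g (h i)))))"
  if W: "opn W" "W \<subseteq> V" "r \<in> R W" "q' \<in> W" for W r q'
 proof -
  have "r \<in> carrier (sec F W)" using R[OF W(1) order_trans[OF W(2) V(3)]] W(3) by auto
  then obtain z where z: "r = \<Phi> W z" "reg W z" unfolding carrier_reg[OF W(1)] by auto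
  obtain W' c where W': "opn W'" "q' \<in> W'" "W' \<subseteq> W" and c: "\<forall>x\<in>A. scal W' (c x)"
   and eq: "pts W' ~= {} --> z = (%l. \<Sum>x\<in>A. \<rho> (c x) * g x l)"
   using gen[rule_format, OF W(1,2) z(2) W(3)[unfolded z(1)] W(4)] by (elim exE conjE)
  interpret A: abelian_group "sec F W'" by (rule sections_group[OF W'(1)])
  have gr: "reg V (g (h i))" "reg W' (g (h i))" "scal W' (c (h i))" if "i < card A" for i
   using V(5) c hA[OF that] reg_mono[of V "g (h i)" W'] W(2) W'(3) by auto
  have rr: "reg W' (%l. \<rho> (c (h i)) * g (h i) l)" if "i < card A" for i by (rule reg_scale[OF W'(1) gr(3,2)[OF that]])
  have "(\<Oplus>\<^bsub>sec F W'\<^esub>i\<in>{..<card A}. cst W' (c (h i)) \<odot>\<^bsub>sec F W'\<^esub> res F V W' (\<Phi> V (g (h i)))) =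
    (\<Oplus>\<^bsub>sec F W'\<^esub>i\<in>{..<card A}. \<Phi> W' (%l. \<rho> (c (h i)) * g (h i) l))"
  proof (rule A.finsum_cong'[OF refl])
   show "(%i. \<Phi> W' (%l. \<rho> (c (h i)) * g (h i) l)) \<in> {..<card A} \<rightarrow> carrier (sec F W')"
    unfolding carrier_reg[OF W'(1)] using rr by auto
   fix i assume "i \<in> {..<card A}"
   then have i: "i < card A" by simp
   show "cst W' (c (h i)) \<odot>\<^bsub>sec F W'\<^esub> res F V W' (\<Phi> V (g (h i))) = \<Phi> W' (%l. \<rho> (c (h i)) * g (h i) l)"
    unfolding res_reg[OF V(1) W'(1) order_trans[OF W'(3) W(2)] gr(1)[OF i]] by (rule smult_reg[OF W'(1) gr(3,2)[OF i]])
  qed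
  also have "\<dots> = \<Phi> W' (%l. \<Sum>i<card A. \<rho> (c (h i)) * g (h i) l)" by (rule sections_finsum[OF W'(1)]) (simp add: rr)
  also have "\<dots> = \<Phi> W' (%l. \<Sum>x\<in>A. \<rho> (c x) * g x l)" using sum.reindex_bij_betw[OF h, of "%x. \<rho> (c x) * g x l" for l] by simp
  also have "\<dots> = \<Phi> W' z" using trivial[OF W'(1)] eq by (cases "pts W' = {}") auto
  also have "\<dots> = res F W W' r" unfolding z(1) by (rule res_reg[OF W(1) W'(1,3) z(2), symmetric])
  finally have "res F W W' r = (\<Oplus>\<^bsub>sec F W'\<^esub>i\<in>{..<card A}. cst W' (c (h i)) \<odot>\<^bsub>sec F W'\<^esub> res F V W' (\<Phi> V (g (h i))))" by (rule sym)
  moreover have "cst W' (c (h i)) \<in> O_sections J 0 W'" if "i < card A" for i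
   by (rule cst_O_sections[OF W'(1)]) (use gr(3)[OF that] in \<open>auto simp: scal_def\<close>)
  ultimately show ?thesis using W' by (intro exI[of _ W'] conjI exI[of _ "%i. cst W' (c (h i))"] allI impI)
 qed
 have gR: "\<forall>i<card A. \<Phi> V (g (h i)) \<in> R V" using V(5) hA by simp
 have main: "\<forall>W. opn W & W \<subseteq> V --> (\<forall>r\<in>R W. \<forall>q\<in>W. \<exists>W'. opn W' & q \<in> W' & W' \<subseteq> W &
    (\<exists>c. (\<forall>i<card A. c i \<in> O_sections J 0 W') &
     res F W W' r = (\<Oplus>\<^bsub>sec F W'\<^esub>i\<in>{..<card A}. c i \<odot>\<^bsub>sec F W'\<^esub> res F V W' (\<Phi> V (g (h i))))))"
  by (rule allI, rule impI, rule ballI, rule ballI, erule conjE, rule ex)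
 show "\<exists>V. opn V & q \<in> V & V \<subseteq> U0 & (\<exists>m::nat. \<exists>g. (\<forall>i<m. g i \<in> R V) &
   (\<forall>W. opn W & W \<subseteq> V --> (\<forall>r\<in>R W. \<forall>q\<in>W. \<exists>W'. opn W' & q \<in> W' & W' \<subseteq> W &
    (\<exists>c. (\<forall>i<m. c i \<in> O_sections J 0 W') &
     res F W W' r = (\<Oplus>\<^bsub>sec F W'\<^esub>i\<in>{..<m}. c i \<odot>\<^bsub>sec F W'\<^esub> res F V W' (g i))))))"
  using V(1-3) gR main by (intro exI[of _ V] conjI exI[of _ "card A"] exI[of _ "%i. \<Phi> V (g (h i))"])
qed

lemma struct_module_proj_O: "struct_module (proj I) = proj_O I 0"
 by (simp add: struct_module_def proj_O_def) (simp add: proj_def cst_def)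

text \<open>The instance in which \<open>pts V\<close> is \<open>V\<close> and scalars act as they
  are; the relations in the definition of coherence live in it.\<close>

lemma free_sheaf: "vector_module_sheaf J (direct_power n (struct_module (proj J))) (%V. V)
 (%P. {w. (\<forall>i<n. w i \<in> loc J 0 P) & (\<forall>i\<ge>n. w i = 0)}) (fam n) (%x :: ('j::linorder, 'k::field) mpoly fract. x)"
 unfolding struct_module_proj_O
proof (unfold_locales, goal_cases)
 case (3 V W)
 then show ?case using generic_in_open[of J V] generic_in_open[of J W] by blast
next
 case (7 V)
 show ?case unfolding direct_power_O_carrier[OF 7]
 proof (intro equalityI subsetI)
  fix s assume "s \<in> {fam n V w |w. \<forall>i<n. \<forall>P\<in>V. w i \<in> loc J 0 P}"
  then obtain w where w: "s = fam n V w" "\<forall>i<n. \<forall>P\<in>V. w i \<in> loc J 0 P" by auto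
  have "s = fam n V (%i. if i < n then w i else 0)" unfolding w(1) fam_def by (rule restrict_ext) simp
  then show "s \<in> {fam n V z |z. \<forall>p\<in>V. z \<in> {w. (\<forall>i<n. w i \<in> loc J 0 p) & (\<forall>i\<ge>n. w i = 0)}}"
   using w(2) by (intro CollectI exI[of _ "%i. if i < n then w i else 0"]) simp
 qed auto
next
 case (11 V p z z')
 then have "\<forall>i<n. z i = z' i" using fam_eq_iff[OF 11(2), of n z z'] by simp
 then show ?case using 11(3,4) by (auto simp: fun_eq_iff) (metis not_le)
next
 case (12 V z z')
 then show ?case unfolding fam_def cst_def by (intro restrict_ext) simp
next
 case (16 V p x z)
 then have "p \<in> proj_points J" using open_subset_points by blast
 then show ?case using 16 loc_mult'[of p J x 0 _ 0 0] by auto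
qed (auto simp: direct_power_O_add direct_power_O_zero direct_power_O_smult direct_power_O_res
  intro: loc_0 loc_add loc_uminus dest: subsetD[OF open_subset_points])

lemma common_denominator:
 fixes w :: "'a => ('j::linorder, 'k::field) mpoly fract"
 assumes P: "P \<in> proj_points J" and A: "finite A" and w: "!!i. i \<in> A ==> w i \<in> loc J 0 P"
 shows "\<exists>f k a. f \<in> forms J k & f \<notin> P & (\<forall>i\<in>A. a i \<in> forms J k & to_fract f * w i = to_fract (a i))"
 using A w
proof (induction A)
 case empty
 show ?case using proj_pointD(4)[OF P] by (intro exI[of _ 1] exI[of _ 0]) simp
next
 case (insert x A)
 then have "\<exists>f k a. f \<in> forms J k & f \<notin> P & (\<forall>i\<in>A. a i \<in> forms J k & to_fract f * w i = to_fract (a i))" by simp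
 then obtain f k a where f: "f \<in> forms J k" "f \<notin> P" "\<forall>i\<in>A. a i \<in> forms J k & to_fract f * w i = to_fract (a i)"
  by (elim exE conjE)
 obtain b g k' l where g: "b \<in> forms J k'" "g \<in> forms J l" "g \<notin> P" "int k' = int l + 0" "w x = Fract b g"
  using insert.prems[of x] by (auto elim: locE)
 have b: "b \<in> forms J l" using g(1,4) by simp
 have gx: "to_fract g * w x = to_fract b" using nonzero_if_notin[OF P g(3)] by (simp add: g(5) Fract_conv_to_fract)
 let ?a = "%i. if i = x then f * b else g * a i"
 have "?a i \<in> forms J (k + l) & to_fract (f * g) * w i = to_fract (?a i)" if "i \<in> insert x A" for i
 proof (cases "i = x")
  case True
  have "to_fract (f * g) * w x = to_fract f * (to_fract g * w x)" by (simp add: mult.assoc)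
  then show ?thesis using True gx forms_mult[OF f(1) b] by simp
 next
  case False
  then have i: "a i \<in> forms J k" "to_fract f * w i = to_fract (a i)" using that f(3) by auto
  have "to_fract (f * g) * w i = to_fract g * (to_fract f * w i)" by (simp add: mult_ac)
  then show ?thesis using False i forms_mult[OF g(2) i(1)] by (simp add: add.commute)
 qed
 then show ?case using forms_mult[OF f(1) g(2)] forms_mult_notin[OF P f(1) g(2) f(2) g(3)]
  by (intro exI[of _ "f * g"] exI[of _ "k + l"] exI[of _ ?a]) simp
qed

section \<open>Generators of the kernel sheaf and finite type\<close>

context pencil
begin

lemma cramer:
 assumes z: "z \<in> G m P" and ab: "a < e + 2" "b < e + 2" "Q e al (unit a) (unit b) ~= 0"
 shows "to_fract (Q e al (unit a) (unit b)) * z l = z a * BB (unit b) l - z b * BB (unit a) l"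
proof (cases "l < e + 2")
 case True
 have "to_fract (Q e al (unit a) (unit b)) * z l = BB (%i. z a * unit b i - z b * unit a i) l"
  unfolding BB_def using True
   Q_exact_middle[of e "%i j. to_fract (al i j)" z a b l, OF _ ab(1,2) _ True] z ab(3)
  by (simp add: Q_units aT_def G_def)
 then show ?thesis by (simp add: BB_diff BB_scale)
qed (use z in \<open>simp add: G_def BB_def\<close>)

text \<open>The columns of B have degree e; the e-th powers of the variables, which have no common
  zero, raise them to degree 2e.\<close>

definition gen :: "nat \<times> nat => nat => 'k xpoly fract" where
 "gen x l = to_fract (mvar (snd x) ^ e) * BB (unit (fst x)) l"

lemma gen_G:
 assumes P: "P \<in> pp" and x: "snd x < 3"
 shows "gen x \<in> G (2 * int e) P"
proof -
 have "mvar (snd x) ^ e \<in> forms xyz (e * 1)" by (rule forms_power[OF forms_mvar]) (use x in simp)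
 then have "to_fract (mvar (snd x) ^ e) \<in> L (int e) P" using loc_form[OF P, of "mvar (snd x) ^ e" e] by simp
 then have "BB (%i. to_fract (mvar (snd x) ^ e) * unit (fst x) i) \<in> G (int e + int e) P"
  by (intro BB_G[OF P] unit_loc[OF P])
 then show ?thesis unfolding gen_def[abs_def] BB_scale[symmetric] by simp
qed

text \<open>The products of a nonzero minor with some x_i^e have no common zero, so a power of
  \<open>h\<close> is a combination of them. By \<open>cramer\<close> such a product times
  \<open>z\<close> is a combination of two generators, with entries of \<open>z\<close> as
  coefficients.\<close>

lemma gen_generate:
 fixes h :: "'k xpoly"
 assumes h: "h \<in> forms xyz n" "0 < n" and z: "!!P. P \<in> pbasic xyz h ==> z \<in> G (2 * int e) P" and h0: "h ~= 0"
 shows "\<exists>v. (\<forall>x\<in>{..<e + 2} \<times> xyz. \<forall>P\<in>pbasic xyz h. v x \<in> L 0 P) &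
  z = (%l. \<Sum>x\<in>{..<e + 2} \<times> xyz. v x * gen x l)"
proof -
 define q where "q a b = Q e al (unit a) (unit b)" for a b
 define ok where "ok t x \<longleftrightarrow> fst x < e + 2 & fst (snd x) < e + 2 & snd (snd x) < (3::nat) & q (fst x) (fst (snd x)) ~= 0 &
  t = q (fst x) (fst (snd x)) * mvar (snd (snd x)) ^ e" for t and x :: "nat \<times> nat \<times> nat"
 define T where "T = {t. \<exists>x. ok t x}"
 have Tf: "t \<in> forms xyz (2 * e)" if t: "t \<in> T" for t
 proof -
  obtain x where x: "ok t x" using t unfolding T_def by auto
  have "q (fst x) (fst (snd x)) * mvar (snd (snd x)) ^ e \<in> forms xyz (e + e * 1)"
   unfolding q_def by (intro forms_mult Q_form forms_power forms_mvar) (use x in \<open>simp add: ok_def\<close>)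
  then show ?thesis using x unfolding ok_def by (simp add: mult_2)
 qed
 have "h \<in> P" if P: "P \<in> pp" "T \<subseteq> P" for P
 proof -
  obtain a b where ab: "a < e + 2" "b < e + 2" "q a b \<notin> P" using nondegenerate[OF P(1)] unfolding q_def by auto
  obtain i where i: "i \<in> xyz" "mvar i \<notin> P" using proj_pointD(6)[OF P(1)] by auto
  have "q a b * mvar i ^ e \<in> T" unfolding T_def ok_def
   using ab i nonzero_if_notin[OF P(1) ab(3)] by (intro CollectI exI[of _ "(a, b, i)"]) simp
  moreover have "q a b * mvar i ^ e \<notin> P"
   using forms_mult_notin[OF P(1) Q_form forms_power[OF forms_mvar[OF i(1)]] _ forms_power_notin[OF P(1) forms_mvar[OF i(1)] i(2)]] ab(3)
   unfolding q_def by blast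
  ultimately show ?thesis using P(2) by auto
 qed
 then obtain N where N: "h ^ N \<in> pgen xyz T"
  using projective_nullstellensatz[of T xyz h n] Tf h by blast
 obtain F c where F: "finite F" "F \<subseteq> T" and c: "!!t. t \<in> F ==> 2 * e \<le> N * n & c t \<in> forms xyz (N * n - 2 * e)"
  and hN: "h ^ N = (\<Sum>t\<in>F. c t * t)"
 proof (rule pgen_form[OF N forms_power[OF h(1)], of "%_. 2 * e"])
  fix F c assume "finite F" "F \<subseteq> T" "!!t. t \<in> F ==> 2 * e \<le> N * n & c t \<in> forms xyz (N * n - 2 * e)"
   "h ^ N = (\<Sum>t\<in>F. c t * t)"
  then show thesis by (rule that)
 qed (rule Tf)
 define y where "y t = (SOME x. ok t x)" for t
 have y: "ok t (y t)" if "t \<in> F" for t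
  unfolding y_def using F(2) that by (intro someI_ex[of "ok t"]) (auto simp: T_def)
 define a b i where "a t = fst (y t)" and "b t = fst (snd (y t))" and "i t = snd (snd (y t))" for t
 have ok: "a t < e + 2" "b t < e + 2" "i t < 3" "q (a t) (b t) ~= 0" "t = q (a t) (b t) * mvar (i t) ^ e" if "t \<in> F" for t
  using y[OF that] unfolding ok_def a_def b_def i_def by blast+
 let ?A = "{..<e + 2} \<times> xyz"
 let ?H = "to_fract (h ^ N)"
 \<comment> \<open>Each \<open>t\<close> in \<open>F\<close> contributes to the two generators that
   \<open>cramer\<close> attaches to its minor and its variable; the contributions are collected by
   generator.\<close>
 define v where "v x = (\<Sum>t\<in>F. (if (b t, i t) = x then to_fract (c t) * z (a t) / ?H else 0) -
   (if (a t, i t) = x then to_fract (c t) * z (b t) / ?H else 0))" for x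
 have H0: "?H ~= 0" using h0 by simp
 have tm: "to_fract (c t) * z r / ?H \<in> L 0 P" if t: "t \<in> F" and P: "P \<in> pbasic xyz h" for t r P
 proof -
  have P': "P \<in> pp" "h \<notin> P" using P by (auto simp: pbasic_def)
  have "z r \<in> L (2 * int e) P" using z[OF P] by (simp add: G_def)
  then have "to_fract (c t) * z r \<in> L (int (N * n - 2 * e) + 2 * int e) P"
   by (rule loc_form_mult[OF P'(1) conjunct2[OF c[OF t]]]) (rule refl)
  moreover have "int (N * n - 2 * e) + 2 * int e = int (N * n)" using conjunct1[OF c[OF t]] by linarith
  ultimately have "to_fract (c t) * z r \<in> L (int (N * n)) P" by simp
  then show ?thesis by (rule loc_form_divide[OF P'(1) forms_power[OF h(1)] forms_power_notin[OF P'(1) h(1) P'(2)]]) simp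
 qed
 have "v x \<in> L 0 P" if P: "P \<in> pbasic xyz h" for x P
 proof -
  have P': "P \<in> pp" using P by (auto simp: pbasic_def)
  show ?thesis unfolding v_def
   by (rule loc_sum[OF P'], rule loc_diff[OF P']) (use tm[OF _ P] loc_0[OF P'] in auto)
 qed
 moreover have "z l = (\<Sum>x\<in>?A. v x * gen x l)" for l
 proof -
  obtain P where P: "P \<in> pbasic xyz h"
   using generic_point[of xyz] h0 by (auto simp: pbasic_def lessThan_empty_iff)
  have "(\<Sum>x\<in>?A. v x * gen x l) = (\<Sum>x\<in>?A. \<Sum>t\<in>F. (if (b t, i t) = x then to_fract (c t) * z (a t) / ?H * gen x l else 0) -
   (if (a t, i t) = x then to_fract (c t) * z (b t) / ?H * gen x l else 0))"
   unfolding v_def sum_distrib_right by (intro sum.cong refl) (simp add: left_diff_distrib)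
  also have "\<dots> = (\<Sum>t\<in>F. \<Sum>x\<in>?A. (if (b t, i t) = x then to_fract (c t) * z (a t) / ?H * gen x l else 0) -
   (if (a t, i t) = x then to_fract (c t) * z (b t) / ?H * gen x l else 0))" by (rule sum.swap)
  also have "\<dots> = (\<Sum>t\<in>F. to_fract (c t) * z (a t) / ?H * gen (b t, i t) l - to_fract (c t) * z (b t) / ?H * gen (a t, i t) l)"
   by (intro sum.cong refl) (simp add: sum_subtractf ok)
  also have "\<dots> = (\<Sum>t\<in>F. to_fract (c t * t) * z l / ?H)"
  proof (rule sum.cong[OF refl])
   fix t assume t: "t \<in> F"
   let ?x = "to_fract (mvar (i t) ^ e)"
   have "to_fract (c t) * z (a t) / ?H * gen (b t, i t) l - to_fract (c t) * z (b t) / ?H * gen (a t, i t) l =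
     to_fract (c t) * ?x * (z (a t) * BB (unit (b t)) l - z (b t) * BB (unit (a t)) l) / ?H"
    by (simp add: gen_def right_diff_distrib diff_divide_distrib mult_ac)
   also have "\<dots> = to_fract (c t) * ?x * (to_fract (q (a t) (b t)) * z l) / ?H"
    unfolding q_def using cramer[OF z[OF P] ok(1,2)[OF t] ok(4)[OF t, unfolded q_def], of l] by simp
   also have "\<dots> = to_fract (c t) * to_fract (q (a t) (b t) * mvar (i t) ^ e) * z l / ?H" by (simp add: mult_ac)
   also have "\<dots> = to_fract (c t * t) * z l / ?H" unfolding ok(5)[OF t, symmetric] by simp
   finally show "to_fract (c t) * z (a t) / ?H * gen (b t, i t) l - to_fract (c t) * z (b t) / ?H * gen (a t, i t) l =
    to_fract (c t * t) * z l / ?H" .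
  qed
  also have "\<dots> = ?H * z l / ?H" unfolding hN to_fract_sum sum_distrib_right sum_divide_distrib ..
  also have "\<dots> = z l" using H0 by simp
  finally show ?thesis by simp
 qed
 ultimately show ?thesis by (intro exI[of _ v] conjI ballI ext)
qed

end

context uple_pencil
begin

text \<open>Over the preimage of D(H) the numerator of a function has degree
  \<open>d * (N * t)\<close>; forms whose degree is a multiple of d are pullbacks.\<close>

lemma scalar_lift:
 assumes H: "H \<in> forms mons t" "0 < t" "uple_pull H ~= 0" and v: "!!P. P \<in> pbasic xyz (uple_pull H) ==> v \<in> L 0 P"
 shows "\<exists>c. uf.scal (pbasic mons H) c & \<rho> c = v"
proof -
 let ?h = "uple_pull H"
 have h: "?h \<in> forms xyz (d * t)" "0 < d * t" using uple_pull_forms[OF H(1)] d_pos H(2) by auto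
 obtain a N k where a: "a \<in> forms xyz k" "int k = int (N * (d * t)) + 0" "v = to_fract a / to_fract ?h ^ N"
  using loc_pbasic[OF h H(3) v] by blast
 have "k = d * (N * t)" using a(2) unfolding add_0_right of_nat_eq_iff by (simp add: mult.left_commute)
 then have "a \<in> forms xyz (d * (N * t))" using a(1) by simp
 then obtain b where b: "b \<in> forms mons (N * t)" "uple_pull b = a" using uple_pull_onto by blast
 have "\<rho> (Fract b (H ^ N)) = Fract (uple_pull b) (uple_pull (H ^ N))"
  by (rule pullf_Fract[OF generic_pp forms_polys[OF b(1)] forms_polys[OF forms_power[OF H(1)]]]) (use H(3) in \<open>simp add: uple_pull_power\<close>)
 then have "\<rho> (Fract b (H ^ N)) = v" unfolding a(3) b(2) uple_pull_power by (simp add: Fract_conv_to_fract to_fract_power)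
 moreover have "uf.scal (pbasic mons H) (Fract b (H ^ N))" unfolding uf.scal_def
 proof
  fix R assume "R \<in> pbasic mons H"
  then have "R \<in> proj_points mons" "H \<notin> R" by (auto simp: pbasic_def)
  then show "Fract b (H ^ N) \<in> loc mons 0 R" by (intro locI[OF b(1) forms_power[OF H(1)] forms_power_notin[OF _ H(1)]]) auto
 qed
 ultimately show ?thesis by blast
qed

text \<open>The extra coordinate makes the degree positive and supplies a unit by whose powers forms
  can be brought to degree 0.\<close>

lemma basic_neighbourhood:
 assumes W: "opm W" "q \<in> W"
 shows "\<exists>F t m. F \<in> forms mons t & m \<in> mons & q \<in> pbasic mons (F * mvar m) & pbasic mons (F * mvar m) \<subseteq> W &
  F * mvar m \<in> forms mons (t + 1) & pbasic mons (F * mvar m) = pbasic mons F \<inter> pbasic mons (mvar m)"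
proof -
 obtain F t where F: "F \<in> forms mons t" "q \<in> pbasic mons F" "pbasic mons F \<subseteq> W" using W by (rule open_pbasic)
 then have q: "q \<in> proj_points mons" by (simp add: pbasic_def)
 obtain m where m: "m \<in> mons" "mvar m \<notin> q" using proj_pointD(6)[OF q] by auto
 have eq: "pbasic mons (F * mvar m) = pbasic mons F \<inter> pbasic mons (mvar m)" by (rule pbasic_mult[OF F(1) forms_mvar[OF m(1)]])
 show ?thesis using F q m eq forms_mult[OF F(1) forms_mvar[OF m(1)]]
  by (intro exI[of _ F] exI[of _ t] exI[of _ m]) (auto simp: pbasic_def)
qed

lemma finite_type: "locally_fg (proj mons) UF (%U. carrier (sec UF U)) (proj_points mons)"
proof (rule uf.locally_fgI)
 fix q :: "'k ypoly set" assume q: "q \<in> proj_points mons"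
 let ?V = "proj_points mons :: 'k ypoly set set" and ?A = "{..<e + 2} \<times> xyz"
 have V: "opm ?V" unfolding topspace_proj_top[symmetric] by (rule openin_topspace)
 have rg: "uf.reg ?V (gen x)" if "x \<in> ?A" for x
  using gen_G[of _ x] that pre_pp(1)[of _ ?V] by (auto simp: uf.reg_def)
 have g: "\<forall>x\<in>?A. uf.reg ?V (gen x) & ksec (pre ?V) (gen x) \<in> carrier (sec UF ?V)"
  unfolding uf.carrier_reg[OF V] using rg by auto
 have lift: "\<exists>W' c. opm W' & q' \<in> W' & W' \<subseteq> W & (\<forall>x\<in>?A. uf.scal W' (c x)) &
     (pre W' ~= {} --> z = (%l. \<Sum>x\<in>?A. \<rho> (c x) * gen x l))"
  if W: "opm W" and z: "uf.reg W z" and q': "q' \<in> W" for W z q'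
 proof -
  obtain F t m where F: "q' \<in> pbasic mons (F * mvar m)" "pbasic mons (F * mvar m) \<subseteq> W" "F * mvar m \<in> forms mons (t + 1)"
   using basic_neighbourhood[OF W q'] by blast
  let ?H = "F * mvar m" and ?h = "uple_pull (F * mvar m)"
  have oH: "opm (pbasic mons ?H)" by (rule openin_pbasic[OF F(3)])
  have pH: "pre (pbasic mons ?H) = pbasic xyz ?h" by (rule preim_pbasic[OF d_pos forms_polys[OF F(3)]])
  show ?thesis
  proof (cases "?h = 0")
   \<comment> \<open>The principal open set has empty preimage, so the identity for \<open>z\<close>
     is void and any regular scalars do.\<close>
   case True
   then have "pre (pbasic mons ?H) = {}" unfolding pH using proj_pointD(5) by (auto simp: pbasic_def)
   moreover have "uf.scal (pbasic mons ?H) 0" by (auto simp: uf.scal_def pbasic_def loc_0)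
   ultimately show ?thesis using oH F by (intro exI[of _ "pbasic mons ?H"] exI[of _ "%_. 0"] conjI) auto
  next
   case False
   have zH: "z \<in> G (2 * int e) P" if "P \<in> pbasic xyz ?h" for P
    using uf.reg_mono[OF z F(2)] that unfolding uf.reg_def pH by auto
   obtain v where v: "\<forall>x\<in>?A. \<forall>P\<in>pbasic xyz ?h. v x \<in> L 0 P" "z = (%l. \<Sum>x\<in>?A. v x * gen x l)"
    using gen_generate[OF uple_pull_forms[OF F(3)] _ zH False] d_pos by auto
   have "\<forall>x\<in>?A. \<exists>c. uf.scal (pbasic mons ?H) c & \<rho> c = v x"
   proof
    fix x assume x: "x \<in> ?A"
    show "\<exists>c. uf.scal (pbasic mons ?H) c & \<rho> c = v x"
     by (rule scalar_lift[OF F(3) _ False]) (simp, rule bspec[OF bspec[OF v(1) x]])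
   qed
   from bchoice[OF this] obtain c where c: "\<forall>x\<in>?A. uf.scal (pbasic mons ?H) (c x) & \<rho> (c x) = v x" by (elim exE)
   have "z = (%l. \<Sum>x\<in>?A. \<rho> (c x) * gen x l)" unfolding v(2)
    by (intro ext sum.cong refl) (simp only: conjunct2[OF bspec[OF c]])
   moreover have "\<forall>x\<in>?A. uf.scal (pbasic mons ?H) (c x)" using conjunct1[OF bspec[OF c]] by (intro ballI)
   ultimately show ?thesis using oH F(1,2) by (intro exI[of _ "pbasic mons ?H"] exI[of _ c] conjI impI)
  qed
 qed
 show "\<exists>V (A :: (nat \<times> nat) set) g. opm V & q \<in> V & V \<subseteq> ?V & finite A & (\<forall>x\<in>A. uf.reg V (g x) & ksec (pre V) (g x) \<in> carrier (sec UF V)) &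
   (\<forall>W z q'. opm W --> W \<subseteq> V --> uf.reg W z --> ksec (pre W) z \<in> carrier (sec UF W) --> q' \<in> W -->
    (\<exists>W' c. opm W' & q' \<in> W' & W' \<subseteq> W & (\<forall>x\<in>A. uf.scal W' (c x)) &
     (pre W' ~= {} --> z = (%l. \<Sum>x\<in>A. \<rho> (c x) * g x l))))"
  by (rule exI[of _ ?V], rule exI[of _ ?A], rule exI[of _ gen]) (intro conjI V q g order_refl allI impI lift, simp)
qed simp

end

section \<open>Relations between sections and coherence\<close>

context uple_pencil
begin

text \<open>Over a set with nonempty preimage a relation is an identity between constants; over the
  others all sections agree, and every tuple of scalars is a relation.\<close>

lemma relations_iff:
 assumes U: "opm U" and s': "\<forall>i<n. s i = ksec (pre U) (z i) & uf.reg U (z i)" and W: "opm W" "W \<subseteq> U"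
  and w': "\<forall>i<n. uf.scal W (w i)"
 shows "fam n W w \<in> relations (proj mons) UF n U s W \<longleftrightarrow> (pre W ~= {} --> (\<forall>l. (\<Sum>i<n. \<rho> (w i) * z i l) = 0))"
proof -
 interpret A: abelian_group "sec UF W" by (rule uf.sections_group[OF W(1)])
 note s = s'[rule_format] and w = w'[rule_format]
 have r: "uf.reg W (z i)" "uf.reg W (%l. \<rho> (w i) * z i l)" if "i < n" for i
  using uf.reg_mono[OF conjunct2[OF s[OF that]] W(2)] uf.reg_scale[OF W(1) w[OF that]] by auto
 have "(\<Oplus>\<^bsub>sec UF W\<^esub>i\<in>{..<n}. fam n W w i \<odot>\<^bsub>sec UF W\<^esub> res UF U W (s i)) =
   (\<Oplus>\<^bsub>sec UF W\<^esub>i\<in>{..<n}. ksec (pre W) (%l. \<rho> (w i) * z i l))"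
 proof (rule A.finsum_cong'[OF refl])
  show "(%i. ksec (pre W) (%l. \<rho> (w i) * z i l)) \<in> {..<n} \<rightarrow> carrier (sec UF W)"
   unfolding uf.carrier_reg[OF W(1)] using r(2) by auto
  fix i assume "i \<in> {..<n}"
  then have i: "i < n" by simp
  have "fam n W w i = cst W (w i)" using i by (simp add: fam_def)
  then show "fam n W w i \<odot>\<^bsub>sec UF W\<^esub> res UF U W (s i) = ksec (pre W) (%l. \<rho> (w i) * z i l)"
   unfolding conjunct1[OF s[OF i]] uf.res_reg[OF U W conjunct2[OF s[OF i]]] by (simp only: uf.smult_reg[OF W(1) w[OF i] r(1)[OF i]])
 qed
 also have "\<dots> = ksec (pre W) (%l. \<Sum>i<n. \<rho> (w i) * z i l)" by (rule uf.sections_finsum[OF W(1)]) (simp add: r)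
 finally have sum: "(\<Oplus>\<^bsub>sec UF W\<^esub>i\<in>{..<n}. fam n W w i \<odot>\<^bsub>sec UF W\<^esub> res UF U W (s i)) =
   ksec (pre W) (%l. \<Sum>i<n. \<rho> (w i) * z i l)" .
 have rs: "uf.reg W (%l. \<Sum>i<m. \<rho> (w i) * z i l)" if "m \<le> n" for m
  using that
 proof (induction m)
  case 0 show ?case by (simp add: uf.reg_0[OF W(1)])
 next
  case (Suc m)
  then show ?case using uf.reg_add[OF W(1) _ r(2)[of m], of "%l. \<Sum>i<m. \<rho> (w i) * z i l"] by simp
 qed
 have "fam n W w \<in> {..<n} \<rightarrow>\<^sub>E O_sections mons 0 W"
 proof (rule PiE_I)
  fix i assume "i \<in> {..<n}"
  then have i: "i < n" by simp
  have "cst W (w i) \<in> O_sections mons 0 W"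
   by (rule cst_O_sections[OF W(1)]) (use w[OF i] in \<open>auto simp: uf.scal_def\<close>)
  then show "fam n W w i \<in> O_sections mons 0 W" using i by (simp add: fam_def)
 qed (simp add: fam_def)
 then have "fam n W w \<in> relations (proj mons) UF n U s W \<longleftrightarrow> ksec (pre W) (%l. \<Sum>i<n. \<rho> (w i) * z i l) = ksec (pre W) (%_. 0)"
  unfolding relations_def rs_proj mem_Collect_eq sum uf.zero[OF W(1)] by simp
 also have "\<dots> \<longleftrightarrow> (pre W ~= {} --> (%l. \<Sum>i<n. \<rho> (w i) * z i l) = (%_. 0))"
  using uf.sections_inject[OF W(1) rs[OF order_refl] uf.reg_0[OF W(1)]] uf.eq_sections[OF W(1) rs[OF order_refl] uf.reg_0[OF W(1)]]
  by blast
 also have "\<dots> \<longleftrightarrow> (pre W ~= {} --> (\<forall>l. (\<Sum>i<n. \<rho> (w i) * z i l) = 0))" by (simp add: fun_eq_iff)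
 finally show ?thesis .
qed

text \<open>Homogeneous relations of degree \<open>k\<close> whose coefficients are forms on the
  target. The flag \<open>c\<close> records whether the neighbourhood under consideration meets the
  plane; if it does not, every vector of forms counts as a relation.\<close>

definition relM :: "nat => (nat => nat => 'k xpoly fract) => bool => nat => (nat => 'k ypoly) set" where
 "relM n z c k = {b. (\<forall>i. b i \<in> forms mons k) & (\<forall>i\<ge>n. b i = 0) &
  (c --> (\<forall>l. (\<Sum>i<n. to_fract (uple_pull (b i)) * z i l) = 0))}"

lemma uple_pull_diff: "uple_pull (f - g) = uple_pull f - uple_pull g"
 using uple_pull_add[of "f - g" g] by simp

lemma relM_finite: "\<exists>B. finite B & (\<forall>x\<in>B. snd x \<in> relM n z c (fst x)) & (\<forall>k. \<forall>a\<in>relM n z c k. \<exists>r.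
  (\<forall>x\<in>B. r x = 0 \<or> fst x \<le> k & r x \<in> forms mons (k - fst x)) & (\<forall>i. a i = (\<Sum>x\<in>B. r x * snd x i)))"
proof (rule graded_submodule_finite)
 show "finite mons" by (rule finite_monomials) simp
 fix k l b b' r
 assume b: "b \<in> relM n z c k"
 show "b i \<in> forms mons k" for i using b by (simp add: relM_def)
 show "n \<le> i ==> b i = 0" for i using b by (simp add: relM_def)
 show "(%i. r * b i) \<in> relM n z c (l + k)" if "r \<in> forms mons l"
 proof -
  have "(\<Sum>i<n. to_fract (uple_pull (r * b i)) * z i j) = to_fract (uple_pull r) * (\<Sum>i<n. to_fract (uple_pull (b i)) * z i j)" for j
   by (simp add: uple_pull_mult sum_distrib_left mult.assoc)
  then show ?thesis using b forms_mult[OF that] by (simp add: relM_def)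
 qed
 assume b': "b' \<in> relM n z c k"
 have "(\<Sum>i<n. to_fract (uple_pull (b i - b' i)) * z i j) =
   (\<Sum>i<n. to_fract (uple_pull (b i)) * z i j) - (\<Sum>i<n. to_fract (uple_pull (b' i)) * z i j)" for j
  by (simp add: uple_pull_diff left_diff_distrib sum_subtractf)
 then show "(%i. b i - b' i) \<in> relM n z c k" using b b' by (simp add: relM_def forms_diff)
qed

text \<open>A common denominator turns the scalars into forms. If \<open>W\<close> has empty
  preimage or the denominator pulls back to 0, the relation cannot be transferred to the numerators;
  these are then multiplied by a form that pulls back to 0 without vanishing at \<open>q\<close>,
  which makes them satisfy the relation trivially.\<close>

lemma relation_numerator:
 assumes W: "opm W" "q \<in> W" and w: "\<forall>i<n. uf.scal W (w i)" "\<forall>i\<ge>n. w i = 0"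
  and rel: "pre W ~= {} --> (\<forall>l. (\<Sum>i<n. \<rho> (w i) * z i l) = 0)"
 shows "\<exists>f k a. f \<in> forms mons k & f \<notin> q & a \<in> relM n z c k & (\<forall>i. to_fract f * w i = to_fract (a i))"
proof -
 have q: "q \<in> proj_points mons" using W open_subset_points by blast
 have "\<exists>f k a. f \<in> forms mons k & f \<notin> q & (\<forall>i\<in>{..<n}. a i \<in> forms mons k & to_fract f * w i = to_fract (a i))"
  by (rule common_denominator[OF q]) (use w(1) W(2) in \<open>auto simp: uf.scal_def\<close>)
 then obtain f k a where f: "f \<in> forms mons k" "f \<notin> q"
  "\<forall>i\<in>{..<n}. a i \<in> forms mons k & to_fract f * w i = to_fract (a i)" by (elim exE conjE)
 define b where "b i = (if i < n then a i else 0)" for i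
 have b: "b i \<in> forms mons k" "to_fract f * w i = to_fract (b i)" "n \<le> i ==> b i = 0" for i
  using f(3) w(2) by (auto simp: b_def)
 show ?thesis
 proof (cases "pre W ~= {} & uple_pull f ~= 0")
  case True
  have "to_fract (uple_pull (b i)) = to_fract (uple_pull f) * \<rho> (w i)" for i
  proof -
   have "w i = Fract (b i) f" using b(2)[of i] nonzero_if_notin[OF q f(2)]
    by (simp add: Fract_conv_to_fract field_simps)
   then have "\<rho> (w i) = Fract (uple_pull (b i)) (uple_pull f)"
    using pullf_Fract[OF generic_pp forms_polys[OF b(1)] forms_polys[OF f(1)]] True by simp
   then show ?thesis using True by (simp add: Fract_conv_to_fract)
  qed
  then have "(\<Sum>i<n. to_fract (uple_pull (b i)) * z i l) = to_fract (uple_pull f) * (\<Sum>i<n. \<rho> (w i) * z i l)" for l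
   by (simp add: sum_distrib_left mult.assoc)
  then have "b \<in> relM n z c k" using b(1,3) rel True by (simp add: relM_def)
  then show ?thesis using f(1,2) b(2) by (intro exI[of _ f] exI[of _ k] exI[of _ b] conjI allI)
 next
  case False
  have "\<exists>E t. E \<in> forms mons t & E \<notin> q & uple_pull E = 0"
  proof (cases "uple_pull f = 0")
   case True then show ?thesis using f(1,2) by blast
  next
   case f0: False
   obtain E t where E: "E \<in> forms mons t" "q \<in> pbasic mons E" "pbasic mons E \<subseteq> W" using W by (rule open_pbasic)
   have "pre (pbasic mons E) = {}" using False f0 E(3) by (auto simp: preim_proj)
   then have "pbasic xyz (uple_pull E) = {}" unfolding preim_pbasic[OF d_pos forms_polys[OF E(1)]] .
   then have "uple_pull E = 0" using generic_pp by (auto simp: pbasic_def)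
   then show ?thesis using E(1,2) by (auto simp: pbasic_def)
  qed
  then obtain E t where E: "E \<in> forms mons t" "E \<notin> q" "uple_pull E = 0" by (elim exE conjE)
  have "(%i. E * b i) \<in> relM n z c (t + k)"
   using forms_mult[OF E(1) b(1)] b(3) by (simp add: relM_def uple_pull_mult E(3))
  moreover have "to_fract (E * f) * w i = to_fract (E * b i)" for i using b(2)[of i] by (simp add: mult.assoc)
  ultimately show ?thesis
   using forms_mult[OF E(1) f(1)] forms_mult_notin[OF q E(1) f(1) E(2) f(2)]
   by (intro exI[of _ "E * f"] exI[of _ "t + k"] exI[of _ "%i. E * b i"] conjI allI)
 qed
qed

text \<open>The graded module of homogeneous relations has finitely many generators. Divided by
  powers of a coordinate that is a unit near \<open>q\<close>, they become relations with regular
  scalars, and these generate because any relation near \<open>q\<close> has a numerator in the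
  graded module.\<close>

lemma relations_finite_type:
 assumes U: "opm U" and s: "!!i. i < n ==> s i \<in> carrier (sec UF U)"
 shows "locally_fg (proj mons) (direct_power n (struct_module (proj mons))) (relations (proj mons) UF n U s) U"
proof -
 let ?O = "direct_power n (struct_module (proj mons)) ::
  ('k ypoly set, (nat \<Rightarrow>\<^sub>0 nat, 'k) proj_fun, nat => (nat \<Rightarrow>\<^sub>0 nat, 'k) proj_fun) mod_presheaf"
 let ?R = "relations (proj mons) UF n U s"
 interpret fr: vector_module_sheaf mons ?O "%V. V"
  "%P. {w. (\<forall>i<n. w i \<in> loc mons 0 P) & (\<forall>i\<ge>n. w i = 0)}" "fam n" "%x. x" by (rule free_sheaf)
 have "\<forall>i\<in>{..<n}. \<exists>z. s i = ksec (pre U) z & uf.reg U z"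
  using s unfolding uf.carrier_reg[OF U] by auto
 from bchoice[OF this] obtain z where "\<forall>i\<in>{..<n}. s i = ksec (pre U) (z i) & uf.reg U (z i)" by (elim exE)
 then have z: "\<forall>i<n. s i = ksec (pre U) (z i) & uf.reg U (z i)" by simp
 have regD: "\<forall>i<n. uf.scal W (w i)" if "fr.reg W w" for W w using that by (auto simp: fr.reg_def uf.scal_def)
 have regD0: "\<forall>i\<ge>n. w i = 0" if "fr.reg W w" "q \<in> W" for W w q using that by (auto simp: fr.reg_def)
 show ?thesis
 proof (rule fr.locally_fgI)
  fix W show "?R W \<subseteq> carrier (sec ?O W)"
   by (auto simp: relations_def direct_power_def struct_module_def)
 next
  fix q :: "'k ypoly set" assume q: "q \<in> U"
  obtain F t m where F: "F \<in> forms mons t" "m \<in> mons" "q \<in> pbasic mons (F * mvar m)" "pbasic mons (F * mvar m) \<subseteq> U"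
   "F * mvar m \<in> forms mons (t + 1)" "pbasic mons (F * mvar m) = pbasic mons F \<inter> pbasic mons (mvar m)"
   using basic_neighbourhood[OF U q] by (elim exE conjE)
  let ?V = "pbasic mons (F * mvar m)" and ?c = "uple_pull (F * mvar m) ~= 0" and ?y = "to_fract (mvar m) :: 'k ypoly fract"
  have V: "opm ?V" by (rule openin_pbasic[OF F(5)])
  have Vm: "P \<in> proj_points mons" "mvar m \<notin> P" if "P \<in> ?V" for P using that unfolding F(6) by (auto simp: pbasic_def)
  have preV: "pre ?V ~= {} --> ?c"
   unfolding preim_pbasic[OF d_pos forms_polys[OF F(5)]] by (auto simp: pbasic_def dest: proj_pointD(5))
  obtain B where B: "finite B" "\<forall>x\<in>B. snd x \<in> relM n z ?c (fst x)" "\<forall>k. \<forall>a\<in>relM n z ?c k. \<exists>r.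
   (\<forall>x\<in>B. r x = 0 \<or> fst x \<le> k & r x \<in> forms mons (k - fst x)) & (\<forall>i. a i = (\<Sum>x\<in>B. r x * snd x i))"
   using relM_finite[of n z ?c] by (elim exE conjE)
  define g where "g x i = to_fract (snd x i) / ?y ^ fst x" for x :: "nat \<times> (nat => 'k ypoly)" and i
  have gl: "g x i \<in> loc mons 0 P" if x: "x \<in> B" and P: "P \<in> ?V" for x i P
  proof -
   have "snd x i \<in> forms mons (fst x)" using B(2) x by (auto simp: relM_def)
   moreover have "mvar m ^ fst x \<in> forms mons (fst x)" using forms_power[OF forms_mvar[OF F(2)], of "fst x"] by simp
   ultimately have "to_fract (snd x i) / to_fract (mvar m ^ fst x) \<in> loc mons 0 P"
    by (intro loc_form_divide[OF Vm(1)[OF P] _ forms_power_notin[OF Vm(1)[OF P] forms_mvar[OF F(2)] Vm(2)[OF P]] loc_form[OF Vm(1)[OF P]]]) simp_all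
   then show ?thesis by (simp add: g_def to_fract_power)
  qed
  have gr: "fr.reg ?V (g x)" if x: "x \<in> B" for x
   unfolding fr.reg_def using gl[OF x] B(2) x by (auto simp: g_def relM_def)
  have gR: "fam n ?V (g x) \<in> ?R ?V" if x: "x \<in> B" for x
   unfolding relations_iff[where w = "g x" and z = z and s = s, OF U z V F(4) regD[OF gr[OF x]]]
  proof (intro impI allI)
   fix l assume "pre ?V ~= {}"
   then have rel: "(\<Sum>i<n. to_fract (uple_pull (snd x i)) * z i l) = 0" using preV B(2) x by (auto simp: relM_def)
   have "\<rho> (g x i) = to_fract (uple_pull (snd x i)) / mfr m ^ fst x" for i
   proof -
    have f: "snd x i \<in> polys mons" by (rule forms_polys[of _ _ "fst x"]) (use B(2) x in \<open>auto simp: relM_def\<close>)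
    have "g x i = Fract (snd x i) (mvar m ^ fst x)" by (simp add: g_def Fract_conv_to_fract to_fract_power)
    then show ?thesis
     using pullf_Fract[OF generic_pp f polys_power[OF forms_polys[OF forms_mvar[OF F(2)]], of "fst x"]]
     by (simp add: uple_pull_power Fract_conv_to_fract to_fract_power mfr_def)
   qed
   then have "(\<Sum>i<n. \<rho> (g x i) * z i l) = (\<Sum>i<n. to_fract (uple_pull (snd x i)) * z i l) / mfr m ^ fst x"
    by (simp add: sum_divide_distrib)
   then show "(\<Sum>i<n. \<rho> (g x i) * z i l) = 0" using rel by simp
  qed
  have lift: "\<exists>W' c. opm W' & q' \<in> W' & W' \<subseteq> W & (\<forall>x\<in>B. fr.scal W' (c x)) &
    (W' ~= {} --> w = (%i. \<Sum>x\<in>B. c x * g x i))"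
   if W: "opm W" "W \<subseteq> ?V" and w: "fr.reg W w" "fam n W w \<in> ?R W" and q': "q' \<in> W" for W w q'
  proof -
   have "pre W ~= {} --> (\<forall>l. (\<Sum>i<n. \<rho> (w i) * z i l) = 0)"
    using w(2) unfolding relations_iff[where w = w and z = z and s = s, OF U z W(1) order_trans[OF W(2) F(4)] regD[OF w(1)]] .
   from relation_numerator[where c = ?c and w = w, OF W(1) q' regD[OF w(1)] regD0[OF w(1) q'] this]
   obtain f k a where f: "f \<in> forms mons k" "f \<notin> q'" "a \<in> relM n z ?c k" "\<forall>i. to_fract f * w i = to_fract (a i)"
    by (elim exE conjE)
   obtain r where r: "\<forall>x\<in>B. r x = 0 \<or> fst x \<le> k & r x \<in> forms mons (k - fst x)" "\<forall>i. a i = (\<Sum>x\<in>B. r x * snd x i)"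
    using bspec[OF spec[OF B(3)] f(3)] by (elim exE conjE)
   let ?W = "W \<inter> pbasic mons f"
   \<comment> \<open>The power of the coordinate undoes the division in \<open>g\<close>, and
     \<open>f\<close> is the denominator of \<open>w\<close>.\<close>
   define c where "c x = to_fract (r x) * ?y ^ fst x / to_fract f" for x
   have q'p: "q' \<in> proj_points mons" using W(1) q' open_subset_points by blast
   have f0: "to_fract f ~= 0" using nonzero_if_notin[OF q'p f(2)] by simp
   have "fr.scal ?W (c x)" if x: "x \<in> B" for x
    unfolding fr.scal_def
   proof
    fix P assume P: "P \<in> ?W"
    then have P': "P \<in> proj_points mons" "f \<notin> P" by (auto simp: pbasic_def)
    show "c x \<in> loc mons 0 P"
    proof (cases "r x = 0")
     case False
     then have rx: "fst x \<le> k" "r x \<in> forms mons (k - fst x)" using bspec[OF r(1) x] by auto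
     have "r x * mvar m ^ fst x \<in> forms mons (k - fst x + fst x * 1)"
      by (rule forms_mult[OF rx(2) forms_power[OF forms_mvar[OF F(2)]]])
     then have "r x * mvar m ^ fst x \<in> forms mons k" using rx(1) by simp
     then have "to_fract (r x * mvar m ^ fst x) / to_fract f \<in> loc mons 0 P"
      by (intro loc_form_divide[OF P'(1) f(1) P'(2) loc_form[OF P'(1)]]) simp_all
     then show ?thesis by (simp add: c_def to_fract_power)
    qed (simp add: c_def loc_0[OF P'(1)])
   qed
   moreover have "w = (%i. \<Sum>x\<in>B. c x * g x i)"
   proof
    fix i
    have "c x * g x i = to_fract (r x * snd x i) / to_fract f" for x by (simp add: c_def g_def)
    then have "(\<Sum>x\<in>B. c x * g x i) = to_fract (\<Sum>x\<in>B. r x * snd x i) / to_fract f"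
     by (simp only: to_fract_sum sum_divide_distrib)
    also have "\<dots> = to_fract f * w i / to_fract f" using f(4) r(2) by simp
    finally show "w i = (\<Sum>x\<in>B. c x * g x i)" using f0 by simp
   qed
   moreover have "opm ?W" "q' \<in> ?W" "?W \<subseteq> W" using W(1) openin_pbasic[OF f(1)] q' q'p f(2) by (auto simp: pbasic_def)
   ultimately show ?thesis by (intro exI[of _ ?W] exI[of _ c] conjI ballI impI)
  qed
  show "\<exists>V (A :: (nat \<times> (nat => 'k ypoly)) set) g. opm V & q \<in> V & V \<subseteq> U & finite A &
   (\<forall>x\<in>A. fr.reg V (g x) & fam n V (g x) \<in> ?R V) &
   (\<forall>W z q'. opm W --> W \<subseteq> V --> fr.reg W z --> fam n W z \<in> ?R W --> q' \<in> W -->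
    (\<exists>W' c. opm W' & q' \<in> W' & W' \<subseteq> W & (\<forall>x\<in>A. fr.scal W' (c x)) &
     (W' ~= {} --> z = (%l. \<Sum>x\<in>A. c x * g x l))))"
   by (rule exI[of _ ?V], rule exI[of _ B], rule exI[of _ g]) (intro conjI V F(3,4) B(1) ballI gr gR allI impI lift)
 qed
qed

theorem coherent_UF: "coherent (proj mons) UF"
 unfolding coherent_def rs_proj topspace_proj_top
 using uf.is_sheaf finite_type relations_finite_type by blast

end

theorem proposition5p9:
  fixes d :: nat and \<alpha> :: "(nat, 'k::field) mpoly mat"
  assumes "d \<ge> 2"
    and "\<alpha> \<in> carrier_mat (d + 1) (d - 1)"
    and "\<And>i j. i < d + 1 \<Longrightarrow> j < d - 1 \<Longrightarrow> \<alpha> $$ (i, j) \<in> forms plane_coords 1"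
    and "ideal_codim (poly_ring plane_coords) (genideal (poly_ring plane_coords) (maximal_minors \<alpha>)) = 3"
  shows "ulrich_on_uple plane_coords d
    (coker_sheaf (proj plane_coords)
      (direct_power (d - 1) (proj_O plane_coords (int d - 2)))
      (direct_power (d + 1) (proj_O plane_coords (int d - 1)))
      (matrix_map \<alpha>))"
proof -
 define e where "e = d - 1"
 have de: "d = e + 1" "d + 1 = e + 2" "d - 1 = e" "0 < e" "int d - 2 = int e - 1" "int d - 1 = int e"
  using assms(1) by (auto simp: e_def)
 have \<alpha>: "\<alpha> \<in> carrier_mat (e + 2) e" using assms(2) unfolding de(2,3) .
 have lin: "\<alpha> $$ (i, j) \<in> forms xyz 1" if "i < e + 2" "j < e" for i j
  using assms(3)[of i j] that unfolding de(2,3) by blast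
 have "pencil e (%i j. \<alpha> $$ (i, j))"
 proof
  fix P :: "'k xpoly set" assume P: "P \<in> proj_points xyz"
  have minor: "\<exists>a<e + 2. \<exists>b<e + 2. f = Q e (%i j. \<alpha> $$ (i, j)) (unit a) (unit b) \<or> f = - Q e (%i j. \<alpha> $$ (i, j)) (unit a) (unit b)"
   if "f \<in> maximal_minors \<alpha>" for f
  proof -
   have "f \<in> {det (submatrix \<alpha> R UNIV) | R. R \<subseteq> {..<e + 2} & card R = e}"
    using that unfolding maximal_minors_def carrier_matD[OF \<alpha>] .
   then obtain R where "R \<subseteq> {..<e + 2}" "card R = e" "f = det (submatrix \<alpha> R UNIV)" by auto
   then obtain a b where "a < b" "b < e + 2" "f = Q e (%i j. \<alpha> $$ (i, j)) (unit a) (unit b) \<or> f = - Q e (%i j. \<alpha> $$ (i, j)) (unit a) (unit b)"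
    using maximal_minor_Q[OF \<alpha>] by metis
   then show ?thesis by (intro exI[of _ a] exI[of _ b]) auto
  qed
  have Qf: "Q e (%i j. \<alpha> $$ (i, j)) (unit a) (unit b) \<in> polys xyz" for a b
   by (rule forms_polys[OF Q_forms[OF lin]])
  have T: "maximal_minors \<alpha> \<subseteq> polys xyz"
  proof
   fix f assume "f \<in> maximal_minors \<alpha>"
   then show "f \<in> polys xyz" using minor[of f] Qf polys_uminus by metis
  qed
  \<comment> \<open>The value 3 is read as the number of variables, which no point of the plane
    attains as its height.\<close>
  have "ideal_codim (poly_ring xyz) (genideal (poly_ring xyz) (maximal_minors \<alpha>)) = enat (card xyz)"
   using assms(4) by (simp add: numeral_eq_enat)
  then have "\<not> maximal_minors \<alpha> \<subseteq> P" by (rule full_codim_no_point[OF finite_lessThan T _ P])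
  then obtain f where f: "f \<in> maximal_minors \<alpha>" "f \<notin> P" by auto
  then obtain a b where ab: "a < e + 2" "b < e + 2"
   "f = Q e (%i j. \<alpha> $$ (i, j)) (unit a) (unit b) \<or> f = - Q e (%i j. \<alpha> $$ (i, j)) (unit a) (unit b)" using minor by metis
  have "Q e (%i j. \<alpha> $$ (i, j)) (unit a) (unit b) \<notin> P"
   using f(2) ab(3) pidealD(6)[OF proj_pointD(2)[OF P], of "Q e (%i j. \<alpha> $$ (i, j)) (unit a) (unit b)"] by auto
  then show "\<exists>a<e + 2. \<exists>b<e + 2. Q e (%i j. \<alpha> $$ (i, j)) (unit a) (unit b) \<notin> P" using ab(1,2) by blast
 qed (use de lin in auto)
 then have "uple_pencil e \<alpha> d" using \<alpha> de(1) by (intro uple_pencil.intro matrix_pencil.intro uple_pencil_axioms.intro)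
 then interpret uple_pencil e \<alpha> d .
 have "cohomology_zero (proj mons) (twist mons j UF) q" if "1 \<le> q" "int q \<le> int 2 - 1" for q j
 proof -
  have "q = 1" using that by simp
  then show ?thesis using cohomology_H1 by simp
 qed
 then have "ulrich_sheaf mons UF"
  unfolding ulrich_sheaf_def using coherent_UF krull_dim cohomology_H0 cohomology_H2
  by (intro conjI exI[of _ 2] allI impI) auto
 then show ?thesis unfolding ulrich_on_uple_def de(2,3,5,6) .
qed

end
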